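(* Let $(X,\mathcal{R})$ be a partially metric association scheme with rank $d+1$, partially metric with respect to the relation $R_1$ with scheme graph $\Gamma$, and suppose $(X,\mathcal{R})$ has a minimal scheme idempotent with multiplicity three. Then one of the following holds: (i) $d=1$ and $\Gamma$ is $K_4$; (ii) $d=3$ and $\Gamma$ is the cube; (iii) $d=5$ and $\Gamma$ is the Möbius–Kantor graph $GP(8,3)$; (iv) $d=6$ and $\Gamma$ is the Nauru graph $GP(12,5)$; (v) $d=11$ and $\Gamma$ is the Foster graph F048A $=GP(24,5)$; (vi) $d=5$ and $\Gamma$ is the dodecahedron; (vii) $d=11$ and $\Gamma$ is the bipartite double of the dodecahedron; (viii) $d=3$ and $\Gamma$ is the icosahedron; (ix) $d=2$ and $\Gamma$ is the octahedron $K_{2,2,2}$; (x) $d=2$ and $\Gamma$ is a regular complete $4$-partite graph. Moreover, $(X,\mathcal{R})$ is uniquely determined by $\Gamma$: in all cases except (vii) it is the association scheme generated by $\Gamma$, and in case (vii) it is the bipartite double scheme of the association scheme of the dodecahedron.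
   Context: A (symmetric) association scheme with rank $d+1$ on a finite set $X$ is a partition $\mathcal{R}=\{R_0,\dots,R_d\}$ of $X\times X$ with $R_0$ the diagonal, each $R_i$ symmetric, and numbers $p^h_{ij}$ such that for every $(x,y)\in R_h$ the number of $z$ with $(x,z)\in R_i$, $(z,y)\in R_j$ equals $p^h_{ij}$. The scheme graph of $R_i$ ($i>0$) is the graph on $X$ with $x\sim y$ iff $(x,y)\in R_i$. The scheme is partially metric with respect to a connected relation $R_1$ if the distance-$2$ relation of the scheme graph of $R_1$ is a relation of the scheme; a rank-$2$ scheme is also called partially metric. The Bose–Mesner algebra has a basis of minimal scheme idempotents; the multiplicity of one is its rank. The association scheme generated by a graph is the association scheme of minimal rank having the graph's edge relation as a relation. The generalized Petersen graph $GP(n,s)$ has vertices $i$ and $i^*$ for $i\in\mathbb{Z}_n$, with $i$ adjacent to $i\pm1$ and $i^*$, and $i^*$ adjacent to $(i\pm s)^*$. The bipartite double of a graph on $V$ has vertices $x^{\pm}$ with $x^+\sim y^-$ iff $x\sim y$. The bipartite double scheme of a scheme with relation matrices $A_i$ is the scheme with relation matrices $A_i\otimes I_2$ and $A_i\otimes(J_2-I_2)$. *)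

theory Defs
  imports "HOL-Analysis.Analysis"
begin

section \<open>Symmetric association schemes (on a carrier set X)\<close>

text \<open>A symmetric association scheme of rank d+1 on the finite set X: relations R 0, ..., R d
  partition X x X into nonempty parts, R 0 is the diagonal, each R i is symmetric, and the
  intersection numbers exist.\<close>
definition assoc_scheme :: "'a set \<Rightarrow> (nat \<Rightarrow> ('a \<times> 'a) set) \<Rightarrow> nat \<Rightarrow> bool" where
  "assoc_scheme X R d \<longleftrightarrow>
     finite X \<and>
     (\<forall>i\<le>d. R i \<subseteq> X \<times> X \<and> R i \<noteq> {}) \<and>
     (\<forall>i\<le>d. \<forall>j\<le>d. i \<noteq> j \<longrightarrow> R i \<inter> R j = {}) \<and>
     (\<Union>i\<le>d. R i) = X \<times> X \<and>
     R 0 = Id_on X \<and>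
     (\<forall>i\<le>d. sym (R i)) \<and>
     (\<forall>h\<le>d. \<forall>i\<le>d. \<forall>j\<le>d. \<exists>p::nat. \<forall>(x, y)\<in>R h.
        card {z\<in>X. (x, z) \<in> R i \<and> (z, y) \<in> R j} = p)"

text \<open>Distance-2 relation of the graph with edge relation E on X.\<close>
definition dist2_rel :: "'a set \<Rightarrow> ('a \<times> 'a) set \<Rightarrow> ('a \<times> 'a) set" where
  "dist2_rel X E = {(x, y). x \<in> X \<and> y \<in> X \<and> x \<noteq> y \<and> (x, y) \<notin> E \<and> (x, y) \<in> E O E}"

text \<open>Partially metric with respect to R 1 (rank-2 schemes are partially metric by convention).\<close>
definition partially_metric :: "'a set \<Rightarrow> (nat \<Rightarrow> ('a \<times> 'a) set) \<Rightarrow> nat \<Rightarrow> bool" where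
  "partially_metric X R d \<longleftrightarrow>
     assoc_scheme X R d \<and> 1 \<le> d \<and>
     (\<forall>x\<in>X. \<forall>y\<in>X. (x, y) \<in> (R 1)\<^sup>*) \<and>
     (d = 1 \<or> (\<exists>j\<le>d. R j = dist2_rel X (R 1)))"

text \<open>The scheme S of rank d+1 on X is the association scheme generated by the graph with edge
  relation E: it has E as a relation, and every association scheme on X of rank at most d+1
  having E as a relation has exactly the same set of relations (so S is the unique scheme of
  minimal rank with E as a relation).\<close>
definition generated_scheme :: "'a set \<Rightarrow> ('a \<times> 'a) set \<Rightarrow> (nat \<Rightarrow> ('a \<times> 'a) set) \<Rightarrow> nat \<Rightarrow> bool" where
  "generated_scheme X E S d \<longleftrightarrow>
     assoc_scheme X S d \<and> (\<exists>i. 1 \<le> i \<and> i \<le> d \<and> S i = E) \<and>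
     (\<forall>d' S'. assoc_scheme X S' d' \<and> (\<exists>i. 1 \<le> i \<and> i \<le> d' \<and> S' i = E) \<and> d' \<le> d
        \<longrightarrow> S' ` {..d'} = S ` {..d})"

section \<open>Bose--Mesner algebra (scheme on the whole finite type 'x)\<close>

definition rel_matrix :: "('x::finite \<times> 'x) set \<Rightarrow> real^'x^'x" where
  "rel_matrix E = (\<chi> x y. if (x, y) \<in> E then 1 else 0)"

definition bose_mesner :: "(nat \<Rightarrow> ('x::finite \<times> 'x) set) \<Rightarrow> nat \<Rightarrow> (real^'x^'x) set" where
  "bose_mesner R d = span ((\<lambda>i. rel_matrix (R i)) ` {..d})"

text \<open>Minimal (primitive) idempotents of the Bose--Mesner algebra.\<close>
definition minimal_idempotent :: "(nat \<Rightarrow> ('x::finite \<times> 'x) set) \<Rightarrow> nat \<Rightarrow> real^'x^'x \<Rightarrow> bool" where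
  "minimal_idempotent R d E \<longleftrightarrow>
     E \<in> bose_mesner R d \<and> E ** E = E \<and> E \<noteq> 0 \<and>
     (\<forall>F\<in>bose_mesner R d. F ** F = F \<and> F ** E = F \<longrightarrow> F = 0 \<or> F = E)"

section \<open>Graphs\<close>

text \<open>The graph on the whole type 'a with edge relation G is isomorphic (via f) to the graph
  with vertex set V and edge relation E.\<close>
definition graph_iso_via :: "('a \<Rightarrow> 'b) \<Rightarrow> ('a \<times> 'a) set \<Rightarrow> 'b set \<Rightarrow> ('b \<times> 'b) set \<Rightarrow> bool" where
  "graph_iso_via f G V E \<longleftrightarrow> bij_betw f UNIV V \<and> (\<forall>x y. (x, y) \<in> G \<longleftrightarrow> (f x, f y) \<in> E)"

definition graph_iso :: "('a \<times> 'a) set \<Rightarrow> 'b set \<Rightarrow> ('b \<times> 'b) set \<Rightarrow> bool" where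
  "graph_iso G V E \<longleftrightarrow> (\<exists>f. graph_iso_via f G V E)"

definition K4_V :: "nat set" where "K4_V = {0..<4}"
definition K4_E :: "(nat \<times> nat) set" where
  "K4_E = {(x, y). x \<in> K4_V \<and> y \<in> K4_V \<and> x \<noteq> y}"

text \<open>The cube Q_3: 0/1-words of length 3, adjacent iff they differ in exactly one place.\<close>
definition cube_V :: "bool list set" where "cube_V = {xs. length xs = 3}"
definition cube_E :: "(bool list \<times> bool list) set" where
  "cube_E = {(xs, ys). xs \<in> cube_V \<and> ys \<in> cube_V \<and> card {i. i < 3 \<and> xs ! i \<noteq> ys ! i} = 1}"

text \<open>Generalized Petersen graph GP(n,s): (False,i) is the outer vertex i, (True,i) is i*.\<close>
definition GP_V :: "int \<Rightarrow> (bool \<times> int) set" where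
  "GP_V n = {(b, i). 0 \<le> i \<and> i < n}"
definition GP_E :: "int \<Rightarrow> int \<Rightarrow> ((bool \<times> int) \<times> (bool \<times> int)) set" where
  "GP_E n s = {((b, i), (c, j)). (b, i) \<in> GP_V n \<and> (c, j) \<in> GP_V n \<and>
      ((\<not> b \<and> \<not> c \<and> ((i - j) mod n = 1 mod n \<or> (i - j) mod n = (-1) mod n)) \<or>
       (b \<noteq> c \<and> i = j) \<or>
       (b \<and> c \<and> ((i - j) mod n = s mod n \<or> (i - j) mod n = (-s) mod n)))}"

text \<open>The dodecahedron, realised as GP(10,2).\<close>
definition dodeca_V :: "(bool \<times> int) set" where "dodeca_V = GP_V 10"
definition dodeca_E :: "((bool \<times> int) \<times> (bool \<times> int)) set" where "dodeca_E = GP_E 10 2"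

text \<open>The icosahedron: north pole (0,0), upper pentagon (1,i), lower pentagon (2,i), south pole
  (3,0); u_i ~ N, u_i ~ u_(i+1), l_i ~ S, l_i ~ l_(i+1), u_i ~ l_i, u_i ~ l_(i+1).\<close>
definition icosa_V :: "(nat \<times> int) set" where
  "icosa_V = {(0, 0), (3, 0)} \<union> {(k, i). (k = 1 \<or> k = 2) \<and> 0 \<le> i \<and> i < 5}"
definition icosa_base :: "((nat \<times> int) \<times> (nat \<times> int)) set" where
  "icosa_base = (\<Union>i\<in>{0..<5}.
     {((0, 0), (1, i)), ((3, 0), (2, i)), ((1, i), (1, (i + 1) mod 5)), ((2, i), (2, (i + 1) mod 5)),
      ((1, i), (2, i)), ((1, i), (2, (i + 1) mod 5))})"
definition icosa_E :: "((nat \<times> int) \<times> (nat \<times> int)) set" where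
  "icosa_E = icosa_base \<union> icosa_base\<inverse>"

text \<open>Complete multipartite graph with m parts of size k each.\<close>
definition cmp_V :: "nat \<Rightarrow> nat \<Rightarrow> (nat \<times> nat) set" where
  "cmp_V m k = {0..<m} \<times> {0..<k}"
definition cmp_E :: "nat \<Rightarrow> nat \<Rightarrow> ((nat \<times> nat) \<times> (nat \<times> nat)) set" where
  "cmp_E m k = {(x, y). x \<in> cmp_V m k \<and> y \<in> cmp_V m k \<and> fst x \<noteq> fst y}"

text \<open>Bipartite double: vertex (x, False) is x^+, (x, True) is x^-.\<close>
definition bd_V :: "'b set \<Rightarrow> ('b \<times> bool) set" where
  "bd_V V = V \<times> UNIV"
definition bd_E :: "('b \<times> 'b) set \<Rightarrow> (('b \<times> bool) \<times> ('b \<times> bool)) set" where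
  "bd_E E = {((x, a), (y, b)). (x, y) \<in> E \<and> a \<noteq> b}"

text \<open>Relation of the bipartite double scheme: D (x) I_2 for b = False, D (x) (J_2 - I_2) for b = True.\<close>
definition bd_rel :: "('b \<times> 'b) set \<Rightarrow> bool \<Rightarrow> (('b \<times> bool) \<times> ('b \<times> bool)) set" where
  "bd_rel D b = {((x, a), (y, c)). (x, y) \<in> D \<and> ((a \<noteq> c) \<longleftrightarrow> b)}"

end

theory Submission
  imports Defs "HOL-Library.Multiset" "HOL-Library.Code_Binary_Nat" "HOL-Analysis.Cross3"
begin

text \<open>A minimal idempotent of rank three turns the vertices into unit vectors \<open>u x\<close> of three-space whose inner
  products depend only on the relation, with \<open>\<theta> u x\<close> the sum over the neighbours of \<open>x\<close>. If vertices at distance two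
  coincide, the graph is complete multipartite; otherwise the neighbours of a vertex are distinct points of a circle with
  at most two inner products, so the valency is at most five and everything but the cubic, triangle-free graphs with
  unique paths of length two is settled locally. There, left and right turns of a path are visible in the inner
  products: paths turning twice to the same side form a union of relations, whose matrix commutes with the adjacency
  matrix. Counting paths of length four then forces \<open>\<theta>\<^sup>2 = 1\<close> or \<open>\<theta>\<^sup>2 = 5\<close> and yields relations in the group
  generated by three edge colours (respectively by the reversal and rotation of arcs), which has order 48 (respectively 120);
  its coset table is the universal graph, and the possible quotients are those listed. The scheme is determined because
  equitable refinement from a root separates its relations in every scheme containing the edge relation.\<close>

section \<open>The coherent class function of a scheme\<close>

text \<open>A class forgets orientation: reading a path backwards exchanges left and right. Turns
  are therefore no class functions, only the comparison of two successive turns is, and commuting it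
  with adjacency merely says that a vertex reached with one mixed pattern is also reached with the
  other, by an unknown path. The inner products identify that path completely when
  \<open>\<theta>\<^sup>2 = 5\<close>. When \<open>\<theta>\<^sup>2 = 1\<close> the images are
  vertices of a cube, too few values remain, and \<open>PQ\<close> leaves two alternatives; the
  predicates \<open>degen\<close> and \<open>twist\<close> and the count behind
  \<open>F_const\<close> serve to decide between them.

  The vectors alone never bound the graph, since distinct vertices may share an image. A finite
  table of words does, and the vectors then leave only few words that can fix a vertex or an arc.

  That the scheme is determined has two halves: refined colours are separated in every competing
  scheme, and each colour is one class in the given scheme. Only the second half uses the class at
  distance two. For the double of the dodecahedron the refinement starts from a colouring that marks
  the twin of the root as well.\<close>

definition class_inv :: "('v => 'v => nat) => ('v => 'v => 'b) => bool" where
  "class_inv c F \<longleftrightarrow> (\<forall>x y x' y'. c x y = c x' y' --> F x y = F x' y')"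

lemma class_invD: "class_inv c F ==> c x y = c x' y' ==> F x y = F x' y'"
  unfolding class_inv_def by blast

lemma class_inv_comp: "class_inv c F ==> class_inv c (\<lambda>x y. h (F x y))"
  unfolding class_inv_def by metis

lemma class_inv_comp2: "class_inv c F ==> class_inv c G ==> class_inv c (\<lambda>x y. h (F x y) (G x y))"
  unfolding class_inv_def by metis

lemma class_inv_const: "class_inv c (\<lambda>x y. a)"
  by (simp add: class_inv_def)

lemma class_inv_self: "class_inv c c"
  by (simp add: class_inv_def)

lemma class_inv_factor:
  assumes "class_inv c F" obtains f where "!!x y. F x y = f (c x y)"
proof -
  define f where "f k = (SOME v. \<exists>x y. c x y = k \<and> F x y = v)" for k
  have "F x y = f (c x y)" for x y
  proof -
    have "\<exists>x' y'. c x' y' = c x y \<and> F x' y' = f (c x y)"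
      unfolding f_def by (rule someI_ex) blast
    then show ?thesis using assms by (metis class_invD)
  qed
  then show ?thesis using that by blast
qed

locale coherent =
  fixes c :: "'v::finite => 'v => nat"
  assumes c_sym: "c x y = c y x"
    and c_diag: "c x y = 0 \<longleftrightarrow> x = y"
    and c_coh: "c x y = c x' y' ==>
      card {z. c x z = i \<and> c z y = j} = card {z. c x' z = i \<and> c z y' = j}"
begin

text \<open>Grouping the vertices \<open>z\<close> by the pair of classes
  \<open>(c x z, c z y)\<close> gives a sum whose coefficients are intersection numbers. Hence class
  functions are closed under matrix products over any commutative semiring: over \<open>real\<close>
  this is the Bose-Mesner algebra, over \<open>nat\<close> it yields counts of walks.\<close>

lemma class_inv_sum0: "class_inv c (\<lambda>x y. \<Sum>z\<in>UNIV. (h (c x z) (c z y) :: 'b::comm_semiring_1))"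
proof -
  define I where "I = (\<lambda>(x, y). c x y) ` UNIV"
  have fI: "finite I" unfolding I_def by simp
  have "(\<Sum>z\<in>UNIV. h (c x z) (c z y)) =
      (\<Sum>p\<in>I \<times> I. of_nat (card {z. c x z = fst p \<and> c z y = snd p}) * h (fst p) (snd p))" for x y
  proof -
    have "(\<Sum>p\<in>I \<times> I. \<Sum>z\<in>{z \<in> UNIV. (c x z, c z y) = p}. h (c x z) (c z y)) =
        (\<Sum>z\<in>UNIV. h (c x z) (c z y))"
      by (rule sum.group) (auto simp: fI I_def)
    moreover have "(\<Sum>z\<in>{z \<in> UNIV. (c x z, c z y) = p}. h (c x z) (c z y)) =
        of_nat (card {z. c x z = fst p \<and> c z y = snd p}) * h (fst p) (snd p)" for p
    proof -
      have "{z \<in> UNIV. (c x z, c z y) = p} = {z. c x z = fst p \<and> c z y = snd p}"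
        by (auto simp: prod_eq_iff)
      then show ?thesis by (simp add: sum_constant[symmetric] del: sum_constant)
    qed
    ultimately show ?thesis by simp
  qed
  then have e: "(\<lambda>x y. \<Sum>z\<in>UNIV. h (c x z) (c z y)) = (\<lambda>x y.
      \<Sum>p\<in>I \<times> I. of_nat (card {z. c x z = fst p \<and> c z y = snd p}) * h (fst p) (snd p))"
    by presburger
  show ?thesis unfolding e class_inv_def
  proof (intro allI impI)
    fix x y x' y' assume "c x y = c x' y'"
    show "(\<Sum>p\<in>I \<times> I. of_nat (card {z. c x z = fst p \<and> c z y = snd p}) * h (fst p) (snd p)) =
      (\<Sum>p\<in>I \<times> I. of_nat (card {z. c x' z = fst p \<and> c z y' = snd p}) * h (fst p) (snd p))"
      by (intro sum.cong refl) (metis c_coh[OF \<open>c x y = c x' y'\<close>])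
  qed
qed

lemma class_inv_sum:
  fixes h :: "'a => 'b => 'd::comm_semiring_1"
  assumes "class_inv c F" "class_inv c G"
  shows "class_inv c (\<lambda>x y. \<Sum>z\<in>UNIV. h (F x z) (G z y))"
proof -
  obtain f where f: "!!x y. F x y = f (c x y)" using class_inv_factor[OF assms(1)] by blast
  obtain g where g: "!!x y. G x y = g (c x y)" using class_inv_factor[OF assms(2)] by blast
  show ?thesis unfolding f g using class_inv_sum0[of "\<lambda>i j. h (f i) (g j)"] .
qed

lemma class_inv_card:
  assumes "class_inv c P" "class_inv c Q"
  shows "class_inv c (\<lambda>x y. card {z. P x z \<and> Q z y})"
proof -
  have "card {z. P x z \<and> Q z y} = (\<Sum>z\<in>UNIV. if P x z \<and> Q z y then 1 else 0)" for x y
    by (simp add: sum.If_cases)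
  then show ?thesis using class_inv_sum[OF assms, of "\<lambda>p q. if p \<and> q then 1 else 0 :: nat"]
    by presburger
qed

lemma class_inv_sym: "class_inv c F ==> F x y = F y x"
  using class_invD[of c F x y y x] c_sym[of x y] by blast

text \<open>Symmetric matrices with a symmetric product commute, and the product is symmetric
  because it is a class function.\<close>

lemma class_inv_commute:
  fixes F G :: "'v => 'v => 'b::comm_semiring_1"
  assumes "class_inv c F" "class_inv c G"
  shows "(\<Sum>z\<in>UNIV. F x z * G z y) = (\<Sum>z\<in>UNIV. G x z * F z y)"
proof -
  have "(\<Sum>z\<in>UNIV. F x z * G z y) = (\<Sum>z\<in>UNIV. F y z * G z x)"
    using class_inv_sym[OF class_inv_sum[OF assms, of "(*)"]] .
  also have "\<dots> = (\<Sum>z\<in>UNIV. G x z * F z y)"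
    by (rule sum.cong) (auto simp: class_inv_sym[OF assms(1), of _ y] class_inv_sym[OF assms(2), of x] mult.commute)
  finally show ?thesis .
qed

lemma class_inv_eq: "class_inv c (\<lambda>x y. x = y)"
  unfolding class_inv_def by (metis c_diag)

end

definition scheme_class :: "(nat => ('a \<times> 'a) set) => nat => 'a => 'a => nat" where
  "scheme_class R d x y = (THE i. i \<le> d \<and> (x, y) \<in> R i)"

lemma scheme_class_unique:
  assumes "assoc_scheme UNIV R d"
  shows "\<exists>!i. i \<le> d \<and> (x, y) \<in> R i"
proof -
  have "(x, y) \<in> (\<Union>i\<le>d. R i)" using assms unfolding assoc_scheme_def by auto
  then obtain i where "i \<le> d" "(x, y) \<in> R i" by auto
  moreover have "j = i" if "j \<le> d" "(x, y) \<in> R j" for j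
  proof (rule ccontr)
    assume "j ~= i"
    then have "R i \<inter> R j = {}" using assms that(1) \<open>i \<le> d\<close> unfolding assoc_scheme_def by metis
    then show False using that(2) \<open>(x, y) \<in> R i\<close> by blast
  qed
  ultimately show ?thesis by blast
qed

lemma scheme_class_iff:
  assumes "assoc_scheme UNIV R d" "i \<le> d"
  shows "scheme_class R d x y = i \<longleftrightarrow> (x, y) \<in> R i"
  unfolding scheme_class_def
  using theI'[OF scheme_class_unique[OF assms(1)], of x y] scheme_class_unique[OF assms(1), of x y] assms(2)
  by metis

lemma scheme_class_le: "assoc_scheme UNIV R d ==> scheme_class R d x y \<le> d"
  unfolding scheme_class_def using theI'[OF scheme_class_unique] by metis

lemma scheme_class_mem: "assoc_scheme UNIV R d ==> (x, y) \<in> R (scheme_class R d x y)"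
  using scheme_class_iff scheme_class_le by metis

lemma scheme_coherent:
  fixes R :: "nat => ('v::finite \<times> 'v) set"
  assumes R: "assoc_scheme UNIV R d"
  shows "coherent (scheme_class R d)"
proof
  fix x y
  show "scheme_class R d x y = scheme_class R d y x"
  proof -
    have "sym (R (scheme_class R d y x))" using R scheme_class_le[OF R, of y x] unfolding assoc_scheme_def by simp
    then show ?thesis using scheme_class_iff[OF R scheme_class_le[OF R]] scheme_class_mem[OF R]
      by (metis symD)
  qed
  show "(scheme_class R d x y = 0) = (x = y)"
    using R scheme_class_iff[OF R, of 0 x y] unfolding assoc_scheme_def by auto
  fix x' y' i j
  assume e: "scheme_class R d x y = scheme_class R d x' y'"
  show "card {z. scheme_class R d x z = i \<and> scheme_class R d z y = j} =
      card {z. scheme_class R d x' z = i \<and> scheme_class R d z y' = j}"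
  proof (cases "i \<le> d \<and> j \<le> d")
    case True
    let ?h = "scheme_class R d x y"
    have h: "?h \<le> d" by (rule scheme_class_le[OF R])
    have "\<forall>h\<le>d. \<forall>i\<le>d. \<forall>j\<le>d. \<exists>p::nat. \<forall>(x, y)\<in>R h. card {z\<in>UNIV. (x, z) \<in> R i \<and> (z, y) \<in> R j} = p"
      using R unfolding assoc_scheme_def by blast
    then obtain p where "\<forall>(x, y)\<in>R ?h. card {z\<in>UNIV. (x, z) \<in> R i \<and> (z, y) \<in> R j} = p"
      using h True by blast
    then have p: "card {z. (x, z) \<in> R i \<and> (z, y) \<in> R j} = p" if "(x, y) \<in> R ?h" for x y
      using that by auto
    show ?thesis using p[OF scheme_class_mem[OF R]] p[of x' y'] scheme_class_mem[OF R, of x' y'] e True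
      by (simp add: scheme_class_iff[OF R])
  next
    case False
    then have "{z. scheme_class R d x z = i \<and> scheme_class R d z y = j} = {}" for x y
      using scheme_class_le[OF R] by auto
    then show ?thesis by (simp only:)
  qed
qed

text \<open>Membership in the span becomes a property of entries, for which closure under products,
  commutativity and symmetry are already available.\<close>

lemma bose_mesner_iff:
  fixes R :: "nat => ('v::finite \<times> 'v) set"
  assumes R: "assoc_scheme UNIV R d"
  shows "M \<in> bose_mesner R d \<longleftrightarrow> class_inv (scheme_class R d) (\<lambda>x y. M $ x $ y)"
proof
  assume "M \<in> bose_mesner R d"
  then show "class_inv (scheme_class R d) (\<lambda>x y. M $ x $ y)"
    unfolding bose_mesner_def
  proof (induction rule: span_induct_alt)
    case base
    then show ?case by (simp add: class_inv_def)
  next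
    case (step a A B)
    then obtain i where i: "i \<le> d" "A = rel_matrix (R i)" by auto
    show ?case unfolding class_inv_def
    proof (intro allI impI)
      fix x y x' y' assume e: "scheme_class R d x y = scheme_class R d x' y'"
      then have "(x, y) \<in> R i \<longleftrightarrow> (x', y') \<in> R i" using scheme_class_iff[OF R i(1)] by metis
      then show "(a *\<^sub>R A + B) $ x $ y = (a *\<^sub>R A + B) $ x' $ y'"
        using class_invD[OF step(2) e] i by (simp add: rel_matrix_def)
    qed
  qed
next
  assume "class_inv (scheme_class R d) (\<lambda>x y. M $ x $ y)"
  then obtain g where g: "!!x y. M $ x $ y = g (scheme_class R d x y)" by (rule class_inv_factor) blast
  have "M = (\<Sum>i\<le>d. g i *\<^sub>R rel_matrix (R i))"
  proof -
    have "(\<Sum>i\<le>d. g i *\<^sub>R rel_matrix (R i)) $ x $ y = M $ x $ y" for x y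
    proof -
      have "(\<Sum>i\<le>d. g i *\<^sub>R rel_matrix (R i)) $ x $ y = (\<Sum>i\<le>d. if i = scheme_class R d x y then g i else 0)"
        unfolding sum_component vector_scaleR_component rel_matrix_def
        by (rule sum.cong) (auto simp: scheme_class_iff[OF R, symmetric])
      then show ?thesis using scheme_class_le[OF R, of x y] g by simp
    qed
    then show ?thesis by (simp add: vec_eq_iff)
  qed
  also have "\<dots> \<in> bose_mesner R d" unfolding bose_mesner_def
    by (intro span_sum span_scale span_base) auto
  finally show "M \<in> bose_mesner R d" .
qed

section \<open>From a minimal idempotent to unit vectors in space\<close>

lemma inner_matrix: "(M::real^'n::finite^'n) \<bullet> N = (\<Sum>x\<in>UNIV. \<Sum>y\<in>UNIV. M $ x $ y * N $ x $ y)"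
  by (simp add: inner_vec_def)

text \<open>For the trace form, multiplication by \<open>N\<close> from the left has the transpose
  of \<open>N\<close> as its adjoint.\<close>

lemma inner_matrix_mult_right:
  fixes M N K :: "real^'n::finite^'n"
  shows "M \<bullet> (N ** K) = (transpose N ** M) \<bullet> K"
proof -
  have "M \<bullet> (N ** K) = (\<Sum>x\<in>UNIV. \<Sum>y\<in>UNIV. \<Sum>z\<in>UNIV. M $ x $ y * N $ x $ z * K $ z $ y)"
    by (simp add: inner_matrix matrix_matrix_mult_def sum_distrib_left mult.assoc)
  also have "\<dots> = (\<Sum>z\<in>UNIV. \<Sum>y\<in>UNIV. \<Sum>x\<in>UNIV. M $ x $ y * N $ x $ z * K $ z $ y)"
    by (subst (2) sum.swap, subst sum.swap, rule sum.cong[OF refl], rule sum.swap)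
  also have "\<dots> = (transpose N ** M) \<bullet> K"
    by (simp add: inner_matrix matrix_matrix_mult_def transpose_def sum_distrib_right sum_distrib_left mult_ac)
  finally show ?thesis .
qed

lemma matrix_diff_mult: "(A - B) ** C = A ** C - B ** (C::real^'n::finite^'n)" for A B :: "real^'n^'n"
  by (simp add: vec_eq_iff matrix_matrix_mult_def left_diff_distrib sum_subtractf)

lemma matrix_add_mult: "(A + B) ** C = A ** C + B ** (C::real^'n::finite^'n)" for A B :: "real^'n^'n"
  by (simp add: vec_eq_iff matrix_matrix_mult_def distrib_right sum.distrib)

lemma matrix_scaleR_mult: "(k *\<^sub>R A) ** C = k *\<^sub>R (A ** C)" for A C :: "real^'n::finite^'n"
  by (simp add: vec_eq_iff matrix_matrix_mult_def sum_distrib_left mult.assoc)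

text \<open>In a commutative algebra of symmetric matrices with no idempotent strictly below
  the unit \<open>E\<close>, every nonzero element is invertible: the orthogonal projection of \<open>E\<close> to the ideal
  generated by \<open>M\<close> (for the trace form) is an idempotent that acts as the identity on that ideal.\<close>

lemma symmetric_algebra_inverse:
  fixes B :: "(real^'n::finite^'n) set" and E M :: "real^'n^'n"
  assumes sub: "subspace B"
    and mult: "!!P Q. P \<in> B ==> Q \<in> B ==> P ** Q \<in> B"
    and comm: "!!P Q. P \<in> B ==> Q \<in> B ==> P ** Q = Q ** P"
    and symm: "!!P. P \<in> B ==> transpose P = P"
    and E: "E \<in> B" "E ** E = E"
    and min: "!!F. F \<in> B ==> F ** F = F ==> F ** E = F ==> F = 0 \<or> F = E"
    and M: "M \<in> B" "M ** E = M" "M ~= 0"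
  obtains G where "G \<in> B" "M ** G = E"
proof -
  define I where "I = (\<lambda>N. M ** N) ` B"
  have lin: "linear (\<lambda>N. M ** N)"
    by (rule linearI) (simp_all add: vec_eq_iff matrix_matrix_mult_def sum.distrib sum_distrib_left algebra_simps)
  have subI: "subspace I" unfolding I_def by (rule linear_subspace_image[OF lin sub])
  have IB: "I \<subseteq> B" unfolding I_def using M(1) mult by blast
  obtain F Z where F: "F \<in> span I" and Z: "!!w. w \<in> span I ==> orthogonal Z w" and EFZ: "E = F + Z"
    using orthogonal_subspace_decomp_exists by blast
  have FI: "F \<in> I" using F subI by (simp add: span_eq_iff[THEN iffD2])
  have Z': "Z \<bullet> w = 0" if "w \<in> I" for w using Z[OF span_base[OF that]] by (simp add: orthogonal_def)
  have FB: "F \<in> B" using FI IB by blast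
  have ZB: "Z \<in> B" using E(1) FB sub EFZ subspace_diff[OF sub E(1) FB] by simp
  \<comment> \<open>The square norm of \<open>Z ** N\<close> is
    \<open>Z \<bullet> (N ** (Z ** N))\<close>, and \<open>N ** (Z ** N)\<close> lies in the ideal,
    to which \<open>Z\<close> is orthogonal. Here the trace form being definite enters.\<close>
  have ZN: "Z ** N = 0" if N: "N \<in> I" for N
  proof -
    have NB: "N \<in> B" using N IB by blast
    have "(Z ** N) \<bullet> (Z ** N) = Z \<bullet> (N ** (Z ** N))"
    proof -
      have "Z \<bullet> (N ** (Z ** N)) = (transpose N ** Z) \<bullet> (Z ** N)" by (rule inner_matrix_mult_right)
      also have "transpose N ** Z = Z ** N" using comm[OF NB ZB] symm[OF NB] by simp
      finally show ?thesis by simp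
    qed
    moreover have "N ** (Z ** N) \<in> I"
    proof -
      obtain N' where N': "N' \<in> B" "N = M ** N'" using N unfolding I_def by blast
      have "N ** (Z ** N) = M ** (N' ** (Z ** N))" unfolding N'(2) by (simp add: matrix_mul_assoc)
      moreover have "N' ** (Z ** N) \<in> B" by (intro mult N' ZB NB)
      ultimately show ?thesis unfolding I_def by blast
    qed
    ultimately show ?thesis using Z' by simp
  qed
  have MI: "M \<in> I" unfolding I_def using E(1) M(2) by (metis imageI)
  have EN: "E ** N = N" if N: "N \<in> I" for N
  proof -
    obtain N' where N': "N' \<in> B" "N = M ** N'" using N unfolding I_def by blast
    have "E ** N = (E ** M) ** N'" using N' by (simp add: matrix_mul_assoc)
    also have "E ** M = M" using comm[OF E(1) M(1)] M(2) by simp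
    finally show ?thesis using N' by simp
  qed
  have FN: "F ** N = N" if "N \<in> I" for N
  proof -
    have "E ** N = F ** N + Z ** N" unfolding EFZ by (simp add: matrix_add_mult)
    then show ?thesis using ZN[OF that] EN[OF that] by simp
  qed
  have "F ** E = F" using EN[OF FI] comm[OF E(1) FB] by simp
  then have "F = 0 \<or> F = E" using min[OF FB FN[OF FI]] by blast
  moreover have "F ~= 0"
  proof
    assume "F = 0"
    then have "M = 0" using FN[OF MI] by simp
    then show False using M(3) by blast
  qed
  ultimately have "E \<in> I" using FI by blast
  then show ?thesis using that unfolding I_def by blast
qed

text \<open>The Rayleigh quotient attains its maximum on the compact unit sphere of the invariant
  subspace. At a maximiser the residual \<open>r\<close> vanishes: otherwise a small move along
  \<open>r\<close> gains a linear term that the quadratic term cannot cancel.\<close>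

lemma symmetric_eigenvector_in_subspace:
  fixes A :: "real^'n::finite^'n" and S :: "(real^'n) set"
  assumes S: "subspace S" "S ~= {0}" and A: "transpose A = A" "!!v. v \<in> S ==> A *v v \<in> S"
  obtains \<theta> v where "v \<in> S" "v ~= 0" "A *v v = \<theta> *\<^sub>R v"
proof -
  define K where "K = S \<inter> sphere 0 1"
  have sym: "v \<bullet> (A *v w) = w \<bullet> (A *v v)" for v w
    using dot_lmul_matrix[of v A w] vector_transpose_matrix[of v A] A(1) by (metis inner_commute)
  obtain s where s: "s \<in> S" "s ~= 0" using S subspace_0 by blast
  have "s /\<^sub>R norm s \<in> K" using s S(1) unfolding K_def by (simp add: subspace_scale)
  moreover have "compact K" unfolding K_def
    using closed_subspace[OF S(1)] compact_sphere closed_Int_compact by blast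
  moreover have "continuous_on K (\<lambda>v. v \<bullet> (A *v v))"
    by (intro continuous_intros linear_continuous_on linear_linear[THEN iffD2] matrix_vector_mul_linear)
  ultimately obtain v where v: "v \<in> K" "!!w. w \<in> K ==> w \<bullet> (A *v w) \<le> v \<bullet> (A *v v)"
    using continuous_attains_sup[of K "\<lambda>v. v \<bullet> (A *v v)"] by blast
  define \<theta> where "\<theta> = v \<bullet> (A *v v)"
  have vS: "v \<in> S" "v \<bullet> v = 1" using v(1) unfolding K_def by (auto simp: dot_square_norm)
  have q: "w \<bullet> (A *v w) \<le> \<theta> * (w \<bullet> w)" if w: "w \<in> S" for w
  proof (cases "w = 0")
    case False
    have "w /\<^sub>R norm w \<in> K" using w False S(1) unfolding K_def by (simp add: subspace_scale)
    then have "(w /\<^sub>R norm w) \<bullet> (A *v (w /\<^sub>R norm w)) \<le> \<theta>" using v(2) \<theta>_def by blast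
    then have "(w \<bullet> (A *v w)) / (norm w)\<^sup>2 \<le> \<theta>"
      by (simp add: matrix_vector_mult_scaleR power2_eq_square divide_inverse mult_ac)
    then show ?thesis using False by (simp add: divide_le_eq dot_square_norm)
  qed simp
  define r where "r = A *v v - \<theta> *\<^sub>R v"
  have rS: "r \<in> S" unfolding r_def using A(2)[OF vS(1)] vS(1) S(1) by (simp add: subspace_diff subspace_scale)
  have "r \<bullet> r = 0"
  proof (rule ccontr)
    assume "r \<bullet> r ~= 0"
    then have pos: "r \<bullet> r > 0" using inner_ge_zero[of r] by linarith
    define C where "C = \<theta> * (r \<bullet> r) - r \<bullet> (A *v r)"
    have ineq: "2 * t * (r \<bullet> r) \<le> t\<^sup>2 * C" for t
    proof -
      have "v + t *\<^sub>R r \<in> S" using vS(1) rS S(1) by (simp add: subspace_add subspace_scale)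
      from q[OF this] have "v \<bullet> (A *v v) + 2 * t * (r \<bullet> (A *v v)) + t\<^sup>2 * (r \<bullet> (A *v r)) \<le>
          \<theta> * (v \<bullet> v + 2 * t * (r \<bullet> v) + t\<^sup>2 * (r \<bullet> r))"
        using sym[of v r]
        by (simp add: matrix_vector_right_distrib matrix_vector_mult_scaleR inner_add_left inner_add_right
           power2_eq_square inner_commute algebra_simps)
      moreover have "r \<bullet> (A *v v) - \<theta> * (r \<bullet> v) = r \<bullet> r" unfolding r_def by (simp add: inner_diff_right)
      ultimately show ?thesis using vS(2) \<theta>_def unfolding C_def by (simp add: algebra_simps)
    qed
    \<comment> \<open>The summand 1 avoids division by zero; with this \<open>t\<close>, the product
      \<open>t * C\<close> is at most \<open>r \<bullet> r\<close>, although
      \<open>2 * (r \<bullet> r)\<close> is required.\<close>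
    define t where "t = (r \<bullet> r) / (\<bar>C\<bar> + 1)"
    have t: "t > 0" unfolding t_def using pos by simp
    have "2 * (r \<bullet> r) \<le> t * C" using ineq[of t] t by (simp add: power2_eq_square)
    also have "\<dots> \<le> t * (\<bar>C\<bar> + 1)" using t by (intro mult_left_mono) auto
    also have "\<dots> = r \<bullet> r" unfolding t_def by simp
    finally show False using pos by simp
  qed
  then have "A *v v = \<theta> *\<^sub>R v" unfolding r_def by simp
  moreover have "v ~= 0" using vS(2) by auto
  ultimately show ?thesis using that vS(1) by blast
qed

text \<open>The columns of a symmetric idempotent form a eutactic star, the projection of an
  orthonormal basis to its range; here rescaled to unit length. The third condition says that the
  first relation acts on that range as the scalar \<open>\<theta>\<close>.\<close>

definition eutactic_rep :: "('v::finite => 'v => nat) => ('v => real^3) => real => bool" where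
  "eutactic_rep c u \<theta> \<longleftrightarrow> (\<forall>x. u x \<bullet> u x = 1) \<and> class_inv c (\<lambda>x y. u x \<bullet> u y) \<and>
     (\<forall>x. (\<Sum>y | c x y = 1. u y) = \<theta> *\<^sub>R u x) \<and> span (range u) = UNIV"

text \<open>Minimality makes the part of the algebra below \<open>E\<close> a field, so an element
  of it that kills a nonzero vector of the range of \<open>E\<close> is zero. Applied to
  \<open>A ** E - \<theta> *\<^sub>R E\<close>, with \<open>\<theta>\<close> an eigenvalue of
  \<open>A\<close> on the range, this makes \<open>A\<close> a scalar there.\<close>

lemma minimal_idempotent_rep:
  fixes R :: "nat => ('v::finite \<times> 'v) set"
  assumes R: "assoc_scheme UNIV R d" and d: "1 \<le> d"
    and E: "minimal_idempotent R d E" and rk: "rank E = 3"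
  obtains u \<theta> where "eutactic_rep (scheme_class R d) u \<theta>"
proof -
  let ?c = "scheme_class R d"
  interpret coherent ?c by (rule scheme_coherent[OF R])
  let ?B = "bose_mesner R d"
  note iff = bose_mesner_iff[OF R]
  have sub: "subspace ?B" unfolding bose_mesner_def by simp
  have mult: "P ** Q \<in> ?B" if "P \<in> ?B" "Q \<in> ?B" for P Q
  proof -
    have e: "(\<lambda>x y. (P ** Q) $ x $ y) = (\<lambda>x y. \<Sum>z\<in>UNIV. P $ x $ z * Q $ z $ y)"
      by (intro ext) (simp add: matrix_matrix_mult_def)
    have "class_inv ?c (\<lambda>x y. (P ** Q) $ x $ y)"
      by (subst e) (rule class_inv_sum[OF iff[THEN iffD1, OF that(1)] iff[THEN iffD1, OF that(2)]])
    then show ?thesis by (rule iff[THEN iffD2])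
  qed
  have comm: "P ** Q = Q ** P" if "P \<in> ?B" "Q \<in> ?B" for P Q
    using class_inv_commute[OF iff[THEN iffD1, OF that(1)] iff[THEN iffD1, OF that(2)]]
    unfolding matrix_matrix_mult_def by (simp add: vec_eq_iff)
  have symm: "transpose P = P" if "P \<in> ?B" for P
    using class_inv_sym[OF iff[THEN iffD1, OF that]] by (simp add: transpose_def vec_eq_iff)
  have EB: "E \<in> ?B" and EE: "E ** E = E" and E0: "E ~= 0"
    and min: "!!F. F \<in> ?B ==> F ** F = F ==> F ** E = F ==> F = 0 \<or> F = E"
    using E unfolding minimal_idempotent_def by auto
  define A where "A = rel_matrix (R 1)"
  have AB: "A \<in> ?B" unfolding A_def bose_mesner_def by (rule span_base) (use d in auto)
  define S where "S = range (\<lambda>v. E *v v)"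
  have subS: "subspace S" unfolding S_def
    by (rule linear_subspace_image[OF matrix_vector_mul_linear subspace_UNIV])
  have ES: "E *v v = v" if "v \<in> S" for v
    using that EE unfolding S_def by (auto simp: matrix_vector_mul_assoc)
  have dimS: "dim S = 3" using rk unfolding S_def rank_dim_range .
  have S0: "S ~= {0}" using dimS by auto
  have AS: "A *v v \<in> S" if "v \<in> S" for v
  proof -
    have "A *v v = A *v (E *v v)" using ES[OF that] by simp
    also have "\<dots> = E *v (A *v v)" by (simp add: matrix_vector_mul_assoc comm[OF AB EB])
    finally show ?thesis unfolding S_def by blast
  qed
  obtain \<theta> w where w: "w \<in> S" "w ~= 0" "A *v w = \<theta> *\<^sub>R w"
    by (rule symmetric_eigenvector_in_subspace[OF subS S0 symm[OF AB] AS])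
  define M where "M = A ** E - \<theta> *\<^sub>R E"
  have MB: "M \<in> ?B" unfolding M_def by (intro subspace_diff[OF sub] mult AB EB subspace_scale[OF sub])
  have ME: "M ** E = M" unfolding M_def
    by (simp add: matrix_diff_mult matrix_scaleR_mult matrix_mul_assoc[symmetric] EE)
  have Mw: "M *v w = 0" unfolding M_def using ES[OF w(1)] w(3)
    by (simp add: matrix_vector_mult_diff_rdistrib scaleR_matrix_vector_assoc[symmetric] flip: matrix_vector_mul_assoc)
  have "M = 0"
  proof (rule ccontr)
    assume "M ~= 0"
    obtain G where G: "G \<in> ?B" "M ** G = E"
      by (rule symmetric_algebra_inverse[OF sub mult comm symm EB EE min MB ME \<open>M ~= 0\<close>])
    have "w = (G ** M) *v w" using ES[OF w(1)] G comm[OF G(1) MB] by simp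
    also have "\<dots> = 0" using Mw by (simp add: matrix_vector_mul_assoc[symmetric])
    finally show False using w(2) by simp
  qed
  then have AE: "A ** E = \<theta> *\<^sub>R E" unfolding M_def by simp
  have d3: "dim S = dim (UNIV :: (real^3) set)" using dimS by simp
  obtain f where f: "linear f" "f ` S = (UNIV :: (real^3) set)" "!!x. x \<in> S ==> norm (f x) = norm x"
  proof (rule isometry_subspaces[OF subS subspace_UNIV d3])
    fix f :: "real^'v => real^3"
    assume "linear f" "f ` S = UNIV" "!!x. x \<in> S ==> norm (f x) = norm x"
    then show thesis by (rule that)
  qed
  have fin: "f x \<bullet> f y = x \<bullet> y" if "x \<in> S" "y \<in> S" for x y
  proof -
    have "x + y \<in> S" using that subS by (simp add: subspace_add)
    then show ?thesis using f(3)[of "x + y"] f(3)[OF that(1)] f(3)[OF that(2)] linear_add[OF f(1), of x y]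
      by (simp add: dot_norm)
  qed
  \<comment> \<open>As \<open>E\<close> is a symmetric idempotent, the Gram matrix of its columns is
    \<open>E\<close> again; so inner products are class functions and the common square length is
    the constant diagonal entry \<open>k\<close>.\<close>
  define e where "e x = E *v axis x 1" for x
  have eS: "e x \<in> S" for x unfolding e_def S_def by blast
  have e_comp: "e x $ y = E $ x $ y" for x y
    unfolding e_def matrix_vector_mult_basis column_def
    using class_inv_sym[OF iff[THEN iffD1, OF EB]] by simp
  have ee: "e x \<bullet> e y = E $ x $ y" for x y
  proof -
    have "e x \<bullet> e y = (\<Sum>z\<in>UNIV. E $ x $ z * E $ z $ y)"
      unfolding inner_vec_def e_comp using class_inv_sym[OF iff[THEN iffD1, OF EB]] by simp
    also have "\<dots> = (E ** E) $ x $ y" by (simp add: matrix_matrix_mult_def)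
    finally show ?thesis using EE by simp
  qed
  obtain k where k: "!!x. E $ x $ x = k"
    using iff[THEN iffD1, OF EB] c_diag unfolding class_inv_def by metis
  have k0: "k > 0"
  proof -
    have "k \<ge> 0" using ee[of undefined undefined] k[of undefined] inner_ge_zero[of "e undefined"] by simp
    moreover have "k ~= 0"
    proof
      assume "k = 0"
      then have "e x = 0" for x using ee[of x x] k by simp
      then have "E $ x $ y = 0" for x y using e_comp[of x y] by simp
      then show False using E0 by (simp add: vec_eq_iff)
    qed
    ultimately show ?thesis by simp
  qed
  define u where "u x = (1 / sqrt k) *\<^sub>R f (e x)" for x
  have uu: "u x \<bullet> u y = E $ x $ y / k" for x y
    unfolding u_def using fin[OF eS eS] ee k0 by (simp add: real_sqrt_mult_self mult.assoc[symmetric])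
  have sumA: "(\<Sum>y | ?c x y = 1. e y) = \<theta> *\<^sub>R e x" for x
  proof -
    have "(\<Sum>y | ?c x y = 1. e y) = (\<Sum>y\<in>UNIV. A $ x $ y *\<^sub>R e y)"
      unfolding A_def rel_matrix_def
      by (simp add: scheme_class_iff[OF R d, symmetric] sum.If_cases if_distrib[of "\<lambda>r. r *\<^sub>R _"]
          del: One_nat_def cong: if_cong)
    moreover have "(\<Sum>y\<in>UNIV. A $ x $ y *\<^sub>R e y) $ z = (\<theta> *\<^sub>R e x) $ z" for z
    proof -
      have "(\<Sum>y\<in>UNIV. A $ x $ y *\<^sub>R e y) $ z = (A ** E) $ x $ z"
        by (simp add: sum_component e_comp matrix_matrix_mult_def)
      then show ?thesis using AE e_comp by simp
    qed
    ultimately show ?thesis by (simp add: vec_eq_iff)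
  qed
  have "eutactic_rep ?c u \<theta>" unfolding eutactic_rep_def
  proof (intro conjI allI)
    fix x
    show "u x \<bullet> u x = 1" using uu k k0 by simp
    show "(\<Sum>y | ?c x y = 1. u y) = \<theta> *\<^sub>R u x"
      using arg_cong[OF sumA[of x], of f] unfolding u_def
      by (simp add: linear_sum[OF f(1)] linear_cmul[OF f(1)] scaleR_sum_right[symmetric])
  next
    show "class_inv ?c (\<lambda>x y. u x \<bullet> u y)"
      unfolding uu using class_inv_comp[OF iff[THEN iffD1, OF EB], of "\<lambda>t. t / k"] .
    show "span (range u) = UNIV"
    proof -
      have "f (E *v v) \<in> span (range u)" for v
      proof -
        have "v = (\<Sum>x\<in>UNIV. v $ x *\<^sub>R axis x 1)" using basis_expansion[of v] by (simp add: scalar_mult_eq_scaleR)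
        then have "E *v v = (\<Sum>x\<in>UNIV. v $ x *\<^sub>R e x)"
          unfolding e_def by (metis (no_types, lifting) linear_sum[OF matrix_vector_mul_linear] matrix_vector_mult_scaleR sum.cong)
        then have "f (E *v v) = (\<Sum>x\<in>UNIV. (v $ x * sqrt k) *\<^sub>R u x)"
          using k0 by (simp add: linear_sum[OF f(1)] linear_cmul[OF f(1)] u_def)
        then show ?thesis by (simp only:) (intro span_sum span_scale span_base rangeI)
      qed
      then have "f ` S \<subseteq> span (range u)" unfolding S_def by auto
      then show ?thesis using f(2) by blast
    qed
  qed
  then show ?thesis using that by blast
qed

section \<open>Rooted models and equitable refinement\<close>

text \<open>\<open>nb\<close> is an adjacency table on positions, and \<open>F x\<close> is an
  isomorphism from it to the graph that puts position 0 at \<open>x\<close>. Having one for every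
  root makes positions comparable between roots.\<close>

definition rooted_model :: "('v::finite => 'v => bool) => nat list list => ('v => nat => 'v) => bool" where
  "rooted_model adj nb F \<longleftrightarrow>
     (\<forall>x. F x 0 = x \<and> bij_betw (F x) {..<length nb} UNIV \<and>
       (\<forall>p<length nb. {y. adj (F x p) y} = F x ` set (nb ! p)))"

definition table_ok :: "nat list list => bool" where
  "table_ok nb \<longleftrightarrow> (\<forall>l\<in>set nb. distinct l \<and> (\<forall>q\<in>set l. q < length nb))"

text \<open>One round of colour refinement: the old colour with the multiset of colours of the
  neighbours, sorted so that equality of lists decides equality of multisets.\<close>

definition keys :: "nat list list => nat list => nat list list" where
  "keys nb K = map (\<lambda>(k, l). k # sort (map ((!) K) l)) (zip K nb)"

text \<open>The list \<open>T\<close> gives, for every new colour, the key of the vertices with that colour.\<close>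

definition refine_ok :: "nat list list => nat list => nat list \<times> nat list list => bool" where
  "refine_ok nb K = (\<lambda>(K', T). length K = length nb \<and> length K' = length nb \<and>
     distinct T \<and> list_all (\<lambda>i. i < length T) K' \<and> keys nb K = map ((!) T) K')"

text \<open>The situation in which being a single class passes from colour \<open>i\<close> to
  colour \<open>j\<close>: every vertex of colour \<open>j\<close> is entered from colour
  \<open>i\<close>, and from there by one edge only.\<close>

definition chain_ok :: "nat list list => nat list => nat => nat => bool" where
  "chain_ok nb K i j \<longleftrightarrow> length K = length nb \<and> list_all (\<lambda>(k, l).
     (k = i --> length (filter (\<lambda>q. K ! q = j) l) = 1) \<and>
     (k = j --> list_ex (\<lambda>q. K ! q = i) l)) (zip K nb)"

lemma refine_okD:
  assumes "refine_ok nb K (K', T)" "p < length nb" "p' < length nb"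
    and "K ! p = K ! p'" "sort (map ((!) K) (nb ! p)) = sort (map ((!) K) (nb ! p'))"
  shows "K' ! p = K' ! p'"
proof -
  have len: "length K = length nb" "length K' = length nb" and T: "distinct T"
    and lt: "!!i. i \<in> set K' ==> i < length T" and eq: "keys nb K = map ((!) T) K'"
    using assms(1) unfolding refine_ok_def by (auto simp: list_all_iff)
  have "keys nb K ! p = keys nb K ! p'"
    unfolding keys_def using assms len by simp
  then have "T ! (K' ! p) = T ! (K' ! p')" unfolding eq using assms len by simp
  moreover have "K' ! p < length T" "K' ! p' < length T" using lt len assms by auto
  ultimately show ?thesis using T by (simp add: nth_eq_iff_index_eq)
qed

lemma chain_okD:
  assumes "chain_ok nb K i j" "p < length nb"
  shows "K ! p = i ==> length (filter (\<lambda>q. K ! q = j) (nb ! p)) = 1"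
    and "K ! p = j ==> \<exists>q\<in>set (nb ! p). K ! q = i"
proof -
  have "(K ! p, nb ! p) \<in> set (zip K nb)"
    unfolding set_zip using assms unfolding chain_ok_def by auto
  then show "K ! p = i ==> length (filter (\<lambda>q. K ! q = j) (nb ! p)) = 1"
    and "K ! p = j ==> \<exists>q\<in>set (nb ! p). K ! q = i"
    using assms unfolding chain_ok_def by (fastforce simp: list_all_iff list_ex_iff)+
qed

text \<open>Classes refine colours, uniformly in the root. The converse inclusion for one colour is
  \<open>one_class\<close>; both together identify colours with classes.\<close>

definition colored :: "('v => 'v => nat) => ('v => nat => 'v) => nat => nat list => bool" where
  "colored c F n K \<longleftrightarrow> (\<forall>x x'. \<forall>p<n. \<forall>p'<n. c x (F x p) = c x' (F x' p') --> K ! p = K ! p')"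

definition one_class :: "('v => 'v => nat) => ('v => nat => 'v) => nat => nat list => nat => bool" where
  "one_class c F n K j \<longleftrightarrow>
     (\<forall>x x'. \<forall>p<n. \<forall>p'<n. K ! p = j --> K ! p' = j --> c x (F x p) = c x' (F x' p'))"

locale model = coherent c for c :: "'v::finite => 'v => nat" +
  fixes adj :: "'v => 'v => bool" and nb :: "nat list list" and F :: "'v => nat => 'v"
  assumes adj_inv: "class_inv c adj"
    and model: "rooted_model adj nb F"
    and tab: "table_ok nb"
begin

abbreviation "n \<equiv> length nb"

lemma F0: "F x 0 = x" and Fbij: "bij_betw (F x) {..<n} UNIV"
  and Fadj: "p < n ==> {y. adj (F x p) y} = F x ` set (nb ! p)"
  using model unfolding rooted_model_def by auto

lemma adj_sym: "adj x y = adj y x"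
  by (rule class_inv_sym[OF adj_inv])

lemma Finj: "p < n ==> q < n ==> F x p = F x q \<longleftrightarrow> p = q"
  using Fbij[of x] by (auto simp: bij_betw_def inj_on_def)

lemma Fsurj: "\<exists>p<n. y = F x p"
  using Fbij[of x] unfolding bij_betw_def by (metis UNIV_I imageE lessThan_iff)

lemma n_pos: "n > 0"
  using Fsurj[of undefined undefined] by force

lemma nb_lt: "p < n ==> q \<in> set (nb ! p) ==> q < n" and nb_distinct: "p < n ==> distinct (nb ! p)"
  using tab unfolding table_ok_def by (auto dest: nth_mem)

text \<open>Since classes refine colours, having colour \<open>j\<close> as seen from the root is a
  class function, and so is the number of such neighbours. Injectivity of \<open>F x\<close> and the
  absence of repetitions in the table turn that number into a length.\<close>

lemma count_neighbours:
  assumes p: "p < n" and inv: "colored c F n K"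
  shows "\<exists>k. \<forall>x' p'. p' < n --> c x' (F x' p') = c x (F x p) -->
    length (filter (\<lambda>q. K ! q = j) (nb ! p')) = k"
proof -
  define P where "P x z \<longleftrightarrow> (\<exists>q<n. z = F x q \<and> K ! q = j)" for x z
  have Pinv: "class_inv c P" unfolding class_inv_def
  proof (intro allI impI)
    fix x y x' y' assume e: "c x y = c x' y'"
    obtain q q' where "q < n" "y = F x q" "q' < n" "y' = F x' q'" using Fsurj by metis
    then show "P x y = P x' y'" using inv e Finj unfolding P_def colored_def by metis
  qed
  have card: "card {z. P x z \<and> adj z (F x p)} = length (filter (\<lambda>q. K ! q = j) (nb ! p))"
    if "p < n" for x p
  proof -
    have "z \<in> {z. P x z \<and> adj z (F x p)} \<longleftrightarrow> z \<in> F x ` set (filter (\<lambda>q. K ! q = j) (nb ! p))" for z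
    proof -
      have "adj z (F x p) \<longleftrightarrow> z \<in> F x ` set (nb ! p)" using Fadj[OF that, of x] adj_sym by blast
      then show ?thesis unfolding P_def using nb_lt[OF that] Finj by fastforce
    qed
    then have "{z. P x z \<and> adj z (F x p)} = F x ` set (filter (\<lambda>q. K ! q = j) (nb ! p))" by blast
    moreover have "inj_on (F x) (set (filter (\<lambda>q. K ! q = j) (nb ! p)))"
      using nb_lt[OF that] Finj unfolding inj_on_def by simp
    ultimately show ?thesis
      using distinct_card[OF distinct_filter[OF nb_distinct[OF that]]] by (simp add: card_image)
  qed
  show ?thesis using class_invD[OF class_inv_card[OF Pinv adj_inv]] card p by metis
qed

text \<open>Pairs of one class have equally many neighbours of each colour, hence equal multisets of
  neighbour colours and equal keys.\<close>

lemma refine: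
  assumes inv: "colored c F n K" and ok: "refine_ok nb K (K', T)"
  shows "colored c F n K'"
  unfolding colored_def
proof (intro allI impI)
  fix x x' p p' assume p: "p < n" "p' < n" and e: "c x (F x p) = c x' (F x' p')"
  have K: "K ! p = K ! p'" using inv p e unfolding colored_def by blast
  have "count (mset (map ((!) K) (nb ! p))) j = count (mset (map ((!) K) (nb ! p'))) j" for j
  proof -
    have "count (mset (map ((!) K) l)) j = length (filter (\<lambda>q. K ! q = j) l)" for l
      by (induction l) auto
    moreover obtain k where "!!x' p'. p' < n ==> c x' (F x' p') = c x (F x p) ==>
      length (filter (\<lambda>q. K ! q = j) (nb ! p')) = k" using count_neighbours[OF p(1) inv] by metis
    ultimately show ?thesis using p e by metis
  qed
  then have "mset (map ((!) K) (nb ! p)) = mset (map ((!) K) (nb ! p'))" by (rule multiset_eqI)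
  then have "sort (map ((!) K) (nb ! p)) = sort (map ((!) K) (nb ! p'))"
    by (metis mset_sort properties_for_sort sorted_sort)
  then show "K' ! p = K' ! p'" using refine_okD[OF ok p K] by blast
qed

lemma colored_root: "K = 0 # replicate (n - 1) 1 ==> colored c F n K"
  unfolding colored_def
proof (intro allI impI)
  fix x x' p p' assume K: "K = 0 # replicate (n - 1) 1" and p: "p < n" "p' < n"
    and e: "c x (F x p) = c x' (F x' p')"
  have "p = 0 \<longleftrightarrow> p' = 0" using e p F0 Finj c_diag n_pos by metis
  then show "K ! p = K ! p'" using p unfolding K by (auto simp: nth_Cons')
qed

text \<open>If \<open>(x, F x q)\<close> and \<open>(x', F x' q')\<close> lie in one class,
  coherence matches every continuation of the first by an edge with a continuation of the second
  having the same end class. That end has colour \<open>j\<close> because classes refine colours,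
  and only one edge at \<open>q'\<close> leads to colour \<open>j\<close>.\<close>

lemma chain:
  assumes inv: "colored c F n K" and i: "one_class c F n K i" and ok: "chain_ok nb K i j"
  shows "one_class c F n K j"
  unfolding one_class_def
proof (intro allI impI)
  fix x x' p p' assume p: "p < n" "p' < n" and K: "K ! p = j" "K ! p' = j"
  obtain q where q: "q \<in> set (nb ! p)" "K ! q = i" using chain_okD(2)[OF ok p(1) K(1)] by blast
  obtain q' where q': "q' \<in> set (nb ! p')" "K ! q' = i" using chain_okD(2)[OF ok p(2) K(2)] by blast
  have qn: "q < n" "q' < n" using q q' nb_lt p by auto
  have e: "c x (F x q) = c x' (F x' q')" using i qn q q' unfolding one_class_def by blast
  have "F x q \<in> {y. adj (F x p) y}" unfolding Fadj[OF p(1)] using q by blast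
  then have a: "adj (F x p) (F x q)" by simp
  have "class_inv c (\<lambda>x y. card {z. c x z = c0 \<and> adj z y})" for c0
    by (rule class_inv_card[OF class_inv_comp[OF class_inv_self] adj_inv])
  from class_invD[OF this e, of "c x (F x p)"]
  moreover have "card {z. c x z = c x (F x p) \<and> adj z (F x q)} > 0" using a by (subst card_gt_0_iff) auto
  ultimately have "{z. c x' z = c x (F x p) \<and> adj z (F x' q')} ~= {}" by (metis card.empty less_irrefl)
  then obtain z where z: "c x' z = c x (F x p)" "adj z (F x' q')" by blast
  obtain r where r: "r < n" "z = F x' r" using Fsurj by blast
  have Kr: "K ! r = j" using inv r z K p unfolding colored_def by blast
  have nbr: "s \<in> set (nb ! q') \<longleftrightarrow> adj (F x' s) (F x' q')" if "s < n" for s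
  proof -
    have "adj (F x' s) (F x' q') \<longleftrightarrow> F x' s \<in> F x' ` set (nb ! q')"
      using Fadj[OF qn(2), of x'] adj_sym by blast
    then show ?thesis using Finj that nb_lt[OF qn(2)] by blast
  qed
  have "F x' q' \<in> {y. adj (F x' p') y}" unfolding Fadj[OF p(2)] using q' by blast
  then have "p' \<in> set (nb ! q')" using nbr[OF p(2)] by simp
  moreover have "r \<in> set (nb ! q')" using nbr[OF r(1)] z r by simp
  moreover have "length (filter (\<lambda>s. K ! s = j) (nb ! q')) = 1"
    using chain_okD(1)[OF ok qn(2) q'(2)] .
  then obtain s0 where "filter (\<lambda>s. K ! s = j) (nb ! q') = [s0]" by (auto simp: length_Suc_conv)
  then have "{s \<in> set (nb ! q'). K ! s = j} = {s0}" by (metis list.set(1) list.set(2) set_filter)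
  ultimately have "r = p'" using Kr K by (metis (mono_tags, lifting) mem_Collect_eq singletonD)
  then show "c x (F x p) = c x' (F x' p')" using z r by simp
qed

lemma one_class_root: "colored c F n K ==> one_class c F n K (K ! 0)"
  if root: "\<forall>p<n. K ! p = K ! 0 --> p = 0"
  unfolding one_class_def using root F0 c_diag by metis

end

lemma model_graph_iso:
  fixes adj :: "'v::finite => 'v => bool"
  assumes "rooted_model adj nb F" and vs: "distinct vs" "set vs = V" "length vs = length nb"
    and E: "!!p q. p < length nb ==> q < length nb ==> (vs ! p, vs ! q) \<in> E \<longleftrightarrow> q \<in> set (nb ! p)"
    and tab: "table_ok nb"
  shows "\<exists>f. graph_iso_via f {(x, y). adj x y} V E \<and> (\<forall>p<length nb. f (F x p) = vs ! p)"
proof -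
  let ?n = "length nb"
  let ?g = "inv_into {..<?n} (F x)"
  define f where "f y = vs ! ?g y" for y
  have bij: "bij_betw (F x) {..<?n} UNIV" and Fadj: "!!p. p < ?n ==> {y. adj (F x p) y} = F x ` set (nb ! p)"
    using assms(1) unfolding rooted_model_def by auto
  have fF: "f (F x p) = vs ! p" if "p < ?n" for p
    unfolding f_def using bij_betw_inv_into_left[OF bij] that by simp
  have "bij_betw ((!) vs) {..<?n} V" using bij_betw_nth[OF vs(1) _ vs(2)[symmetric]] vs(3) by auto
  then have "bij_betw f UNIV V"
    unfolding f_def using bij_betw_trans[OF bij_betw_inv_into[OF bij]] unfolding comp_def by blast
  moreover have "adj y z \<longleftrightarrow> (f y, f z) \<in> E" for y z
  proof -
    have surj: "\<exists>p<?n. y = F x p" for y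
      using bij_betw_imp_surj_on[OF bij] UNIV_I[of y] by (metis imageE lessThan_iff)
    obtain p where p: "p < ?n" "y = F x p" using surj by blast
    obtain q where q: "q < ?n" "z = F x q" using surj by blast
    note pq = p q
    have "adj y z \<longleftrightarrow> z \<in> {y. adj (F x p) y}" unfolding pq(2) by simp
    also have "\<dots> \<longleftrightarrow> F x q \<in> F x ` set (nb ! p)" unfolding Fadj[OF pq(1)] pq(4) ..
    also have "\<dots> \<longleftrightarrow> q \<in> set (nb ! p)"
    proof -
      have sub: "set (nb ! p) \<subseteq> {..<?n}" using tab nth_mem[OF pq(1)] unfolding table_ok_def by auto
      have inj: "inj_on (F x) {..<?n}" using bij unfolding bij_betw_def by blast
      have "F x q \<in> F x ` set (nb ! p) \<longleftrightarrow> q \<in> set (nb ! p)"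
        by (rule inj_on_image_mem_iff[OF inj _ sub]) (use pq in simp)
      then show ?thesis .
    qed
    finally show ?thesis using E[OF pq(1,3)] fF pq by simp
  qed
  ultimately have "graph_iso_via f {(x, y). adj x y} V E" unfolding graph_iso_via_def by simp
  then show ?thesis using fF by blast
qed

text \<open>The classes of \<open>S\<close> map onto those of \<open>R\<close>. As \<open>S\<close>
  has no more classes than \<open>R\<close>, the map is a bijection and the relations
  coincide.\<close>

lemma scheme_image_eq:
  fixes R S :: "nat => ('v::finite \<times> 'v) set"
  assumes R: "assoc_scheme UNIV R d" and S: "assoc_scheme UNIV S d'" and "d' \<le> d"
    and ref: "!!x y x' y'. scheme_class S d' x y = scheme_class S d' x' y' ==>
      scheme_class R d x y = scheme_class R d x' y'"
  shows "S ` {..d'} = R ` {..d}"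
proof -
  let ?r = "scheme_class R d" and ?s = "scheme_class S d'"
  have "\<exists>p. p \<in> S i" if "i \<le> d'" for i using S that unfolding assoc_scheme_def by fast
  then have "\<exists>x y. ?s x y = i" if "i \<le> d'" for i using scheme_class_iff[OF S] that by (metis surj_pair)
  then obtain a b where ab: "!!i. i \<le> d' ==> ?s (a i) (b i) = i" by metis
  define \<phi> where "\<phi> i = ?r (a i) (b i)" for i
  have phi: "?r x y = \<phi> (?s x y)" for x y
    unfolding \<phi>_def using ref ab[OF scheme_class_le[OF S]] by metis
  have "\<phi> ` {..d'} = {..d}"
  proof
    show "\<phi> ` {..d'} \<subseteq> {..d}" unfolding \<phi>_def using scheme_class_le[OF R] by auto
    show "{..d} \<subseteq> \<phi> ` {..d'}"
    proof
      fix j assume "j \<in> {..d}"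
      then have j: "j \<le> d" by simp
      then have "\<exists>p. p \<in> R j" using R unfolding assoc_scheme_def by fast
      then obtain x y where "?r x y = j" using scheme_class_iff[OF R j] by (metis surj_pair)
      then show "j \<in> \<phi> ` {..d'}" using phi scheme_class_le[OF S] by (metis atMost_iff imageI)
    qed
  qed
  moreover have "card (\<phi> ` {..d'}) \<le> Suc d'" using card_image_le[of "{..d'}" \<phi>] by simp
  ultimately have "d' = d" using \<open>d' \<le> d\<close> by simp
  then have inj: "inj_on \<phi> {..d'}" using \<open>\<phi> ` {..d'} = {..d}\<close> by (simp add: eq_card_imp_inj_on)
  have "S i = R (\<phi> i)" if i: "i \<le> d'" for i
  proof -
    have "(x, y) \<in> S i \<longleftrightarrow> (x, y) \<in> R (\<phi> i)" for x y
    proof -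
      have "\<phi> i \<le> d" unfolding \<phi>_def by (rule scheme_class_le[OF R])
      then show ?thesis
        using scheme_class_iff[OF S i] scheme_class_iff[OF R] phi inj i scheme_class_le[OF S]
        unfolding inj_on_def by (metis atMost_iff)
    qed
    then show ?thesis by auto
  qed
  then have "S ` {..d'} = R ` \<phi> ` {..d'}" by (auto simp: image_image)
  then show ?thesis using \<open>\<phi> ` {..d'} = {..d}\<close> by simp
qed

text \<open>All classes are visible from one fixed root, where they correspond to the colours one to
  one; so the rank can be read off the final colouring.\<close>

lemma model_rank:
  fixes R :: "nat => ('v::finite \<times> 'v) set"
  assumes R: "assoc_scheme UNIV R d" and F: "!!x y. \<exists>p<n. y = F x p"
    and len: "length K = n"
    and col: "colored (scheme_class R d) F n K" and one: "!!j. j \<in> set K ==> one_class (scheme_class R d) F n K j"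
  shows "card (set K) = Suc d"
proof -
  let ?r = "scheme_class R d"
  define x0 where "x0 = (undefined::'v)"
  have "(\<lambda>p. ?r x0 (F x0 p)) ` {..<n} = {..d}"
  proof
    show "(\<lambda>p. ?r x0 (F x0 p)) ` {..<n} \<subseteq> {..d}" using scheme_class_le[OF R] by auto
    show "{..d} \<subseteq> (\<lambda>p. ?r x0 (F x0 p)) ` {..<n}"
    proof
      fix j assume "j \<in> {..d}"
      then have j: "j \<le> d" by simp
      then have "\<exists>p. p \<in> R j" using R unfolding assoc_scheme_def by fast
      then obtain x y where xy: "?r x y = j" using scheme_class_iff[OF R j] by (metis surj_pair)
      obtain p where p: "p < n" "y = F x p" using F by blast
      have "?r x (F x p) = ?r x0 (F x0 p)"
        using one[of "K ! p"] p(1) len unfolding one_class_def by auto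
      then show "j \<in> (\<lambda>p. ?r x0 (F x0 p)) ` {..<n}" using xy p by (intro image_eqI[where x = p]) auto
    qed
  qed
  moreover have "bij_betw (\<lambda>k. ?r x0 (F x0 (SOME p. p < n \<and> K ! p = k))) (set K) ((\<lambda>p. ?r x0 (F x0 p)) ` {..<n})"
  proof -
    have some: "(SOME p. p < n \<and> K ! p = k) < n \<and> K ! (SOME p. p < n \<and> K ! p = k) = k" if "k \<in> set K" for k
      using someI_ex[of "\<lambda>p. p < n \<and> K ! p = k"] that len by (metis in_set_conv_nth)
    show ?thesis
    proof (rule bij_betwI')
      fix k l assume "k \<in> set K" "l \<in> set K"
      then show "(?r x0 (F x0 (SOME p. p < n \<and> K ! p = k)) = ?r x0 (F x0 (SOME p. p < n \<and> K ! p = l))) = (k = l)"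
        using some[of k] some[of l] col unfolding colored_def by metis
    next
      fix k assume "k \<in> set K"
      then show "?r x0 (F x0 (SOME p. p < n \<and> K ! p = k)) \<in> (\<lambda>p. ?r x0 (F x0 p)) ` {..<n}"
        using some by auto
    next
      fix h assume "h \<in> (\<lambda>p. ?r x0 (F x0 p)) ` {..<n}"
      then obtain p where p: "p < n" "h = ?r x0 (F x0 p)" by auto
      then have k: "K ! p \<in> set K" using len by simp
      then show "\<exists>k\<in>set K. h = ?r x0 (F x0 (SOME p. p < n \<and> K ! p = k))"
        using one[OF k] some[OF k] p unfolding one_class_def by blast
    qed
  qed
  ultimately show ?thesis using bij_betw_same_card by fastforce
qed

section \<open>Certificates for refinement and chains\<close>

fun refines_ok :: "nat list list => nat list => (nat list \<times> nat list list) list => bool" where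
  "refines_ok nb K [] = True"
| "refines_ok nb K (K' # Ks) = (refine_ok nb K K' \<and> refines_ok nb (fst K') Ks)"

fun chains_ok :: "nat list list => nat list => nat list => (nat \<times> nat) list => bool" where
  "chains_ok nb K ks [] = list_all (\<lambda>j. j \<in> set ks) K"
| "chains_ok nb K ks ((i, j) # st) = (i \<in> set ks \<and> chain_ok nb K i j \<and> chains_ok nb K (j # ks) st)"

text \<open>Colours 0, 1 and 2 are the seeds of the chain: they lie inside the root, its neighbours
  and the vertices at distance two, and these sets are known to be single classes.\<close>

definition start_ok :: "nat list list => nat list => bool" where
  "start_ok nb K \<longleftrightarrow> length K = length nb \<and> list_all (\<lambda>p.
     (K ! p = 0 --> p = 0) \<and> (K ! p = 1 --> p \<in> set (nb ! 0)) \<and>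
     (K ! p = 2 --> p ~= 0 \<and> p \<notin> set (nb ! 0) \<and> list_ex (\<lambda>q. p \<in> set (nb ! q)) (nb ! 0))) [0..<length nb]"

definition cert_ok :: "nat list list => (nat list \<times> nat list list) list => (nat \<times> nat) list => bool" where
  "cert_ok nb Ks st \<longleftrightarrow> nb ~= [] \<and> Ks ~= [] \<and> table_ok nb \<and> refines_ok nb (0 # replicate (length nb - 1) 1) Ks \<and>
     start_ok nb (fst (last Ks)) \<and> chains_ok nb (fst (last Ks)) [0, 1, 2] st"

context model
begin

lemma refines:
  assumes "colored c F n K" "refines_ok nb K Ks"
  shows "colored c F n (fst (last ((K, T) # Ks)))"
  using assms
proof (induction Ks arbitrary: K T)
  case (Cons K' Ks)
  obtain K1 T1 where K': "K' = (K1, T1)" by (cases K')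
  have "colored c F n K1" by (rule refine[OF Cons.prems(1), of _ T1]) (use Cons.prems(2) K' in simp)
  then show ?case using Cons.IH[of K1 T1] Cons.prems(2) K' by simp
qed simp

lemma chains:
  assumes "colored c F n K" "!!j. j \<in> set ks ==> one_class c F n K j" "chains_ok nb K ks st"
  shows "j \<in> set K ==> one_class c F n K j"
  using assms
proof (induction st arbitrary: ks)
  case Nil
  then show ?case by (auto simp: list_all_iff)
next
  case (Cons s st)
  obtain i k where s: "s = (i, k)" by (cases s)
  have "one_class c F n K k" by (rule chain[OF Cons.prems(2), of i]) (use Cons.prems(3,4) s in auto)
  then have o: "one_class c F n K j" if "j \<in> set (k # ks)" for j using Cons.prems(3) that by auto
  show ?case
  proof (rule Cons.IH[OF Cons.prems(1,2), of "k # ks"])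
    show "chains_ok nb K (k # ks) st" using Cons.prems(4) s by simp
  qed (fact o)
qed

lemma adj_root_iff: "p < n ==> adj x (F x p) \<longleftrightarrow> p \<in> set (nb ! 0)"
proof -
  assume p: "p < n"
  have "adj x (F x p) \<longleftrightarrow> F x p \<in> {y. adj (F x 0) y}" by (simp add: F0)
  also have "\<dots> \<longleftrightarrow> F x p \<in> F x ` set (nb ! 0)" unfolding Fadj[OF n_pos] ..
  also have "\<dots> \<longleftrightarrow> p \<in> set (nb ! 0)" using Finj p nb_lt[OF n_pos] by blast
  finally show ?thesis .
qed

lemma start:
  assumes "start_ok nb K"
    and d1: "!!x y x' y'. adj x y ==> adj x' y' ==> c x y = c x' y'"
    and d2: "!!x y z x' y' z'. x ~= y ==> \<not> adj x y ==> adj x z ==> adj z y ==>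
      x' ~= y' ==> \<not> adj x' y' ==> adj x' z' ==> adj z' y' ==> c x y = c x' y'"
    and j: "j \<in> {0, 1, 2}"
  shows "one_class c F n K j"
proof -
  have K: "!!p. p < n ==> K ! p = 0 ==> p = 0" "!!p. p < n ==> K ! p = 1 ==> p \<in> set (nb ! 0)"
    "!!p. p < n ==> K ! p = 2 ==> p ~= 0 \<and> p \<notin> set (nb ! 0) \<and> (\<exists>q\<in>set (nb ! 0). p \<in> set (nb ! q))"
    using assms(1) unfolding start_ok_def by (auto simp: list_all_iff list_ex_iff)
  have two: "x ~= F x p \<and> \<not> adj x (F x p) \<and> (\<exists>z. adj x z \<and> adj z (F x p))" if p: "p < n" "K ! p = 2" for x p
  proof -
    obtain q where q: "q \<in> set (nb ! 0)" "p \<in> set (nb ! q)" and p': "p ~= 0" "p \<notin> set (nb ! 0)"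
      using K(3)[OF p] by blast
    have qn: "q < n" using nb_lt[OF n_pos q(1)] .
    have "F x p \<in> {y. adj (F x q) y}" unfolding Fadj[OF qn] using q by blast
    then have "adj (F x q) (F x p)" by simp
    moreover have "adj x (F x q)" using adj_root_iff[OF qn] q by simp
    moreover have "x ~= F x p" using F0[of x] Finj[OF n_pos p(1), of x] p' by auto
    ultimately show ?thesis using adj_root_iff[OF p(1)] p' by blast
  qed
  consider "j = 0" | "j = 1" | "j = 2" using j by blast
  then show ?thesis
  proof cases
    case 1
    have "c x (F x 0) = c x' (F x' 0)" for x x' using c_diag[of x x] c_diag[of x' x'] F0 by simp
    then show ?thesis unfolding one_class_def 1 using K(1) by metis
  next
    case 2
    show ?thesis unfolding one_class_def 2 using K(2) adj_root_iff d1 by metis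
  next
    case 3
    show ?thesis unfolding one_class_def 3 using two d2 by metis
  qed
qed

end

text \<open>The form in which being partially metric is used. For \<open>d = 1\<close> it holds
  because no pair is at distance two.\<close>

definition dist2_one_class :: "('v::finite => 'v => nat) => ('v => 'v => bool) => bool" where
  "dist2_one_class c adj \<longleftrightarrow> (\<forall>x y z x' y' z'. x ~= y --> \<not> adj x y --> adj x z --> adj z y -->
      x' ~= y' --> \<not> adj x' y' --> adj x' z' --> adj z' y' --> c x y = c x' y')"

text \<open>The refinement is valid in every scheme \<open>S\<close> that contains the edge
  relation, whereas the chain is run in \<open>R\<close>, where distance two is one class. So the
  classes of \<open>S\<close> refine those of \<open>R\<close>, and the bound on the rank gives
  equality.\<close>

lemma cert_generated:
  fixes R :: "nat => ('v::finite \<times> 'v) set"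
  assumes R: "assoc_scheme UNIV R d" and d: "1 \<le> d"
    and d2: "dist2_one_class (scheme_class R d) (\<lambda>x y. (x, y) \<in> R 1)"
    and F: "rooted_model (\<lambda>x y. (x, y) \<in> R 1) nb F"
    and ok: "cert_ok nb Ks st"
  shows "Suc d = card (set (fst (last Ks)))" "generated_scheme UNIV (R 1) R d"
proof -
  let ?c = "scheme_class R d" and ?adj = "\<lambda>x y. (x, y) \<in> R 1" and ?n = "length nb"
  let ?K = "fst (last Ks)" and ?Init = "0 # replicate (?n - 1) 1"
  have tab: "table_ok nb" and Ks: "Ks ~= []" and ref: "refines_ok nb ?Init Ks"
    and st: "start_ok nb ?K" and ch: "chains_ok nb ?K [0, 1, 2] st"
    using ok unfolding cert_ok_def by auto
  have lenK: "length ?K = ?n" using st unfolding start_ok_def by blast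
  have col: "colored (scheme_class S d') F ?n ?K" "model (scheme_class S d') ?adj nb F"
    if S: "assoc_scheme UNIV S d'" and i: "i \<le> d'" "S i = R 1" for S :: "nat => ('v \<times> 'v) set" and d' i
  proof -
    interpret S: coherent "scheme_class S d'" by (rule scheme_coherent[OF S])
    have "class_inv (scheme_class S d') ?adj"
      unfolding class_inv_def i(2)[symmetric] scheme_class_iff[OF S i(1), symmetric] by simp
    then interpret S: model "scheme_class S d'" ?adj nb F using F tab by unfold_locales
    show "model (scheme_class S d') ?adj nb F" by (rule S.model_axioms)
    show "colored (scheme_class S d') F ?n ?K"
      using S.refines[OF S.colored_root[OF refl] ref, of "[]"] Ks by simp
  qed
  interpret model ?c ?adj nb F by (rule col(2)[OF R d refl])
  note colR = col(1)[OF R d refl]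
  have d1: "?c x y = ?c x' y'" if "?adj x y" "?adj x' y'" for x y x' y'
    using that scheme_class_iff[OF R d] by metis
  note d2' = d2[unfolded dist2_one_class_def, rule_format]
  have "one_class ?c F ?n ?K j" if "j \<in> {0, 1, 2}" for j
  proof (rule start[OF st _ _ that])
    fix x y x' y' assume "?adj x y" "?adj x' y'"
    then show "?c x y = ?c x' y'" by (rule d1)
  next
    fix x y z x' y' z' assume "x ~= y" "\<not> ?adj x y" "?adj x z" "?adj z y"
      "x' ~= y'" "\<not> ?adj x' y'" "?adj x' z'" "?adj z' y'"
    then show "?c x y = ?c x' y'" by (rule d2')
  qed
  then have one: "one_class ?c F ?n ?K j" if "j \<in> set ?K" for j
    by (intro chains[OF colR _ ch that]) auto
  show "Suc d = card (set ?K)"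
    using model_rank[OF R Fsurj lenK colR one] by simp
  show "generated_scheme UNIV (R 1) R d" unfolding generated_scheme_def
  proof (intro conjI allI impI)
    show "\<exists>i\<ge>1. i \<le> d \<and> R i = R 1" using d by blast
    fix d' S assume "assoc_scheme UNIV S d' \<and> (\<exists>i\<ge>1. i \<le> d' \<and> S i = R 1) \<and> d' \<le> d"
    then obtain i where S: "assoc_scheme UNIV S d'" "i \<le> d'" "S i = R 1" "d' \<le> d" by blast
    show "S ` {..d'} = R ` {..d}"
    proof (rule scheme_image_eq[OF R S(1,4)])
      fix x y x' y' assume e: "scheme_class S d' x y = scheme_class S d' x' y'"
      obtain p where p: "p < ?n" "y = F x p" using Fsurj by blast
      obtain p' where p': "p' < ?n" "y' = F x' p'" using Fsurj by blast
      have "?K ! p = ?K ! p'" using col(1)[OF S(1-3)] e p p' unfolding colored_def by blast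
      then show "?c x y = ?c x' y'"
        using one[of "?K ! p"] p p' lenK unfolding one_class_def by (metis nth_mem)
    qed
  qed (rule R)
qed

section \<open>Adjacency tables of generalized Petersen graphs\<close>

definition gp_tab :: "nat => nat => nat list list" where
  "gp_tab n s = map (\<lambda>i. [(i + 1) mod n, (i + n - 1) mod n, n + i]) [0..<n] @
     map (\<lambda>i. [n + (i + s) mod n, n + (i + n - s) mod n, i]) [0..<n]"

definition gp_list :: "nat => (bool \<times> int) list" where
  "gp_list n = map (\<lambda>i. (False, int i)) [0..<n] @ map (\<lambda>i. (True, int i)) [0..<n]"

lemma gp_length: "length (gp_tab n s) = 2 * n" "length (gp_list n) = 2 * n"
  unfolding gp_tab_def gp_list_def by auto

lemma gp_list_set: "set (gp_list n) = GP_V (int n)" and gp_list_distinct: "distinct (gp_list n)"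
proof -
  have "(b, i) \<in> set (gp_list n) \<longleftrightarrow> (b, i) \<in> GP_V (int n)" for b i
  proof -
    have "i \<in> int ` {0..<n} \<longleftrightarrow> 0 \<le> i \<and> i < int n"
      by (simp add: image_int_atLeastLessThan)
    then show ?thesis unfolding gp_list_def GP_V_def by (cases b) auto
  qed
  then show "set (gp_list n) = GP_V (int n)" by auto
  show "distinct (gp_list n)" unfolding gp_list_def by (auto simp: distinct_map inj_on_def)
qed

lemma int_mod_diff_iff:
  fixes i j :: int
  assumes "0 \<le> i" "i < n" "0 \<le> j" "j < n"
  shows "(i - j) mod n = k mod n \<longleftrightarrow> j = (i - k) mod n"
proof -
  have "(i - j) mod n = k mod n \<longleftrightarrow> n dvd i - j - k" by (simp add: mod_eq_dvd_iff)
  also have "\<dots> \<longleftrightarrow> n dvd j - (i - k)" by (metis dvd_minus_iff minus_diff_eq diff_diff_eq2 diff_diff_add add.commute)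
  also have "\<dots> \<longleftrightarrow> j mod n = (i - k) mod n" by (simp add: mod_eq_dvd_iff)
  finally show ?thesis using assms by simp
qed

lemma gp_edge:
  assumes p: "p < 2 * n" and q: "q < 2 * n" and s: "1 \<le> s" "s \<le> n"
  shows "(gp_list n ! p, gp_list n ! q) \<in> GP_E (int n) (int s) \<longleftrightarrow> q \<in> set (gp_tab n s ! p)"
proof -
  have nth: "gp_list n ! p = (if p < n then (False, int p) else (True, int p - int n))" if "p < 2 * n" for p
    using that unfolding gp_list_def by (auto simp: nth_append)
  have tab: "gp_tab n s ! p = (if p < n then [(p + 1) mod n, (p + n - 1) mod n, n + p]
      else [n + (p - n + s) mod n, n + (p - n + n - s) mod n, p - n])"
    using p unfolding gp_tab_def by (auto simp: nth_append)
  have n: "n > 0" using p by auto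
  have modI: "int ((i + k) mod n) = (int i - (- int k)) mod int n" for i k by (simp add: zmod_int)
  have modI': "int ((i + n - k) mod n) = (int i - int k) mod int n" if "k \<le> n" for i k
  proof -
    have "int ((i + n - k) mod n) = (int i - int k + int n) mod int n" using that by (simp add: zmod_int of_nat_diff algebra_simps)
    then show ?thesis by simp
  qed
  have eq: "((int i - int j) mod int n = int k mod int n \<or> (int i - int j) mod int n = (- int k) mod int n) \<longleftrightarrow>
      j = (i + k) mod n \<or> j = (i + n - k) mod n" if "i < n" "j < n" "k \<le> n" for i j k
    using int_mod_diff_iff[of "int i" "int n" "int j" "int k"] int_mod_diff_iff[of "int i" "int n" "int j" "- int k"]
      that modI[of i k] modI'[OF that(3), of i] by (metis of_nat_0_le_iff of_nat_eq_iff of_nat_less_iff)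
  have V: "(b, int i) \<in> GP_V (int n) \<longleftrightarrow> i < n" for b i unfolding GP_V_def by simp
  show ?thesis
  proof (cases "p < n")
    case True
    show ?thesis
    proof (cases "q < n")
      case q': True
      show ?thesis using eq[OF True q', of 1] n unfolding nth[OF p] nth[OF q] tab GP_E_def
        using True q' V by auto
    next
      case False
      then have "int q - int n = int (q - n)" "q - n < n" using q by auto
      then show ?thesis unfolding nth[OF p] nth[OF q] tab GP_E_def
        using True False V[of _ "q - n"] V n by auto
    qed
  next
    case pn: False
    then obtain p' where p': "p = n + p'" "p' < n" using p by (metis add.commute add_less_cancel_left le_Suc_ex mult_2 not_le)
    show ?thesis
    proof (cases "q < n")
      case True
      show ?thesis unfolding nth[OF p] nth[OF q] tab GP_E_def
        using True p' V n by auto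
    next
      case False
      then obtain q' where q': "q = n + q'" "q' < n" using q by (metis add.commute add_less_cancel_left le_Suc_ex mult_2 not_le)
      show ?thesis using eq[OF p'(2) q'(2) s(2)] unfolding nth[OF p] nth[OF q] tab GP_E_def
        using p' q' V n by auto
    qed
  qed
qed

lemma gp_graph_iso:
  fixes G :: "('v::finite \<times> 'v) set"
  assumes "rooted_model (\<lambda>x y. (x, y) \<in> G) (gp_tab n s) F" "1 \<le> s" "s \<le> n" "table_ok (gp_tab n s)"
  shows "graph_iso G (GP_V (int n)) (GP_E (int n) (int s))"
proof -
  have E: "(gp_list n ! p, gp_list n ! q) \<in> GP_E (int n) (int s) \<longleftrightarrow> q \<in> set (gp_tab n s ! p)"
    if "p < length (gp_tab n s)" "q < length (gp_tab n s)" for p q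
    using gp_edge[OF _ _ assms(2,3)] that unfolding gp_length by blast
  obtain f where "graph_iso_via f {(x, y). (x, y) \<in> G} (GP_V (int n)) (GP_E (int n) (int s))"
    using model_graph_iso[OF assms(1) gp_list_distinct gp_list_set _ E assms(4)] unfolding gp_length by blast
  moreover have "{(x, y). (x, y) \<in> G} = G" by auto
  ultimately show ?thesis unfolding graph_iso_def by auto
qed

section \<open>Vectors of a partially metric scheme\<close>

unbundle cross3_syntax

lemma unit_eqI: "a \<bullet> a = 1 ==> b \<bullet> b = 1 ==> a \<bullet> b = 1 ==> a = (b::'a::real_inner)"
proof -
  assume "a \<bullet> a = 1" "b \<bullet> b = 1" "a \<bullet> b = 1"
  then have "(a - b) \<bullet> (a - b) = 0" by (simp add: inner_diff_left inner_diff_right inner_commute)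
  then show ?thesis by simp
qed

text \<open>The Gram determinant is the square of the triple product; it turns inner products into a
  test for linear independence.\<close>

lemma gram3:
  fixes x a b :: "real^3"
  shows "(x \<bullet> (a \<times> b))\<^sup>2 = (x \<bullet> x) * (a \<bullet> a) * (b \<bullet> b) + 2 * (x \<bullet> a) * (a \<bullet> b) * (x \<bullet> b)
    - (x \<bullet> x) * (a \<bullet> b)\<^sup>2 - (a \<bullet> a) * (x \<bullet> b)\<^sup>2 - (b \<bullet> b) * (x \<bullet> a)\<^sup>2"
  by (simp add: cross3_simps inner_vec_def sum_3 forall_3 power2_eq_square)

lemma cross_sq: fixes a b :: "real^3"
  shows "(a \<times> b) \<bullet> (a \<times> b) = (a \<bullet> a) * (b \<bullet> b) - (a \<bullet> b)\<^sup>2"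
  by (simp add: cross3_simps inner_vec_def sum_3 power2_eq_square)

lemma perp_cross:
  fixes t a b :: "real^3"
  assumes "t \<bullet> a = 0" "t \<bullet> b = 0" "a \<times> b ~= 0"
  obtains m where "t = m *\<^sub>R (a \<times> b)"
proof -
  let ?n = "a \<times> b"
  have "t \<times> ?n = 0" using assms(1,2) by (simp add: Lagrange)
  moreover have "?n \<times> (t \<times> ?n) = (?n \<bullet> ?n) *\<^sub>R t - (?n \<bullet> t) *\<^sub>R ?n" by (rule Lagrange)
  ultimately have e: "(?n \<bullet> ?n) *\<^sub>R t = (?n \<bullet> t) *\<^sub>R ?n" by simp
  have "t = ((?n \<bullet> t) / (?n \<bullet> ?n)) *\<^sub>R ?n"
    using arg_cong[OF e, of "\<lambda>v. (1 / (?n \<bullet> ?n)) *\<^sub>R v"] assms(3) by simp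
  then show ?thesis using that by blast
qed

lemma three_perp_zero:
  fixes v x a b :: "real^3"
  assumes "v \<bullet> x = 0" "v \<bullet> a = 0" "v \<bullet> b = 0" "x \<bullet> (a \<times> b) ~= 0"
  shows "v = 0"
proof -
  have "a \<times> b ~= 0" using assms(4) by auto
  then obtain m where m: "v = m *\<^sub>R (a \<times> b)" using perp_cross[OF assms(2,3)] by blast
  then have "m * (x \<bullet> (a \<times> b)) = 0" using assms(1) by (simp add: inner_commute)
  then show ?thesis using m assms(4) by simp
qed

text \<open>Fixing the inner products with two independent vectors leaves a line in the direction of
  their cross product, and a line meets a sphere in at most two points.\<close>

lemma at_most_two_on_circle:
  fixes x y z1 z2 z3 :: "real^3"
  assumes "x \<times> y ~= 0"
    and "z1 \<bullet> x = p" "z2 \<bullet> x = p" "z3 \<bullet> x = p" "z1 \<bullet> y = q" "z2 \<bullet> y = q" "z3 \<bullet> y = q"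
    and "z1 \<bullet> z1 = r" "z2 \<bullet> z2 = r" "z3 \<bullet> z3 = r" "z1 ~= z2" "z1 ~= z3"
  shows "z2 = z3"
proof -
  have "(z1 - z2) \<bullet> x = 0" "(z1 - z2) \<bullet> y = 0" "(z1 - z3) \<bullet> x = 0" "(z1 - z3) \<bullet> y = 0"
    using assms by (auto simp: inner_diff_left)
  then obtain m n where m: "z1 - z2 = m *\<^sub>R (x \<times> y)" and n: "z1 - z3 = n *\<^sub>R (x \<times> y)"
    using perp_cross[OF _ _ assms(1)] by metis
  have mn: "m ~= 0" "n ~= 0" using m n assms(11,12) by auto
  have z2: "z2 = z1 - m *\<^sub>R (x \<times> y)" and z3: "z3 = z1 - n *\<^sub>R (x \<times> y)"
    using m n by (auto simp: algebra_simps)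
  let ?s = "z1 \<bullet> (x \<times> y)" and ?t = "(x \<times> y) \<bullet> (x \<times> y)"
  have "z2 \<bullet> z2 = z1 \<bullet> z1 - 2 * m * ?s + m * m * ?t" "z3 \<bullet> z3 = z1 \<bullet> z1 - 2 * n * ?s + n * n * ?t"
    unfolding z2 z3 by (simp_all add: inner_diff_left inner_diff_right inner_commute algebra_simps)
  moreover have "m * (m * ?t - 2 * ?s) = m * m * ?t - 2 * m * ?s"
    "n * (n * ?t - 2 * ?s) = n * n * ?t - 2 * n * ?s" by (simp_all add: algebra_simps)
  ultimately have "m * (m * ?t - 2 * ?s) = 0" "n * (n * ?t - 2 * ?s) = 0"
    using assms(8-10) by linarith+
  then have "m * ?t = n * ?t" using mn by simp
  moreover have "?t ~= 0" using assms(1) by simp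
  ultimately show ?thesis using z2 z3 by simp
qed

lemma UNIV_neq_zero: "(UNIV :: (real^3) set) ~= {0}"
proof
  assume "(UNIV :: (real^3) set) = {0}"
  then have "(axis 1 1 :: real^3) = 0" by (metis UNIV_I singletonD)
  then show False by (simp add: axis_eq_0_iff)
qed

text \<open>All vectors but one form a basis. They span because the omitted one is minus their sum;
  a dependency between them would have equal coefficients and force \<open>w = 0\<close>, against
  \<open>w * card T = - 1\<close>.\<close>

lemma simplex_card:
  fixes U :: "(real^3) set"
  assumes fin: "finite U" and one: "!!a. a \<in> U ==> a \<bullet> a = 1"
    and w: "!!a b. a \<in> U ==> b \<in> U ==> a ~= b ==> a \<bullet> b = w" and w1: "w ~= 1"
    and sum0: "\<Sum>U = 0" and span: "span U = UNIV"
  shows "card U = 4"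
proof -
  have "U ~= {}"
  proof
    assume "U = {}"
    then show False using span UNIV_neq_zero by simp
  qed
  then obtain b where b: "b \<in> U" by blast
  define T where "T = U - {b}"
  have UT: "U = insert b T" "b \<notin> T" "finite T" unfolding T_def using b fin by auto
  have bT: "b = - \<Sum>T" using sum0 UT by (simp add: eq_neg_iff_add_eq_0)
  have "b \<in> span T" unfolding bT by (intro span_neg span_sum span_base)
  then have spanT: "span T = UNIV" using span unfolding UT(1) by (simp add: span_redundant)
  have Tw: "(\<Sum>a\<in>T. f a *\<^sub>R a) \<bullet> y = f y * (1 - w) + w * sum f T" if y: "y \<in> T" for f y
  proof -
    have "(\<Sum>a\<in>T. f a *\<^sub>R a) \<bullet> y = (\<Sum>a\<in>T. f a * (a \<bullet> y))" by (simp add: inner_sum_left)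
    also have "\<dots> = (\<Sum>a\<in>T. w * f a + (if a = y then f y * (1 - w) else 0))"
      by (rule sum.cong) (use y one w UT in \<open>auto simp: algebra_simps\<close>)
    also have "\<dots> = f y * (1 - w) + w * sum f T" using y UT(3)
      by (simp add: sum.distrib sum_distrib_left)
    finally show ?thesis .
  qed
  have "T ~= {}" using spanT UNIV_neq_zero by auto
  then obtain y0 where y0: "y0 \<in> T" by blast
  have wn: "w * real (card T) = - 1"
  proof -
    have "b \<bullet> b = - (\<Sum>a\<in>T. a \<bullet> b)" by (subst bT) (simp add: inner_sum_left)
    also have "\<dots> = - (\<Sum>a\<in>T. w)" using w UT by (intro arg_cong[where f = uminus] sum.cong) auto
    finally show ?thesis using one[OF b] by (simp add: mult.commute)
  qed
  have "independent T"
  proof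
    assume "dependent T"
    then obtain f y where fy: "y \<in> T" "f y ~= 0" and z: "(\<Sum>a\<in>T. f a *\<^sub>R a) = 0"
      using UT(3) dependent_finite by blast
    have eq: "f y * (1 - w) = - (w * sum f T)" if "y \<in> T" for y using Tw[OF that, of f] z by simp
    have "f a = f y" if "a \<in> T" for a
    proof -
      have "f a * (1 - w) = f y * (1 - w)" using eq[OF that] eq[OF fy(1)] by simp
      then show ?thesis using w1 by simp
    qed
    then have "sum f T = f y * real (card T)" by simp
    then have "f y * (1 - w) = f y * - (w * real (card T))" using eq[OF fy(1)] by (simp add: algebra_simps)
    then have "f y * (1 - w) = f y" unfolding wn by simp
    then have "w = 0" using fy(2) by (simp add: algebra_simps)
    then show False using wn by simp
  qed
  then have "card T = dim T" by (simp add: dim_eq_card_independent)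
  moreover have "dim T = dim (span T)" by simp
  ultimately have "card T = 3" unfolding spanT by simp
  then show ?thesis using UT by simp
qed

lemma multipartite_iso:
  fixes G :: "('x::finite \<times> 'x) set" and f :: "'x => 'b"
  assumes G: "!!x y. (x, y) \<in> G \<longleftrightarrow> f x ~= f y" and m: "card (range f) = m"
    and q: "!!b. b \<in> range f ==> card {x. f x = b} = q"
  shows "graph_iso G (cmp_V m q) (cmp_E m q)"
proof -
  obtain g where g: "bij_betw g (range f) {0..<m}"
    using ex_bij_betw_finite_nat[of "range f"] m by auto
  have "\<exists>h. bij_betw h {x. f x = b} {0..<q}" if "b \<in> range f" for b
    using ex_bij_betw_finite_nat[of "{x. f x = b}"] q[OF that] by auto
  then obtain h where h: "!!b. b \<in> range f ==> bij_betw (h b) {x. f x = b} {0..<q}" by metis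
  define F where "F x = (g (f x), h (f x) x)" for x
  have gi: "g (f x) = g (f y) \<longleftrightarrow> f x = f y" for x y
    using bij_betw_imp_inj_on[OF g] by (simp add: inj_on_eq_iff)
  have gb: "g (f x) < m" for x using bij_betwE[OF g] by auto
  have hb: "h (f x) x < q" for x using bij_betwE[OF h[of "f x"]] by auto
  have "inj F"
  proof (rule injI)
    fix x y assume "F x = F y"
    then have "f x = f y" "h (f x) x = h (f x) y" unfolding F_def using gi by auto
    then show "x = y" using h[of "f x"] unfolding bij_betw_def inj_on_def by auto
  qed
  moreover have "range F = cmp_V m q"
  proof
    show "range F \<subseteq> cmp_V m q" unfolding F_def cmp_V_def using gb hb by auto
    show "cmp_V m q \<subseteq> range F"
    proof
      fix p assume "p \<in> cmp_V m q"
      then obtain i j where p: "p = (i, j)" "i < m" "j < q" unfolding cmp_V_def by auto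
      then have "i \<in> g ` range f" using g by (simp add: bij_betw_def)
      then obtain b where b: "b \<in> range f" "g b = i" by blast
      have "j \<in> h b ` {x. f x = b}" using h[OF b(1)] p by (simp add: bij_betw_def)
      then obtain x where "f x = b" "h b x = j" by blast
      then show "p \<in> range F" unfolding F_def using b p by auto
    qed
  qed
  ultimately have "bij_betw F UNIV (cmp_V m q)" unfolding bij_betw_def by simp
  moreover have "(x, y) \<in> G \<longleftrightarrow> (F x, F y) \<in> cmp_E m q" for x y
    unfolding G cmp_E_def cmp_V_def F_def using gi gb hb by auto
  ultimately show ?thesis unfolding graph_iso_def graph_iso_via_def by blast
qed

section \<open>The vectors of a connected partially metric scheme\<close>

locale pm_rep = coherent c for c :: "'x::finite => 'x => nat" +
  fixes u :: "'x => real^3" and \<theta> :: real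
  assumes rep: "eutactic_rep c u \<theta>"
    and conn: "(x, y) \<in> {(x, y). c x y = 1}\<^sup>*"
    and d2: "dist2_one_class c (\<lambda>x y. c x y = 1)"
begin

definition adj :: "'x => 'x => bool" where "adj x y \<longleftrightarrow> c x y = 1"

definition N :: "'x => 'x set" where "N x = {y. adj x y}"

lemma adj_sym: "adj x y \<longleftrightarrow> adj y x" unfolding adj_def using c_sym by metis
lemma adj_irrefl [simp]: "\<not> adj x x" unfolding adj_def using c_diag[of x x] by simp
lemma adj_neq: "adj x y ==> x ~= y" by auto
lemma N_iff [simp]: "y \<in> N x \<longleftrightarrow> adj x y" unfolding N_def by simp
lemma adj_inv: "class_inv c adj"
  unfolding adj_def using class_inv_comp[OF class_inv_self, of c "\<lambda>k. k = 1"] .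

lemma uu [simp]: "u x \<bullet> u x = 1" using rep unfolding eutactic_rep_def by blast
lemma u_inv: "class_inv c (\<lambda>x y. u x \<bullet> u y)" using rep unfolding eutactic_rep_def by blast
lemma u_eig: "(\<Sum>y\<in>N x. u y) = \<theta> *\<^sub>R u x" using rep unfolding eutactic_rep_def N_def adj_def by simp
lemma u_span: "span (range u) = UNIV" using rep unfolding eutactic_rep_def by blast
lemma u_inner_eq: "c x y = c x' y' ==> u x \<bullet> u y = u x' \<bullet> u y'" by (rule class_invD[OF u_inv])

lemma conn_induct: "P x ==> (!!y z. P y ==> adj y z ==> P z) ==> P y"
  using conn[of x y] by (induction rule: rtrancl_induct) (auto simp: adj_def)

definition dist2 :: "'x => 'x => bool" where
  "dist2 x y \<longleftrightarrow> x ~= y \<and> \<not> adj x y \<and> (\<exists>z. adj x z \<and> adj z y)"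

lemma dist2_class: "dist2 x y ==> dist2 x' y' ==> c x y = c x' y'"
  using d2 unfolding dist2_one_class_def dist2_def adj_def by blast

lemma dist2_sym: "dist2 x y \<longleftrightarrow> dist2 y x" unfolding dist2_def using adj_sym by metis

lemma dist2_inner: "dist2 x y ==> dist2 x' y' ==> u x \<bullet> u y = u x' \<bullet> u y'"
  by (rule u_inner_eq[OF dist2_class])

lemma adj_inner: "adj x y ==> adj x' y' ==> u x \<bullet> u y = u x' \<bullet> u y'"
  by (rule u_inner_eq) (simp add: adj_def)

text \<open>The contradiction reached whenever all images are confined to a plane.\<close>

lemma not_in_small_span: "\<exists>x. u x \<notin> span {a, b}"
proof (rule ccontr)
  assume "\<not> (\<exists>x. u x \<notin> span {a, b})"
  then have "span (range u) \<subseteq> span {a, b}" by (intro span_minimal) auto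
  then have "dim (UNIV :: (real^3) set) \<le> dim (span {a, b})" using u_span by (intro dim_subset) simp
  also have "\<dots> \<le> card {a, b}" by (simp add: dim_le_card')
  also have "\<dots> \<le> 2" by (simp add: card_insert_if)
  finally show False by simp
qed

lemma common_const:
  assumes "c x y = c x' y'"
  shows "card (N x \<inter> N y) = card (N x' \<inter> N y')"
proof -
  have I: "class_inv c (\<lambda>x y. card {z. adj x z \<and> adj z y})" by (rule class_inv_card[OF adj_inv adj_inv])
  have "{z. adj x z \<and> adj z y} = N x \<inter> N y" for x y by (auto simp: adj_sym)
  then show ?thesis using class_invD[OF I assms] by simp
qed

lemma degree_const: "card (N x) = card (N y)"
  using common_const[of x x y y] c_diag[of x x] c_diag[of y y] by simp

lemma common_adj: "adj x y ==> adj x' y' ==> card (N x \<inter> N y) = card (N x' \<inter> N y')"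
  by (rule common_const) (simp add: adj_def)

lemma ex_adj: "\<exists>y. adj x y"
proof (rule ccontr)
  assume n: "\<not> (\<exists>y. adj x y)"
  have yx: "y = x" for y by (rule conn_induct[of "\<lambda>y. y = x"]) (use n in auto)
  have "u y \<in> span {u x, u x}" for y unfolding yx[of y] by (rule span_base) simp
  then show False using not_in_small_span by blast
qed

text \<open>All edges have the same inner product, so one coincidence spreads along edges to the
  whole connected graph and leaves a single image.\<close>

lemma inner_adj_ne_1: "adj x y ==> u x \<bullet> u y ~= 1"
proof
  assume xy: "adj x y" and one: "u x \<bullet> u y = 1"
  have "u z = u x" for z
  proof (rule conn_induct[of "\<lambda>z. u z = u x"])
    fix z w assume "u z = u x" "adj z w"
    then show "u w = u x" using unit_eqI[of "u z" "u w"] adj_inner[OF xy, of z w] one by simp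
  qed simp
  then have "u z \<in> span {u x, u x}" for z by (metis insertI1 span_base)
  then show False using not_in_small_span by blast
qed

lemma u_adj_neq: "adj x y ==> u x ~= u y"
  using inner_adj_ne_1[of x y] uu[of x] by metis

lemma theta_degree: "adj x y ==> real (card (N x)) * (u x \<bullet> u y) = \<theta>"
proof -
  assume xy: "adj x y"
  have "\<theta> = (\<Sum>z\<in>N x. u z) \<bullet> u x" unfolding u_eig by simp
  also have "\<dots> = (\<Sum>z\<in>N x. u x \<bullet> u y)"
    unfolding inner_sum_left by (rule sum.cong) (use adj_inner[OF xy] in \<open>auto simp: inner_commute\<close>)
  finally show ?thesis by simp
qed

text \<open>Adding \<open>u x\<close> to the eigenvalue equation shows that
  \<open>(\<theta> + 1) *\<^sub>R u x\<close> is the sum of all vectors, whatever \<open>x\<close>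
  is. As images differ, the sum is zero and the vectors form a regular simplex.\<close>

lemma complete_card:
  assumes "!!x y. x ~= y ==> adj x y"
  shows "card (UNIV :: 'x set) = 4"
proof -
  have inj: "inj u" using assms u_adj_neq by (metis injI)
  have S: "(\<Sum>y\<in>UNIV. u y) = (\<theta> + 1) *\<^sub>R u x" for x
  proof -
    have "y \<in> N x \<longleftrightarrow> y \<in> UNIV - {x}" for y using assms[of x y] by auto
    then have "N x = UNIV - {x}" by blast
    then show ?thesis using u_eig[of x] by (simp add: sum_diff1 algebra_simps)
  qed
  obtain x y where xy: "adj x y" using ex_adj by blast
  have "(\<theta> + 1) *\<^sub>R u x = (\<theta> + 1) *\<^sub>R u y" using S by metis
  then have "\<theta> + 1 = 0" using u_adj_neq[OF xy] by simp
  then have S0: "(\<Sum>y\<in>UNIV. u y) = 0" using S[of x] by simp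
  have "card (range u) = 4"
  proof (rule simplex_card[where w = "u x \<bullet> u y"])
    show "\<Sum>(range u) = 0" using S0 inj by (simp add: sum.reindex)
    show "a \<bullet> b = u x \<bullet> u y" if "a \<in> range u" "b \<in> range u" "a ~= b" for a b
    proof -
      obtain x' y' where "a = u x'" "b = u y'" "x' ~= y'" using \<open>a \<in> range u\<close> \<open>b \<in> range u\<close> \<open>a ~= b\<close> by auto
      then show ?thesis using adj_inner[OF assms xy] by simp
    qed
  qed (use u_span inner_adj_ne_1[OF xy] in auto)
  then show ?thesis using inj by (simp add: card_image)
qed

lemma ex_dist2:
  assumes "x ~= y" "\<not> adj x y"
  shows "\<exists>z. dist2 x z"
proof (rule ccontr)
  assume n: "\<nexists>z. dist2 x z"
  have "y = x \<or> adj x y"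
    by (rule conn_induct[of "\<lambda>y. y = x \<or> adj x y"]) (use n in \<open>auto simp: dist2_def\<close>)
  then show False using assms by blast
qed

text \<open>Vertices at distance two have the same image: the nonadjacent neighbours of a
  vertex are exactly the neighbours with equal image, and this forces diameter two.\<close>

lemma multipartite_case:
  assumes ab: "dist2 a b" and one: "u a \<bullet> u b = 1"
  shows "!!x y. adj x y \<longleftrightarrow> u x ~= u y" and "card (range u) = 4"
    and "\<exists>q\<ge>1. \<forall>b\<in>range u. card {x. u x = b} = q"
proof -
  have same: "u x = u y" if "dist2 x y" for x y
    using unit_eqI[of "u x" "u y"] dist2_inner[OF that ab] one by simp
  \<comment> \<open>Every edge lies in a triangle: otherwise the neighbours of a vertex are pairwise
    at distance two, hence share one image, and only two images occur in all.\<close>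
  obtain v where tri: "!!x y. adj x y ==> \<exists>z. adj x z \<and> adj y z"
  proof (cases "\<exists>x y z. adj x y \<and> adj x z \<and> adj y z")
    case True
    then obtain x y z where xyz: "adj x y" "z \<in> N x \<inter> N y" by auto
    have "\<exists>z. adj x' z \<and> adj y' z" if "adj x' y'" for x' y'
    proof -
      have "card (N x' \<inter> N y') ~= 0" using common_adj[OF xyz(1) that] xyz(2) by (metis card_0_eq empty_iff finite)
      then show ?thesis by (metis Int_emptyI N_iff card.empty)
    qed
    then show ?thesis using that by blast
  next
    case False
    obtain x y where xy: "adj x y" using ex_adj by blast
    define P where "P z \<longleftrightarrow> (u z = u x \<or> u z = u y) \<and> (\<forall>w. adj z w --> u w = u x \<or> u w = u y)" for z
    have "P z" for z
    proof (rule conn_induct[of P x])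
      have "u w = u y" if "adj x w" for w
      proof (cases "w = y")
        case n: False
        have "dist2 w y" unfolding dist2_def using n False xy that adj_sym by blast
        then show ?thesis by (rule same)
      qed simp
      then show "P x" unfolding P_def by blast
    next
      fix z w assume z: "P z" and zw: "adj z w"
      have "u v = u z" if "adj w v" for v
      proof (cases "v = z")
        case n: False
        have "dist2 v z" unfolding dist2_def using n False zw that adj_sym by blast
        then show ?thesis by (rule same)
      qed simp
      then show "P w" using z zw unfolding P_def by metis
    qed
    then have "u z \<in> span {u x, u y}" for z unfolding P_def by (metis insertI1 insertI2 span_base)
    then show ?thesis using not_in_small_span by blast
  qed
  have nb: "adj v w" if "adj y v" "adj y w" "u v ~= u w" for v w y
  proof (rule ccontr)
    assume "\<not> adj v w"
    then have "dist2 v w" unfolding dist2_def using that adj_sym by auto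
    then show False using same that by blast
  qed
  \<comment> \<open>Given a path \<open>x, y, z\<close> between vertices at distance two, complete
    the edge from \<open>y\<close> to \<open>z\<close> to a triangle with \<open>v\<close>. The
    image of \<open>v\<close> differs from that of \<open>x\<close>, so \<open>x\<close> and
    \<open>v\<close> are adjacent, and a further neighbour \<open>w\<close> of \<open>z\<close> is
    \<open>y\<close> or joined to \<open>y\<close> or to \<open>v\<close>.\<close>
  have diam: "x = y \<or> adj x y \<or> dist2 x y" for x y
  proof (rule conn_induct[of _ x])
    fix z w assume z: "x = z \<or> adj x z \<or> dist2 x z" and zw: "adj z w"
    show "x = w \<or> adj x w \<or> dist2 x w"
    proof (cases "dist2 x z")
      case True
      then obtain y where y: "adj x y" "adj y z" unfolding dist2_def by blast
      obtain v where v: "adj y v" "adj z v" using tri[OF y(2)] by blast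
      have "u v ~= u x" using same[OF True] u_adj_neq[OF v(2)] by simp
      then have xv: "adj x v" using nb[of y x v] y v adj_sym by metis
      show ?thesis
      proof (cases "w = y \<or> adj y w")
        case False
        then have "dist2 y w" unfolding dist2_def using y zw by blast
        then have "u w ~= u v" using same[of y w] u_adj_neq[OF v(1)] by simp
        then have "adj v w" using nb[of z v w] v zw by auto
        then show ?thesis unfolding dist2_def using xv by blast
      qed (use y in \<open>auto simp: dist2_def\<close>)
    qed (use z zw in \<open>auto simp: dist2_def\<close>)
  qed simp
  show A: "adj x y \<longleftrightarrow> u x ~= u y" for x y using diam[of x y] u_adj_neq same by blast
  define q where "q = card (UNIV - N a)"
  have fib: "{x. u x = u y} = UNIV - N y" for y using A by auto
  have q: "card {x. u x = u y} = q" for y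
    unfolding fib q_def using degree_const[of y a] by (simp add: card_Diff_subset)
  have q1: "q \<ge> 1"
  proof -
    have "a \<in> UNIV - N a" by simp
    then show ?thesis unfolding q_def by (metis One_nat_def Suc_leI card_gt_0_iff empty_iff finite)
  qed
  then show "\<exists>q\<ge>1. \<forall>b\<in>range u. card {x. u x = b} = q" using q by auto
  have sumU: "(\<Sum>y\<in>UNIV. u y) = real q *\<^sub>R \<Sum>(range u)"
  proof -
    have "(\<Sum>y\<in>UNIV. u y) = (\<Sum>b\<in>range u. \<Sum>x\<in>{x \<in> UNIV. u x = b}. u x)"
      by (rule sum.group[symmetric]) auto
    also have "\<dots> = (\<Sum>b\<in>range u. real q *\<^sub>R b)"
    proof (rule sum.cong[OF refl])
      fix b assume "b \<in> range u"
      then have "card {x. u x = b} = q" using q by auto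
      moreover have "(\<Sum>x\<in>{x \<in> UNIV. u x = b}. u x) = (\<Sum>x\<in>{x. u x = b}. b)" by (rule sum.cong) auto
      ultimately show "(\<Sum>x\<in>{x \<in> UNIV. u x = b}. u x) = real q *\<^sub>R b" by (simp only: sum_constant_scaleR)
    qed
    finally show ?thesis by (simp add: scaleR_sum_right)
  qed
  \<comment> \<open>The neighbours contribute \<open>\<theta> *\<^sub>R u x\<close>, and the
    \<open>q\<close> non-neighbours all have the image of \<open>x\<close>. The left side is
    independent of \<open>x\<close>, so two different images give \<open>\<theta> = - q\<close> and
    total sum zero.\<close>
  have S: "real q *\<^sub>R \<Sum>(range u) = (\<theta> + real q) *\<^sub>R u x" for x
  proof -
    have "(\<Sum>y\<in>UNIV. u y) = (\<Sum>y\<in>N x. u y) + (\<Sum>y\<in>UNIV - N x. u y)"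
      by (metis finite subset_UNIV sum.subset_diff add.commute)
    also have "(\<Sum>y\<in>UNIV - N x. u y) = real q *\<^sub>R u x"
      unfolding fib[symmetric]
    proof -
      have "(\<Sum>y | u y = u x. u y) = (\<Sum>y | u y = u x. u x)" by (rule sum.cong) auto
      then show "(\<Sum>y | u y = u x. u y) = real q *\<^sub>R u x" using q[of x] by (simp only: sum_constant_scaleR)
    qed
    finally show ?thesis using u_eig sumU by (simp add: scaleR_add_left)
  qed
  obtain y where ay: "adj a y" using ex_adj by blast
  have "(\<theta> + real q) *\<^sub>R u a = (\<theta> + real q) *\<^sub>R u y" using S by metis
  then have "\<theta> + real q = 0" using u_adj_neq[OF ay] by simp
  then have S0: "\<Sum>(range u) = 0" using S[of a] q1 by simp
  show "card (range u) = 4"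
  proof (rule simplex_card[where w = "u a \<bullet> u y"])
    show "r \<bullet> s = u a \<bullet> u y" if "r \<in> range u" "s \<in> range u" "r ~= s" for r s
      using that A adj_inner[OF _ ay] by auto
  qed (use u_span inner_adj_ne_1[OF ay] S0 in auto)
qed

end

section \<open>Valency at most five\<close>

lemma card_le_2I:
  assumes "finite A" and "!!x y z. x \<in> A ==> y \<in> A ==> z \<in> A ==> x ~= y ==> x ~= z ==> y = z"
  shows "card A \<le> 2"
proof (rule ccontr)
  assume "\<not> card A \<le> 2"
  then have "3 \<le> card A" by simp
  then obtain B where "B \<subseteq> A" "card B = 3" using obtain_subset_with_card_n by metis
  then obtain x y z where "B = {x, y, z}" "x ~= y" "x ~= z" "y ~= z" by (auto simp: card_3_iff)
  then show False using assms(2)[of x y z] \<open>B \<subseteq> A\<close> by auto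
qed

lemma card_2_eqI: "card A = 2 ==> p \<in> A ==> q \<in> A ==> p ~= q ==> A = {p, q}"
  by (auto simp: card_2_iff)

lemma card_2_other: "card A = 2 ==> p \<in> A ==> \<exists>q. q ~= p \<and> A = {p, q}"
  by (auto simp: card_2_iff)

context pm_rep
begin

text \<open>A list closed under taking neighbours exhausts a connected graph; this gives
  surjectivity.\<close>

lemma model_from_lists:
  assumes nb: "nb ~= []" and vs: "!!x. \<exists>vs. length vs = length nb \<and> vs ! 0 = x \<and> distinct vs \<and>
      (\<forall>p<length nb. N (vs ! p) = (!) vs ` set (nb ! p))" and tab: "table_ok nb"
  shows "\<exists>F. rooted_model adj nb F"
proof -
  obtain v where v: "!!x. length (v x) = length nb" "!!x. v x ! 0 = x" "!!x. distinct (v x)"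
    "!!x p. p < length nb ==> N (v x ! p) = (!) (v x) ` set (nb ! p)"
    using vs by metis
  have "bij_betw ((!) (v x)) {..<length nb} UNIV" for x
  proof -
    have "y \<in> set (v x)" for y
    proof (rule conn_induct[of "\<lambda>y. y \<in> set (v x)" x])
      show "x \<in> set (v x)" using v(1,2)[of x] nb by (metis length_greater_0_conv nth_mem)
      fix y z assume "y \<in> set (v x)" "adj y z"
      then obtain p where p: "p < length nb" "y = v x ! p" using v(1) by (metis in_set_conv_nth)
      then have "z \<in> (!) (v x) ` set (nb ! p)" using v(4)[of p x] \<open>adj y z\<close> by auto
      then show "z \<in> set (v x)" using tab nth_mem[OF p(1)] v(1) unfolding table_ok_def by auto
    qed
    then show ?thesis using bij_betw_nth[OF v(3)[of x], of "{..<length nb}" UNIV] v(1)[of x] by auto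
  qed
  then have "rooted_model adj nb (\<lambda>x. (!) (v x))"
    unfolding rooted_model_def using v(2,4) unfolding N_def by blast
  then show ?thesis by blast
qed

end

section \<open>Distinct images at distance two: the possible valencies\<close>

locale pm_inj = pm_rep c u \<theta> for c :: "'x::finite => 'x => nat" and u \<theta> +
  fixes a0 b0 :: 'x
  assumes ab0: "dist2 a0 b0" and ab0_inner: "u a0 \<bullet> u b0 ~= 1"
begin

text \<open>The common inner product of adjacent vertices, by \<open>inner_adj\<close>;
  \<open>w2\<close> is the one at distance two.\<close>

definition "w1 = \<theta> / real (card (N a0))"
definition "w2 = u a0 \<bullet> u b0"

lemma inner_dist2: "dist2 x y ==> u x \<bullet> u y = w2"
  unfolding w2_def by (rule dist2_inner[OF _ ab0])

lemma u_dist2_neq: "dist2 x y ==> u x ~= u y"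
  using inner_dist2[of x y] uu[of x] ab0_inner unfolding w2_def by metis

lemma N_nonempty: "card (N x) > 0"
  using ex_adj[of x] by (subst card_gt_0_iff) auto

lemma inner_adj: "adj x y ==> u x \<bullet> u y = w1"
proof -
  assume "adj x y"
  then have "real (card (N a0)) * (u x \<bullet> u y) = \<theta>" using theta_degree[of x y] degree_const[of x a0] by simp
  moreover have "real (card (N a0)) ~= 0" using N_nonempty[of a0] by linarith
  ultimately show ?thesis unfolding w1_def by (simp add: eq_divide_eq mult.commute)
qed

lemma theta_w1: "\<theta> = real (card (N x)) * w1"
proof -
  have "real (card (N a0)) ~= 0" using N_nonempty[of a0] by linarith
  then have "\<theta> = real (card (N a0)) * w1" unfolding w1_def by simp
  then show ?thesis unfolding degree_const[of x a0] .
qed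

lemma siblings: "adj x y ==> adj x z ==> y ~= z ==> adj y z \<or> dist2 y z"
  unfolding dist2_def using adj_sym by blast

lemma u_siblings_neq: "adj x y ==> adj x z ==> y ~= z ==> u y ~= u z"
  using siblings u_adj_neq u_dist2_neq by blast

text \<open>With valency at most two the eigenvalue equation is a recurrence of order two along a
  path, so all images stay in the plane of the first two.\<close>

lemma degree_ge_3: "card (N x) \<ge> 3"
proof (rule ccontr)
  assume "\<not> card (N x) \<ge> 3"
  then have k: "card (N z) \<le> 2" for z using degree_const[of z x] by simp
  obtain y where xy: "adj x y" using ex_adj by blast
  let ?S = "span {u x, u y}"
  have nbr: "u v \<in> ?S" if "adj w z" "adj w v" "u w \<in> ?S" "u z \<in> ?S" for w z v
  proof (cases "v = z")
    case False
    have "{z, v} \<subseteq> N w" using that by auto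
    moreover have "card {z, v} = 2" using False by simp
    ultimately have "N w = {z, v}" using k[of w] by (metis card_seteq finite)
    then have "u v = \<theta> *\<^sub>R u w - u z" using u_eig[of w] False by (simp add: algebra_simps)
    then show ?thesis using that by (simp add: span_diff span_scale)
  qed (use that in simp)
  define P where "P z \<longleftrightarrow> u z \<in> ?S \<and> (\<forall>w. adj z w --> u w \<in> ?S)" for z
  have "P z" for z
  proof (rule conn_induct[of P x])
    have "u x \<in> ?S" "u y \<in> ?S" by (simp_all add: span_base)
    then show "P x" unfolding P_def using nbr[OF xy] by blast
    fix z w assume "P z" "adj z w"
    then show "P w" unfolding P_def using nbr[of w z] adj_sym by blast
  qed
  then show False using not_in_small_span unfolding P_def by blast
qed

text \<open>The value 1 is excluded by \<open>inner_adj_ne_1\<close>; the value -1 would put all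
  neighbours of a vertex at its antipode, although siblings have distinct images.\<close>

lemma w1_sq: "w1\<^sup>2 < 1"
proof -
  obtain y where y: "adj a0 y" using ex_adj by blast
  have "w1\<^sup>2 \<le> 1" using Cauchy_Schwarz_ineq[of "u a0" "u y"] inner_adj[OF y] by simp
  moreover have "w1 ~= 1" using inner_adj_ne_1[OF y] inner_adj[OF y] by simp
  moreover have "w1 ~= -1"
  proof
    assume m: "w1 = -1"
    have neg: "u z = - u a0" if "adj a0 z" for z
      using unit_eqI[of "- u a0" "u z"] inner_adj[OF that] m by simp
    obtain B where B: "B \<subseteq> N a0" "card B = 2"
      using obtain_subset_with_card_n[of 2 "N a0"] degree_ge_3[of a0] by auto
    then obtain p q where "B = {p, q}" "p ~= q" by (auto simp: card_2_iff)
    then have pq: "adj a0 p" "adj a0 q" "p ~= q" using B by auto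
    show False using u_siblings_neq[OF pq] neg[OF pq(1)] neg[OF pq(2)] by simp
  qed
  ultimately show ?thesis by (metis abs_square_eq_1 less_le power2_eq_1_iff)
qed

lemma cross_nz: "adj x y ==> u x \<times> u y ~= 0"
proof
  assume xy: "adj x y" and z: "u x \<times> u y = 0"
  have "(u x \<times> u y) \<bullet> (u x \<times> u y) = 1 - w1\<^sup>2" by (simp add: cross_sq inner_adj[OF xy])
  then show False using z w1_sq by simp
qed

text \<open>All neighbours of \<open>x\<close> have the same inner product with \<open>u x\<close>,
  so a common inner product with \<open>u y\<close> puts them on one line, and distinct neighbours
  have distinct images.\<close>

lemma circle2:
  assumes xy: "adj x y" and S: "S \<subseteq> N x" and q: "!!z. z \<in> S ==> u z \<bullet> u y = q"
  shows "card S \<le> 2"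
proof (rule card_le_2I)
  fix z1 z2 z3 assume z: "z1 \<in> S" "z2 \<in> S" "z3 \<in> S" "z1 ~= z2" "z1 ~= z3"
  have ax: "adj x z" if "z \<in> S" for z using S that by auto
  have zx: "u z \<bullet> u x = w1" if "z \<in> S" for z using inner_adj[OF ax[OF that]] by (simp add: inner_commute)
  have ne: "u z1 ~= u z2" "u z1 ~= u z3" using u_siblings_neq ax z by blast+
  have "u z2 = u z3"
    by (rule at_most_two_on_circle[OF cross_nz[OF xy] zx[OF z(1)] zx[OF z(2)] zx[OF z(3)]
        q[OF z(1)] q[OF z(2)] q[OF z(3)] uu uu uu ne])
  then show "z2 = z3" using u_siblings_neq z S by (metis N_iff subsetD)
qed simp

lemma local_degree: "adj x y ==> card (N x \<inter> N y) \<le> 2"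
  by (rule circle2[where q = w1]) (auto simp: inner_adj adj_sym)

lemma local_codegree: "adj x y ==> card (N x - N y - {y}) \<le> 2"
  by (rule circle2[where q = w2]) (use siblings inner_dist2 dist2_sym in fastforce)+

lemma card_split: "adj x y ==> card (N x) = card (N x \<inter> N y) + card (N x - N y - {y}) + 1"
proof -
  assume xy: "adj x y"
  have "card (N x) = card (N x \<inter> N y) + card (N x - N y)"
    by (metis card_Int_Diff finite)
  moreover have "card (N x - N y) = card (N x - N y - {y}) + 1"
    using xy by (subst card_Suc_Diff1[symmetric, of _ y]) auto
  ultimately show ?thesis by simp
qed

text \<open>With \<open>k\<close> the valency and \<open>a1\<close> the number of common neighbours
  on an edge, the two circle bounds give \<open>a1 \<le> 2\<close> and
  \<open>k \<le> a1 + 3\<close>, and the existence of a pair at distance two gives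
  \<open>k > a1 + 1\<close>. The pair \<open>k = 3\<close>, \<open>a1 = 1\<close> fails because
  three neighbours would have to be perfectly matched.\<close>

lemma degree_cases:
  obtains "!!x. card (N x) = 3" "!!x y. adj x y ==> N x \<inter> N y = {}"
  | "!!x. card (N x) = 4" "!!x y. adj x y ==> card (N x \<inter> N y) = 1"
  | "!!x. card (N x) = 4" "!!x y. adj x y ==> card (N x \<inter> N y) = 2"
  | "!!x. card (N x) = 5" "!!x y. adj x y ==> card (N x \<inter> N y) = 2"
proof -
  obtain v where av: "adj a0 v" and vb: "adj v b0" using ab0 unfolding dist2_def by blast
  define k where "k = card (N a0)"
  define a1 where "a1 = card (N a0 \<inter> N v)"
  have k: "card (N x) = k" for x unfolding k_def by (rule degree_const)
  have a: "card (N x \<inter> N y) = a1" if "adj x y" for x y unfolding a1_def by (rule common_adj[OF that av])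
  have b: "a1 \<le> 2" "k \<le> a1 + 3" "k \<ge> 3"
    using local_degree[OF av] local_codegree[OF av] card_split[OF av] degree_ge_3[of a0] unfolding k_def a1_def by auto
  have nc: "k > a1 + 1"
  proof -
    have "b0 \<in> N v - N a0 - {a0}" using vb ab0 unfolding dist2_def by auto
    then have "card (N v - N a0 - {a0}) > 0" by (subst card_gt_0_iff) auto
    moreover have va: "adj v a0" using av adj_sym by blast
    ultimately show ?thesis using card_split[OF va] k[of v] a[OF va] by linarith
  qed
  have "\<not> (k = 3 \<and> a1 = 1)"
  proof
    assume ka: "k = 3 \<and> a1 = 1"
    obtain y where y: "adj a0 y" using ex_adj by blast
    have one: "\<exists>z. N a0 \<inter> N y = {z}" if "adj a0 y" for y using a[OF that] ka by (simp add: card_1_singleton_iff)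
    obtain z where z: "N a0 \<inter> N y = {z}" using one[OF y] by blast
    then have az: "adj a0 z" "adj y z" by auto
    obtain w where w: "N a0 \<inter> N z = {w}" using one[OF az(1)] by blast
    have "y \<in> {w}" unfolding w[symmetric] using az(2) y adj_sym[of y z] by simp
    then have zy: "N a0 \<inter> N z = {y}" using w by simp
    have "card {y, z} = 2" using az(2) by (auto simp: card_insert_if)
    then have "\<not> N a0 \<subseteq> {y, z}" using k[of a0] ka card_mono[of "{y, z}" "N a0"] by auto
    then obtain r where "r \<in> N a0" "r \<notin> {y, z}" by blast
    then have r: "adj a0 r" "r ~= y" "r ~= z" by simp_all
    obtain s where s: "N a0 \<inter> N r = {s}" using one[OF r(1)] by blast
    have "card {y, z, r} = 3" using az(2) r by (auto simp: card_insert_if)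
    then have Na: "N a0 = {y, z, r}" using k[of a0] ka y az r by (intro card_subset_eq[symmetric]) simp_all
    have "s \<in> N a0 \<inter> N r" unfolding s by simp
    then have "s \<in> N a0" "adj r s" by simp_all
    then have "s \<in> {y, z, r}" and "s ~= r" unfolding Na using adj_neq[of r s] by auto
    moreover have "r \<in> N a0 \<inter> N s" using r \<open>adj r s\<close> adj_sym[of r s] by simp
    ultimately have rs: "r \<in> N a0 \<inter> N s" "s = y \<or> s = z" using \<open>s \<in> {y, z, r}\<close> \<open>s ~= r\<close> by blast+
    then have "r \<in> {y} \<or> r \<in> {z}" unfolding z[symmetric] zy[symmetric] by metis
    then show False using r by simp
  qed
  then have "(k = 3 \<and> a1 = 0) \<or> (k = 4 \<and> a1 = 1) \<or> (k = 4 \<and> a1 = 2) \<or> (k = 5 \<and> a1 = 2)"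
    using b nc by arith
  then show ?thesis using that k a by (metis card_0_eq finite)
qed

text \<open>Degree four with one common neighbour per edge: the image of every triangle sums
  to zero, and suitable walks have images whose inner products with the starting point have denominators
  \<open>2 ^ n\<close>, so that they never close up.\<close>

lemma no_four_one:
  assumes k: "!!x. card (N x) = 4" and a: "!!x y. adj x y ==> card (N x \<inter> N y) = 1"
  shows False
proof -
  have loc: "\<exists>b b' c. N x = {y, c, b, b'} \<and> distinct [y, c, b, b'] \<and> adj y c \<and> adj b b' \<and>
      \<not> adj y b \<and> \<not> adj y b' \<and> \<not> adj c b \<and> \<not> adj c b'" if xy: "adj x y" for x y
  proof -
    obtain c where c: "N x \<inter> N y = {c}" using a[OF xy] by (auto simp: card_1_singleton_iff)
    then have xc: "adj x c" "adj y c" by auto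
    obtain w where w: "N x \<inter> N c = {w}" using a[OF xc(1)] by (meson card_1_singletonE)
    have "y \<in> {w}" unfolding w[symmetric] using xc(2) xy adj_sym[of y c] by simp
    then have cy: "N x \<inter> N c = {y}" using w by simp
    have "card (N x - {y, c}) = 2" using k[of x] xy xc adj_irrefl by (subst card_Diff_subset) (auto simp: card_insert_if)
    then obtain b b' where b: "N x - {y, c} = {b, b'}" "b ~= b'" by (auto simp: card_2_iff)
    have "b \<in> N x - {y, c}" "b' \<in> N x - {y, c}" unfolding b by simp_all
    then have bx: "adj x b" "adj x b'" "b ~= y" "b ~= c" "b' ~= y" "b' ~= c" by simp_all
    have "y \<in> N x" "c \<in> N x" using xy xc by simp_all
    then have Nx: "N x = {y, c, b, b'}" using b(1) by blast
    obtain e where e: "N x \<inter> N b = {e}" using a[OF bx(1)] by (auto simp: card_1_singleton_iff)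
    have "b \<notin> N x \<inter> N y" "b' \<notin> N x \<inter> N y" unfolding c using bx by simp_all
    moreover have "b \<notin> N x \<inter> N c" "b' \<notin> N x \<inter> N c" unfolding cy using bx by simp_all
    ultimately have ye: "\<not> adj y b" "\<not> adj y b'" "\<not> adj c b" "\<not> adj c b'" using bx by simp_all
    have "e \<in> N x \<inter> N b" unfolding e by simp
    then have eb: "e \<in> N x" "adj b e" by simp_all
    have "e ~= y" "e ~= c" "e ~= b" using eb(2) ye adj_sym[of b] adj_irrefl by metis+
    then have "e = b'" using eb(1) unfolding Nx by simp
    then have bb: "adj b b'" using eb(2) by simp
    have "distinct [y, c, b, b']" using adj_neq[OF xc(2)] bx b(2) by auto
    then show ?thesis using Nx ye xc(2) bb by blast
  qed
  \<comment> \<open>The nonzero vector \<open>u b - u b'\<close> is orthogonal to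
    \<open>u a0\<close>, \<open>u y\<close> and \<open>u c\<close>, so these three are dependent.
    Their Gram determinant is \<open>(1 - w1)\<^sup>2 * (1 + 2 * w1)\<close>, and \<open>w1\<close>
    is not 1.\<close>
  have tr: "w1 = -1/2 \<and> w2 = 1/4"
  proof -
    obtain y where xy: "adj a0 y" using ex_adj by blast
    obtain b b' c where N: "N a0 = {y, c, b, b'}" "distinct [y, c, b, b']" "adj y c"
      "\<not> adj y b" "\<not> adj y b'" "\<not> adj c b" "\<not> adj c b'"
      using loc[OF xy] by blast
    then have x: "adj a0 y" "adj a0 c" "adj a0 b" "adj a0 b'" by (auto simp flip: N_iff)
    have d: "dist2 y b" "dist2 y b'" "dist2 c b" "dist2 c b'" using siblings N x by auto
    have ip: "u y \<bullet> u b = w2" "u y \<bullet> u b' = w2" "u c \<bullet> u b = w2" "u c \<bullet> u b' = w2" "u y \<bullet> u c = w1"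
      "u a0 \<bullet> u y = w1" "u a0 \<bullet> u c = w1" "u a0 \<bullet> u b = w1" "u a0 \<bullet> u b' = w1"
      using d inner_dist2 N(3) x inner_adj by auto
    have "u a0 \<bullet> (u y \<times> u c) = 0"
    proof (rule ccontr)
      assume nz: "u a0 \<bullet> (u y \<times> u c) ~= 0"
      have "u b - u b' = 0"
        by (rule three_perp_zero[OF _ _ _ nz])
          (simp_all add: inner_diff_left inner_commute[of "u b"] inner_commute[of "u b'"] ip)
      then show False using u_siblings_neq[OF x(3,4)] N(2) by simp
    qed
    then have "1 + 2 * w1 * w1 * w1 - w1\<^sup>2 - w1\<^sup>2 - w1\<^sup>2 = 0" using gram3[of "u a0" "u y" "u c"] ip by simp
    then have "(1 - w1)\<^sup>2 * (1 + 2 * w1) = 0" by (simp add: power2_eq_square algebra_simps)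
    moreover have "w1 ~= 1" using w1_sq by auto
    ultimately have w: "w1 = - 1/2" by simp
    have "u y \<bullet> (\<Sum>z\<in>N a0. u z) = \<theta> * w1" unfolding u_eig using ip by (simp add: inner_commute)
    then have "1 + w1 + w2 + w2 = \<theta> * w1" using N(1,2) ip by (simp add: inner_add_right)
    then show ?thesis using w theta_w1[of a0] k[of a0] by simp
  qed
  have theta: "\<theta> = -2" using theta_w1[of a0] k[of a0] tr by simp
  have tri: "u x + u y + u z = 0" if "adj x y" "adj x z" "adj y z" for x y z
  proof -
    have "(u x + u y + u z) \<bullet> (u x + u y + u z) = 0"
      using that inner_adj tr by (simp add: inner_add_left inner_add_right inner_commute)
    then show ?thesis by simp
  qed
  define good where "good x y z \<longleftrightarrow> adj x y \<and> adj y z \<and> dist2 x z" for x y z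
  \<comment> \<open>The two neighbours \<open>e\<close>, \<open>e'\<close> of \<open>z\<close>
    outside the triangle have inner products with \<open>u x\<close> of sum -1/4 and of difference
    3/2 up to sign, so one of them is 5/8. Always continuing there makes the walk obey a linear
    recurrence.\<close>
  have step: "\<exists>e. good y z e \<and> u x \<bullet> u e = 5/8" if g: "good x y z" for x y z
  proof -
    have xyz: "adj x y" "adj y z" "dist2 x z" using g unfolding good_def by auto
    have zy: "adj z y" "adj y x" using xyz adj_sym by blast+
    obtain e e' y' where Nz: "N z = {y, y', e, e'}" "distinct [y, y', e, e']" "adj y y'" "adj e e'"
      "\<not> adj y e" "\<not> adj y e'" using loc[OF zy(1)] by blast
    then have z: "adj z y'" "adj z e" "adj z e'" by (auto simp flip: N_iff)
    have ye: "dist2 y e" "dist2 y e'"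
      using siblings[OF zy(1) z(2)] siblings[OF zy(1) z(3)] Nz(2,5,6) by auto
    have "u y + u y' + u e + u e' = -2 *\<^sub>R u z" using u_eig[of z] Nz(1,2) theta by (simp add: add.assoc)
    moreover have "u z + u y + u y' = 0" using tri[OF zy(1) z(1) Nz(3)] .
    ultimately have e12: "u y + u y' + u e + u e' = -2 *\<^sub>R u z" "u y + u y' = - u z"
      by (simp_all add: eq_neg_iff_add_eq_0 add.commute add.left_commute)
    have "(u y + u y') + (u e + u e') = -2 *\<^sub>R u z" using e12(1) by (simp only: add.assoc)
    then have "- u z + (u e + u e') = - u z + (- u z)" unfolding e12(2) by (simp add: scaleR_2)
    then have sum: "u e + u e' = - u z" by (simp only: add_left_cancel)
    have ip: "u e \<bullet> u z = w1" "u e' \<bullet> u z = w1" "u e \<bullet> u y = w2" "u e' \<bullet> u y = w2" "u e \<bullet> u e' = w1"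
      "u y \<bullet> u z = w1" "u x \<bullet> u y = w1" "u x \<bullet> u z = w2"
      using inner_adj[OF z(2)] inner_adj[OF z(3)] inner_dist2[OF ye(1)] inner_dist2[OF ye(2)] inner_adj[OF Nz(4)]
        inner_adj[OF xyz(2)] inner_adj[OF xyz(1)] inner_dist2[OF xyz(3)] by (simp_all add: inner_commute)
    have "(u e - u e') \<bullet> u y = 0" "(u e - u e') \<bullet> u z = 0" using ip by (auto simp: inner_diff_left)
    then obtain m where m: "u e - u e' = m *\<^sub>R (u y \<times> u z)" using perp_cross[OF _ _ cross_nz[OF xyz(2)]] by metis
    have "(u e - u e') \<bullet> (u e - u e') = 3" using ip tr by (simp add: inner_diff_left inner_diff_right inner_commute)
    then have "m * m * ((u y \<times> u z) \<bullet> (u y \<times> u z)) = 3" unfolding m by simp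
    then have m2: "m * m * (3/4) = 3" by (simp add: cross_sq ip tr power2_eq_square)
    have n2: "(u x \<bullet> (u y \<times> u z))\<^sup>2 = 9/16" unfolding gram3 by (simp add: ip tr power2_eq_square)
    have "(u x \<bullet> u e - u x \<bullet> u e')\<^sup>2 = (m * (u x \<bullet> (u y \<times> u z)))\<^sup>2"
      using arg_cong[OF m, of "\<lambda>v. u x \<bullet> v"] by (simp add: inner_diff_right)
    also have "\<dots> = m * m * (u x \<bullet> (u y \<times> u z))\<^sup>2" by (simp add: power2_eq_square)
    also have "\<dots> = (3/2)\<^sup>2" using m2 n2 by (simp add: power2_eq_square)
    finally have "u x \<bullet> u e - u x \<bullet> u e' = 3/2 \<or> u x \<bullet> u e - u x \<bullet> u e' = -(3/2)" by (simp only: power2_eq_iff)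
    moreover have "u x \<bullet> u e + u x \<bullet> u e' = - 1/4" using arg_cong[OF sum, of "\<lambda>v. u x \<bullet> v"] ip tr by (simp add: inner_add_right)
    ultimately have "u x \<bullet> u e = 5/8 \<or> u x \<bullet> u e' = 5/8" by linarith
    then show ?thesis unfolding good_def using xyz(2) z ye by blast
  qed
  then obtain f where f: "!!x y z. good x y z ==> good y z (f x y z) \<and> u x \<bullet> u (f x y z) = 5/8" by metis
  obtain v where v: "good a0 v b0" using ab0 unfolding good_def dist2_def by blast
  define T where "T k = ((\<lambda>(x, y, z). (y, z, f x y z)) ^^ k) (a0, v, b0)" for k
  define s where "s k = fst (T k)" for k
  have Ts: "T (Suc k) = (fst (snd (T k)), snd (snd (T k)), f (fst (T k)) (fst (snd (T k))) (snd (snd (T k))))" for k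
    unfolding T_def by (simp add: case_prod_beta)
  have s: "fst (snd (T k)) = s (k + 1)" "snd (snd (T k)) = s (k + 2)" for k
    unfolding s_def using Ts by (simp_all add: numeral_2_eq_2)
  have good: "good (s k) (s (k + 1)) (s (k + 2))" for k
  proof (induction k)
    case 0
    have "T 0 = (a0, v, b0)" unfolding T_def by simp
    then show ?case using v s(1)[of 0] s(2)[of 0] unfolding s_def by simp
  next
    case (Suc k)
    have "s (k + 3) = f (s k) (s (k + 1)) (s (k + 2))"
      using s(2)[of "Suc k"] Ts[of k] s[of k] unfolding s_def[of k] by (simp add: numeral_3_eq_3)
    then show ?case using f[OF Suc] by (simp add: numeral_3_eq_3 numeral_2_eq_2)
  qed
  have s3: "s (k + 3) = f (s k) (s (k + 1)) (s (k + 2))" for k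
    using s(2)[of "Suc k"] Ts[of k] s[of k] unfolding s_def[of k] by (simp add: numeral_3_eq_3)
  \<comment> \<open>Both sides have the same inner products with the three preceding vectors, which
    are independent.\<close>
  have rec: "u (s (k + 3)) = u (s k) + (1/2) *\<^sub>R u (s (k + 1)) - (1/2) *\<^sub>R u (s (k + 2))" for k
  proof -
    have ip: "u (s k) \<bullet> u (s (k + 1)) = -1/2" "u (s (k + 1)) \<bullet> u (s (k + 2)) = -1/2" "u (s k) \<bullet> u (s (k + 2)) = 1/4"
      "u (s (k + 2)) \<bullet> u (s (k + 3)) = -1/2" "u (s (k + 1)) \<bullet> u (s (k + 3)) = 1/4" "u (s k) \<bullet> u (s (k + 3)) = 5/8"
      using good[of k] good[of "k + 1"] inner_adj inner_dist2 tr f[OF good[of k]] s3[of k]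
      unfolding good_def by (auto simp: numeral_3_eq_3 numeral_2_eq_2)
    have "u (s (k + 3)) - (u (s k) + (1/2) *\<^sub>R u (s (k + 1)) - (1/2) *\<^sub>R u (s (k + 2))) = 0"
    proof (rule three_perp_zero)
      have "(u (s k) \<bullet> (u (s (k + 1)) \<times> u (s (k + 2))))\<^sup>2 = 9/16" unfolding gram3 ip uu by (simp add: power2_eq_square)
      then show "u (s k) \<bullet> (u (s (k + 1)) \<times> u (s (k + 2))) ~= 0" by auto
    qed (use ip in \<open>simp_all add: inner_diff_left inner_add_left inner_diff_right inner_add_right inner_commute\<close>)
    then show ?thesis by simp
  qed
  \<comment> \<open>Scaled by powers of two, the recurrence has coefficients 8, 2 and -1; the odd
    last term keeps all values odd.\<close>
  have odd: "\<exists>i::int. odd i \<and> 2 ^ k * (u (s 0) \<bullet> u (s k)) = of_int i" for k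
  proof (induction k rule: less_induct)
    case (less k)
    consider "k = 0" | "k = 1" | "k = 2" | j where "k = j + 3"
      using le_Suc_ex[of 3 k] by (cases "k < 3") (auto simp: less_Suc_eq numeral_3_eq_3 add.commute)
    then show ?case
    proof cases
      case 4
      obtain i0 where i0: "2 ^ j * (u (s 0) \<bullet> u (s j)) = of_int i0" using less[of j] 4 by auto
      obtain i1 where i1: "2 ^ (j + 1) * (u (s 0) \<bullet> u (s (j + 1))) = of_int i1" using less[of "j + 1"] 4 by auto
      obtain i2 where i2: "odd i2" "2 ^ (j + 2) * (u (s 0) \<bullet> u (s (j + 2))) = of_int i2" using less[of "j + 2"] 4 by auto
      have "2 ^ k * (u (s 0) \<bullet> u (s k)) = 8 * (2 ^ j * (u (s 0) \<bullet> u (s j))) + 2 * (2 ^ (j + 1) * (u (s 0) \<bullet> u (s (j + 1))))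
          - 2 ^ (j + 2) * (u (s 0) \<bullet> u (s (j + 2)))"
        unfolding 4 rec by (simp add: inner_diff_right inner_add_right power_add algebra_simps)
      also have "\<dots> = of_int (8 * i0 + 2 * i1 - i2)" unfolding i0 i1 i2 by simp
      finally show ?thesis using i2(1) by (intro exI[of _ "8 * i0 + 2 * i1 - i2"]) auto
    next
      case 1
      then show ?thesis by (intro exI[of _ 1]) auto
    next
      case 2
      then show ?thesis using good[of 0] inner_adj tr unfolding good_def by (intro exI[of _ "-1"]) auto
    next
      case 3
      have "u (s 0) \<bullet> u (s 2) = 1/4" using good[of 0] inner_dist2[of "s 0" "s 2"] tr
        unfolding good_def by (simp add: numeral_2_eq_2)
      then show ?thesis using 3 by (intro exI[of _ 1]) simp
    qed
  qed
  \<comment> \<open>A repetition would equate an odd integer with an even one, by the different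
    powers of two.\<close>
  have neq: "s j ~= s k" if jk: "j < k" for j k
  proof
    assume e: "s j = s k"
    obtain i where i: "2 ^ j * (u (s 0) \<bullet> u (s j)) = of_int i" using odd by blast
    obtain i' where i': "odd i'" "2 ^ k * (u (s 0) \<bullet> u (s k)) = of_int i'" using odd by blast
    have "(of_int i' :: real) = 2 ^ (k - j) * of_int i" unfolding i[symmetric] i'(2)[symmetric] e
      using jk by (simp add: power_add[symmetric] flip: mult.assoc)
    then have "i' = 2 ^ (k - j) * i" by (metis of_int_eq_iff of_int_mult of_int_numeral of_int_power)
    then show False using i'(1) jk by simp
  qed
  have "inj s" by (metis injI linorder_neqE_nat neq)
  then show False using finite_imageD[of s UNIV] by simp
qed

text \<open>Each vertex has exactly one further non-neighbour, with the same neighbourhood. The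
  complements of neighbourhoods are therefore the parts.\<close>

lemma octahedron:
  assumes k: "!!x. card (N x) = 4" and a: "!!x y. adj x y ==> card (N x \<inter> N y) = 2"
  shows "!!x y. adj x y \<longleftrightarrow> UNIV - N x ~= UNIV - N y" and "card (range (\<lambda>x. UNIV - N x)) = 3"
    and "!!b. b \<in> range (\<lambda>x. UNIV - N x) ==> card {x. UNIV - N x = b} = 2"
proof -
  have main: "\<exists>z. z ~= x \<and> UNIV - N x = {x, z} \<and> N z = N x \<and> card (UNIV :: 'x set) = 6" for x
  proof -
    obtain y where xy: "adj x y" using ex_adj by blast
    obtain p q where pq: "N x \<inter> N y = {p, q}" "p ~= q" using a[OF xy] by (auto simp: card_2_iff)
    then have x: "adj x p" "adj x q" "adj y p" "adj y q" by auto
    have "card (N x - {y, p, q}) = 1" using k[of x] xy x pq(2) adj_irrefl by (subst card_Diff_subset) (auto simp: card_insert_if)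
    then obtain r where r: "N x - {y, p, q} = {r}" by (meson card_1_singletonE)
    moreover have "y \<in> N x" "p \<in> N x" "q \<in> N x" using xy x by simp_all
    ultimately have Nx: "N x = {y, p, q, r}" by blast
    have "r \<in> N x - {y, p, q}" unfolding r by blast
    then have d: "distinct [y, p, q, r]" using pq(2) adj_neq[OF x(3)] adj_neq[OF x(4)] by auto
    have xr: "adj x r" using Nx N_iff by blast
    have "r \<notin> N x \<inter> N y" unfolding pq(1) using d by auto
    then have "\<not> adj y r" using xr by simp
    then have "N x \<inter> N r \<subseteq> {p, q}" using Nx adj_sym by auto
    then have Nr: "N x \<inter> N r = {p, q}"
      by (rule card_subset_eq[rotated]) (use a[OF xr] pq(2) in \<open>simp_all add: card_insert_if\<close>)
    then have rpq: "adj r p" "adj r q" by auto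
    have pr: "adj p y" "adj q y" "adj p r" "adj q r" "adj y x" using x rpq xy adj_sym by blast+
    have Np: "N x \<inter> N p = {y, r}" by (rule card_2_eqI[OF a[OF x(1)]]) (use x xy xr pr d in auto)
    have Nq: "N x \<inter> N q = {y, r}" by (rule card_2_eqI[OF a[OF x(2)]]) (use x xy xr pr d in auto)
    have Ny: "N x \<inter> N y = {p, q}" by (rule pq(1))
    have out: "\<exists>z. N w = {x, z} \<union> (N x \<inter> N w) \<and> z ~= x \<and> \<not> adj x z" if w: "adj x w" for w
    proof -
      have wx: "adj w x" using w adj_sym by blast
      have "card (N w - N x - {x}) = 1" using card_split[OF wx] k[of w] a[OF wx] by simp
      then obtain z where z: "N w - N x - {x} = {z}" by (meson card_1_singletonE)
      have "x \<in> N w" using wx by simp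
      then have "N w = {x, z} \<union> (N x \<inter> N w)" using z by blast
      moreover have "z \<in> N w - N x - {x}" unfolding z by simp
      ultimately show ?thesis by auto
    qed
    have same: "N w' \<inter> N w = {x, z}" if w: "adj x w" "adj x w'" "adj w w'" and z: "N w = {x, z} \<union> (N x \<inter> N w)" "z ~= x"
      and t: "N x \<inter> N w \<inter> N w' = {}" for w w' z
    proof -
      have "N w' \<inter> N w \<subseteq> {x, z}" using z t by auto
      moreover have "adj w' w" using w(3) adj_sym by blast
      then have "card (N w' \<inter> N w) = 2" by (rule a)
      moreover have "card {x, z} = 2" using z(2) by simp
      ultimately show ?thesis by (intro card_subset_eq) simp_all
    qed
    obtain z where z: "N y = {x, z} \<union> (N x \<inter> N y)" "z ~= x" "\<not> adj x z" using out[OF xy] by blast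
    have tp: "N x \<inter> N y \<inter> N p = {}" "N x \<inter> N y \<inter> N q = {}" "N x \<inter> N p \<inter> N r = {}"
    proof -
      have "q \<notin> N x \<inter> N p" unfolding Np using d by auto
      then have "\<not> adj p q" using x(2) by simp
      then show "N x \<inter> N y \<inter> N p = {}" "N x \<inter> N y \<inter> N q = {}"
        unfolding Ny using adj_sym[of p q] by simp_all
      show "N x \<inter> N p \<inter> N r = {}" unfolding Np using \<open>\<not> adj y r\<close> adj_sym[of y r] by simp
    qed
    have "N p \<inter> N y = {x, z}" by (rule same[OF xy x(1) x(3) z(1,2) tp(1)])
    then have zp: "adj p z" by auto
    have "N q \<inter> N y = {x, z}" by (rule same[OF xy x(2) x(4) z(1,2) tp(2)])
    then have zq: "adj q z" by auto
    obtain z' where z': "N p = {x, z'} \<union> (N x \<inter> N p)" "z' ~= x" "\<not> adj x z'" using out[OF x(1)] by blast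
    have "z \<in> {x, z'} \<union> (N x \<inter> N p)" using z'(1) zp by auto
    then have "z' = z" using z(2,3) by auto
    have "N r \<inter> N p = {x, z'}" by (rule same[OF x(1) xr _ z'(1,2) tp(3)]) (use pr in auto)
    then have zr: "adj r z" using \<open>z' = z\<close> by auto
    have zy: "adj y z" using z by auto
    have "{y, p, q, r} \<subseteq> N z" using zy zp zq zr by (simp add: adj_sym)
    moreover have "card {y, p, q, r} = 4" using d by simp
    ultimately have Nz: "N z = {y, p, q, r}" using k[of z] by (metis card_seteq finite order_refl)
    have nb: "N w \<subseteq> {x, z} \<union> N x" if "w \<in> {x, z} \<union> N x" for w
    proof (cases "adj x w")
      case True
      obtain z2 where z2: "N w = {x, z2} \<union> (N x \<inter> N w)" "z2 ~= x" "\<not> adj x z2" using out[OF True] by blast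
      have "w \<in> {y, p, q, r}" using True unfolding Nx[symmetric] by simp
      then have "adj w z" using zy zp zq zr by auto
      then have "z \<in> {x, z2} \<union> (N x \<inter> N w)" using z2(1) by auto
      then have "z2 = z" using z(2,3) by auto
      then show ?thesis using z2 by blast
    next
      case False
      then have "w = x \<or> w = z" using that by simp
      then have "N w = N x" using Nz Nx by auto
      then show ?thesis by blast
    qed
    have "w \<in> {x, z} \<union> N x" for w
      by (rule conn_induct[of "\<lambda>w. w \<in> {x, z} \<union> N x" x], simp) (metis N_iff nb subsetD)
    then have univ: "UNIV = {x, z} \<union> N x" by blast
    have "x \<notin> {y, p, q, r}" "z \<notin> {y, p, q, r}" unfolding Nx[symmetric] using z(3) by simp_all
    then have dz: "distinct [x, z, y, p, q, r]" using d z(2) by auto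
    then have "card {x, z, y, p, q, r} = 6" by simp
    moreover have "(UNIV :: 'x set) = {x, z, y, p, q, r}" using univ unfolding Nx by (simp add: insert_commute Un_insert_left)
    ultimately have "card (UNIV :: 'x set) = 6" by metis
    moreover have "UNIV - N x = {x, z}"
    proof -
      have "x \<notin> N x" "z \<notin> N x" using z(3) by simp_all
      then show ?thesis using univ by blast
    qed
    ultimately show ?thesis using z(2) Nz Nx by blast
  qed
  then obtain g where g: "!!x. g x ~= x" "!!x. UNIV - N x = {x, g x}" "!!x. N (g x) = N x"
    and card6: "card (UNIV :: 'x set) = 6" by metis
  show A: "adj x y \<longleftrightarrow> UNIV - N x ~= UNIV - N y" for x y
  proof
    assume "adj x y"
    then show "UNIV - N x ~= UNIV - N y" using adj_irrefl[of y] by (metis DiffD2 DiffI N_iff UNIV_I)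
  next
    assume n: "UNIV - N x ~= UNIV - N y"
    show "adj x y"
    proof (rule ccontr)
      assume "\<not> adj x y"
      then have "y \<in> {x, g x}" unfolding g(2)[of x, symmetric] by simp
      then have "N y = N x" using g(3)[of x] by (elim insertE emptyE) simp_all
      then show False using n by simp
    qed
  qed
  have fib: "{y. UNIV - N y = UNIV - N x} = {x, g x}" for x
  proof -
    have "UNIV - N y = UNIV - N x \<longleftrightarrow> y \<in> UNIV - N x" for y using A[of x y] by (metis DiffI DiffD2 N_iff UNIV_I)
    then have "{y. UNIV - N y = UNIV - N x} = UNIV - N x" by blast
    then show ?thesis using g(2)[of x] by simp
  qed
  show two: "card {x. UNIV - N x = b} = 2" if br: "b \<in> range (\<lambda>x. UNIV - N x)" for b
  proof -
    obtain x where b: "b = UNIV - N x" using br by blast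
    show ?thesis unfolding b fib using g(1)[of x] by (simp add: card_insert_if)
  qed
  have "(\<Sum>b\<in>range (\<lambda>x. UNIV - N x). \<Sum>x\<in>{x \<in> UNIV. UNIV - N x = b}. 1::nat) = (\<Sum>x\<in>(UNIV :: 'x set). 1)"
    by (rule sum.group) auto
  then have "(\<Sum>b\<in>range (\<lambda>x. UNIV - N x). card {x. UNIV - N x = b}) = 6" using card6 by simp
  then have "(\<Sum>b\<in>range (\<lambda>x. UNIV - N x). 2::nat) = 6" using two by (simp cong: sum.cong)
  then show "card (range (\<lambda>x. UNIV - N x)) = 3" by simp
qed

end

text \<open>Position 0 is the root, 1 to 5 its pentagon of neighbours, 6 to 10 the second pentagon,
  11 the antipode.\<close>

definition icosa_tab :: "nat list list" where
  "icosa_tab = [[1, 2, 3, 4, 5],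
     [0, 2, 5, 6, 10], [0, 3, 1, 7, 6], [0, 4, 2, 8, 7], [0, 5, 3, 9, 8], [0, 1, 4, 10, 9],
     [1, 2, 7, 10, 11], [2, 3, 8, 6, 11], [3, 4, 9, 7, 11], [4, 5, 10, 8, 11], [5, 1, 6, 9, 11],
     [6, 7, 8, 9, 10]]"

definition cube_tab :: "nat list list" where
  "cube_tab = [[1, 2, 3], [0, 4, 5], [0, 4, 6], [0, 5, 6], [1, 2, 7], [1, 3, 7], [2, 3, 7], [4, 5, 6]]"

section \<open>The icosahedron, and the cubic triangle-free graphs with 4-cycles\<close>

context pm_inj
begin

text \<open>The local graph at \<open>x\<close> is a pentagon, listed in cyclic order.\<close>

definition pent :: "'x => 'x => 'x => 'x => 'x => 'x => bool" where
  "pent x p q r s t \<longleftrightarrow> N x = {p, q, r, s, t} \<and> distinct [p, q, r, s, t] \<and> N x \<inter> N p = {q, t} \<and>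
     N x \<inter> N q = {p, r} \<and> N x \<inter> N r = {q, s} \<and> N x \<inter> N s = {r, t} \<and> N x \<inter> N t = {s, p}"

lemma pentD:
  assumes "pent x p q r s t"
  shows "N x = {p, q, r, s, t}" "distinct [p, q, r, s, t]" "N x \<inter> N p = {q, t}"
    "N x \<inter> N q = {p, r}" "N x \<inter> N r = {q, s}" "N x \<inter> N s = {r, t}" "N x \<inter> N t = {s, p}"
  by (insert assms, unfold pent_def, elim conjE, assumption)+

lemma common_mem: "z \<in> N x \<inter> N y \<longleftrightarrow> adj x z \<and> adj y z" by simp

text \<open>The local graph has five vertices, all of degree two, so it is a 5-cycle: a triangle
  would leave two vertices, too few for degree two.\<close>

lemma pentagon:
  assumes k: "!!x. card (N x) = 5" and a: "!!x y. adj x y ==> card (N x \<inter> N y) = 2"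
    and xp: "adj x p" and q: "q \<in> N x \<inter> N p"
  shows "\<exists>r s t. pent x p q r s t"
proof -
  obtain t where t: "t ~= q" "N x \<inter> N p = {q, t}" using card_2_other[OF a[OF xp] q] by blast
  have xq: "adj x q" "adj q p" using q adj_sym[of p q] by simp_all
  have "p \<in> N x \<inter> N q" using xp xq by simp
  then obtain r where r: "r ~= p" "N x \<inter> N q = {p, r}" using card_2_other[OF a[OF xq(1)]] by blast
  have "t \<in> N x \<inter> N p" unfolding t by simp
  then have xt: "adj x t" "adj p t" "adj t p" using adj_sym[of p t] by simp_all
  have "r \<in> N x \<inter> N q" unfolding r by simp
  then have xr: "adj x r" "adj q r" "adj r q" using adj_sym[of q r] by simp_all
  have pq: "p ~= q" "t ~= p" "r ~= q" using adj_neq xq xt xr by metis+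
  have rt: "r ~= t"
  proof
    assume e: "r = t"
    have Nr: "N x \<inter> N r = {p, q}" by (rule card_2_eqI[OF a[OF xr(1)]]) (use xp xq xt xr e pq in simp_all)
    have "card {p, q, r} = 3" using pq e t r by auto
    moreover have "{p, q, r} \<subseteq> N x" using xp xq xr by simp
    ultimately have "card (N x - {p, q, r}) = 2" using k[of x] by (simp add: card_Diff_subset)
    then obtain s v where sv: "N x - {p, q, r} = {s, v}" "s ~= v" by (auto simp: card_2_iff)
    have "s \<in> N x - {p, q, r}" unfolding sv by simp
    then have s: "adj x s" "s \<notin> {p, q, r}" by simp_all
    have "N x \<inter> N s \<subseteq> {v}"
    proof
      fix z assume "z \<in> N x \<inter> N s"
      then have z: "adj x z" "adj s z" "adj z s" using adj_sym[of s z] by simp_all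
      have "z ~= s" using adj_neq[OF z(2)] by simp
      have "s \<notin> N x \<inter> N p" "s \<notin> N x \<inter> N q" "s \<notin> N x \<inter> N r" unfolding t(2) r(2) Nr using s e by auto
      then have "z ~= p" "z ~= q" "z ~= r" using s(1) z(3) by auto
      then have "z \<in> N x - {p, q, r}" using z(1) by simp
      then show "z \<in> {v}" unfolding sv using \<open>z ~= s\<close> by simp
    qed
    then have "card (N x \<inter> N s) \<le> card {v}" by (rule card_mono[rotated]) simp
    then show False using a[OF s(1)] by simp
  qed
  have d4: "distinct [p, q, r, t]" using pq t r rt by auto
  have "{p, q, r, t} \<subseteq> N x" using xp xq xr xt by simp
  moreover have "card {p, q, r, t} = 4" using d4 by simp
  ultimately have "card (N x - {p, q, r, t}) = 1" using k[of x] by (simp add: card_Diff_subset)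
  then obtain s where s: "N x - {p, q, r, t} = {s}" by (meson card_1_singletonE)
  have Nx: "N x = {p, q, r, s, t}" using s \<open>{p, q, r, t} \<subseteq> N x\<close> by blast
  have "s \<in> N x - {p, q, r, t}" unfolding s by simp
  then have s': "adj x s" "s \<notin> {p, q, r, t}" by simp_all
  have "N x \<inter> N s \<subseteq> {r, t}"
  proof
    fix z assume "z \<in> N x \<inter> N s"
    then have z: "adj x z" "adj s z" "adj z s" using adj_sym[of s z] by simp_all
    have "z ~= s" using adj_neq[OF z(2)] by simp
    have "s \<notin> N x \<inter> N p" "s \<notin> N x \<inter> N q" unfolding t(2) r(2) using s' by auto
    then have "z ~= p" "z ~= q" using s'(1) z(3) by auto
    moreover have "z \<in> {p, q, r, s, t}" using z(1) unfolding Nx[symmetric] by simp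
    ultimately show "z \<in> {r, t}" using \<open>z ~= s\<close> by simp
  qed
  then have Ns: "N x \<inter> N s = {r, t}"
    by (intro card_subset_eq) (use a[OF s'(1)] rt in simp_all)
  have "r \<in> N x \<inter> N s" "t \<in> N x \<inter> N s" unfolding Ns by simp_all
  then have rs: "adj r s" "adj t s" using adj_sym[of s r] adj_sym[of s t] by simp_all
  have Nr: "N x \<inter> N r = {q, s}" by (rule card_2_eqI[OF a[OF xr(1)]]) (use xq xr rs s' in auto)
  have Nt: "N x \<inter> N t = {s, p}" by (rule card_2_eqI[OF a[OF xt(1)]]) (use xp xt rs s' in auto)
  have "distinct [p, q, r, s, t]" using d4 s' by auto
  then have "pent x p q r s t" unfolding pent_def using Nx t(2) r(2) Nr Ns Nt by simp
  then show ?thesis by blast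
qed

lemma pair_eq: "{a, b} = {a, d} ==> a ~= b ==> b = d" "{b, a} = {a, d} ==> a ~= b ==> b = d"
  by (auto simp: doubleton_eq_iff)

text \<open>Local pentagons glue: \<open>y\<close> runs around \<open>x\<close>, \<open>a' i\<close>
  completes the triangle beyond the edge from \<open>y i\<close> to \<open>y (i + 1)\<close>, and
  the vertex \<open>w i\<close> still open in the pentagon around \<open>a' (i + 1)\<close> does not
  depend on \<open>i\<close>. Indices run over all naturals with period five, so each identity is
  proved once.\<close>

lemma icosahedron_list:
  assumes k: "!!x. card (N x) = 5" and a: "!!x y. adj x y ==> card (N x \<inter> N y) = 2"
  shows "\<exists>vs. length vs = length icosa_tab \<and> vs ! 0 = x \<and> distinct vs \<and>
      (\<forall>p<length icosa_tab. N (vs ! p) = (!) vs ` set (icosa_tab ! p))"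
proof -
  have pg: "\<exists>r s t. pent x p q r s t" if "adj x p" "q \<in> N x \<inter> N p" for x p q
    by (rule pentagon[OF k a that])
  obtain p where xp: "adj x p" using ex_adj by blast
  have "card (N x \<inter> N p) ~= 0" using a[OF xp] by simp
  then obtain q where "q \<in> N x \<inter> N p" by (metis card.empty ex_in_conv)
  then obtain r s t where P: "pent x p q r s t" using pg[OF xp] by blast
  define y where "y i = [p, q, r, s, t] ! (i mod 5)" for i
  have y5: "y (i + 5) = y i" for i unfolding y_def by simp
  have mod5: "i mod 5 = 0 \<or> i mod 5 = 1 \<or> i mod 5 = 2 \<or> i mod 5 = 3 \<or> i mod 5 = 4" for i :: nat by linarith
  have ysucc: "y (i + j) = [p, q, r, s, t] ! ((i mod 5 + j) mod 5)" for i j unfolding y_def by (simp add: mod_add_left_eq)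
  have Nxy: "N x \<inter> N (y i) = {y (i + 1), y (i + 4)}" for i
    using pentD(3-)[OF P] mod5[of i] unfolding ysucc[of i 1] ysucc[of i 4] y_def[of i]
    by (elim disjE) (simp_all add: insert_commute)
  have xy: "adj x (y i)" "adj (y i) x" for i
  proof -
    have "y i \<in> N x" unfolding pentD(1)[OF P] y_def using mod5[of i] by (elim disjE) simp_all
    then show "adj x (y i)" "adj (y i) x" using adj_sym[of x "y i"] by simp_all
  qed
  have yneq: "y (i + 4) ~= y (i + 1)" "y (i + 2) ~= y i" for i
    using pentD(2)[OF P] mod5[of i] unfolding ysucc[of i 1] ysucc[of i 4] ysucc[of i 2] y_def[of i]
    by (elim disjE; auto)+
  have "\<exists>A B C. pent (y i) x (y (i + 1)) A B C" for i
  proof -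
    have "y (i + 1) \<in> N x \<inter> N (y i)" unfolding Nxy by simp
    then have "y (i + 1) \<in> N (y i) \<inter> N x" by simp
    then show ?thesis using pg[OF xy(2)] by blast
  qed
  \<comment> \<open>The choice is made for a pair of vertices and not for an index, so that it
    inherits the period of \<open>y\<close>.\<close>
  then have "\<exists>A B C. pent v x w A B C" if "\<exists>i. v = y i \<and> w = y (i + 1)" for v w using that by blast
  then obtain A B C where ABC: "!!v w. \<exists>i. v = y i \<and> w = y (i + 1) ==> pent v x w (A v w) (B v w) (C v w)"
    by metis
  define a' where "a' i = A (y i) (y (i + 1))" for i
  define b where "b i = B (y i) (y (i + 1))" for i
  define cc where "cc i = C (y i) (y (i + 1))" for i
  have a5: "a' (i + 5) = a' i" for i
  proof -
    have "y (i + 5 + 1) = y (i + 1)" using y5[of "i + 1"] by (simp add: algebra_simps)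
    then show ?thesis unfolding a'_def y5 by simp
  qed
  have pc: "pent (y i) x (y (i + 1)) (a' i) (b i) (cc i)" for i
    unfolding a'_def b_def cc_def by (rule ABC) blast
  have c: "cc i = y (i + 4)" for i
  proof -
    have "{y (i + 1), cc i} = {y (i + 1), y (i + 4)}"
      unfolding pentD(3)[OF pc[of i], symmetric] Nxy[of i, symmetric] by (rule Int_commute)
    moreover have "y (i + 1) ~= cc i" using pentD(2)[OF pc[of i]] by simp
    ultimately show ?thesis by (rule pair_eq(1))
  qed
  have ba: "b (i + 1) = a' i" for i
  proof -
    have "cc (i + 1) = y i" using c[of "i + 1"] y5[of i] by (simp add: add.commute)
    then have "N (y (i + 1)) \<inter> N (y i) = {b (i + 1), x}" using pentD(7)[OF pc[of "i + 1"]] by simp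
    moreover have "N (y i) \<inter> N (y (i + 1)) = {x, a' i}" by (rule pentD(4)[OF pc[of i]])
    ultimately have "{b (i + 1), x} = {x, a' i}" by (simp only: Int_commute[of "N (y (i + 1))"])
    moreover have "x ~= b (i + 1)" using pentD(2)[OF pc[of "i + 1"]] by auto
    ultimately show ?thesis by (rule pair_eq(2))
  qed
  have py: "pent (y (i + 1)) x (y (i + 2)) (a' (i + 1)) (a' i) (y i)" for i
    using pc[of "i + 1"] c[of "i + 1"] ba[of i] y5[of i] by (simp add: add.commute)
  have "\<exists>w. pent (a' (i + 1)) (y (i + 1)) (y (i + 2)) (a' (i + 2)) w (a' i)" for i
  proof -
    have e1: "N (y (i + 1)) \<inter> N (a' (i + 1)) = {y (i + 2), a' i}" by (rule pentD(5)[OF py[of i]])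
    have "a' (i + 1) \<in> N (y (i + 1))" unfolding pentD(1)[OF py[of i]] by simp
    then have ay: "adj (a' (i + 1)) (y (i + 1))" using adj_sym[of "a' (i + 1)"] by simp
    have "y (i + 2) \<in> N (a' (i + 1)) \<inter> N (y (i + 1))" unfolding Int_commute[of "N (a' (i + 1))"] e1 by simp
    then obtain d e f where pa: "pent (a' (i + 1)) (y (i + 1)) (y (i + 2)) d e f" using pg[OF ay] by blast
    have "{y (i + 2), f} = {y (i + 2), a' i}" unfolding pentD(3)[OF pa, symmetric] e1[symmetric] by (rule Int_commute)
    moreover have "y (i + 2) ~= f" using pentD(2)[OF pa] by auto
    ultimately have f: "f = a' i" by (rule pair_eq(1))
    have e2: "N (y (i + 2)) \<inter> N (a' (i + 1)) = {a' (i + 2), y (i + 1)}"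
      using pentD(6)[OF py[of "i + 1"]] by (simp add: add.assoc numeral_2_eq_2 numeral_3_eq_3)
    have "{y (i + 1), d} = {a' (i + 2), y (i + 1)}" unfolding pentD(4)[OF pa, symmetric] e2[symmetric] by (rule Int_commute)
    then have "{d, y (i + 1)} = {y (i + 1), a' (i + 2)}" by (simp only: insert_commute)
    moreover have "y (i + 1) ~= d" using pentD(2)[OF pa] by auto
    ultimately have "d = a' (i + 2)" by (rule pair_eq(2))
    then show ?thesis using pa f by blast
  qed
  then obtain w where pa: "!!i. pent (a' (i + 1)) (y (i + 1)) (y (i + 2)) (a' (i + 2)) (w i) (a' i)" by metis
  have wsucc: "w (i + 1) = w i" for i
  proof -
    have "N (a' (i + 1)) \<inter> N (a' (i + 2)) = {y (i + 2), w i}" by (rule pentD(5)[OF pa[of i]])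
    moreover have "N (a' (i + 2)) \<inter> N (a' (i + 1)) = {w (i + 1), y (i + 2)}"
      using pentD(7)[OF pa[of "i + 1"]] by (simp add: add.assoc numeral_2_eq_2 numeral_3_eq_3)
    ultimately have "{w (i + 1), y (i + 2)} = {y (i + 2), w i}" by (simp only: Int_commute[of "N (a' (i + 1))"])
    moreover have "y (i + 2) ~= w (i + 1)" using pentD(2)[OF pa[of "i + 1"]] by (auto simp: numeral_2_eq_2)
    ultimately show ?thesis by (rule pair_eq(2))
  qed
  have w0: "w i = w 0" for i by (induction i) (use wsucc in auto)
  have Na: "N (a' (i + 1)) = {y (i + 1), y (i + 2), a' (i + 2), w 0, a' i}"
    and da: "distinct [y (i + 1), y (i + 2), a' (i + 2), w 0, a' i]" for i
    using pentD(1,2)[OF pa[of i]] w0[of i] by simp_all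
  have Ny: "N (y (i + 1)) = {x, y (i + 2), a' (i + 1), a' i, y i}"
    and dy: "distinct [x, y (i + 2), a' (i + 1), a' i, y i]" for i
    using pentD(1,2)[OF py[of i]] by simp_all
  \<comment> \<open>If they were equal, \<open>y (i + 2)\<close> would be a third common neighbour
    of \<open>y (i + 1)\<close> and \<open>a' i\<close>.\<close>
  have a2: "a' i ~= a' (i + 2)" for i
  proof
    assume e: "a' i = a' (i + 2)"
    have "N (y (i + 1)) \<inter> N (a' i) = {a' (i + 1), y i}" by (rule pentD(6)[OF py[of i]])
    moreover have "y (i + 2) \<in> N (y (i + 1))" unfolding Ny by simp
    moreover have "y (i + 2) \<in> N (a' i)"
    proof -
      have "a' (i + 2) \<in> N (y (i + 2))" using Ny[of "i + 1"] by (simp add: numeral_2_eq_2)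
      then show ?thesis unfolding e using adj_sym[of "y (i + 2)"] by simp
    qed
    ultimately have "y (i + 2) \<in> {a' (i + 1), y i}" by blast
    then show False using dy[of i] by auto
  qed
  have ax: "a' (i + 1) ~= y j" "a' (i + 1) ~= x" for i j
  proof -
    have "\<not> adj x (a' (i + 1))"
    proof
      assume "adj x (a' (i + 1))"
      then have "a' (i + 1) \<in> N x \<inter> N (y (i + 1))" using Ny[of i] by simp
      then have "a' (i + 1) \<in> {y (i + 2), y (i + 5)}" unfolding Nxy by (simp add: numeral_2_eq_2 add.commute[of i])
      then show False using dy[of i] y5[of i] by auto
    qed
    then show "a' (i + 1) ~= y j" using xy(1)[of j] by auto
    show "a' (i + 1) ~= x" using dy[of i] by auto
  qed
  have wx: "w 0 ~= x"
  proof
    assume "w 0 = x"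
    then have "x \<in> N (a' 1)" using Na[of 0] by simp
    moreover have "\<not> adj x (a' 1)"
    proof
      assume "adj x (a' 1)"
      then have "a' 1 \<in> N x \<inter> N (y 1)" using Ny[of 0] by simp
      then have "a' 1 \<in> {y 2, y 5}" unfolding Nxy by (simp add: numeral_2_eq_2)
      then show False using ax(1)[of 0] by auto
    qed
    ultimately show False using adj_sym[of x] by simp
  qed
  let ?ys = "[y 0, y 1, y 2, y 3, y 4]" and ?as = "[a' 0, a' 1, a' 2, a' 3, a' 4]"
  have p5: "y 5 = y 0" "y 6 = y 1" "a' 5 = a' 0" "a' 6 = a' 1" using y5[of 0] y5[of 1] a5[of 0] a5[of 1] by simp_all
  have NY: "N (y 1) = {x, y 2, a' 1, a' 0, y 0}" "N (y 2) = {x, y 3, a' 2, a' 1, y 1}"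
    "N (y 3) = {x, y 4, a' 3, a' 2, y 2}" "N (y 4) = {x, y 0, a' 4, a' 3, y 3}" "N (y 0) = {x, y 1, a' 0, a' 4, y 4}"
    using Ny[of 0] Ny[of 1] Ny[of 2] Ny[of 3] Ny[of 4] p5 by (simp_all add: eval_nat_numeral)
  have NA: "N (a' 1) = {y 1, y 2, a' 2, w 0, a' 0}" "N (a' 2) = {y 2, y 3, a' 3, w 0, a' 1}"
    "N (a' 3) = {y 3, y 4, a' 4, w 0, a' 2}" "N (a' 4) = {y 4, y 0, a' 0, w 0, a' 3}" "N (a' 0) = {y 0, y 1, a' 1, w 0, a' 4}"
    using Na[of 0] Na[of 1] Na[of 2] Na[of 3] Na[of 4] p5 by (simp_all add: eval_nat_numeral)
  have aa: "a' 0 ~= a' 2" "a' 1 ~= a' 3" "a' 2 ~= a' 4" "a' 3 ~= a' 0" "a' 4 ~= a' 1"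
    using a2[of 0] a2[of 1] a2[of 2] a2[of 3] a2[of 4] p5 by (simp_all add: eval_nat_numeral)
  have aa': "a' 0 ~= a' 1" "a' 1 ~= a' 2" "a' 2 ~= a' 3" "a' 3 ~= a' 4" "a' 4 ~= a' 0"
    using dy[of 0] dy[of 1] dy[of 2] dy[of 3] dy[of 4] p5 by (auto simp: eval_nat_numeral)
  have ay: "a' 0 ~= y j" "a' 1 ~= y j" "a' 2 ~= y j" "a' 3 ~= y j" "a' 4 ~= y j" for j
    using ax(1)[of 0 j] ax(1)[of 1 j] ax(1)[of 2 j] ax(1)[of 3 j] ax(1)[of 4 j] p5 by (simp_all add: eval_nat_numeral)
  have axx: "a' 0 ~= x" "a' 1 ~= x" "a' 2 ~= x" "a' 3 ~= x" "a' 4 ~= x"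
    using ax(2)[of 0] ax(2)[of 1] ax(2)[of 2] ax(2)[of 3] ax(2)[of 4] p5 by (simp_all add: eval_nat_numeral)
  have yx: "y j ~= x" for j using adj_neq[OF xy(1)[of j]] by simp
  have wy: "w 0 ~= y 0" "w 0 ~= y 1" "w 0 ~= y 2" "w 0 ~= y 3" "w 0 ~= y 4"
    using da[of 0] da[of 1] da[of 2] da[of 3] da[of 4] p5 by (auto simp: eval_nat_numeral)
  have wa: "w 0 ~= a' 0" "w 0 ~= a' 1" "w 0 ~= a' 2" "w 0 ~= a' 3" "w 0 ~= a' 4"
    using da[of 0] da[of 1] da[of 2] da[of 3] da[of 4] p5 by (auto simp: eval_nat_numeral)
  have yv: "y 0 = p" "y 1 = q" "y 2 = r" "y 3 = s" "y 4 = t" unfolding y_def by simp_all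
  have yd: "distinct ?ys" and Nx: "N x = set ?ys" unfolding yv using pentD(1,2)[OF P] by simp_all
  have ad: "distinct ?as" using aa aa' by auto
  have "set ?as \<subseteq> N (w 0)"
  proof
    fix v assume "v \<in> set ?as"
    then have "w 0 \<in> N v" using NA by auto
    then show "v \<in> N (w 0)" using adj_sym[of v] by simp
  qed
  moreover have "card (set ?as) = 5" using distinct_card[OF ad] by simp
  ultimately have Nw: "N (w 0) = set ?as" using k[of "w 0"] by (intro card_subset_eq[symmetric]) simp_all
  let ?vs = "x # ?ys @ ?as @ [w 0]"
  have "N (?vs ! p) = (!) ?vs ` set (icosa_tab ! p)" if "p < 12" for p
  proof -
    have "p = 0 \<or> p = 1 \<or> p = 2 \<or> p = 3 \<or> p = 4 \<or> p = 5 \<or> p = 6 \<or> p = 7 \<or> p = 8 \<or> p = 9 \<or> p = 10 \<or> p = 11"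
      using that by arith
    then show ?thesis
      by (elim disjE) (simp_all add: icosa_tab_def Nx Nw NY[unfolded One_nat_def] NA[unfolded One_nat_def] insert_commute)
  qed
  moreover have "distinct ?vs" using yd ad yx yx[symmetric] axx axx[symmetric] wx wx[symmetric] wy wy[symmetric]
      wa wa[symmetric] ay ay[symmetric] by auto
  ultimately show ?thesis by (intro exI[of _ ?vs]) (simp add: icosa_tab_def)
qed

text \<open>Equal neighbourhoods of vertices with distinct images force \<open>\<theta> = 0\<close>.
  Then \<open>u a0\<close> and \<open>u b0\<close> are both orthogonal to \<open>u p\<close> and
  \<open>u q\<close>, hence parallel unit vectors, whereas their inner product is -1/2.\<close>

lemma no_K33:
  assumes k: "!!x. card (N x) = 3" and a: "!!x y. adj x y ==> N x \<inter> N y = {}"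
    and c2: "!!x y. dist2 x y ==> card (N x \<inter> N y) = 3"
  shows False
proof -
  have eqN: "N x = N z" if "dist2 x z" for x z
  proof -
    have "N x \<inter> N z = N x" "N x \<inter> N z = N z" by (intro card_subset_eq; use c2[OF that] k in simp)+
    then show ?thesis by simp
  qed
  have "\<theta> *\<^sub>R u a0 = \<theta> *\<^sub>R u b0" using eqN[OF ab0] u_eig by metis
  then have th: "\<theta> = 0" using u_dist2_neq[OF ab0] by simp
  then have w1: "w1 = 0" using theta_w1[of a0] k[of a0] by simp
  obtain p q r where N: "N a0 = {p, q, r}" "p ~= q" "p ~= r" "q ~= r" using k[of a0] by (auto simp: card_3_iff)
  have pqr: "p \<in> N a0" "q \<in> N a0" "r \<in> N a0" unfolding N by simp_all
  have nadj: "\<not> adj v w" if "v \<in> N a0" "w \<in> N a0" for v w using a[of a0 v] that by (metis N_iff common_mem empty_iff)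
  have d: "dist2 p q" "dist2 p r" using siblings[of a0] pqr N(2-4) nadj by (metis N_iff)+
  have "u p \<bullet> (\<Sum>z\<in>N a0. u z) = 0" unfolding u_eig th by simp
  then have w2: "w2 = -1/2" unfolding N(1) using N(2-4) inner_dist2[OF d(1)] inner_dist2[OF d(2)] by (simp add: inner_add_right)
  have "adj b0 p" "adj b0 q" using pqr eqN[OF ab0] by simp_all
  then have z: "u a0 \<bullet> u p = 0" "u a0 \<bullet> u q = 0" "u b0 \<bullet> u p = 0" "u b0 \<bullet> u q = 0" using inner_adj w1 pqr by auto
  have "(u p \<times> u q) \<bullet> (u p \<times> u q) = 3/4" using inner_dist2[OF d(1)] w2 by (simp add: cross_sq power2_eq_square)
  then have nz: "u p \<times> u q ~= 0" by auto
  obtain m where m: "u a0 = m *\<^sub>R (u p \<times> u q)" using perp_cross[OF z(1,2) nz] .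
  obtain m' where m': "u b0 = m' *\<^sub>R (u p \<times> u q)" using perp_cross[OF z(3,4) nz] .
  have n: "(u p \<times> u q) \<bullet> (u p \<times> u q) = 3/4" by fact
  have "m * m * (3/4) = 1" using uu[of a0] unfolding m inner_scaleR_left inner_scaleR_right n by simp
  moreover have "m' * m' * (3/4) = 1" using uu[of b0] unfolding m' inner_scaleR_left inner_scaleR_right n by simp
  moreover have "m * m' * (3/4) = -1/2" using inner_dist2[OF ab0]
    unfolding m m' inner_scaleR_left inner_scaleR_right n w2 by (simp add: mult_ac)
  ultimately have "m * m * (3/4) = 1" "m' * m' * (3/4) = 1" "m * m' * (3/4) = -1/2" by blast+
  then have "(m * m * (3/4)) * (m' * m' * (3/4)) = 1" "(m * m' * (3/4)) * (m * m' * (3/4)) = 1/4" by algebra+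
  moreover have "(m * m * (3/4)) * (m' * m' * (3/4)) = (m * m' * (3/4)) * (m * m' * (3/4))" by simp
  ultimately show False by simp
qed

text \<open>Two neighbours of a vertex have exactly one further common neighbour. The three vertices
  obtained in this way from the neighbours of \<open>x\<close> are joined to one last
  vertex.\<close>

lemma cube_list:
  assumes k: "!!x. card (N x) = 3" and a: "!!x y. adj x y ==> N x \<inter> N y = {}"
    and c2: "!!x y. dist2 x y ==> card (N x \<inter> N y) = 2"
  shows "\<exists>vs. length vs = length cube_tab \<and> vs ! 0 = x \<and> distinct vs \<and>
      (\<forall>p<length cube_tab. N (vs ! p) = (!) vs ` set (cube_tab ! p))"
proof -
  have nt: False if "adj v w" "adj w z" "adj v z" for v w z
    using a[OF that(1)] that by (metis common_mem empty_iff)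
  have sib: "dist2 v w" if "adj z v" "adj z w" "v ~= w" for v w z
    using siblings[OF that] nt[of z v w] that by blast
  have N3: "N z = {p, q, r}" if "adj z p" "adj z q" "adj z r" "distinct [p, q, r]" for z p q r
    using that k[of z] by (intro card_subset_eq[symmetric]) auto
  have fourth: "\<exists>z. N p \<inter> N q = {x, z} \<and> z ~= x \<and> adj p z \<and> adj q z \<and> adj z p \<and> adj z q \<and> dist2 x z \<and> N x \<inter> N z = {p, q}"
    if pq: "adj x p" "adj x q" "p ~= q" for x p q
  proof -
    note that = pq
    have "x \<in> N p \<inter> N q" using that adj_sym[of x] by simp
    then obtain z where z: "z ~= x" "N p \<inter> N q = {x, z}" using card_2_other[OF c2[OF sib[OF pq]]] by blast
    have "z \<in> N p \<inter> N q" unfolding z by simp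
    then have pz: "adj p z" "adj q z" by simp_all
    then have zp: "adj z p" "adj z q" using adj_sym by blast+
    have "\<not> adj x z" using nt[of x p z] that pz by blast
    then have "dist2 x z" unfolding dist2_def using z(1) that(1) pz(1) by blast
    moreover have "N x \<inter> N z = {p, q}" by (rule card_2_eqI[OF c2[OF \<open>dist2 x z\<close>]]) (use that zp in simp_all)
    ultimately show ?thesis using z pz zp by blast
  qed
  obtain p q r where "N x = {p, q, r}" and d: "p ~= q" "p ~= r" "q ~= r" using k[of x] by (auto simp: card_3_iff)
  note Nx = \<open>N x = {p, q, r}\<close>
  have "p \<in> N x" "q \<in> N x" "r \<in> N x" unfolding Nx by simp_all
  then have xa: "adj x p" "adj x q" "adj x r" by simp_all
  then have ax: "adj p x" "adj q x" "adj r x" using adj_sym by blast+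
  obtain z1 where z1: "N p \<inter> N q = {x, z1}" "z1 ~= x" "adj p z1" "adj q z1" "adj z1 p" "adj z1 q" "dist2 x z1" "N x \<inter> N z1 = {p, q}"
    using fourth[OF xa(1,2) d(1)] by blast
  obtain z2 where z2: "N p \<inter> N r = {x, z2}" "z2 ~= x" "adj p z2" "adj r z2" "adj z2 p" "adj z2 r" "dist2 x z2" "N x \<inter> N z2 = {p, r}"
    using fourth[OF xa(1,3) d(2)] by blast
  obtain z3 where z3: "N q \<inter> N r = {x, z3}" "z3 ~= x" "adj q z3" "adj r z3" "adj z3 q" "adj z3 r" "dist2 x z3" "N x \<inter> N z3 = {q, r}"
    using fourth[OF xa(2,3) d(3)] by blast
  have "r \<notin> N x \<inter> N z1" "q \<notin> N x \<inter> N z2" "p \<notin> N x \<inter> N z3" unfolding z1 z2 z3 using d by auto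
  then have nr: "\<not> adj z1 r" "\<not> adj z2 q" "\<not> adj z3 p" using xa by auto
  have dz: "z1 ~= z2" "z1 ~= z3" "z2 ~= z3" using nr z1(5,6) z2(5,6) z3(5,6) by metis+
  have Np: "N p = {x, z1, z2}" by (rule N3) (use ax z1 z2 dz in auto)
  have Nq: "N q = {x, z1, z3}" by (rule N3) (use ax z1 z3 dz in auto)
  have Nr: "N r = {x, z2, z3}" by (rule N3) (use ax z2 z3 dz in auto)
  obtain w where w: "N z1 \<inter> N z2 = {p, w}" "w ~= p" "adj z1 w" "adj z2 w" "adj w z1" "adj w z2"
    using fourth[OF z1(3) z2(3) dz(1)] by blast
  obtain w' where w': "N z1 \<inter> N z3 = {q, w'}" "w' ~= q" "adj z1 w'" "adj z3 w'" "adj w' z1" "adj w' z3"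
    using fourth[OF z1(4) z3(3) dz(2)] by blast
  have wq: "w ~= q" "w' ~= p" using nr w w' by auto
  have Nz1: "N z1 = {p, q, w}" by (rule N3) (use z1 w wq d in auto)
  have "w' \<in> N z1" using w' by simp
  then have ww: "w' = w" unfolding Nz1 using w'(2) wq by simp
  have wr: "w ~= r" using nr w by auto
  have Nz2: "N z2 = {p, r, w}" by (rule N3) (use z2 w wr d in auto)
  have Nz3: "N z3 = {q, r, w}" by (rule N3) (use z3 w' ww wr wq d in auto)
  have Nw: "N w = {z1, z2, z3}" by (rule N3) (use w w' ww dz in auto)
  have nx: "\<not> adj x z1" "\<not> adj x z2" "\<not> adj x z3" using z1(7) z2(7) z3(7) unfolding dist2_def by auto
  have "w ~= x" using nx w adj_sym by metis
  moreover have "w ~= z1" "w ~= z2" "w ~= z3" using w w' ww adj_neq by metis+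
  moreover have "z1 \<notin> {p, q, r}" "z2 \<notin> {p, q, r}" "z3 \<notin> {p, q, r}" using nx xa by auto
  moreover have "p ~= x" "q ~= x" "r ~= x" using adj_neq[OF ax(1)] adj_neq[OF ax(2)] adj_neq[OF ax(3)] by simp_all
  ultimately have "distinct [x, p, q, r, z1, z2, z3, w]" using d dz z1(2) z2(2) z3(2) w(2) wq wr by auto
  moreover have "N ([x, p, q, r, z1, z2, z3, w] ! i) = (!) [x, p, q, r, z1, z2, z3, w] ` set (cube_tab ! i)" if "i < 8" for i
  proof -
    have "i = 0 \<or> i = 1 \<or> i = 2 \<or> i = 3 \<or> i = 4 \<or> i = 5 \<or> i = 6 \<or> i = 7" using that by arith
    then show ?thesis by (elim disjE) (simp_all add: cube_tab_def Nx Np Nq Nr Nz1 Nz2 Nz3 Nw)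
  qed
  ultimately show ?thesis by (intro exI[of _ "[x, p, q, r, z1, z2, z3, w]"]) (simp add: cube_tab_def)
qed

end

section \<open>Cubic graphs: left and right turns\<close>

lemma card_pair_sigma:
  assumes "!!a b. P a b ==> a = f b"
  shows "card {(a, b). P a b} = card {b. P (f b) b}"
proof -
  have "inj_on snd {(a, b). P a b}"
  proof (rule inj_onI)
    fix v w assume v: "v \<in> {(a, b). P a b}" and w: "w \<in> {(a, b). P a b}" and e: "snd v = snd w"
    have "fst v = f (snd v)" using v by (intro assms) (simp add: case_prod_beta)
    moreover have "fst w = f (snd w)" using w by (intro assms) (simp add: case_prod_beta)
    ultimately show "v = w" using e by (simp add: prod_eq_iff)
  qed
  moreover have "snd ` {(a, b). P a b} = {b. P (f b) b}"
  proof (rule set_eqI)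
    fix b
    have "b \<in> snd ` {(a, b). P a b} \<longleftrightarrow> (\<exists>a. P a b)" by force
    also have "\<dots> \<longleftrightarrow> P (f b) b" using assms[of _ b] by metis
    finally show "b \<in> snd ` {(a, b). P a b} \<longleftrightarrow> b \<in> {b. P (f b) b}" by simp
  qed
  ultimately show ?thesis using card_image by metis
qed

locale pm_cubic = pm_inj c u \<theta> a0 b0 for c :: "'x::finite => 'x => nat" and u \<theta> a0 b0 +
  assumes k3: "card (N x) = 3" and tf: "adj x y ==> N x \<inter> N y = {}"
    and c2: "dist2 x y ==> card (N x \<inter> N y) = 1"
begin

definition path3 :: "'x => 'x => 'x => bool" where
  "path3 x y z \<longleftrightarrow> adj x y \<and> adj y z \<and> x ~= z"

lemma no_triangle: "adj x y ==> adj y z ==> \<not> adj x z"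
  using tf[of x y] by (metis Int_iff N_iff empty_iff)

lemma path3_dist2: "path3 x y z ==> dist2 x z"
  unfolding path3_def dist2_def using no_triangle by blast

lemma path3_sym: "path3 x y z \<longleftrightarrow> path3 z y x"
  unfolding path3_def using adj_sym by metis

lemma path3_middle: "path3 x y z ==> path3 x y' z ==> y = y'"
proof -
  assume p: "path3 x y z" "path3 x y' z"
  obtain w where w: "N x \<inter> N z = {w}" using c2[OF path3_dist2[OF p(1)]] by (meson card_1_singletonE)
  have "y \<in> N x \<inter> N z" "y' \<in> N x \<inter> N z" using p adj_sym unfolding path3_def by simp_all
  then show ?thesis unfolding w by simp
qed

lemma path3_not_adj: "path3 x y z ==> path3 y z w ==> \<not> adj x w"
proof
  assume p: "path3 x y z" "path3 y z w" and a: "adj x w"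
  have "path3 x w z" using p a adj_sym unfolding path3_def by blast
  then have "y = w" using path3_middle p(1) by blast
  then show False using p(2) unfolding path3_def by simp
qed

lemma path3_neq: "path3 x y z ==> path3 y z w ==> x ~= w"
  using no_triangle[of x y z] adj_sym[of z x] unfolding path3_def by auto

lemma two_extensions:
  assumes "adj x y"
  obtains z z' where "N y = {x, z, z'}" "z ~= z'" "path3 x y z" "path3 x y z'"
proof -
  have xy: "x \<in> N y" using assms adj_sym by simp
  have "card (N y - {x}) = 2" using k3[of y] xy by (simp add: card_Diff_singleton)
  then obtain z z' where z: "N y - {x} = {z, z'}" "z ~= z'" by (auto simp: card_2_iff)
  have "z \<in> N y - {x}" "z' \<in> N y - {x}" unfolding z by simp_all
  then have "path3 x y z" "path3 x y z'" unfolding path3_def using assms by auto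
  moreover have "N y = {x, z, z'}" using z(1) xy by blast
  ultimately show ?thesis using that z(2) by blast
qed

lemma w1_theta: "w1 = \<theta> / 3" using theta_w1[of a0] k3[of a0] by simp

lemma theta_sq: "\<theta>\<^sup>2 < 9" using w1_sq unfolding w1_theta by (simp add: power_divide)

lemma sum_ext:
  assumes "N y = {x, z, z'}" "z ~= z'" "path3 x y z" "path3 x y z'"
  shows "u x + u z + u z' = \<theta> *\<^sub>R u y"
  using u_eig[of y] assms unfolding path3_def by (simp add: add.assoc)

lemma w2_theta: "w2 = (\<theta>\<^sup>2 - 3) / 6"
proof -
  obtain y where "adj a0 y" using ex_adj by blast
  then obtain z z' where z: "N y = {a0, z, z'}" "z ~= z'" "path3 a0 y z" "path3 a0 y z'" by (rule two_extensions)
  have "u a0 \<bullet> (u a0 + u z + u z') = \<theta> * w1" unfolding sum_ext[OF z] using inner_adj[OF \<open>adj a0 y\<close>] by simp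
  then have "1 + w2 + w2 = \<theta> * w1"
    using inner_dist2[OF path3_dist2[OF z(3)]] inner_dist2[OF path3_dist2[OF z(4)]] by (simp add: inner_add_right)
  then show ?thesis unfolding w1_theta by (simp add: power2_eq_square field_simps)
qed

text \<open>Normal vector of the plane of a directed edge. The factor \<open>sqrt 3\<close> makes
  the passage to the next edge, in \<open>turn_vec\<close> and \<open>T_step\<close>, a formula over
  the half-integers and \<open>\<theta>\<close>.\<close>

definition T :: "'x => 'x => real^3" where "T x y = sqrt 3 *\<^sub>R (u x \<times> u y)"

text \<open>On paths the inner product is never zero, as the proof of \<open>turn_vec\<close> shows,
  so the default -1 means a turn to the other side.\<close>

definition eps :: "'x => 'x => 'x => real" where "eps x y z = (if u z \<bullet> T x y > 0 then 1 else -1)"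

lemma eps_cases: "eps x y z = 1 \<or> eps x y z = -1" unfolding eps_def by simp

lemma T_perp: "u x \<bullet> T x y = 0" "u y \<bullet> T x y = 0" "T x y \<bullet> u x = 0" "T x y \<bullet> u y = 0"
  unfolding T_def by (simp_all add: dot_cross_self)

lemma T_sq: "adj x y ==> T x y \<bullet> T x y = (9 - \<theta>\<^sup>2) / 3"
proof -
  assume xy: "adj x y"
  have "T x y \<bullet> T x y = (sqrt 3 * sqrt 3) * ((u x \<times> u y) \<bullet> (u x \<times> u y))" unfolding T_def by (simp only: inner_scaleR_left inner_scaleR_right mult.assoc)
  also have "\<dots> = 3 * (1 - (\<theta> / 3)\<^sup>2)" unfolding cross_sq uu inner_adj[OF xy] w1_theta by simp
  finally show ?thesis by (simp add: power_divide field_simps)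
qed

lemma T_swap: "T y x = - T x y"
  unfolding T_def by (metis cross_skew scaleR_minus_right)

text \<open>The two forward neighbours of a directed edge form, together with its tail,
  an equilateral triangle centred on the axis through its head; \<open>eps\<close> tells left from right.\<close>

lemma turn_vec:
  assumes p: "path3 x y z"
  shows "u z = (1/2) *\<^sub>R (\<theta> *\<^sub>R u y - u x + eps x y z *\<^sub>R T x y)"
    and "\<exists>z'. z' ~= z \<and> path3 x y z' \<and> eps x y z' = - eps x y z \<and> (\<forall>v. path3 x y v --> v = z \<or> v = z')"
proof -
  have xy: "adj x y" using p unfolding path3_def by blast
  obtain r r' where r: "N y = {x, r, r'}" "r ~= r'" "path3 x y r" "path3 x y r'" by (rule two_extensions[OF xy])
  have "z \<in> N y" "z ~= x" using p unfolding path3_def by auto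
  then have "\<exists>z'. N y = {x, z, z'} \<and> z ~= z' \<and> path3 x y z'" using r unfolding r(1) by auto
  then obtain z' where z': "N y = {x, z, z'}" "z ~= z'" "path3 x y z'" by blast
  have sum: "u x + u z + u z' = \<theta> *\<^sub>R u y" by (rule sum_ext[OF z'(1,2) p z'(3)])
  have yz: "adj y z" "adj y z'" using p z'(3) unfolding path3_def by blast+
  have d: "dist2 x z" "dist2 x z'" "dist2 z z'"
    using path3_dist2[OF p] path3_dist2[OF z'(3)] path3_dist2[of z y z'] yz z'(2) adj_sym unfolding path3_def by blast+
  have ip: "u z \<bullet> u x = w2" "u z' \<bullet> u x = w2" "u z \<bullet> u y = w1" "u z' \<bullet> u y = w1" "u z \<bullet> u z' = w2"
    using inner_dist2[OF d(1)] inner_dist2[OF d(2)] inner_dist2[OF d(3)] inner_adj[OF yz(1)] inner_adj[OF yz(2)]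
    by (simp_all add: inner_commute)
  have "(u z - u z') \<bullet> u x = 0" "(u z - u z') \<bullet> u y = 0" using ip by (simp_all add: inner_diff_left)
  then obtain m where m: "u z - u z' = m *\<^sub>R (u x \<times> u y)" by (rule perp_cross[OF _ _ cross_nz[OF xy]])
  have n: "(u x \<times> u y) \<bullet> (u x \<times> u y) = (9 - \<theta>\<^sup>2) / 9" unfolding cross_sq uu inner_adj[OF xy] w1_theta by (simp add: power_divide field_simps)
  have "(u z - u z') \<bullet> (u z - u z') = 2 - 2 * w2"
    using ip by (simp add: inner_diff_left inner_diff_right inner_commute)
  then have "m * m * ((9 - \<theta>\<^sup>2) / 9) = (9 - \<theta>\<^sup>2) / 3"
    unfolding m inner_scaleR_left inner_scaleR_right n w2_theta by (simp add: field_simps)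
  then have "(9 - \<theta>\<^sup>2) * (m * m - 3) = 0" by (simp add: field_simps)
  then have "m\<^sup>2 = (sqrt 3)\<^sup>2" using theta_sq by (simp add: power2_eq_square)
  then have ms: "m = sqrt 3 \<or> m = - sqrt 3" by (simp only: power2_eq_iff)
  \<comment> \<open>The length of \<open>u z - u z'\<close> fixes \<open>m\<close> up to its sign,
    and that sign is the turn.\<close>
  define e where "e = m / sqrt 3"
  have e: "e = 1 \<or> e = -1" using ms unfolding e_def by auto
  have mT: "m *\<^sub>R (u x \<times> u y) = e *\<^sub>R T x y" unfolding T_def e_def by simp
  have "2 *\<^sub>R u z = (u x + u z + u z') - u x + (u z - u z')" by (simp add: scaleR_2)
  then have z2: "2 *\<^sub>R u z = \<theta> *\<^sub>R u y - u x + e *\<^sub>R T x y" unfolding sum m mT .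
  have z1: "u z = (1/2) *\<^sub>R (\<theta> *\<^sub>R u y - u x + e *\<^sub>R T x y)" unfolding z2[symmetric] by simp
  have "2 *\<^sub>R u z' = (u x + u z + u z') - u x - (u z - u z')" by (simp add: scaleR_2)
  then have z2': "2 *\<^sub>R u z' = \<theta> *\<^sub>R u y - u x - e *\<^sub>R T x y" unfolding sum m mT .
  have z1': "u z' = (1/2) *\<^sub>R (\<theta> *\<^sub>R u y - u x - e *\<^sub>R T x y)" unfolding z2'[symmetric] by simp
  have pos: "(9 - \<theta>\<^sup>2) / 3 > 0" using theta_sq by simp
  have "u z \<bullet> T x y = (1/2) * (e * ((9 - \<theta>\<^sup>2) / 3))"
    unfolding z1 by (simp add: inner_add_left inner_diff_left T_perp T_sq[OF xy])
  then have ez: "eps x y z = e" unfolding eps_def using e pos by auto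
  have "u z' \<bullet> T x y = - (1/2) * (e * ((9 - \<theta>\<^sup>2) / 3))"
    unfolding z1' by (simp add: inner_add_left inner_diff_left T_perp T_sq[OF xy])
  then have ez': "eps x y z' = - e" unfolding eps_def using e pos by auto
  show "u z = (1/2) *\<^sub>R (\<theta> *\<^sub>R u y - u x + eps x y z *\<^sub>R T x y)" unfolding ez by (rule z1)
  have "v = z \<or> v = z'" if "path3 x y v" for v
  proof -
    have "v \<in> N y" "v ~= x" using that unfolding path3_def by auto
    then show ?thesis unfolding z'(1) by simp
  qed
  then show "\<exists>z'. z' ~= z \<and> path3 x y z' \<and> eps x y z' = - eps x y z \<and> (\<forall>v. path3 x y v --> v = z \<or> v = z')"
    using z'(2,3) ez ez' by (intro exI[of _ z']) auto
qed

lemma ex_turn: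
  assumes "adj x y" "e = 1 \<or> e = -1"
  shows "\<exists>z. path3 x y z \<and> eps x y z = e"
proof -
  obtain z z' where z: "N y = {x, z, z'}" "z ~= z'" "path3 x y z" "path3 x y z'" by (rule two_extensions[OF assms(1)])
  then show ?thesis using turn_vec(2)[OF z(3)] eps_cases[of x y z] assms(2) by (metis minus_minus)
qed

lemma turn_unique: "path3 x y z ==> path3 x y z' ==> eps x y z = eps x y z' ==> z = z'"
  using turn_vec(2)[of x y z] eps_cases[of x y z] by fastforce

text \<open>Together with \<open>turn_vec\<close>, the triple of tail, head and normal evolves
  linearly along a path, governed by the turns alone; all later coordinates are computed in this
  way.\<close>

lemma T_step:
  assumes p: "path3 x y z"
  shows "T y z = (1/2) *\<^sub>R (T x y + eps x y z *\<^sub>R (3 *\<^sub>R u x - \<theta> *\<^sub>R u y))"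
proof -
  have xy: "adj x y" using p unfolding path3_def by blast
  have "u y \<times> (u x \<times> u y) = (u y \<bullet> u y) *\<^sub>R u x - (u y \<bullet> u x) *\<^sub>R u y" by (rule Lagrange)
  then have L: "u y \<times> (u x \<times> u y) = u x - (\<theta> / 3) *\<^sub>R u y" using inner_adj[OF xy] w1_theta by (simp add: inner_commute)
  have "u y \<times> u z = (1/2) *\<^sub>R (u x \<times> u y + (eps x y z * sqrt 3) *\<^sub>R (u x - (\<theta> / 3) *\<^sub>R u y))"
    unfolding turn_vec(1)[OF p] T_def L[symmetric]
    by (simp add: cross_add_right cross_mult_right right_diff_distrib scaleR_right_distrib cross_skew[of "u y" "u x"]
       Cross3.right_diff_distrib)
  moreover have s3: "sqrt 3 * (a * sqrt 3) = 3 * a" "sqrt 3 * (a * (b * sqrt 3)) = 3 * (a * b)"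
    "sqrt 3 * (a * (sqrt 3 * b)) = 3 * (a * b)" for a b
  proof -
    have "sqrt 3 * (a * sqrt 3) = (sqrt 3 * sqrt 3) * a" "sqrt 3 * (a * (b * sqrt 3)) = (sqrt 3 * sqrt 3) * (a * b)"
      "sqrt 3 * (a * (sqrt 3 * b)) = (sqrt 3 * sqrt 3) * (a * b)" by (simp_all only: mult_ac)
    then show "sqrt 3 * (a * sqrt 3) = 3 * a" "sqrt 3 * (a * (b * sqrt 3)) = 3 * (a * b)"
      "sqrt 3 * (a * (sqrt 3 * b)) = 3 * (a * b)" by simp_all
  qed
  ultimately have "T y z = sqrt 3 *\<^sub>R ((1/2) *\<^sub>R (u x \<times> u y + (eps x y z * sqrt 3) *\<^sub>R (u x - (\<theta> / 3) *\<^sub>R u y)))"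
    unfolding T_def by simp
  also have "\<dots> = (1/2) *\<^sub>R (sqrt 3 *\<^sub>R (u x \<times> u y) + (sqrt 3 * (eps x y z * sqrt 3)) *\<^sub>R (u x - (\<theta> / 3) *\<^sub>R u y))"
    by (simp add: scaleR_right_distrib mult.commute)
  also have "\<dots> = (1/2) *\<^sub>R (T x y + eps x y z *\<^sub>R (3 *\<^sub>R u x - \<theta> *\<^sub>R u y))"
    unfolding s3(1) T_def by (simp add: scaleR_right_diff_distrib mult.commute)
  finally show ?thesis .
qed

text \<open>The inner product of the ends of a path of length three whose two turns agree, from
  \<open>inner_path4\<close>.\<close>

definition "kC = (\<theta> * w2 - w1 + (9 - \<theta>\<^sup>2) / 6) / 2"

lemma inner_path4:
  assumes "path3 x y z" "path3 y z w"
  shows "u x \<bullet> u w = (\<theta> * w2 - w1 + eps x y z * eps y z w * ((9 - \<theta>\<^sup>2) / 6)) / 2"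
proof -
  have xy: "adj x y" using assms unfolding path3_def by blast
  have "u x \<bullet> T y z = eps x y z * ((9 - \<theta>\<^sup>2) / 6)"
    unfolding T_step[OF assms(1)] using inner_adj[OF xy] w1_theta
    by (simp add: inner_add_right inner_diff_right T_perp power2_eq_square field_simps)
  moreover have "u x \<bullet> u z = w2" "u x \<bullet> u y = w1" using inner_dist2[OF path3_dist2[OF assms(1)]] inner_adj[OF xy] by simp_all
  ultimately show ?thesis unfolding turn_vec(1)[OF assms(2)]
    by (simp add: inner_add_right inner_diff_right)
qed

text \<open>As for conformations of a chain: both turns to the same side. The inner product makes it
  a class function; on paths, \<open>cis_iff\<close> gives its meaning.\<close>

definition cis :: "'x => 'x => bool" where "cis x w \<longleftrightarrow> u x \<bullet> u w = kC"

lemma cis_iff: "path3 x y z ==> path3 y z w ==> cis x w \<longleftrightarrow> eps x y z = eps y z w"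
  unfolding cis_def kC_def using inner_path4[of x y z w] theta_sq eps_cases[of x y z] eps_cases[of y z w] by auto

lemma cis_inv: "class_inv c cis"
  unfolding cis_def by (rule class_inv_comp[OF u_inv])

lemma cis_sym: "cis x y \<longleftrightarrow> cis y x" unfolding cis_def by (simp add: inner_commute)

lemma ex1_cis:
  assumes "path3 x y z"
  shows "\<exists>w. path3 y z w \<and> cis x w \<and> (\<forall>v. path3 y z v --> cis x v --> v = w)"
proof -
  have "adj y z" using assms unfolding path3_def by blast
  then obtain w where w: "path3 y z w" "eps y z w = eps x y z" using ex_turn[OF _ eps_cases] by blast
  moreover have "cis x w" using cis_iff[OF assms w(1)] w(2) by simp
  moreover have "v = w" if "path3 y z v" "cis x v" for v
    using turn_unique[OF that(1) w(1)] cis_iff[OF assms that(1)] that(2) w(2) by metis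
  ultimately show ?thesis by blast
qed

lemma dist2_inv: "class_inv c dist2"
proof -
  have I: "class_inv c (\<lambda>x y. card {z. adj x z \<and> adj z y} > 0)"
    by (rule class_inv_comp[OF class_inv_card[OF adj_inv adj_inv]])
  have "card {z. adj x z \<and> adj z y} > 0 \<longleftrightarrow> (\<exists>z. adj x z \<and> adj z y)" for x y by (subst card_gt_0_iff) auto
  then have e: "dist2 = (\<lambda>x y. x ~= y \<and> \<not> adj x y \<and> card {z. adj x z \<and> adj z y} > 0)"
    unfolding dist2_def by (intro ext) simp
  show ?thesis unfolding e
    by (intro class_inv_comp2[OF class_inv_comp[OF class_inv_eq, of Not], of _ "(\<and>)"]
        class_inv_comp2[OF class_inv_comp[OF adj_inv, of Not] I, of "(\<and>)"])
qed

text \<open>The number of cis paths of length three, written in class functions only;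
  \<open>NC_eq\<close> identifies it.\<close>

definition NC :: "'x => 'x => nat" where
  "NC x w = (if cis x w \<and> \<not> adj x w then card {z. dist2 x z \<and> adj z w} else 0)"

lemma NC_inv: "class_inv c NC"
proof -
  have "class_inv c (\<lambda>x w. cis x w \<and> \<not> adj x w)"
    by (rule class_inv_comp2[OF cis_inv class_inv_comp[OF adj_inv, of Not], of "(\<and>)"])
  from class_inv_comp2[OF this class_inv_card[OF dist2_inv adj_inv], of "\<lambda>b n. if b then n else 0"]
  show ?thesis unfolding NC_def .
qed

text \<open>The second vertex of a path is determined by the third, and paths of length three do not
  join adjacent vertices, as there are no 4-cycles.\<close>

lemma NC_eq: "NC x w = (if cis x w then card {(y, z). path3 x y z \<and> path3 y z w} else 0)"
proof (cases "cis x w")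
  case True
  define mid where "mid z = (SOME y. path3 x y z)" for z
  have mid: "y = mid z" if "path3 x y z" for y z
    unfolding mid_def using someI[of "\<lambda>y. path3 x y z", OF that] path3_middle[OF that] by blast
  have ex: "path3 x (mid z) z" if "dist2 x z" for z
    unfolding mid_def using that someI_ex[of "\<lambda>y. path3 x y z"] unfolding dist2_def path3_def by blast
  have "card {(y, z). path3 x y z \<and> path3 y z w} = card {z. path3 x (mid z) z \<and> path3 (mid z) z w}"
    by (rule card_pair_sigma) (use mid in blast)
  moreover have "{z. path3 x (mid z) z \<and> path3 (mid z) z w} = (if adj x w then {} else {z. dist2 x z \<and> adj z w})"
  proof -
    have "path3 x (mid z) z \<and> path3 (mid z) z w \<longleftrightarrow> \<not> adj x w \<and> dist2 x z \<and> adj z w" for z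
      using ex[of z] path3_dist2[of x "mid z" z] path3_not_adj[of x "mid z" z w] unfolding path3_def by metis
    then show ?thesis by auto
  qed
  ultimately show ?thesis unfolding NC_def using True by simp
qed (simp add: NC_def)

text \<open>Paths \<open>x, p, q, r, v\<close> of length four, sorted by whether their first three
  and their last three edges are cis.\<close>

definition walks :: "bool => bool => 'x => 'x => ('x \<times> 'x \<times> 'x) set" where
  "walks s t x v = {(p, q, r). path3 x p q \<and> path3 p q r \<and> path3 q r v \<and> (cis x r \<longleftrightarrow> s) \<and> (cis p v \<longleftrightarrow> t)}"

lemma card_image3: "card {(p, q, r). P p q r} = (\<Sum>r\<in>UNIV. card {(p, q). P p q r})" for P :: "'x => 'x => 'x => bool"
proof -
  have "{(p, q, r). P p q r} = (\<lambda>(r, p, q). (p, q, r)) ` (SIGMA r:UNIV. {(p, q). P p q r})" by force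
  moreover have "inj_on (\<lambda>(r, p, q). (p, q, r)) (SIGMA r:UNIV. {(p, q). P p q r})" by (auto simp: inj_on_def)
  ultimately show ?thesis by (simp add: card_image)
qed

text \<open>The number of cis paths of length three commutes with the adjacency matrix; after
  cancelling the walks counted on both sides, this exchanges the two mixed kinds of paths of length four.\<close>

lemma card_switch: "card (walks True False x v) = card (walks False True x v)"
proof -
  let ?a = "\<lambda>x y. if adj x y then 1 else (0::nat)"
  have ainv: "class_inv c ?a" by (rule class_inv_comp[OF adj_inv])
  have comm: "(\<Sum>r\<in>UNIV. NC x r * ?a r v) = (\<Sum>p\<in>UNIV. ?a x p * NC p v)"
    by (rule class_inv_commute[OF NC_inv ainv])
  \<comment> \<open>\<open>L\<close> is a cis path followed by any edge, \<open>R\<close> an edge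
    followed by a cis path. Their backtracking parts \<open>L0\<close> and \<open>R0\<close> are
    equally large, since each path of length two from \<open>x\<close> to \<open>v\<close> has
    exactly one cis extension at either end.\<close>
  define L where "L = {(p, q, r). path3 x p q \<and> path3 p q r \<and> adj r v \<and> cis x r}"
  define R where "R = {(p, q, r). adj x p \<and> path3 p q r \<and> path3 q r v \<and> cis p v}"
  have "card L = (\<Sum>r\<in>UNIV. card {(p, q). path3 x p q \<and> path3 p q r \<and> adj r v \<and> cis x r})"
    unfolding L_def by (rule card_image3)
  also have "\<dots> = (\<Sum>r\<in>UNIV. NC x r * ?a r v)" by (rule sum.cong) (auto simp: NC_eq)
  finally have L: "card L = (\<Sum>r\<in>UNIV. NC x r * ?a r v)" .
  have "R = (\<lambda>(q, r, p). (p, q, r)) ` {(q, r, p). adj x p \<and> path3 p q r \<and> path3 q r v \<and> cis p v}"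
    unfolding R_def by force
  then have "card R = card {(q, r, p). adj x p \<and> path3 p q r \<and> path3 q r v \<and> cis p v}"
    by (simp add: card_image inj_on_def)
  also have "\<dots> = (\<Sum>p\<in>UNIV. card {(q, r). adj x p \<and> path3 p q r \<and> path3 q r v \<and> cis p v})" by (rule card_image3)
  also have "\<dots> = (\<Sum>p\<in>UNIV. ?a x p * NC p v)" by (rule sum.cong) (auto simp: NC_eq)
  finally have LR: "card L = card R" using L comm by simp
  define L0 where "L0 = {(p, q, r). q = v \<and> path3 x p v \<and> path3 p v r \<and> cis x r}"
  define R0 where "R0 = {(p, q, r). q = x \<and> path3 x r v \<and> path3 p x r \<and> cis p v}"
  have "\<exists>w. path3 x p v --> path3 p v w \<and> cis x w \<and> (\<forall>w'. path3 p v w' --> cis x w' --> w' = w)" for p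
    using ex1_cis[of x p v] by blast
  then obtain g where g: "!!p. path3 x p v --> path3 p v (g p) \<and> cis x (g p) \<and> (\<forall>w. path3 p v w --> cis x w --> w = g p)"
    by metis
  have "L0 = (\<lambda>p. (p, v, g p)) ` {p. path3 x p v}" unfolding L0_def using g by blast
  then have cL0: "card L0 = card {p. path3 x p v}" by (simp add: card_image inj_on_def)
  have "\<exists>p. path3 x r v --> path3 p x r \<and> cis p v \<and> (\<forall>w. path3 w x r --> cis w v --> w = p)" for r
    using ex1_cis[of v r x] path3_sym[of x r v] path3_sym[of _ x r] cis_sym[of v] by blast
  then obtain h where h: "!!r. path3 x r v --> path3 (h r) x r \<and> cis (h r) v \<and> (\<forall>w. path3 w x r --> cis w v --> w = h r)"
    by metis
  have "R0 = (\<lambda>r. (h r, x, r)) ` {r. path3 x r v}" unfolding R0_def using h by blast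
  then have cR0: "card R0 = card {r. path3 x r v}" by (simp add: card_image inj_on_def)
  have Ls: "L = L0 \<union> (walks True True x v \<union> walks True False x v)"
    unfolding L_def L0_def walks_def path3_def by (auto intro: adj_sym[THEN iffD1])
  have Rs: "R = R0 \<union> (walks True True x v \<union> walks False True x v)"
    unfolding R_def R0_def walks_def path3_def by (auto intro: adj_sym[THEN iffD1])
  have "card L = card L0 + (card (walks True True x v) + card (walks True False x v))"
    unfolding Ls by (subst card_Un_disjoint, simp, simp, force simp: L0_def walks_def path3_def)
      (subst card_Un_disjoint, auto simp: walks_def)
  moreover have "card R = card R0 + (card (walks True True x v) + card (walks False True x v))"
    unfolding Rs by (subst card_Un_disjoint, simp, simp, force simp: R0_def walks_def path3_def)
      (subst card_Un_disjoint, auto simp: walks_def)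
  ultimately show ?thesis using LR cL0 cR0 by simp
qed

text \<open>By \<open>card_switch\<close> the end of a path with turns left, left, right is also
  reached with turns \<open>e, -e, -e\<close>. Both descriptions express \<open>u v\<close> in
  \<open>u x\<close>, \<open>u p\<close> and the normal; equating the coefficients of
  \<open>u p\<close> is a polynomial condition on \<open>\<theta>\<close>.\<close>

lemma eigenvalue_cases: "\<theta>\<^sup>2 = 1 \<or> \<theta>\<^sup>2 = 5"
proof -
  define x where "x = a0"
  obtain p where xp: "adj x p" using ex_adj by blast
  obtain q where q: "path3 x p q" "eps x p q = 1" using ex_turn[OF xp] by blast
  have pq: "adj p q" using q unfolding path3_def by blast
  obtain r where r: "path3 p q r" "eps p q r = 1" using ex_turn[OF pq] by blast
  have qr: "adj q r" using r unfolding path3_def by blast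
  obtain v where v: "path3 q r v" "eps q r v = -1" using ex_turn[OF qr] by blast
  have "(p, q, r) \<in> walks True False x v" unfolding walks_def
    using q r v cis_iff[OF q(1) r(1)] cis_iff[OF r(1) v(1)] by simp
  then have "card (walks True False x v) > 0" by (subst card_gt_0_iff) auto
  then have "walks False True x v ~= {}" using card_switch[of x v] by auto
  then obtain p' q' r' where w: "path3 x p' q'" "path3 p' q' r'" "path3 q' r' v" "\<not> cis x r'" "cis p' v"
    unfolding walks_def by blast
  define e where "e = eps x p' q'"
  have e: "e = 1 \<or> e = -1" unfolding e_def by (rule eps_cases)
  have e2: "eps p' q' r' = - e" using cis_iff[OF w(1,2)] w(4) eps_cases[of p' q' r'] e unfolding e_def by auto
  have e3: "eps q' r' v = - e" using cis_iff[OF w(2,3)] w(5) e2 by simp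
  define X where "X = u x"
  define Y where "Y = u p"
  define M where "M = T x p"
  have b: "X \<bullet> X = 1" "Y \<bullet> Y = 1" "X \<bullet> Y = \<theta>/3" "Y \<bullet> X = \<theta>/3" "M \<bullet> X = 0" "M \<bullet> Y = 0"
    using inner_adj[OF xp] w1_theta T_perp unfolding X_def Y_def M_def by (simp_all add: inner_commute)
  define fX where "fX w = w \<bullet> X" for w
  define fY where "fY w = w \<bullet> Y" for w
  note lin = inner_add_left inner_diff_left inner_scaleR_left inner_minus_left
  have A: "fX (u z) = (\<theta> * fX (u s) - fX (u t) + eps t s z * fX (T t s)) / 2"
      "fY (u z) = (\<theta> * fY (u s) - fY (u t) + eps t s z * fY (T t s)) / 2"
      "fX (T s z) = (fX (T t s) + eps t s z * (3 * fX (u t) - \<theta> * fX (u s))) / 2"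
      "fY (T s z) = (fY (T t s) + eps t s z * (3 * fY (u t) - \<theta> * fY (u s))) / 2" if "path3 t s z" for t s z
    using turn_vec(1)[OF that] T_step[OF that] unfolding fX_def fY_def by (simp_all add: lin)
  have base: "fX (u x) = 1" "fY (u x) = \<theta>/3" "fX (u p) = \<theta>/3" "fY (u p) = 1" "fX (T x p) = 0" "fY (T x p) = 0"
    using b unfolding fX_def fY_def X_def[symmetric] Y_def[symmetric] M_def[symmetric] by simp_all
  have CT: "fX (u v) = (-1/8 + \<theta>/4 - \<theta>^2/8) + (-3/4 - 3*\<theta>/8 + \<theta>^3/8) * (\<theta>/3)"
    "fY (u v) = (-1/8 + \<theta>/4 - \<theta>^2/8) * (\<theta>/3) + (-3/4 - 3*\<theta>/8 + \<theta>^3/8)"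
    unfolding A[OF v(1)] A[OF r(1)] A[OF q(1)] base q(2) r(2) v(2)
    by (simp_all add: power2_eq_square power3_eq_cube field_simps)
  \<comment> \<open>If \<open>u v\<close> is written in \<open>X\<close>, \<open>Y\<close>,
    \<open>M\<close>, then \<open>fY (u v) - \<theta>/3 * fX (u v)\<close> is
    \<open>1 - \<theta>^2/9\<close> times the coefficient of \<open>Y\<close>. When both paths start
    with the same edge these coefficients differ by 3/2; otherwise they differ by a multiple of
    \<open>(\<theta> - 1)^2 * (\<theta> + 1)\<close> or of
    \<open>(\<theta> + 1) * (\<theta>^2 - 5)\<close>.\<close>
  have main: "(9 - \<theta>\<^sup>2) * (\<theta>\<^sup>2 - 1) * (\<theta>\<^sup>2 - 5) = 0"
  proof (cases "p' = p")
    case True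
    have E: "eps x p q' = e" using e_def True by simp
    have W: "path3 x p q'" "path3 p q' r'" "eps p q' r' = - e" using w True e2 by simp_all
    have "fX (u v) - \<theta>/3 * fY (u v) = fX (u v) - \<theta>/3 * fY (u v)" ..
    from e show ?thesis
    proof
      assume e1: "e = 1"
      have "fY (u v) - \<theta>/3 * fX (u v) = (1 - \<theta>^2/9) * ((-3/4 - 3*\<theta>/8 + \<theta>^3/8) + 3/2)"
        unfolding A[OF w(3)] A[OF W(2)] A[OF W(1)] base e3 W(3) E e1
        by (simp add: power2_eq_square power3_eq_cube field_simps)
      moreover have "fY (u v) - \<theta>/3 * fX (u v) = (1 - \<theta>^2/9) * (-3/4 - 3*\<theta>/8 + \<theta>^3/8)"
        unfolding CT by (simp add: power2_eq_square power3_eq_cube field_simps)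
      ultimately have "(1 - \<theta>^2/9) * (3/2) = 0" by (simp only: distrib_left)
      then show ?thesis using theta_sq by simp
    next
      assume e1: "e = -1"
      have "fY (u v) - \<theta>/3 * fX (u v) = (1 - \<theta>^2/9) * ((-3/4 - 3*\<theta>/8 + \<theta>^3/8) + 3/2)"
        unfolding A[OF w(3)] A[OF W(2)] A[OF W(1)] base e3 W(3) E e1
        by (simp add: power2_eq_square power3_eq_cube field_simps)
      moreover have "fY (u v) - \<theta>/3 * fX (u v) = (1 - \<theta>^2/9) * (-3/4 - 3*\<theta>/8 + \<theta>^3/8)"
        unfolding CT by (simp add: power2_eq_square power3_eq_cube field_simps)
      ultimately have "(1 - \<theta>^2/9) * (3/2) = 0" by (simp only: distrib_left)
      then show ?thesis using theta_sq by simp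
    qed
  next
    case False
    have pp: "path3 p x p'" using w(1) xp False adj_sym unfolding path3_def by blast
    define s where "s = eps p x p'"
    have s: "s = 1 \<or> s = -1" unfolding s_def by (rule eps_cases)
    have base': "fX (T p x) = 0" "fY (T p x) = 0" unfolding T_swap[of p x] fX_def fY_def using b M_def by simp_all
    have c: "fY (u v) - \<theta>/3 * fX (u v) = (1 - \<theta>^2/9) * (-3/4 - 3*\<theta>/8 + \<theta>^3/8)"
      unfolding CT by (simp add: power2_eq_square power3_eq_cube field_simps)
    have "fY (u v) - \<theta>/3 * fX (u v) =
        (1 - \<theta>^2/9) * ((-3/4 - 3*\<theta>/8 + \<theta>^3/8) - 3/16 * (if s = e then (\<theta> - 1)^2 * (\<theta> + 1) else (\<theta> + 1) * (\<theta>^2 - 5)))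
      \<or> fY (u v) - \<theta>/3 * fX (u v) =
        (1 - \<theta>^2/9) * ((-3/4 - 3*\<theta>/8 + \<theta>^3/8) - 3/16 * (if s = e then (\<theta> + 1) * (\<theta>^2 - 5) else (\<theta> - 1)^2 * (\<theta> + 1)))"
      using s e
      unfolding A[OF w(3)] A[OF w(2)] A[OF w(1)] A[OF pp] base base' e3 e2 e_def[symmetric] s_def[symmetric]
      by (elim disjE) (simp_all add: power2_eq_square power3_eq_cube field_simps)
    then have "(1 - \<theta>^2/9) * ((\<theta> - 1)^2 * (\<theta> + 1)) = 0 \<or> (1 - \<theta>^2/9) * ((\<theta> + 1) * (\<theta>^2 - 5)) = 0"
      unfolding c by (auto split: if_splits)
    moreover have "1 - \<theta>^2/9 ~= 0" using theta_sq by simp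
    ultimately have "(\<theta> - 1)^2 * (\<theta> + 1) = 0 \<or> (\<theta> + 1) * (\<theta>^2 - 5) = 0" by simp
    then have "\<theta> = 1 \<or> \<theta> = -1 \<or> \<theta>\<^sup>2 = 5" by (auto simp: eq_neg_iff_add_eq_0)
    then show ?thesis by auto
  qed
  then show ?thesis using theta_sq by auto
qed

end

section \<open>Eigenvalue of absolute value one: three-colouring by a cube\<close>

definition perm3 :: "nat => nat => nat => bool" where
  "perm3 i j k \<longleftrightarrow> i < 3 \<and> j < 3 \<and> k < 3 \<and> i ~= j \<and> j ~= k \<and> i ~= k"

lemma perm3_rot: "perm3 i j k ==> perm3 j i k" "perm3 i j k ==> perm3 j k i" "perm3 i j k ==> perm3 k i j"
    "perm3 i j k ==> perm3 k j i" "perm3 i j k ==> perm3 i k j"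
  unfolding perm3_def by auto

lemma perm3_neq: "perm3 i j k ==> i ~= j \<and> j ~= i \<and> i ~= k \<and> k ~= i \<and> j ~= k \<and> k ~= j"
  unfolding perm3_def by auto

lemma perm3_set: "perm3 i j k ==> {..<3} = {i, j, k}"
  unfolding perm3_def by auto

lemma perm3_cases: "perm3 i j k ==> l < 3 ==> l = i \<or> l = j \<or> l = k"
  unfolding perm3_def by auto

lemma perm3_ex: "i < 3 ==> j < 3 ==> i ~= j ==> \<exists>k. perm3 i j k"
  unfolding perm3_def
  by (rule exI[of _ "if i ~= 0 \<and> j ~= 0 then 0 else if i ~= 1 \<and> j ~= 1 then 1 else 2"]) auto

locale pm_octa = pm_cubic c u \<theta> a0 b0 for c :: "'x::finite => 'x => nat" and u \<theta> a0 b0 +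
  assumes theta1: "\<theta>\<^sup>2 = 1"
begin

lemma theta_theta [simp]: "\<theta> * \<theta> = 1" "\<theta> * (\<theta> * a) = a"
  using theta1 by (simp_all add: power2_eq_square mult.assoc[symmetric])

lemma theta_cases: "\<theta> = 1 \<or> \<theta> = -1" using theta1 by (simp add: power2_eq_1_iff)

lemma theta_nz: "\<theta> ~= 0" using theta_cases by auto

lemma w2_val: "w2 = - (1/3)" unfolding w2_theta theta1 by simp

text \<open>Orthogonal axes such that the images will be the halved signed sums of the
  \<open>W i\<close>, the vertices of a cube; 4/3 gives these sums length one. An edge in direction
  \<open>i\<close> reflects along axis \<open>i\<close>, followed by the antipodal map when
  \<open>\<theta> = -1\<close>.\<close>

definition frame :: "(nat => real^3) => bool" where
  "frame W \<longleftrightarrow> (\<forall>i<3. \<forall>j<3. W i \<bullet> W j = (if i = j then 4/3 else 0)) \<and> u a0 = (1/2) *\<^sub>R (\<Sum>i<3. W i) \<and>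
     (\<forall>i<3. \<exists>y. adj a0 y \<and> u y = \<theta> *\<^sub>R (u a0 - W i))"

lemma ex_frame: "\<exists>W. frame W"
proof -
  obtain x y z where N: "N a0 = {x, y, z}" and d: "x ~= y" "x ~= z" "y ~= z" using k3[of a0] by (auto simp: card_3_iff)
  define v where "v i = [x, y, z] ! i" for i :: nat
  have v: "v 0 = x" "v 1 = y" "v 2 = z" unfolding v_def by simp_all
  have l3: "i = 0 \<or> i = 1 \<or> i = 2" if "i < 3" for i :: nat using that by auto
  have av: "adj a0 (v i)" if "i < 3" for i
  proof -
    have "v i \<in> N a0" using l3[OF that] unfolding N v_def by auto
    then show ?thesis by simp
  qed
  have vd: "i < 3 ==> j < 3 ==> i ~= j ==> v i ~= v j" for i j using l3[of i] l3[of j] d v by auto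
  have vin: "u (v i) \<bullet> u (v j) = - (1/3)" if "i < 3" "j < 3" "i ~= j" for i j
  proof -
    have "path3 (v i) a0 (v j)" unfolding path3_def using av[OF that(1)] av[OF that(2)] vd[OF that] adj_sym by blast
    then show ?thesis using inner_dist2[OF path3_dist2] w2_val by metis
  qed
  have va: "u a0 \<bullet> u (v i) = \<theta> / 3" "u (v i) \<bullet> u a0 = \<theta> / 3" if "i < 3" for i
    using inner_adj[OF av[OF that]] w1_theta by (simp_all add: inner_commute)
  define W where "W i = u a0 - \<theta> *\<^sub>R u (v i)" for i
  have "W i \<bullet> W j = (if i = j then 4/3 else 0)" if "i < 3" "j < 3" for i j
    unfolding W_def
    by (cases "i = j") (simp_all add: inner_diff_left inner_diff_right va[OF that(1)] va[OF that(2)] vin[OF that] right_diff_distrib)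
  moreover have "u a0 = (1/2) *\<^sub>R (\<Sum>i<3. W i)"
  proof -
    have "(\<Sum>i<3. W i) = 3 *\<^sub>R u a0 - \<theta> *\<^sub>R (u x + u y + u z)"
    proof -
      have "{..<3::nat} = {0, 1, 2}" by auto
      then have "(\<Sum>i<3. W i) = W 0 + W 1 + W 2" by (simp add: add.assoc)
      moreover have "3 *\<^sub>R u a0 = u a0 + u a0 + u a0" by (simp add: vec_eq_iff)
      ultimately show ?thesis unfolding W_def v by (simp only: scaleR_right_distrib) (simp add: algebra_simps)
    qed
    also have "u x + u y + u z = \<theta> *\<^sub>R u a0" using u_eig[of a0] d unfolding N by (simp add: add.assoc)
    finally have "(\<Sum>i<3. W i) = 3 *\<^sub>R u a0 - u a0" by simp
    also have "\<dots> = 2 *\<^sub>R u a0" using scaleR_left_diff_distrib[of 3 1 "u a0"] by simp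
    finally show ?thesis by simp
  qed
  moreover have "\<exists>y. adj a0 y \<and> u y = \<theta> *\<^sub>R (u a0 - W i)" if "i < 3" for i
    by (intro exI[of _ "v i"]) (use av[OF that] in \<open>simp add: W_def\<close>)
  ultimately show ?thesis unfolding frame_def by blast
qed

definition "W = (SOME W. frame W)"

lemma frame_W: "frame W" unfolding W_def by (rule someI_ex[OF ex_frame])

lemma W_inner: "i < 3 ==> j < 3 ==> W i \<bullet> W j = (if i = j then 4/3 else 0)"
  using frame_W unfolding frame_def by blast

text \<open>The coordinate on axis \<open>i\<close>, a sign by \<open>sg_cases\<close>; 3/2 undoes
  the factors 1/2 and 4/3.\<close>

definition sg :: "nat => 'x => real" where "sg i x = (3/2) * (u x \<bullet> W i)"

lemma W_expand:
  assumes "u x = (1/2) *\<^sub>R (\<Sum>i<3. s i *\<^sub>R W i)" "j < 3" shows "sg j x = s j"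
proof -
  have "(\<Sum>i<3. s i * (W i \<bullet> W j)) = (\<Sum>i<3. if i = j then s i * (4/3) else 0)"
    by (rule sum.cong) (use W_inner assms(2) in auto)
  also have "\<dots> = s j * (4/3)" using assms(2) by simp
  finally show ?thesis unfolding sg_def assms(1) by (simp add: inner_sum_left)
qed

text \<open>The invariant carried along edges to all vertices; including the three neighbours makes
  the induction step possible.\<close>

definition good :: "'x => bool" where
  "good x \<longleftrightarrow> (\<forall>i<3. sg i x = 1 \<or> sg i x = -1) \<and> u x = (1/2) *\<^sub>R (\<Sum>i<3. sg i x *\<^sub>R W i) \<and>
     (\<forall>i<3. \<exists>y. adj x y \<and> u y = \<theta> *\<^sub>R (u x - sg i x *\<^sub>R W i))"

lemma cand_inner:
  assumes "good x" "i < 3" "j < 3"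
  shows "(\<theta> *\<^sub>R (u x - sg i x *\<^sub>R W i)) \<bullet> (\<theta> *\<^sub>R (u x - sg j x *\<^sub>R W j)) = (if i = j then 1 else -(1/3))"
    and "(\<theta> *\<^sub>R (u x - sg i x *\<^sub>R W i)) \<bullet> u x = \<theta> / 3"
proof -
  have s: "sg i x * sg i x = 1" "sg j x * sg j x = 1" using assms unfolding good_def by auto
  have "u x \<bullet> W i = (2/3) * sg i x" "u x \<bullet> W j = (2/3) * sg j x" unfolding sg_def by simp_all
  then have ip: "u x \<bullet> W i = (2/3) * sg i x" "u x \<bullet> W j = (2/3) * sg j x"
     "W i \<bullet> u x = (2/3) * sg i x" "W j \<bullet> u x = (2/3) * sg j x" by (simp_all add: inner_commute)
  have s': "sg i x * (sg i x * a) = a" "sg j x * (sg j x * a) = a" for a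
    using s by (simp_all add: mult.assoc[symmetric])
  show "(\<theta> *\<^sub>R (u x - sg i x *\<^sub>R W i)) \<bullet> (\<theta> *\<^sub>R (u x - sg j x *\<^sub>R W j)) = (if i = j then 1 else -(1/3))"
    using W_inner[OF assms(2,3)] s s' by (auto simp: inner_diff_left inner_diff_right ip algebra_simps)
  show "(\<theta> *\<^sub>R (u x - sg i x *\<^sub>R W i)) \<bullet> u x = \<theta> / 3"
    using s s' by (simp add: inner_diff_left inner_diff_right ip algebra_simps)
qed

lemma good_nbrs:
  assumes "good x" "adj x z"
  shows "\<exists>i<3. u z = \<theta> *\<^sub>R (u x - sg i x *\<^sub>R W i)"
proof -
  obtain v where v: "!!i. i < 3 ==> adj x (v i) \<and> u (v i) = \<theta> *\<^sub>R (u x - sg i x *\<^sub>R W i)"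
    using assms(1) unfolding good_def by metis
  have "inj_on v {..<3}"
  proof (rule inj_onI)
    fix i j assume ij: "i \<in> {..<3}" "j \<in> {..<3}" "v i = v j"
    then have e: "u (v i) = \<theta> *\<^sub>R (u x - sg i x *\<^sub>R W i)" "u (v j) = \<theta> *\<^sub>R (u x - sg j x *\<^sub>R W j)" using v by blast+
    have "u (v i) \<bullet> u (v j) = (if i = j then 1 else -(1/3))"
      unfolding e by (rule cand_inner(1)[OF assms(1)]) (use ij in auto)
    then show "i = j" using ij(3) by (auto split: if_splits)
  qed
  then have "card (v ` {..<3}) = 3" by (simp add: card_image)
  moreover have "v ` {..<3} \<subseteq> N x" using v by auto
  ultimately have "v ` {..<3} = N x" using k3[of x] by (intro card_subset_eq) simp_all
  moreover have "z \<in> N x" using assms(2) by simp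
  ultimately show ?thesis using v by (metis image_iff lessThan_iff)
qed

text \<open>Passing an edge flips one sign, or the two others when \<open>\<theta> = -1\<close>. One
  of the three expected images of neighbours of \<open>z\<close> belongs to \<open>x\<close>; each
  of the others lies on one line with the two actual ones and on the sphere, which has room for two
  points only.\<close>

lemma good_step:
  assumes g: "good x" and xz: "adj x z"
  shows "good z"
proof -
  obtain i where i: "i < 3" "u z = \<theta> *\<^sub>R (u x - sg i x *\<^sub>R W i)" using good_nbrs[OF assms] by blast
  define s where "s j = \<theta> * (if j = i then -1 else 1) * sg j x" for j
  have ux: "u x = (1/2) *\<^sub>R (\<Sum>j<3. sg j x *\<^sub>R W j)" using g unfolding good_def by blast
  have "(\<Sum>j<3. s j *\<^sub>R W j) = (\<Sum>j<3. \<theta> *\<^sub>R (sg j x *\<^sub>R W j) - (if j = i then (2 * \<theta>) *\<^sub>R (sg i x *\<^sub>R W i) else 0))"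
    unfolding s_def by (rule sum.cong) (auto simp: scaleR_left_diff_distrib[symmetric])
  also have "\<dots> = \<theta> *\<^sub>R (\<Sum>j<3. sg j x *\<^sub>R W j) - (2 * \<theta>) *\<^sub>R (sg i x *\<^sub>R W i)"
    using i(1) by (simp add: sum_subtractf scaleR_sum_right)
  finally have "(1/2) *\<^sub>R (\<Sum>j<3. s j *\<^sub>R W j) = \<theta> *\<^sub>R ((1/2) *\<^sub>R (\<Sum>j<3. sg j x *\<^sub>R W j)) - \<theta> *\<^sub>R (sg i x *\<^sub>R W i)"
    by (simp add: scaleR_right_diff_distrib)
  then have uz: "u z = (1/2) *\<^sub>R (\<Sum>j<3. s j *\<^sub>R W j)" unfolding ux[symmetric] i(2) by (simp add: scaleR_right_diff_distrib)
  have sz: "sg j z = s j" if "j < 3" for j by (rule W_expand[OF uz that])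
  have s1: "sg j z = 1 \<or> sg j z = -1" if "j < 3" for j
    using g theta_cases that unfolding sz[OF that] s_def good_def by (auto split: if_splits)
  have uz': "u z = (1/2) *\<^sub>R (\<Sum>j<3. sg j z *\<^sub>R W j)" unfolding uz using sz by simp
  let ?v = "\<lambda>j. \<theta> *\<^sub>R (u z - sg j z *\<^sub>R W j)"
  have zi: "sg i z = - \<theta> * sg i x" unfolding sz[OF i(1)] s_def by simp
  have vi: "?v i = u x" unfolding zi i(2) by (simp add: scaleR_right_diff_distrib)
  have sq: "sg j z * sg j z = 1" "sg j z * (sg j z * a) = a" if "j < 3" for j a
    using s1[OF that] by (auto simp: mult.assoc[symmetric])
  have vin: "?v j \<bullet> ?v l = (if j = l then 1 else -(1/3))" "?v j \<bullet> u z = \<theta> / 3" if "j < 3" "l < 3" for j l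
  proof -
    have "u z \<bullet> W j = (2/3) * sg j z" "u z \<bullet> W l = (2/3) * sg l z" unfolding sg_def by simp_all
    then have ip: "u z \<bullet> W j = (2/3) * sg j z" "u z \<bullet> W l = (2/3) * sg l z"
     "W j \<bullet> u z = (2/3) * sg j z" "W l \<bullet> u z = (2/3) * sg l z" by (simp_all add: inner_commute)
    show "?v j \<bullet> ?v l = (if j = l then 1 else -(1/3))"
      using W_inner[OF that] sq[OF that(1)] sq[OF that(2)] by (auto simp: inner_diff_left inner_diff_right ip algebra_simps)
    show "?v j \<bullet> u z = \<theta> / 3"
      using sq[OF that(1)] by (simp add: inner_diff_left inner_diff_right ip algebra_simps)
  qed
  obtain r r' where r: "N z = {x, r, r'}" "r ~= r'" "path3 x z r" "path3 x z r'" by (rule two_extensions[OF xz])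
  have zr: "adj z r" "adj z r'" using r(3,4) unfolding path3_def by blast+
  have urr: "u r ~= u r'" using u_siblings_neq[OF zr r(2)] .
  have rin: "u q \<bullet> u x = -(1/3)" "u q \<bullet> u z = \<theta> / 3" if "path3 x z q" for q
  proof -
    have "adj z q" using that unfolding path3_def by blast
    then show "u q \<bullet> u x = -(1/3)" "u q \<bullet> u z = \<theta> / 3"
      using inner_dist2[OF path3_dist2[OF that]] w2_val inner_adj[of z q] w1_theta by (simp_all add: inner_commute)
  qed
  have "\<exists>y. adj z y \<and> u y = ?v j" if j: "j < 3" for j
  proof (cases "j = i")
    case True
    then show ?thesis using vi xz adj_sym by (intro exI[of _ x]) simp
  next
    case False
    have vx: "?v j \<bullet> u x = -(1/3)" using vin(1)[OF j i(1)] False unfolding vi by simp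
    have vv: "?v j \<bullet> ?v j = 1" using vin(1)[OF j j] by simp
    have "u r = ?v j \<or> u r' = ?v j"
      using at_most_two_on_circle[OF cross_nz[OF xz], of "?v j" "-(1/3)" "u r" "u r'" "\<theta> / 3" 1]
        rin[OF r(3)] rin[OF r(4)] vx vin(2)[OF j j] vv urr uu by metis
    then show ?thesis using zr by metis
  qed
  then show ?thesis unfolding good_def using s1 uz' by blast
qed

lemma all_good: "good x"
proof (rule conn_induct[of good a0])
  have e: "u a0 = (1/2) *\<^sub>R (\<Sum>i<3. (\<lambda>i. 1) i *\<^sub>R W i)" using frame_W unfolding frame_def by simp
  have "sg i a0 = 1" if "i < 3" for i by (rule W_expand[OF e that])
  moreover have "\<forall>i<3. \<exists>y. adj a0 y \<and> u y = \<theta> *\<^sub>R (u a0 - W i)" using frame_W unfolding frame_def by blast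
  ultimately show "good a0" unfolding good_def using e by simp
qed (rule good_step)

lemma sg_cases: "i < 3 ==> sg i x = 1 \<or> sg i x = -1" using all_good unfolding good_def by blast

lemma inner_sg: "u x \<bullet> u y = (1/3) * (\<Sum>i<3. sg i x * sg i y)"
proof -
  have ux: "u x = (1/2) *\<^sub>R (\<Sum>i<3. sg i x *\<^sub>R W i)" using all_good[of x] unfolding good_def by blast
  have "u y \<bullet> u x = u y \<bullet> ((1/2) *\<^sub>R (\<Sum>i<3. sg i x *\<^sub>R W i))" by (rule arg_cong[OF ux])
  also have "\<dots> = (1/2) * (\<Sum>i<3. sg i x * (u y \<bullet> W i))" by (simp add: inner_sum_right)
  also have "\<dots> = (1/2) * (\<Sum>i<3. (2/3) * (sg i x * sg i y))" unfolding sg_def[of _ y] by simp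
  also have "\<dots> = (1/2) * ((2/3) * (\<Sum>i<3. sg i x * sg i y))" by (simp only: sum_distrib_left)
  finally show ?thesis by (simp add: inner_commute)
qed

text \<open>The axes colour the edges: adjacency is the union of three involutions, so that walks
  become words.\<close>

definition col :: "nat => 'x => 'x" where
  "col i x = (SOME y. adj x y \<and> u y = \<theta> *\<^sub>R (u x - sg i x *\<^sub>R W i))"

lemma col: "i < 3 ==> adj x (col i x)" "i < 3 ==> u (col i x) = \<theta> *\<^sub>R (u x - sg i x *\<^sub>R W i)"
proof -
  assume "i < 3"
  then have "\<exists>y. adj x y \<and> u y = \<theta> *\<^sub>R (u x - sg i x *\<^sub>R W i)" using all_good[of x] unfolding good_def by blast
  from someI_ex[OF this] show "adj x (col i x)" "u (col i x) = \<theta> *\<^sub>R (u x - sg i x *\<^sub>R W i)" unfolding col_def by blast+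
qed

lemma adj_col: "adj x y \<longleftrightarrow> (\<exists>i<3. y = col i x)"
proof
  assume a: "adj x y"
  obtain i where i: "i < 3" "u y = u (col i x)" using good_nbrs[OF all_good a] col(2) by metis
  then have "y = col i x" using u_siblings_neq[OF a col(1)[OF i(1)]] by blast
  then show "\<exists>i<3. y = col i x" using i(1) by blast
qed (use col in auto)

lemma sg_col: "i < 3 ==> j < 3 ==> sg j (col i x) = \<theta> * (if i = j then -1 else 1) * sg j x"
proof -
  assume "i < 3" "j < 3"
  then have "sg j (col i x) = \<theta> * (sg j x - (3/2) * (sg i x * (W i \<bullet> W j)))"
    unfolding sg_def[of j] col(2)[OF \<open>i < 3\<close>] by (simp add: inner_diff_left algebra_simps)
  then show ?thesis using W_inner \<open>i < 3\<close> \<open>j < 3\<close> by simp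
qed

lemma col_col: "i < 3 ==> col i (col i x) = x"
proof -
  assume i: "i < 3"
  have "sg i (col i x) = - \<theta> * sg i x" using sg_col[OF i i] by simp
  then have "u (col i (col i x)) = u x"
    unfolding col(2)[OF i] by (simp add: scaleR_right_diff_distrib)
  moreover have "adj (col i x) (col i (col i x))" "adj (col i x) x" using col(1)[OF i] adj_sym by blast+
  ultimately show ?thesis using u_siblings_neq by metis
qed

lemma col_neq: "i < 3 ==> j < 3 ==> i ~= j ==> col i x ~= col j x"
  using sg_col[of i i x] sg_col[of j i x] sg_cases[of i x] theta_nz by auto

end

lemma perm3D: "perm3 i j k ==> i < 3" "perm3 i j k ==> j < 3" "perm3 i j k ==> k < 3"
  unfolding perm3_def by auto

lemma perm3_6:
  assumes p: "perm3 i j k" and q: "perm3 a b d"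
  shows "a = i \<and> b = j \<and> d = k \<or> a = i \<and> b = k \<and> d = j \<or> a = j \<and> b = i \<and> d = k \<or>
    a = j \<and> b = k \<and> d = i \<or> a = k \<and> b = i \<and> d = j \<or> a = k \<and> b = j \<and> d = i"
  using perm3_cases[OF p perm3D(1)[OF q]] perm3_cases[OF p perm3D(2)[OF q]] perm3_cases[OF p perm3D(3)[OF q]] perm3_neq[OF q]
  by (elim disjE) simp_all

section \<open>Relations contained in a single class\<close>

context coherent
begin

definition single :: "('v => 'v => bool) => bool" where
  "single S \<longleftrightarrow> (\<forall>x y x' y'. S x y --> S x' y' --> c x y = c x' y')"

lemma singleD: "single S ==> S x y ==> S x' y' ==> c x y = c x' y'" unfolding single_def by blast

lemma step_inv:
  assumes "class_inv c S" "class_inv c E" "class_inv c T"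
  shows "class_inv c (\<lambda>x w. (\<exists>y. S x y \<and> E y w) \<and> T x w)"
proof -
  have "class_inv c (\<lambda>x w. card {y. S x y \<and> E y w} > 0)"
    by (rule class_inv_comp[OF class_inv_card[OF assms(1,2)]])
  moreover have "card {y. S x y \<and> E y w} > 0 \<longleftrightarrow> (\<exists>y. S x y \<and> E y w)" for x w
    by (subst card_gt_0_iff) auto
  ultimately have "class_inv c (\<lambda>x w. \<exists>y. S x y \<and> E y w)" by simp
  from class_inv_comp2[OF this assms(3), of "(\<and>)"] show ?thesis .
qed

text \<open>The mechanism of \<open>chain\<close> for relations: a unique continuation into
  \<open>T\<close> is transported between pairs of one class.\<close>

lemma step_single:
  assumes S: "single S" and E: "class_inv c E" and T: "class_inv c T" and Es: "!!x y. E x y \<longleftrightarrow> E y x"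
    and un: "!!x y w w'. S x y ==> E y w ==> T x w ==> E y w' ==> T x w' ==> w = w'"
  shows "single (\<lambda>x w. (\<exists>y. S x y \<and> E y w) \<and> T x w)"
  unfolding single_def
proof (intro allI impI)
  fix x w x' w'
  assume "(\<exists>y. S x y \<and> E y w) \<and> T x w" "(\<exists>y. S x' y \<and> E y w') \<and> T x' w'"
  then obtain y y' where y: "S x y" "E y w" "T x w" and y': "S x' y'" "E y' w'" "T x' w'" by blast
  have I: "class_inv c (\<lambda>a b. c a b = c x w)" by (rule class_inv_comp[OF class_inv_self])
  have "card {z. c x z = c x w \<and> E z y} = card {z. c x' z = c x w \<and> E z y'}"
    by (rule class_invD[OF class_inv_card[OF I E] singleD[OF S y(1) y'(1)]])
  moreover have "w \<in> {z. c x z = c x w \<and> E z y}" using y(2) Es by blast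
  then have "card {z. c x z = c x w \<and> E z y} > 0" by (auto simp: card_gt_0_iff)
  ultimately have "{z. c x' z = c x w \<and> E z y'} ~= {}" by (metis card.empty less_numeral_extra(3))
  then obtain z where z: "c x' z = c x w" "E y' z" using Es by blast
  have "T x' z" using class_invD[OF T z(1)] y(3) by simp
  then have "z = w'" using un[OF y'(1) z(2) _ y'(2,3)] by blast
  then show "c x w = c x' w'" using z(1) by simp
qed

text \<open>The number of walks with an \<open>S\<close>-step and then an \<open>E\<close>-step is a
  symmetric class function, so such a walk from \<open>x\<close> to \<open>v\<close> yields one of
  the same kind from \<open>v\<close> to \<open>x\<close>.\<close>

lemma step_back:
  assumes "class_inv c S" "class_inv c E" "S x y" "E y v"
  shows "\<exists>z. S v z \<and> E z x"
proof -
  have "class_inv c (\<lambda>x w. card {y. S x y \<and> E y w})" by (rule class_inv_card[OF assms(1,2)])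
  from class_inv_sym[OF this] have "card {z. S x z \<and> E z v} = card {z. S v z \<and> E z x}" .
  moreover have "y \<in> {z. S x z \<and> E z v}" using assms by blast
  then have "card {z. S x z \<and> E z v} > 0" by (auto simp: card_gt_0_iff)
  ultimately show ?thesis by (metis (mono_tags, lifting) card.empty empty_Collect_eq less_numeral_extra(3))
qed

end

section \<open>Words in the three colours\<close>

context pm_octa
begin

definition ap :: "nat list => 'x => 'x" where "ap w = fold col w"

lemma ap_simps: "ap [] x = x" "ap (i # w) x = ap w (col i x)" unfolding ap_def by simp_all

lemma ap_append: "ap (v @ w) x = ap w (ap v x)" unfolding ap_def by simp

lemma sg_ap:
  assumes "set w \<subseteq> {..<3}" "e < 3"
  shows "sg e (ap w x) = \<theta> ^ length w * (-1) ^ count_list w e * sg e x"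
  using assms(1)
proof (induction w arbitrary: x)
  case (Cons i w)
  then show ?case using sg_col[of i e x] assms(2) by (simp add: ap_simps)
qed (simp add: ap_simps)

lemma sg_nz: "i < 3 ==> sg i x ~= 0" using sg_cases[of i x] by auto

text \<open>The signs of a vertex record the number of letters of each colour modulo two. This is
  the main means of identifying an unknown word.\<close>

lemma parity:
  assumes "ap w x = ap w' x" "set w \<subseteq> {..<3}" "set w' \<subseteq> {..<3}" "even (length w + length w')" "e < 3"
  shows "even (count_list w e) \<longleftrightarrow> even (count_list w' e)"
proof -
  have "\<theta> ^ length w = \<theta> ^ length w'" using assms(4) theta_cases by auto
  then have "(-1::real) ^ count_list w e = (-1) ^ count_list w' e"
    using sg_ap[OF assms(2,5), of x] sg_ap[OF assms(3,5), of x] assms(1) theta_nz sg_nz[OF assms(5), of x] by simp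
  then show ?thesis by (cases "even (count_list w e)"; cases "even (count_list w' e)") simp_all
qed

lemma ip:
  assumes "perm3 i j k" "set w \<subseteq> {..<3}"
  shows "u x \<bullet> u (ap w x) = \<theta> ^ length w * ((-1) ^ count_list w i + (-1) ^ count_list w j + (-1) ^ count_list w k) / 3"
proof -
  have t: "sg e x * sg e (ap w x) = \<theta> ^ length w * (-1) ^ count_list w e" if "e < 3" for e
    unfolding sg_ap[OF assms(2) that] using sg_cases[OF that, of x] by auto
  have "u x \<bullet> u (ap w x) = (1/3) * (\<Sum>e\<in>{i, j, k}. sg e x * sg e (ap w x))"
    unfolding inner_sg perm3_set[OF assms(1)] ..
  also have "\<dots> = (1/3) * (\<Sum>e\<in>{i, j, k}. \<theta> ^ length w * (-1) ^ count_list w e)"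
    by (intro arg_cong[where f = "(*) (1/3)"] sum.cong refl t) (use perm3D[OF assms(1)] in auto)
  finally show ?thesis using perm3_neq[OF assms(1)] by (simp add: algebra_simps)
qed

lemma ap_path3: "i < 3 ==> j < 3 ==> i ~= j ==> path3 x (ap [i] x) (ap [i, j] x)"
  unfolding path3_def ap_simps using col(1) col_neq[of i j "col i x"] col_col[of i x] by metis

lemma ap_path3': "i < 3 ==> j < 3 ==> i ~= j ==> path3 x (col i x) (col j (col i x))"
  using ap_path3 unfolding ap_simps .

lemma no_square: "perm3 i j k ==> ap [i, j] x ~= ap [j, i] x"
proof
  assume p: "perm3 i j k" and e: "ap [i, j] x = ap [j, i] x"
  have "ap [i] x = ap [j] x"
    using path3_middle[of x "ap [i] x" "ap [i, j] x" "ap [j] x"] ap_path3[of i j x] ap_path3[of j i x] p e unfolding perm3_def by metis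
  then show False using col_neq[of i j x] p unfolding perm3_def ap_simps by blast
qed

lemma dist2_word: "dist2 x y \<longleftrightarrow> (\<exists>i j k. perm3 i j k \<and> y = ap [i, j] x)"
proof
  assume "dist2 x y"
  then obtain z where z: "adj x z" "adj z y" "x ~= y" unfolding dist2_def by blast
  then obtain i j where ij: "i < 3" "z = col i x" "j < 3" "y = col j z" unfolding adj_col by blast
  then have "i ~= j" using col_col[of i x] z(3) by auto
  then obtain k where "perm3 i j k" using perm3_ex ij by blast
  then show "\<exists>i j k. perm3 i j k \<and> y = ap [i, j] x" using ij unfolding ap_simps by blast
next
  assume "\<exists>i j k. perm3 i j k \<and> y = ap [i, j] x"
  then show "dist2 x y" using path3_dist2[OF ap_path3] unfolding perm3_def by blast
qed

lemma not_adj_ap3: "i < 3 ==> j < 3 ==> l < 3 ==> i ~= j ==> j ~= l ==> \<not> adj x (ap [i, j, l] x)"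
  using path3_not_adj[OF ap_path3'[of i j x] ap_path3'[of j l "col i x"]] unfolding ap_simps by blast

lemma kC_val: "kC = (2 - \<theta>) / 3" unfolding kC_def w2_val w1_theta theta1 by (simp add: field_simps)

text \<open>Which pattern is cis depends on the sign of \<open>\<theta>\<close>:
  \<open>i j i\<close> for 1 and \<open>i j k\<close> for -1. Keeping \<open>\<theta> = 1\<close> as
  a truth value treats both signs at once.\<close>

lemma cis_aba: "perm3 i j k ==> cis x (ap [i, j, i] x) \<longleftrightarrow> \<theta> = 1"
proof -
  assume p: "perm3 i j k"
  have "u x \<bullet> u (ap [i, j, i] x) = \<theta> / 3" by (subst ip[OF p]) (use perm3D[OF p] perm3_neq[OF p] in auto)
  then show ?thesis unfolding cis_def kC_val by auto
qed

lemma cis_abc: "perm3 i j k ==> cis x (ap [i, j, k] x) \<longleftrightarrow> \<theta> ~= 1"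
proof -
  assume p: "perm3 i j k"
  have "u x \<bullet> u (ap [i, j, k] x) = - \<theta>" by (subst ip[OF p]) (use perm3D[OF p] perm3_neq[OF p] in auto)
  then show ?thesis unfolding cis_def kC_val using theta_cases by auto
qed

lemma switch_ex: "walks s (\<not> s) x v ~= {} ==> walks (\<not> s) s x v ~= {}"
proof -
  assume "walks s (\<not> s) x v ~= {}"
  then have "card (walks s (\<not> s) x v) ~= 0" by simp
  then have "card (walks (\<not> s) s x v) ~= 0" using card_switch[of x v] by (cases s) simp_all
  then show ?thesis by force
qed

lemma walk_colours:
  assumes "(p, q, r) \<in> walks s t x v"
  obtains a b c' d where "a < 3" "b < 3" "c' < 3" "d < 3" "a ~= b" "b ~= c'" "c' ~= d"
    "r = ap [a, b, c'] x" "p = ap [a] x" "v = ap [a, b, c', d] x" "cis x r \<longleftrightarrow> s" "cis p v \<longleftrightarrow> t"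
proof -
  have w: "path3 x p q" "path3 p q r" "path3 q r v" "cis x r \<longleftrightarrow> s" "cis p v \<longleftrightarrow> t" using assms unfolding walks_def by auto
  then obtain a b c' d where l: "a < 3" "b < 3" "c' < 3" "d < 3" "p = col a x" "q = col b p" "r = col c' q" "v = col d r"
    unfolding path3_def adj_col by blast
  have "a ~= b" "b ~= c'" "c' ~= d" using w(1-3) l col_col unfolding path3_def by auto
  then show ?thesis using that[of a b c' d] l w(4,5) by (simp add: ap_simps)
qed

text \<open>The first three letters form one kind of pattern, the last three the other. By
  \<open>switch_ex\<close> the end is also reached with the kinds exchanged, by a word of the form
  \<open>a b c b\<close>, and parity leaves \<open>b = i\<close> and the two orders of
  \<open>j\<close> and \<open>k\<close>.\<close>

lemma PQ:
  assumes p: "perm3 i j k"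
  shows "ap [i, j, i, k] x = ap [k, i, j, i] x \<or> ap [i, j, i, k] x = ap [j, i, k, i] x"
proof -
  define v where "v = ap [i, j, i, k] x"
  note l = perm3D[OF p] and n = perm3_neq[OF p]
  have "(ap [i] x, ap [i, j] x, ap [i, j, i] x) \<in> walks (\<theta> = 1) (\<not> \<theta> = 1) x v"
    unfolding walks_def v_def
    using ap_path3'[of i j x] ap_path3'[of j i "col i x"] ap_path3'[of i k "col j (col i x)"] l n
      cis_aba[OF p, of x] cis_abc[of j i k "col i x"] perm3_rot[OF p] by (simp add: ap_simps)
  then have "walks (\<not> \<theta> = 1) (\<theta> = 1) x v ~= {}" using switch_ex[of "\<theta> = 1" x v] by blast
  then obtain p' q' r' where w: "(p', q', r') \<in> walks (\<not> \<theta> = 1) (\<theta> = 1) x v" by auto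
  obtain a b c' d where a: "a < 3" "b < 3" "c' < 3" "d < 3" "a ~= b" "b ~= c'" "c' ~= d"
    "r' = ap [a, b, c'] x" "p' = ap [a] x" "v = ap [a, b, c', d] x" "cis x r' \<longleftrightarrow> \<not> \<theta> = 1" "cis p' v \<longleftrightarrow> \<theta> = 1"
    by (rule walk_colours[OF w])
  obtain e where pe: "perm3 a b e" using perm3_ex[of a b] a by blast
  have "a ~= c'" using cis_aba[OF pe, of x] a(8,11) by auto
  then have pc: "perm3 a b c'" using a unfolding perm3_def by blast
  have "v = ap [b, c', d] p'" using a(9,10) by (simp add: ap_simps)
  moreover have "perm3 b c' a" using perm3_rot(2)[OF pc] .
  ultimately have "d ~= a" using cis_abc[of b c' a p'] a(12) by auto
  then have d: "d = b" using perm3_cases[OF pc a(4)] a(7) by blast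
  have e: "ap [i, j, i, k] x = ap [a, b, c', b] x" using a(10) unfolding v_def d .
  have pr: "even (count_list [i, j, i, k] i) = even (count_list [a, b, c', b] i)"
    by (rule parity[OF e]) (use l a in auto)
  show ?thesis using perm3_6[OF p pc] pr n e by (elim disjE conjE) simp_all
qed

text \<open>As \<open>PQ\<close>, with the two kinds of pattern interchanged.\<close>

lemma PQ':
  assumes p: "perm3 i j k"
  shows "ap [k, i, j, i] x = ap [i, j, i, k] x \<or> ap [k, i, j, i] x = ap [i, k, i, j] x"
proof -
  define v where "v = ap [k, i, j, i] x"
  note l = perm3D[OF p] and n = perm3_neq[OF p]
  have "(ap [k] x, ap [k, i] x, ap [k, i, j] x) \<in> walks (\<not> \<theta> = 1) (\<not> \<not> \<theta> = 1) x v"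
    unfolding walks_def v_def
    using ap_path3'[of k i x] ap_path3'[of i j "col k x"] ap_path3'[of j i "col i (col k x)"] l n
      cis_aba[OF p, of "col k x"] cis_abc[of k i j x] perm3_rot[OF p] by (simp add: ap_simps)
  then have "walks (\<theta> = 1) (\<not> \<theta> = 1) x v ~= {}" using switch_ex[of "\<not> \<theta> = 1" x v] by auto
  then obtain p' q' r' where w: "(p', q', r') \<in> walks (\<theta> = 1) (\<not> \<theta> = 1) x v" by auto
  obtain a b c' d where a: "a < 3" "b < 3" "c' < 3" "d < 3" "a ~= b" "b ~= c'" "c' ~= d"
    "r' = ap [a, b, c'] x" "p' = ap [a] x" "v = ap [a, b, c', d] x" "cis x r' \<longleftrightarrow> \<theta> = 1" "cis p' v \<longleftrightarrow> \<not> \<theta> = 1"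
    by (rule walk_colours[OF w])
  obtain e where pe: "perm3 a b e" using perm3_ex[of a b] a by blast
  have ca: "c' = a"
  proof (rule classical)
    assume "c' ~= a"
    then have "perm3 a b c'" using a unfolding perm3_def by blast
    then show ?thesis using cis_abc[of a b c' x] a(8,11) by auto
  qed
  have "v = ap [b, a, d] p'" using a(9,10) ca by (simp add: ap_simps)
  then have db: "d ~= b" using cis_aba[OF perm3_rot(1)[OF pe], of p'] a(12) by auto
  have e: "ap [k, i, j, i] x = ap [a, b, a, d] x" using a(10) unfolding v_def ca .
  have pr: "even (count_list [k, i, j, i] i) = even (count_list [a, b, a, d] i)"
    by (rule parity[OF e]) (use l a in auto)
  have q: "perm3 a b d" using a db ca unfolding perm3_def by auto
  show ?thesis using perm3_6[OF p q] pr n e by (elim disjE conjE) simp_all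
qed

text \<open>The ends of the words \<open>i j i\<close>, and for \<open>C'\<close> of the words
  \<open>i j k\<close>, described by class functions; see \<open>C_word\<close> and
  \<open>C'_word\<close>.\<close>

definition C :: "'x => 'x => bool" where
  "C x w \<longleftrightarrow> (\<exists>y. dist2 x y \<and> adj y w) \<and> (u x \<bullet> u w = \<theta> / 3 \<and> \<not> adj x w)"

definition C' :: "'x => 'x => bool" where
  "C' x w \<longleftrightarrow> (\<exists>y. dist2 x y \<and> adj y w) \<and> u x \<bullet> u w = - \<theta>"

lemma ip_eval:
  assumes "perm3 i j k"
  shows "u x \<bullet> u (ap [i, j] x) = -(1/3)" "u x \<bullet> u (ap [i, j, i] x) = \<theta> / 3" "u x \<bullet> u (ap [i, j, k] x) = - \<theta>"
    "u x \<bullet> u (ap [i, j, i, j] x) = 1" "u x \<bullet> u (ap [i, j, i, k] x) = -(1/3)"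
    "u x \<bullet> u (ap [i, j, i, k, i] x) = -\<theta>" "u x \<bullet> u (ap [i, j, i, k, j] x) = \<theta> / 3"
  by (subst ip[OF assms], use perm3D[OF assms] perm3_neq[OF assms] in auto)+

lemma vals_neq: "-\<theta> ~= \<theta> / 3" "\<theta> / 3 ~= -\<theta>" "1 ~= -(1/3::real)" using theta_cases by auto

lemma nbr_cases: "perm3 i j k ==> adj y w ==> w = col i y \<or> w = col j y \<or> w = col k y"
  unfolding adj_col using perm3_cases by blast

lemma C_word: "C x w \<longleftrightarrow> (\<exists>i j k. perm3 i j k \<and> w = ap [i, j, i] x)"
proof
  assume "C x w"
  then obtain y where y: "dist2 x y" "adj y w" "u x \<bullet> u w = \<theta> / 3" "\<not> adj x w" unfolding C_def by blast
  obtain i j k where p: "perm3 i j k" and yw: "y = ap [i, j] x" using y(1) dist2_word by blast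
  note l = perm3D[OF p]
  have "w ~= col j y" using y(4) l unfolding yw by (auto simp: ap_simps col_col col(1))
  moreover have "w ~= col k y"
  proof
    assume "w = col k y"
    then have "w = ap [i, j, k] x" unfolding yw by (simp add: ap_simps)
    then show False using ip_eval(3)[OF p, of x] y(3) vals_neq by simp
  qed
  ultimately have "w = col i y" using nbr_cases[OF p y(2)] by blast
  then show "\<exists>i j k. perm3 i j k \<and> w = ap [i, j, i] x" using p unfolding yw ap_simps by blast
next
  assume "\<exists>i j k. perm3 i j k \<and> w = ap [i, j, i] x"
  then obtain i j k where p: "perm3 i j k" and w: "w = ap [i, j, i] x" by blast
  note l = perm3D[OF p] and n = perm3_neq[OF p]
  have "dist2 x (ap [i, j] x)" using dist2_word p by blast
  moreover have "adj (ap [i, j] x) w" unfolding w using col(1)[OF l(1)] by (simp add: ap_simps)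
  ultimately show "C x w" unfolding C_def using ip_eval(2)[OF p, of x] not_adj_ap3[of i j i x] l n unfolding w by blast
qed

lemma C'_word: "C' x w \<longleftrightarrow> (\<exists>i j k. perm3 i j k \<and> w = ap [i, j, k] x)"
proof
  assume "C' x w"
  then obtain y where y: "dist2 x y" "adj y w" "u x \<bullet> u w = - \<theta>" unfolding C'_def by blast
  obtain i j k where p: "perm3 i j k" and yw: "y = ap [i, j] x" using y(1) dist2_word by blast
  note l = perm3D[OF p]
  have "w ~= col j y"
  proof
    assume "w = col j y"
    then have "adj x w" using l unfolding yw by (auto simp: ap_simps col_col col(1))
    then show False using inner_adj[of x w] w1_theta y(3) vals_neq by simp
  qed
  moreover have "w ~= col i y"
  proof
    assume "w = col i y"
    then have "w = ap [i, j, i] x" unfolding yw by (simp add: ap_simps)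
    then show False using ip_eval(2)[OF p, of x] y(3) vals_neq by simp
  qed
  ultimately have "w = col k y" using nbr_cases[OF p y(2)] by blast
  then show "\<exists>i j k. perm3 i j k \<and> w = ap [i, j, k] x" using p unfolding yw ap_simps by blast
next
  assume "\<exists>i j k. perm3 i j k \<and> w = ap [i, j, k] x"
  then obtain i j k where p: "perm3 i j k" and w: "w = ap [i, j, k] x" by blast
  note l = perm3D[OF p] and n = perm3_neq[OF p]
  have "dist2 x (ap [i, j] x)" using dist2_word p by blast
  moreover have "adj (ap [i, j] x) w" unfolding w using col(1)[OF l(3)] by (simp add: ap_simps)
  ultimately show "C' x w" unfolding C'_def using ip_eval(3)[OF p, of x] unfolding w by blast
qed

lemma u_val_inv: "class_inv c (\<lambda>x y. u x \<bullet> u y = t)" by (rule class_inv_comp[OF u_inv])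

lemma nadj_inv: "class_inv c (\<lambda>x y. \<not> adj x y)" by (rule class_inv_comp[OF adj_inv])

lemma dist2_single: "single dist2" unfolding single_def using dist2_class by blast

lemma ip_step:
  assumes "perm3 i j k"
  shows "u x \<bullet> u (col i (ap [i, j] x)) = \<theta> / 3" "u x \<bullet> u (col k (ap [i, j] x)) = - \<theta>" "adj x (col j (ap [i, j] x))"
    "u x \<bullet> u (col j (ap [i, j] x)) = \<theta> / 3"
proof -
  show "u x \<bullet> u (col i (ap [i, j] x)) = \<theta> / 3" "u x \<bullet> u (col k (ap [i, j] x)) = - \<theta>"
    using ip_eval(2,3)[OF assms, of x] by (simp_all add: ap_simps)
  show a: "adj x (col j (ap [i, j] x))" using perm3D[OF assms] by (simp add: ap_simps col_col col(1))
  show "u x \<bullet> u (col j (ap [i, j] x)) = \<theta> / 3" using inner_adj[OF a] w1_theta by simp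
qed

lemma C_inv: "class_inv c C"
  unfolding C_def by (rule step_inv[OF dist2_inv adj_inv class_inv_comp2[OF u_val_inv nadj_inv]])

lemma C_single: "single C"
  unfolding C_def
proof (rule step_single[OF dist2_single adj_inv class_inv_comp2[OF u_val_inv nadj_inv] adj_sym])
  fix x y w w' assume y: "dist2 x y" and w: "adj y w" "u x \<bullet> u w = \<theta> / 3 \<and> \<not> adj x w" "adj y w'" "u x \<bullet> u w' = \<theta> / 3 \<and> \<not> adj x w'"
  obtain i j k where p: "perm3 i j k" and yw: "y = ap [i, j] x" using y dist2_word by blast
  show "w = w'" using nbr_cases[OF p w(1)] nbr_cases[OF p w(3)] w(2,4) ip_step[OF p, of x] vals_neq unfolding yw by auto
qed

lemma C'_single: "single C'"
  unfolding C'_def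
proof (rule step_single[OF dist2_single adj_inv u_val_inv adj_sym])
  fix x y w w' assume y: "dist2 x y" and w: "adj y w" "u x \<bullet> u w = - \<theta>" "adj y w'" "u x \<bullet> u w' = - \<theta>"
  obtain i j k where p: "perm3 i j k" and yw: "y = ap [i, j] x" using y dist2_word by blast
  show "w = w'" using nbr_cases[OF p w(1)] nbr_cases[OF p w(3)] w(2,4) ip_step[OF p, of x] vals_neq unfolding yw by auto
qed

lemma card_dist2_nbrs:
  assumes "single S" "S x w" "S x' w'"
  shows "card {z. dist2 x z \<and> adj z w} = card {z. dist2 x' z \<and> adj z w'}"
  by (rule class_invD[OF class_inv_card[OF dist2_inv adj_inv] singleD[OF assms]])

text \<open>A hexagon coloured \<open>i j i k j k\<close>.\<close>

definition "degen \<longleftrightarrow> (\<exists>x i j k. perm3 i j k \<and> ap [i, j, i] x = ap [k, j, k] x)"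

text \<open>By parity, the word of length two reaching the same vertex avoids \<open>i\<close>. The
  word \<open>j k\<close> would close a 4-cycle, and \<open>k j\<close> is the assertion.\<close>

lemma C_third:
  assumes p: "perm3 i j k" and d: "dist2 x (ap [i, j, i, k] x)"
  shows "ap [i, j, i] x = ap [k, j, k] x"
proof -
  note l = perm3D[OF p] and n = perm3_neq[OF p]
  obtain a b c' where q: "perm3 a b c'" and e: "ap [i, j, i, k] x = ap [a, b] x" using d dist2_word by blast
  note l' = perm3D[OF q] and n' = perm3_neq[OF q]
  have pr: "even (count_list [i, j, i, k] i) = even (count_list [a, b] i)"
    by (rule parity[OF e]) (use l l' in auto)
  then have "a ~= i" "b ~= i" using n n' by auto
  then have "a = j \<and> b = k \<or> a = k \<and> b = j" using perm3_cases[OF p l'(1)] perm3_cases[OF p l'(2)] n' by auto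
  then show ?thesis
  proof
    assume ab: "a = j \<and> b = k"
    have "col k (ap [i, j, i, k] x) = col k (ap [j, k] x)" using e ab by simp
    then have "ap [i, j, i] x = col j x" using l by (simp add: ap_simps col_col)
    then have "adj x (ap [i, j, i] x)" using col(1)[OF l(2)] by simp
    then show ?thesis using not_adj_ap3[of i j i x] l n by blast
  next
    assume ab: "a = k \<and> b = j"
    have "col k (ap [i, j, i, k] x) = col k (ap [k, j] x)" using e ab by simp
    then show ?thesis using l by (simp add: ap_simps col_col)
  qed
qed

lemma dist2_ap: "perm3 i j k ==> dist2 x (ap [i, j] x)" using dist2_word by blast

lemma adj_col_iff: "perm3 i j k ==> adj z w \<longleftrightarrow> z = col i w \<or> z = col j w \<or> z = col k w"
  using nbr_cases[of i j k w z] adj_sym[of z w] col(1)[of _ w] perm3D by metis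

text \<open>The number of neighbours of \<open>w\<close> at distance two from \<open>x\<close> is
  constant on \<open>C\<close>. One coincidence makes it different from 1, so every end of a word
  \<open>i j i\<close> has a second such neighbour, which \<open>C_third\<close> identifies.\<close>

lemma degen_all:
  assumes "degen" "perm3 i j k" shows "ap [i, j, i] x = ap [k, j, k] x"
proof -
  obtain x0 a b c' where q: "perm3 a b c'" and e: "ap [a, b, a] x0 = ap [c', b, c'] x0" using assms(1) unfolding degen_def by blast
  note l' = perm3D[OF q] and n' = perm3_neq[OF q] and l = perm3D[OF assms(2)] and n = perm3_neq[OF assms(2)]
  let ?w = "ap [a, b, a] x0"
  have "ap [a, b] x0 \<in> {z. dist2 x0 z \<and> adj z ?w}"
    using dist2_ap[OF q] adj_col_iff[OF q] l' by (simp add: ap_simps col_col)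
  moreover have "ap [c', b] x0 \<in> {z. dist2 x0 z \<and> adj z ?w}"
    unfolding e using dist2_ap[OF perm3_rot(4)[OF q]] adj_col_iff[OF q] l' by (simp add: ap_simps col_col)
  moreover have "ap [a, b] x0 ~= ap [c', b] x0"
  proof
    assume "ap [a, b] x0 = ap [c', b] x0"
    then have "col b (ap [a, b] x0) = col b (ap [c', b] x0)" by simp
    then show False using col_neq[of a c' x0] l' n' by (simp add: ap_simps col_col)
  qed
  ultimately have "card {z. dist2 x0 z \<and> adj z ?w} ~= 1" by (metis (no_types, lifting) card_1_singletonE singletonD)
  moreover have "C x0 ?w" "C x (ap [i, j, i] x)" using q assms(2) C_word by blast+
  ultimately have c1: "card {z. dist2 x z \<and> adj z (ap [i, j, i] x)} ~= 1"
    using card_dist2_nbrs[OF C_single] by metis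
  have "dist2 x (col k (ap [i, j, i] x))"
  proof (rule ccontr)
    assume nk: "\<not> dist2 x (col k (ap [i, j, i] x))"
    have "col j (ap [i, j, i] x) = ap [i, j, i, j] x" by (simp add: ap_simps)
    then have nj: "\<not> dist2 x (col j (ap [i, j, i] x))"
      using ip_eval(4)[OF assms(2), of x] inner_dist2[of x "ap [i, j, i, j] x"] w2_val by auto
    have "col i (ap [i, j, i] x) = ap [i, j] x" using l by (simp add: ap_simps col_col)
    then have "{z. dist2 x z \<and> adj z (ap [i, j, i] x)} = {ap [i, j] x}"
      using nk nj dist2_ap[OF assms(2), of x] adj_col_iff[OF assms(2), of _ "ap [i, j, i] x"] by auto
    then show False using c1 by simp
  qed
  then show ?thesis using C_third[OF assms(2), of x] by (simp add: ap_simps)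
qed

lemma degen_Q: "degen ==> perm3 i j k ==> ap [i, j, i, k] x = ap [j, i, k, i] x"
proof -
  assume d: "degen" and p: "perm3 i j k"
  have "ap [i, j, i] x = ap [k, j, k] x" by (rule degen_all[OF d p])
  moreover have "ap [i, k, i] (col j x) = ap [j, k, j] (col j x)" by (rule degen_all[OF d perm3_rot(5)[OF p]])
  ultimately show ?thesis using perm3D[OF p] by (simp add: ap_simps col_col)
qed

text \<open>Appending \<open>j\<close> produces a word for \<open>PQ'\<close>; one alternative
  cancels to a 4-cycle, the other to the coincidence in \<open>degen\<close>.\<close>

lemma twist_degen:
  assumes p: "perm3 i j k" and e: "ap [i, j, k] x = ap [k, i, j] x"
  shows degen
proof -
  note l = perm3D[OF p] and n = perm3_neq[OF p]
  have e': "ap [i, j, k, j] x = ap [k, i] x" using arg_cong[OF e, of "col j"] l by (simp add: ap_simps col_col)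
  have "ap [i, j, k, j] x = ap [j, k, j, i] x \<or> ap [i, j, k, j] x = ap [j, i, j, k] x"
    by (rule PQ'[OF perm3_rot(2)[OF p]])
  then show ?thesis
  proof
    assume "ap [i, j, k, j] x = ap [j, k, j, i] x"
    then have "col i (ap [k, i] x) = col i (ap [j, k, j, i] x)" using e' by simp
    then have "col k x = ap [j, k, j] x" using l by (simp add: ap_simps col_col)
    then show ?thesis using not_adj_ap3[of j k j x] col(1)[of k x] l n by auto
  next
    assume "ap [i, j, k, j] x = ap [j, i, j, k] x"
    then have "col k (ap [k, i] x) = col k (ap [j, i, j, k] x)" using e' by simp
    then have "ap [k, i, k] x = ap [j, i, j] x" using l by (simp add: ap_simps col_col)
    then show ?thesis unfolding degen_def using perm3_rot(3)[OF p] by blast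
  qed
qed


definition "twist \<longleftrightarrow> (\<exists>x i j k. perm3 i j k \<and> ap [i, j, k] x = ap [k, j, i] x)"

text \<open>As \<open>degen_all\<close>, for the class \<open>C'\<close>; the other coincidences
  allowed by parity are excluded by \<open>twist_degen\<close> and \<open>no_square\<close>.\<close>

lemma twist_all:
  assumes nd: "\<not> degen" and "twist" and p: "perm3 i j k" shows "ap [i, j, k] x = ap [k, j, i] x"
proof -
  obtain x0 a b c' where q: "perm3 a b c'" and e: "ap [a, b, c'] x0 = ap [c', b, a] x0" using assms(2) unfolding twist_def by blast
  note l' = perm3D[OF q] and n' = perm3_neq[OF q] and l = perm3D[OF p] and n = perm3_neq[OF p]
  let ?w = "ap [a, b, c'] x0"
  have "ap [a, b] x0 \<in> {z. dist2 x0 z \<and> adj z ?w}"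
    using dist2_ap[OF q] adj_col_iff[OF q] l' by (simp add: ap_simps col_col)
  moreover have "ap [c', b] x0 \<in> {z. dist2 x0 z \<and> adj z ?w}"
    unfolding e using dist2_ap[OF perm3_rot(4)[OF q]] adj_col_iff[OF q] l' by (simp add: ap_simps col_col)
  moreover have "ap [a, b] x0 ~= ap [c', b] x0"
  proof
    assume "ap [a, b] x0 = ap [c', b] x0"
    then have "col b (ap [a, b] x0) = col b (ap [c', b] x0)" by simp
    then show False using col_neq[of a c' x0] l' n' by (simp add: ap_simps col_col)
  qed
  ultimately have "card {z. dist2 x0 z \<and> adj z ?w} ~= 1" by (metis (no_types, lifting) card_1_singletonE singletonD)
  moreover have "C' x0 ?w" "C' x (ap [i, j, k] x)" using q p C'_word by blast+
  ultimately have c1: "card {z. dist2 x z \<and> adj z (ap [i, j, k] x)} ~= 1"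
    using card_dist2_nbrs[OF C'_single] by metis
  have "dist2 x (ap [i, j, k, i] x) \<or> dist2 x (ap [i, j, k, j] x)"
  proof (rule ccontr)
    assume "\<not> ?thesis"
    then have "\<not> dist2 x (col i (ap [i, j, k] x))" "\<not> dist2 x (col j (ap [i, j, k] x))" by (simp_all add: ap_simps)
    moreover have "col k (ap [i, j, k] x) = ap [i, j] x" using l by (simp add: ap_simps col_col)
    ultimately have "{z. dist2 x z \<and> adj z (ap [i, j, k] x)} = {ap [i, j] x}"
      using dist2_ap[OF p, of x] adj_col_iff[OF p, of _ "ap [i, j, k] x"] by auto
    then show False using c1 by simp
  qed
  then show ?thesis
  proof
    assume "dist2 x (ap [i, j, k, i] x)"
    then obtain a b c' where q: "perm3 a b c'" and e: "ap [i, j, k, i] x = ap [a, b] x" using dist2_word by blast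
    note l' = perm3D[OF q] and n' = perm3_neq[OF q]
    have "even (count_list [i, j, k, i] i) = even (count_list [a, b] i)" by (rule parity[OF e]) (use l l' in auto)
    then have "a ~= i" "b ~= i" using n n' by auto
    then have ab: "a = j \<and> b = k \<or> a = k \<and> b = j" using perm3_cases[OF p l'(1)] perm3_cases[OF p l'(2)] n' by auto
    have "col i (ap [i, j, k, i] x) = col i (ap [a, b] x)" using e by simp
    then have "ap [i, j, k] x = ap [a, b, i] x" using l by (simp add: ap_simps col_col)
    then have c: "ap [i, j, k] x = ap [j, k, i] x \<or> ap [i, j, k] x = ap [k, j, i] x" using ab by auto
    have "ap [i, j, k] x ~= ap [j, k, i] x"
      using twist_degen[OF perm3_rot(2)[OF p], of x] nd by metis
    then show ?thesis using c by blast
  next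
    assume "dist2 x (ap [i, j, k, j] x)"
    then obtain a b c' where q: "perm3 a b c'" and e: "ap [i, j, k, j] x = ap [a, b] x" using dist2_word by blast
    note l' = perm3D[OF q] and n' = perm3_neq[OF q]
    have "even (count_list [i, j, k, j] j) = even (count_list [a, b] j)" by (rule parity[OF e]) (use l l' in auto)
    then have "a ~= j" "b ~= j" using n n' by auto
    then have ab: "a = i \<and> b = k \<or> a = k \<and> b = i" using perm3_cases[OF p l'(1)] perm3_cases[OF p l'(2)] n' by auto
    have "col j (ap [i, j, k, j] x) = col j (ap [a, b] x)" using e by simp
    then have "ap [i, j, k] x = ap [a, b, j] x" using l by (simp add: ap_simps col_col)
    then have c: "ap [i, j, k] x = ap [i, k, j] x \<or> ap [i, j, k] x = ap [k, i, j] x" using ab by auto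
    have "ap [i, j, k] x ~= ap [i, k, j] x" using no_square[OF perm3_rot(2)[OF p], of "col i x"] by (simp add: ap_simps)
    then show ?thesis using c twist_degen[OF p, of x] nd by blast
  qed
qed

lemma twist_Q:
  assumes "\<not> degen" "twist" "perm3 i j k" shows "ap [i, j, i, k] x = ap [j, i, k, i] x"
proof -
  have "ap [k, i, j] x = ap [j, i, k] x" by (rule twist_all[OF assms(1,2) perm3_rot(3)[OF assms(3)]])
  then have "col i (ap [k, i, j] x) = col i (ap [j, i, k] x)" by simp
  then have "ap [k, i, j, i] x = ap [j, i, k, i] x" by (simp add: ap_simps)
  then show ?thesis using PQ[OF assms(3), of x] by simp
qed

text \<open>After the first letter is cancelled, \<open>PQ'\<close> leaves either a 4-cycle or the
  hypothesis of \<open>twist_degen\<close>.\<close>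

lemma swap_degen:
  assumes p: "perm3 i j k" and e: "ap [i, j, i, k, j] x = ap [i, k, j, i, j] x"
  shows degen
proof -
  note l = perm3D[OF p] and n = perm3_neq[OF p]
  define y where "y = col i x"
  have e': "ap [j, i, k, j] y = ap [k, j, i, j] y" using e unfolding y_def by (simp add: ap_simps)
  have "ap [k, j, i, j] y = ap [j, i, j, k] y \<or> ap [k, j, i, j] y = ap [j, k, j, i] y"
    by (rule PQ'[OF perm3_rot(1)[OF p]])
  then show ?thesis
  proof
    assume "ap [k, j, i, j] y = ap [j, i, j, k] y"
    then have "ap [k, j] (ap [j, i] y) = ap [j, k] (ap [j, i] y)" using e' by (simp add: ap_simps)
    then show ?thesis using no_square[OF perm3_rot(2)[OF p], of "ap [j, i] y"] by simp
  next
    assume "ap [k, j, i, j] y = ap [j, k, j, i] y"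
    then have "ap [k, j, i] (col j y) = ap [i, k, j] (col j y)" using e' by (simp add: ap_simps)
    then show ?thesis by (rule twist_degen[OF perm3_rot(4)[OF p]])
  qed
qed

text \<open>\<open>F\<close>, \<open>H\<close> and \<open>G\<close> are to be the ends of the words
  \<open>i j i j\<close>, \<open>i j i k\<close> and \<open>i j i k j\<close>; for the last two this
  is shown in the absence of \<open>degen\<close> and \<open>twist\<close>.\<close>

definition F :: "'x => 'x => bool" where
  "F x w \<longleftrightarrow> (\<exists>y. C x y \<and> adj y w) \<and> u x \<bullet> u w = 1"

definition H :: "'x => 'x => bool" where
  "H x w \<longleftrightarrow> (\<exists>y. C x y \<and> adj y w) \<and> (u x \<bullet> u w = -(1/3) \<and> \<not> dist2 x w)"

definition G :: "'x => 'x => bool" where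
  "G x w \<longleftrightarrow> (\<exists>y. H x y \<and> adj y w) \<and> (u x \<bullet> u w = \<theta> / 3 \<and> \<not> C x w)"

lemma col_ap: "col l (ap [a] x) = ap [a, l] x" "col l (ap [a, b] x) = ap [a, b, l] x"
  "col l (ap [a, b, d] x) = ap [a, b, d, l] x" "col l (ap [a, b, d, e] x) = ap [a, b, d, e, l] x"
  by (simp_all add: ap_simps)

lemma col_ap_cancel: "d < 3 ==> col d (ap [a, d] x) = ap [a] x" "d < 3 ==> col d (ap [a, b, d] x) = ap [a, b] x"
  "d < 3 ==> col d (ap [a, b, e, d] x) = ap [a, b, e] x" "d < 3 ==> col d (ap [a, b, e, f, d] x) = ap [a, b, e, f] x"
  by (simp_all add: ap_simps col_col)

lemma C_nbr: "C x y ==> adj y w ==> \<exists>i j k. perm3 i j k \<and> y = ap [i, j, i] x \<and>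
    (w = ap [i, j] x \<or> w = ap [i, j, i, j] x \<or> w = ap [i, j, i, k] x)"
proof -
  assume "C x y" and a: "adj y w"
  then obtain i j k where p: "perm3 i j k" and y: "y = ap [i, j, i] x" unfolding C_word by blast
  note l = perm3D[OF p]
  show ?thesis using p y nbr_cases[OF p a] col_ap_cancel(2)[OF l(1)] unfolding y by (metis col_ap(3))
qed

lemma F_word: "F x w \<longleftrightarrow> (\<exists>i j k. perm3 i j k \<and> w = ap [i, j, i, j] x)"
proof
  assume "F x w"
  then obtain y where y: "C x y" "adj y w" "u x \<bullet> u w = 1" unfolding F_def by blast
  then show "\<exists>i j k. perm3 i j k \<and> w = ap [i, j, i, j] x"
    using C_nbr[OF y(1,2)] ip_eval(1,5) vals_neq(3) by metis
next
  assume "\<exists>i j k. perm3 i j k \<and> w = ap [i, j, i, j] x"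
  then obtain i j k where p: "perm3 i j k" and w: "w = ap [i, j, i, j] x" by blast
  then show "F x w" unfolding F_def using ip_eval(4)[OF p] C_word col(1)[OF perm3D(2)[OF p], of "ap [i, j, i] x"] col_ap(3) by metis
qed

lemma F_inv: "class_inv c F" unfolding F_def by (rule step_inv[OF C_inv adj_inv u_val_inv])

lemma F_single: "single F"
  unfolding F_def
proof (rule step_single[OF C_single adj_inv u_val_inv adj_sym])
  fix x y w w' assume y: "C x y" and w: "adj y w" "u x \<bullet> u w = 1" "adj y w'" "u x \<bullet> u w' = 1"
  obtain i j k where p: "perm3 i j k" and yw: "y = ap [i, j, i] x" using y C_word by blast
  note l = perm3D[OF p]
  have "w = col j y" if "adj y w" "u x \<bullet> u w = 1" for w
    using nbr_cases[OF p that(1)] that(2) ip_eval(1,5)[OF p, of x] vals_neq(3) col_ap_cancel(2)[OF l(1)] unfolding yw by (metis col_ap(3))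
  then show "w = w'" using w by metis
qed

lemma H_inv: "class_inv c H"
  unfolding H_def by (rule step_inv[OF C_inv adj_inv class_inv_comp2[OF u_val_inv class_inv_comp[OF dist2_inv]]])

lemma H_T_inv: "class_inv c (\<lambda>x w. u x \<bullet> u w = -(1/3) \<and> \<not> dist2 x w)"
  by (rule class_inv_comp2[OF u_val_inv class_inv_comp[OF dist2_inv]])

lemma G_T_inv: "class_inv c (\<lambda>x w. u x \<bullet> u w = \<theta> / 3 \<and> \<not> C x w)"
  by (rule class_inv_comp2[OF u_val_inv class_inv_comp[OF C_inv]])

lemma G_inv: "class_inv c G" unfolding G_def by (rule step_inv[OF H_inv adj_inv G_T_inv])

lemma parity_all:
  assumes "perm3 i j k" "ap w x = ap w' x" "set w \<subseteq> {..<3}" "set w' \<subseteq> {..<3}" "even (length w + length w')"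
  shows "even (count_list w i) = even (count_list w' i)" "even (count_list w j) = even (count_list w' j)"
    "even (count_list w k) = even (count_list w' k)"
  using parity[OF assms(2-5)] perm3D[OF assms(1)] by blast+

lemma C_pred: "perm3 i j k ==> C x (ap [i, j, i] x)" using C_word by blast

section \<open>The case without degenerate and twisted coincidences\<close>

context
  assumes nd: "\<not> degen" and nt: "\<not> twist"
begin

lemma ndegen: "perm3 i j k ==> ap [i, j, i] x ~= ap [k, j, k] x" using nd unfolding degen_def by blast

lemma ntwist: "perm3 i j k ==> ap [i, j, k] x ~= ap [k, j, i] x" using nt unfolding twist_def by blast

lemma H_word: "H x w \<longleftrightarrow> (\<exists>i j k. perm3 i j k \<and> w = ap [i, j, i, k] x)"
proof
  assume "H x w"
  then obtain y where y: "C x y" "adj y w" "u x \<bullet> u w = -(1/3)" "\<not> dist2 x w" unfolding H_def by blast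
  then show "\<exists>i j k. perm3 i j k \<and> w = ap [i, j, i, k] x"
    using C_nbr[OF y(1,2)] ip_eval(4) vals_neq(3) dist2_ap by metis
next
  assume "\<exists>i j k. perm3 i j k \<and> w = ap [i, j, i, k] x"
  then obtain i j k where p: "perm3 i j k" and w: "w = ap [i, j, i, k] x" by blast
  have "\<not> dist2 x w" using C_third[OF p] ndegen[OF p] unfolding w by blast
  moreover have "C x (ap [i, j, i] x)" using C_word p by blast
  moreover have "adj (ap [i, j, i] x) w" using col(1)[OF perm3D(3)[OF p], of "ap [i, j, i] x"] unfolding col_ap w .
  ultimately show "H x w" unfolding H_def using ip_eval(5)[OF p] unfolding w by blast
qed

lemma H_single: "single H"
  unfolding H_def
proof (rule step_single[OF C_single adj_inv H_T_inv adj_sym])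
  fix x y w w' assume y: "C x y" and w: "adj y w" "u x \<bullet> u w = -(1/3) \<and> \<not> dist2 x w" "adj y w'" "u x \<bullet> u w' = -(1/3) \<and> \<not> dist2 x w'"
  obtain i j k where p: "perm3 i j k" and yw: "y = ap [i, j, i] x" using y C_word by blast
  note l = perm3D[OF p]
  have "w = col k y" if "adj y w" "u x \<bullet> u w = -(1/3) \<and> \<not> dist2 x w" for w
    using nbr_cases[OF p that(1)] that(2) ip_eval(4)[OF p, of x] dist2_ap[OF p, of x] vals_neq(3) col_ap_cancel(2)[OF l(1)] unfolding yw by (metis col_ap(3))
  then show "w = w'" using w by metis
qed

lemma odd_C: 
  assumes "perm3 i j k" "C x v" "v = ap w x" "set w \<subseteq> {..<3}" "odd (length w)"
    "even (count_list w i)" "even (count_list w j)" "odd (count_list w k)"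
  shows "v = ap [i, k, i] x \<or> v = ap [j, k, j] x"
proof -
  obtain a b d where q: "perm3 a b d" and e: "v = ap [a, b, a] x" using assms(2) C_word by blast
  note l = perm3D[OF q] and n = perm3_neq[OF q]
  have e': "ap w x = ap [a, b, a] x" using e assms(3) by simp
  have "odd (count_list [a, b, a] k)" using parity_all(3)[OF assms(1) e'] assms(4,5,8) l by simp
  then have "b = k" using n by (auto split: if_splits)
  then show ?thesis using e perm3_cases[OF assms(1) l(1)] n by blast
qed

text \<open>Parity leaves two words for a vertex of \<open>C\<close>; one cancels to a twisted
  coincidence, the other to a 4-cycle.\<close>

lemma G_notC: "perm3 i j k ==> \<not> C x (ap [i, j, i, k, j] x)"
proof
  assume p: "perm3 i j k" and cc: "C x (ap [i, j, i, k, j] x)"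
  note l = perm3D[OF p] and n = perm3_neq[OF p]
  have "ap [i, j, i, k, j] x = ap [i, k, i] x \<or> ap [i, j, i, k, j] x = ap [j, k, j] x"
    by (rule odd_C[OF p cc refl]) (use l n in auto)
  then show False
  proof
    assume "ap [i, j, i, k, j] x = ap [i, k, i] x"
    then have "col j (ap [i, j, i, k, j] x) = col j (ap [i, k, i] x)" by simp
    then have "ap [j, i, k] (col i x) = ap [k, i, j] (col i x)" using l by (simp add: ap_simps col_col)
    then show False using ntwist[OF perm3_rot(1)[OF p]] by blast
  next
    assume "ap [i, j, i, k, j] x = ap [j, k, j] x"
    then have "col k (col j (ap [i, j, i, k, j] x)) = col k (col j (ap [j, k, j] x))" by simp
    then have "ap [i, j, i] x = col j x" using l by (simp add: ap_simps col_col)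
    then show False using not_adj_ap3[of i j i x] col(1)[of j x] l n by auto
  qed
qed

lemma H_nbr_iff:
  assumes p: "perm3 i j k" and a: "adj (ap [i, j, i, k] x) w"
  shows "u x \<bullet> u w = \<theta> / 3 \<and> \<not> C x w \<longleftrightarrow> w = ap [i, j, i, k, j] x"
proof -
  note l = perm3D[OF p]
  have "w = ap [i, j, i, k, i] x \<or> w = ap [i, j, i, k, j] x \<or> w = ap [i, j, i] x"
    using nbr_cases[OF p a] col_ap_cancel(3)[OF l(3)] by (metis col_ap(4))
  then show ?thesis using ip_eval(6,7)[OF p, of x] G_notC[OF p, of x] C_pred[OF p, of x] vals_neq by metis
qed

lemma G_word: "G x w \<longleftrightarrow> (\<exists>i j k. perm3 i j k \<and> w = ap [i, j, i, k, j] x)"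
proof
  assume "G x w"
  then obtain y where y: "H x y" "adj y w" "u x \<bullet> u w = \<theta> / 3 \<and> \<not> C x w" unfolding G_def by blast
  obtain i j k where p: "perm3 i j k" and yw: "y = ap [i, j, i, k] x" using y(1) H_word by blast
  show "\<exists>i j k. perm3 i j k \<and> w = ap [i, j, i, k, j] x" using H_nbr_iff[OF p y(2)[unfolded yw]] y(3) p by blast
next
  assume "\<exists>i j k. perm3 i j k \<and> w = ap [i, j, i, k, j] x"
  then obtain i j k where p: "perm3 i j k" and w: "w = ap [i, j, i, k, j] x" by blast
  have a: "adj (ap [i, j, i, k] x) w" using col(1)[OF perm3D(2)[OF p], of "ap [i, j, i, k] x"] unfolding col_ap w .
  show "G x w" unfolding G_def using H_nbr_iff[OF p a] a w H_word p by blast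
qed

lemma G_single: "single G"
  unfolding G_def
proof (rule step_single[OF H_single adj_inv G_T_inv adj_sym])
  fix x y w w' assume y: "H x y" and w: "adj y w" "u x \<bullet> u w = \<theta> / 3 \<and> \<not> C x w" "adj y w'" "u x \<bullet> u w' = \<theta> / 3 \<and> \<not> C x w'"
  obtain i j k where p: "perm3 i j k" and yw: "y = ap [i, j, i, k] x" using y H_word by blast
  show "w = w'" using H_nbr_iff[OF p w(1)[unfolded yw]] H_nbr_iff[OF p w(3)[unfolded yw]] w(2,4) by simp
qed

text \<open>By \<open>step_back\<close> some word \<open>a b a d e\<close> leads from
  \<open>v\<close> back to \<open>x\<close>, so its reverse \<open>e d a b a\<close> leads from
  \<open>x\<close> to \<open>v\<close>. Parity, \<open>G_notC\<close> and \<open>swap_degen\<close>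
  leave only the stated word.\<close>

lemma V:
  assumes p: "perm3 i j k"
  shows "ap [i, j, i, k, j] x = ap [j, k, i, j, i] x"
proof -
  note l = perm3D[OF p] and n = perm3_neq[OF p]
  define v where "v = ap [i, j, i, k, j] x"
  have "H x (ap [i, j, i, k] x)" using H_word p by blast
  moreover have "adj (ap [i, j, i, k] x) v" using col(1)[OF l(2), of "ap [i, j, i, k] x"] unfolding col_ap v_def .
  ultimately obtain z where z: "H v z" "adj z x" using step_back[OF H_inv adj_inv] by blast
  obtain a b d where q: "perm3 a b d" and zw: "z = ap [a, b, a, d] v" using z(1) H_word by blast
  note l' = perm3D[OF q] and n' = perm3_neq[OF q]
  obtain e where e: "e < 3" "x = col e z" using z(2) unfolding adj_col by blast
  have "x = ap [a, b, a, d, e] v" unfolding e(2) zw by (simp add: ap_simps)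
  then have "ap [e, d, a, b, a] x = ap [e, d, a, b, a] (ap [a, b, a, d, e] v)" by simp
  also have "\<dots> = v" using l' e(1) by (simp add: ap_simps col_col)
  finally have ve: "ap [i, j, i, k, j] x = ap [e, d, a, b, a] x" unfolding v_def by simp
  have pr: "even (count_list [i, j, i, k, j] i) = even (count_list [e, d, a, b, a] i)"
    "even (count_list [i, j, i, k, j] j) = even (count_list [e, d, a, b, a] j)"
    "even (count_list [i, j, i, k, j] k) = even (count_list [e, d, a, b, a] k)"
    by (rule parity_all[OF p ve], (use l l' e(1) in auto)[3])+
  have "e ~= d"
  proof
    assume "e = d"
    then have "v = ap [a, b, a] x" using ve l' unfolding v_def by (simp add: ap_simps col_col)
    then show False using G_notC[OF p, of x] C_pred[OF q, of x] unfolding v_def by simp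
  qed
  moreover have "e = d \<or> d = k \<and> e = b"
    using perm3_6[OF p q] perm3_cases[OF q e(1)] pr n by (elim disjE conjE) simp_all
  ultimately have "d = k" and eb: "e = b" by auto
  then have "a = i \<and> b = j \<or> a = j \<and> b = i" using perm3_cases[OF p l'(1)] perm3_cases[OF p l'(2)] n' by blast
  then show ?thesis using ve swap_degen[OF p, of x] nd \<open>d = k\<close> eb by auto
qed

end

end

section \<open>Counting neighbours at the ends of the words \<open>i j i j\<close>\<close>

context pm_octa
begin

text \<open>\<open>y\<close> extends a word \<open>a b a\<close> by the letter \<open>j\<close>; the
  inner product 1 leaves only \<open>b = j\<close>, and \<open>a\<close> is one of the other two
  colours.\<close>

lemma F_rep:
  assumes p: "perm3 i j k" and f: "F x y" and cc: "C x (col j y)"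
  shows "y = ap [i, j, i, j] x \<or> y = ap [k, j, k, j] x"
proof -
  obtain a b d where q: "perm3 a b d" and e: "col j y = ap [a, b, a] x" using cc C_word by blast
  note l = perm3D[OF p] and n = perm3_neq[OF p] and l' = perm3D[OF q] and n' = perm3_neq[OF q]
  have "y = col j (col j y)" using col_col[OF l(2)] by simp
  then have y: "y = ap [a, b, a, j] x" unfolding e col_ap .
  have one: "u x \<bullet> u y = 1" using f unfolding F_def by blast
  have "j ~= a"
  proof
    assume "j = a"
    then have "y = ap [a, b] x" unfolding y using l by (simp add: ap_simps col_col)
    then show False using one ip_eval(1)[OF q, of x] by simp
  qed
  moreover have "j ~= d" using one ip_eval(5)[OF q, of x] unfolding y by auto
  ultimately have "j = b" using perm3_cases[OF q l(2)] by blast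
  then show ?thesis using y perm3_cases[OF p l'(1)] n' by auto
qed

lemma F_nbrs: "{w. C x w \<and> adj w y} = (\<lambda>l. col l y) ` {l. l < 3 \<and> C x (col l y)}"
  using adj_sym[of _ y] unfolding adj_col[of y] by auto

lemma F_card: "card {w. C x w \<and> adj w y} = card {l. l < 3 \<and> C x (col l y)}"
proof -
  have "inj_on (\<lambda>l. col l y) {l. l < 3 \<and> C x (col l y)}" using col_neq[of _ _ y] by (auto intro!: inj_onI)
  then show ?thesis unfolding F_nbrs by (rule card_image)
qed

text \<open>\<open>F\<close> lies in one class, so the number of neighbours of \<open>y\<close> in
  \<open>C\<close> is a constant between 1 and 3. The three values are treated by
  \<open>Q_m1\<close>, \<open>not_m2\<close> and \<open>Q_m3\<close>.\<close>

lemma F_const: "F x y ==> F x' y' ==> card {l. l < 3 \<and> C x (col l y)} = card {l. l < 3 \<and> C x' (col l y')}"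
  unfolding F_card[symmetric] by (rule class_invD[OF class_inv_card[OF C_inv adj_inv] singleD[OF F_single]])

text \<open>The relation between squares, taken at \<open>ap [i, j] x\<close> and continued by
  \<open>k i\<close>, cancels to the assertion.\<close>

lemma Q_from_squares:
  assumes "!!i j k y. perm3 i j k ==> ap [i, k, i, k] y = ap [j, i, j, i] y" and p: "perm3 i j k"
  shows "ap [i, j, i, k] x = ap [j, i, k, i] x"
proof -
  note l = perm3D[OF p]
  have "ap [i, k, i, k] (ap [i, j] x) = ap [j, i, j, i] (ap [i, j] x)" by (rule assms(1)[OF p])
  then have "ap [k, i] (ap [i, k, i, k] (ap [i, j] x)) = ap [k, i] (ap [j, i, j, i] (ap [i, j] x))" by simp
  then show ?thesis using l by (simp add: ap_simps col_col)
qed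

lemma squares_from_Q:
  assumes p: "perm3 i j k" and e: "ap [i, j, i, k] x = ap [j, i, k, i] x"
  shows "ap [i, k, i, k] (ap [i, j] x) = ap [j, i, j, i] (ap [i, j] x)"
proof -
  note l = perm3D[OF p]
  have "ap [i, k] (ap [i, j, i, k] x) = ap [i, k] (ap [j, i, k, i] x)" using e by simp
  then show ?thesis using l by (simp add: ap_simps col_col)
qed

text \<open>With \<open>Z = (ij)^2\<close>, \<open>Z' = (ik)^2\<close> the hypotheses make \<open>Z\<close> and \<open>Z'\<close> squares of each other,
  so that \<open>Z\<^sup>3 = 1\<close> and \<open>Z' = Z\<^sup>-\<^sup>1\<close>.\<close>

lemma squares_from_PV:
  assumes P: "!!i j k x. perm3 i j k ==> ap [i, j, i, k] x = ap [k, i, j, i] x"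
    and V: "!!i j k x. perm3 i j k ==> ap [i, j, i, k, j] x = ap [j, k, i, j, i] x"
    and p: "perm3 i j k"
  shows "ap [i, k, i, k] y = ap [j, i, j, i] y"
proof -
  define Z where "Z a b x = ap [a, b, a, b] x" for a b x
  have ZZ: "Z a b (Z b a x) = x" if "perm3 a b d" for a b d x
    unfolding Z_def using perm3D[OF that] by (simp add: ap_simps col_col)
  \<comment> \<open>Both \<open>a\<close>, by cancellation, and the third colour \<open>d\<close>,
    by \<open>P\<close> and \<open>V\<close>, conjugate \<open>Z a b\<close> into its inverse
    \<open>Z b a\<close>; so \<open>Z a b\<close> commutes with \<open>ap [d, a]\<close>.\<close>
  have Zk: "Z a b (col d x) = col d (Z b a x)" if q: "perm3 a b d" for a b d x
  proof -
    have "Z a b (col d x) = col b (ap [d, a, b, a] x)" unfolding Z_def by (simp add: ap_simps)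
    also have "\<dots> = ap [a, b, a, d, b] x" unfolding P[OF q, symmetric] by (simp add: ap_simps)
    also have "\<dots> = ap [d, a, b, a] (col b x)" unfolding V[OF q] by (simp add: ap_simps)
    also have "\<dots> = col d (Z b a x)" unfolding P[OF q, symmetric] Z_def by (simp add: ap_simps)
    finally show ?thesis .
  qed
  have Zi: "Z a b (col a x) = col a (Z b a x)" if "perm3 a b d" for a b d x
    unfolding Z_def using perm3D[OF that] by (simp add: ap_simps col_col)
  have sq: "Z a d y = Z a b (Z a b y)" if q: "perm3 a b d" for a b d y
  proof -
    note l = perm3D[OF q]
    define x where "x = Z a b y"
    have "ap [b, a, b, d] x = ap [d, b, a, b] x" by (rule P[OF perm3_rot(1)[OF q]])
    then have "ap [a, d] (Z b a x) = Z a b (ap [d, a] x)" unfolding Z_def using l by (simp add: ap_simps col_col)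
    also have "\<dots> = ap [d, a] (Z a b x)" using Zi[OF q] Zk[OF perm3_rot(1)[OF q]] by (simp add: ap_simps)
    finally have "ap [a, d] (ap [a, d] (Z b a x)) = ap [a, d] (ap [d, a] (Z a b x))" by simp
    moreover have "Z b a x = y" unfolding x_def using ZZ[OF perm3_rot(1)[OF q]] .
    ultimately have "ap [a, d] (ap [a, d] y) = Z a b x" using l by (simp add: ap_simps col_col)
    then show ?thesis unfolding x_def Z_def by (simp add: ap_simps)
  qed
  have "Z i j y = Z i k (Z i k y)" for y by (rule sq[OF perm3_rot(5)[OF p]])
  then have e: "Z i j y = Z i j (Z i j (Z i j (Z i j y)))" using sq[OF p] by simp
  have "Z j i (Z i j y) = Z j i (Z i j (Z i j (Z i j (Z i j y))))" using e by simp
  then have "y = Z i j (Z i j (Z i j y))" using ZZ[OF perm3_rot(1)[OF p]] by simp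
  then have "Z j i y = Z i j (Z i j y)" using ZZ[OF perm3_rot(1)[OF p], of "Z i j (Z i j y)"] by simp
  then show ?thesis using sq[OF p, of y] unfolding Z_def by simp
qed

context
  assumes nd: "\<not> degen" and nt: "\<not> twist"
begin

lemma F_sq: "perm3 i j k ==> F x (ap [i, j, i, j] x)" using F_word by blast

lemma C_last: "perm3 i j k ==> C x (col j (ap [i, j, i, j] x))"
  using C_pred[of i j k x] perm3D[of i j k] by (simp add: ap_simps col_col)

lemma sq_neq: "perm3 i j k ==> ap [i, k, i, k] x ~= ap [j, k, j, k] x"
proof
  assume p: "perm3 i j k" and e: "ap [i, k, i, k] x = ap [j, k, j, k] x"
  have "col k (ap [i, k, i, k] x) = col k (ap [j, k, j, k] x)" using e by simp
  then show False using perm3D[OF p] ndegen[OF nd nt perm3_rot(5)[OF p], of x] by (simp add: ap_simps col_col)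
qed

lemma sq_neq': "perm3 i j k ==> ap [k, i, k, i] x ~= ap [k, j, k, j] x"
proof
  assume p: "perm3 i j k" and e: "ap [k, i, k, i] x = ap [k, j, k, j] x"
  then have "ap [i, k, i] (col k x) = ap [j, k, j] (col k x)" 
    using ndegen[OF nd nt] perm3D[OF p] by (simp add: ap_simps)
  then show False using ndegen[OF nd nt perm3_rot(5)[OF p], of "col k x"] by blast
qed

text \<open>If the second alternative of \<open>PQ\<close> ever held, \<open>squares_from_Q\<close>
  would give the end of a square two neighbours in \<open>C\<close>. So the first alternative holds
  throughout and, with \<open>V\<close>, yields the relation between squares.\<close>

lemma Q_m1:
  assumes m: "!!x y. F x y ==> card {l. l < 3 \<and> C x (col l y)} = 1" and p: "perm3 i j k"
  shows "ap [i, j, i, k] x = ap [j, i, k, i] x"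
proof -
  have P: "ap [a, b, a, d] x = ap [d, a, b, a] x" if q: "perm3 a b d" for a b d x
  proof (rule ccontr)
    assume "ap [a, b, a, d] x ~= ap [d, a, b, a] x"
    then have "ap [a, b, a, d] x = ap [b, a, d, a] x" using PQ[OF q, of x] by blast
    note e = squares_from_Q[OF q this]
    define y where "y = ap [a, b] x"
    note l = perm3D[OF q] and n = perm3_neq[OF q]
    have "C y (col a (ap [b, a, b, a] y))" by (rule C_last[OF perm3_rot(1)[OF q]])
    moreover have "C y (col d (ap [b, a, b, a] y))" using C_last[OF perm3_rot(5)[OF q], of y] e unfolding y_def by simp
    ultimately have "{a, d} \<subseteq> {l. l < 3 \<and> C y (col l (ap [b, a, b, a] y))}" using l by auto
    then have "card {a, d} \<le> card {l. l < 3 \<and> C y (col l (ap [b, a, b, a] y))}" by (intro card_mono) auto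
    then show False using m[OF F_sq[OF perm3_rot(1)[OF q]], of y] n by simp
  qed
  show ?thesis by (rule Q_from_squares[OF squares_from_PV[OF P V[OF nd nt]] p])
qed

text \<open>The neighbour of the third colour is in \<open>C\<close> as well; \<open>F_rep\<close>
  then writes the square as another square, and \<open>sq_neq'\<close> excludes one of the two
  candidates.\<close>

lemma Q_m3:
  assumes m: "!!x y. F x y ==> card {l. l < 3 \<and> C x (col l y)} = 3" and p: "perm3 i j k"
  shows "ap [i, j, i, k] x = ap [j, i, k, i] x"
proof (rule Q_from_squares[OF _ p])
  fix i j k y assume p: "perm3 i j k"
  have "{l. l < 3 \<and> C y (col l (ap [j, i, j, i] y))} = {..<3}"
    using m[OF F_sq[OF perm3_rot(1)[OF p]], of y] by (intro card_subset_eq) auto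
  then have "C y (col k (ap [j, i, j, i] y))" using perm3D[OF p] by blast
  from F_rep[OF perm3_rot(5)[OF perm3_rot(4)[OF perm3_rot(1)[OF p]]] F_sq[OF perm3_rot(1)[OF p]]]
  have "ap [j, i, j, i] y = ap [i, k, i, k] y \<or> ap [j, i, j, i] y = ap [j, k, j, k] y"
    using F_rep[OF perm3_rot(5)[OF p] F_sq[OF perm3_rot(1)[OF p]] \<open>C y (col k (ap [j, i, j, i] y))\<close>] by blast
  moreover have "ap [j, i, j, i] y ~= ap [j, k, j, k] y" using sq_neq'[OF perm3_rot(5)[OF p], of y] by blast
  ultimately show "ap [i, k, i, k] y = ap [j, i, j, i] y" by simp
qed

text \<open>Exactly one neighbour of the end of a square lies outside \<open>C\<close>. It belongs
  to \<open>G\<close>, and as \<open>G\<close> is a single class, each of its members is next to the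
  end of a square. The squares at \<open>a0\<close> are too few for this: two words in
  \<open>G\<close> coincide, and \<open>V\<close> and \<open>swap_degen\<close> make the coincidence
  degenerate.\<close>

lemma not_m2:
  assumes m: "!!x y. F x y ==> card {l. l < 3 \<and> C x (col l y)} = 2"
  shows False
proof -
  have S: "{l. l < 3 \<and> C x (col l y)} = {l\<in>{i, j, k}. C x (col l y)}" if "perm3 i j k" for x y i j k
    using perm3_set[OF that] by auto
  have A: "C x (col i y)" "C x (col j y)" if p: "perm3 i j k" and f: "F x y" and nk: "\<not> C x (col k y)" for x y i j k
  proof -
    have "{l. l < 3 \<and> C x (col l y)} \<subseteq> {i, j}" unfolding S[OF p] using nk by auto
    moreover have "card {i, j} = 2" using perm3_neq[OF p] by simp
    ultimately have "{l. l < 3 \<and> C x (col l y)} = {i, j}" using m[OF f] by (intro card_subset_eq) auto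
    then show "C x (col i y)" "C x (col j y)" by blast+
  qed
  have B: "\<exists>l<3. \<not> C x (col l y)" if f: "F x y" for x y
  proof (rule ccontr)
    assume "\<not> ?thesis"
    then have "{l. l < 3 \<and> C x (col l y)} = {..<3}" by auto
    then show False using m[OF f] by simp
  qed
  have core: "G x (ap [i, j, i, j, k] x)" if p: "perm3 i j k" and nc: "\<not> C x (ap [i, j, i, j, k] x)" for i j k x
  proof -
    note l = perm3D[OF p] and n = perm3_neq[OF p]
    define v where "v = ap [i, j, i, j, k] x"
    have "adj (ap [i, j, i, j] x) v" using col(1)[OF l(3), of "ap [i, j, i, j] x"] unfolding col_ap v_def .
    then obtain z where z: "F v z" "adj z x" using step_back[OF F_inv adj_inv F_sq[OF p]] by blast
    obtain e where e: "e < 3" "z = col e x" using z(2) adj_sym[of z x] unfolding adj_col by blast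
    \<comment> \<open>Equal images have equal signs, and only colour \<open>k\<close> for the edge
      from \<open>x\<close> to \<open>z\<close> accounts for the sign on axis
      \<open>k\<close>.\<close>
    have "u v \<bullet> u z = 1" using z(1) unfolding F_def by blast
    then have "u v = u z" by (rule unit_eqI[OF uu uu])
    then have "sg k v = sg k z" unfolding sg_def by simp
    moreover have "sg k v = \<theta> ^ length [i, j, i, j, k] * (-1) ^ count_list [i, j, i, j, k] k * sg k x"
      unfolding v_def by (rule sg_ap) (use l in auto)
    ultimately have "- \<theta> * sg k x = \<theta> * (if e = k then -1 else 1) * sg k x"
      unfolding e(2) sg_col[OF e(1) l(3)] using n by simp
    then have "e = k" using theta_nz sg_nz[OF l(3), of x] by (auto split: if_splits)
    then have f: "F (col k x) v" using class_inv_sym[OF F_inv, of v z] z(1) e(2) by simp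
    have nv: "\<not> C x v" using nc unfolding v_def .
    have "C (col k x) (col i v) \<or> C (col k x) (col j v)" using A(1)[OF perm3_rot(2)[OF p] f] by blast
    then show ?thesis
    proof
      assume "C (col k x) (col i v)"
      from F_rep[OF perm3_rot(1)[OF p] f this]
      have "v = ap [k, j, i, j, i] x \<or> v = ap [i, k, i] x" using l by (simp add: ap_simps col_col)
      then have v: "v = col i (ap [k, j, i, j] x)" using nv C_pred[OF perm3_rot(5)[OF p], of x] by (auto simp: ap_simps)
      have "ap [k, j, i, j] x = ap [j, i, j, k] x \<or> ap [k, j, i, j] x = ap [j, k, j, i] x" by (rule PQ'[OF perm3_rot(1)[OF p]])
      then have "v = ap [j, i, j, k, i] x \<or> v = ap [j, k, j] x" unfolding v using l by (auto simp: ap_simps col_col)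
      then show ?thesis using nv C_pred[OF perm3_rot(2)[OF p], of x] G_word[OF nd nt] perm3_rot(1)[OF p] unfolding v_def[symmetric] by metis
    next
      assume "C (col k x) (col j v)"
      from F_rep[OF p f this]
      have "v = ap [k, i, j, i, j] x \<or> v = ap [j, k, j] x" using l by (simp add: ap_simps col_col)
      then have v: "v = col j (ap [k, i, j, i] x)" using nv C_pred[OF perm3_rot(2)[OF p], of x] by (auto simp: ap_simps)
      have "ap [k, i, j, i] x = ap [i, j, i, k] x \<or> ap [k, i, j, i] x = ap [i, k, i, j] x" by (rule PQ'[OF p])
      then have "v = ap [i, j, i, k, j] x \<or> v = ap [i, k, i] x" unfolding v using l by (auto simp: ap_simps col_col)
      then show ?thesis using nv C_pred[OF perm3_rot(5)[OF p], of x] G_word[OF nd nt] p unfolding v_def[symmetric] by metis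
    qed
  qed
  have reps: "(y = ap [i, j, i, j] x \<or> y = ap [k, j, k, j] x) \<and> (y = ap [j, i, j, i] x \<or> y = ap [k, i, k, i] x)"
    if p: "perm3 i j k" and f: "F x y" and nk: "\<not> C x (col k y)" for x y i j k
    using F_rep[OF p f A(2)[OF p f nk]] F_rep[OF perm3_rot(1)[OF p] f A(1)[OF p f nk]] by blast
  have third: "G x (col k y)" if p: "perm3 i j k" and f: "F x y" and nk: "\<not> C x (col k y)" for x y i j k
  proof -
    have "y = ap [i, j, i, j] x \<or> y = ap [j, i, j, i] x"
      using reps[OF that] sq_neq'[OF p, of x] by metis
    then show ?thesis using core[OF p, of x] core[OF perm3_rot(1)[OF p], of x] nk by (auto simp: ap_simps)
  qed
  have p: "perm3 0 1 2" unfolding perm3_def by simp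
  obtain l where l: "l < 3" "\<not> C a0 (col l (ap [0, 1, 0, 1] a0))" using B[OF F_sq[OF p]] by blast
  define v0 where "v0 = col l (ap [0, 1, 0, 1] a0)"
  have g0: "G a0 v0"
  proof -
    have "\<exists>i j. perm3 i j l" using perm3_cases[OF p l(1)] perm3_rot[OF p] p by metis
    then show ?thesis using third[OF _ F_sq[OF p]] l(2) unfolding v0_def by blast
  qed
  have gF: "\<exists>y. F x y \<and> adj y v" if "G x v" for x v
  proof -
    have "ap [0, 1, 0, 1] a0 \<in> {y. F a0 y \<and> adj y v0}" using F_sq[OF p] col(1)[OF l(1)] unfolding v0_def by blast
    then have "card {y. F a0 y \<and> adj y v0} > 0" by (auto simp: card_gt_0_iff)
    moreover have "card {y. F a0 y \<and> adj y v0} = card {y. F x y \<and> adj y v}"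
      by (rule class_invD[OF class_inv_card[OF F_inv adj_inv] singleD[OF G_single[OF nd nt] g0 that]])
    ultimately have "{y. F x y \<and> adj y v} ~= {}" by (metis card.empty less_numeral_extra(3))
    then show ?thesis by blast
  qed
  have gF': "F x (col k (ap [i, j, i, k, j] x))" if p: "perm3 i j k" for i j k x
  proof -
    note l = perm3D[OF p] and n = perm3_neq[OF p]
    define v where "v = ap [i, j, i, k, j] x"
    have "G x v" unfolding v_def using G_word[OF nd nt] p by blast
    then obtain y where y: "F x y" "adj y v" using gF by blast
    obtain e where e: "e < 3" "y = col e v" using y(2) adj_sym[of y v] unfolding adj_col by blast
    have "u x \<bullet> u y = 1" using y(1) unfolding F_def by blast
    then have "u x = u y" by (rule unit_eqI[OF uu uu])
    then have "sg k x = sg k y" unfolding sg_def by simp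
    moreover have "sg k v = \<theta> ^ length [i, j, i, k, j] * (-1) ^ count_list [i, j, i, k, j] k * sg k x"
      unfolding v_def by (rule sg_ap) (use l in auto)
    ultimately have "sg k x = \<theta> * (if e = k then -1 else 1) * (- \<theta> * sg k x)"
      unfolding e(2) sg_col[OF e(1) l(3)] using n by simp
    then have "e = k" using sg_nz[OF l(3), of x] by (auto split: if_splits)
    then show ?thesis using y(1) e(2) unfolding v_def by simp
  qed
  note l3 = perm3D[OF p]
  define y1 where "y1 = col 2 (ap [0, 1, 0, 2, 1] a0)"
  define y2 where "y2 = col 2 (ap [1, 0, 1, 2, 0] a0)"
  have f: "F a0 y1" "F a0 y2" unfolding y1_def y2_def by (rule gF'[OF p], rule gF'[OF perm3_rot(1)[OF p]])
  have c2y: "col 2 y1 = ap [0, 1, 0, 2, 1] a0" "col 2 y2 = ap [1, 0, 1, 2, 0] a0" unfolding y1_def y2_def by (simp_all add: col_col)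
  have nc: "\<not> C a0 (col 2 y1)" "\<not> C a0 (col 2 y2)" unfolding c2y using G_notC[OF nd nt p] G_notC[OF nd nt perm3_rot(1)[OF p]] by blast+
  have "y1 = y2"
  proof (rule ccontr)
    assume ne: "y1 ~= y2"
    \<comment> \<open>A third end of a square: its neighbour of colour 2 is in \<open>C\<close>, so
      its exceptional colour is 0 or 1, and then \<open>F_rep\<close> makes it coincide with
      \<open>y1\<close> or \<open>y2\<close>.\<close>
    define t where "t = ap [0, 2, 0, 2] a0"
    have tF: "F a0 t" unfolding t_def by (rule F_sq[OF perm3_rot(5)[OF p]])
    have tc: "C a0 (col 2 t)" unfolding t_def by (rule C_last[OF perm3_rot(5)[OF p]])
    have tn: "t ~= y1" "t ~= y2" using tc nc by auto
    obtain l where l: "l < 3" "\<not> C a0 (col l t)" using B[OF tF] by blast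
    note r1 = reps[OF p f(1) nc(1)] and r2 = reps[OF p f(2) nc(2)]
    have "l = 0 \<or> l = 1" using l tc perm3_cases[OF p l(1)] by auto
    then show False
    proof
      assume "l = 0"
      then have "C a0 (col 1 t)" using A(1)[OF perm3_rot(2)[OF p] tF] l(2) by simp
      then have "t = ap [0, 1, 0, 1] a0 \<or> t = ap [2, 1, 2, 1] a0" by (rule F_rep[OF p tF])
      then show False using r1 r2 ne tn by metis
    next
      assume "l = 1"
      then have "C a0 (col 0 t)" using A(2)[OF perm3_rot(3)[OF p] tF] l(2) by simp
      then have "t = ap [1, 0, 1, 0] a0 \<or> t = ap [2, 0, 2, 0] a0" by (rule F_rep[OF perm3_rot(1)[OF p] tF])
      then show False using r1 r2 ne tn by metis
    qed
  qed
  then have "ap [0, 1, 0, 2, 1] a0 = ap [1, 0, 1, 2, 0] a0" using c2y by simp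
  also have "\<dots> = ap [0, 2, 1, 0, 1] a0" by (rule V[OF nd nt perm3_rot(1)[OF p]])
  finally show False using swap_degen[OF p] nd by blast
qed

lemma Q_generic: "perm3 i j k ==> ap [i, j, i, k] x = ap [j, i, k, i] x"
proof -
  assume p: "perm3 i j k"
  define m where "m = card {l. l < 3 \<and> C x (col l (ap [i, j, i, j] x))}"
  have c: "card {l. l < 3 \<and> C x' (col l y')} = m" if "F x' y'" for x' y'
    unfolding m_def by (rule F_const[OF that F_sq[OF p]])
  have "m \<le> card {..<3::nat}" unfolding m_def by (intro card_mono) auto
  moreover have "m > 0" unfolding m_def using C_last[OF p, of x] perm3D(2)[OF p] by (auto simp: card_gt_0_iff)
  moreover have "card {..<3::nat} = 3" by simp
  ultimately have "m = 1 \<or> m = 2 \<or> m = 3" by arith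
  then show ?thesis
  proof (elim disjE)
    assume "m = 1" then show ?thesis using Q_m1[OF _ p] c by blast
  next
    assume "m = 2" then show ?thesis using not_m2 c by blast
  next
    assume "m = 3" then show ?thesis using Q_m3[OF _ p] c by blast
  qed
qed

end

text \<open>With the three involutions, this relation presents the group tabulated in
  \<open>colour_entries\<close>.\<close>

theorem Q: "perm3 i j k ==> ap [i, j, i, k] x = ap [j, i, k, i] x"
  using degen_Q twist_Q Q_generic by blast

end

section \<open>Coset tables\<close>

definition act :: "(nat => 's => 's) => nat list => 's => 's" where "act g w = fold g w"

lemma act_simps: "act g [] s = s" "act g (i # w) s = act g w (g i s)" "act g (v @ w) s = act g w (act g v s)"
  unfolding act_def by simp_all

text \<open>Indexed by binary digits, so that the many lookups during evaluation stay short.\<close>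

datatype 'a trie = Tip | Bin 'a "'a trie" "'a trie"

fun look_num :: "'a trie => num => 'a" where
  "look_num (Bin a l r) num.One = a"
| "look_num (Bin a l r) (num.Bit0 k) = look_num l k"
| "look_num (Bin a l r) (num.Bit1 k) = look_num r k"
| "look_num Tip k = undefined"

text \<open>The value put into a missing inner node is a placeholder; it does not occur in
  \<open>trie_of\<close>, which fills positions in increasing order and thus parents first.\<close>

fun insert_num :: "num => 'a => 'a trie => 'a trie" where
  "insert_num num.One v Tip = Bin v Tip Tip"
| "insert_num num.One v (Bin a l r) = Bin v l r"
| "insert_num (num.Bit0 k) v Tip = Bin v (insert_num k v Tip) Tip"
| "insert_num (num.Bit0 k) v (Bin a l r) = Bin a (insert_num k v l) r"
| "insert_num (num.Bit1 k) v Tip = Bin v Tip (insert_num k v Tip)"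
| "insert_num (num.Bit1 k) v (Bin a l r) = Bin a l (insert_num k v r)"

text \<open>Shifted by one because numerals start at 1.\<close>

definition look :: "'a trie => nat => 'a" where "look t p = look_num t (num_of_nat (Suc p))"

fun trie_from :: "num => 'a list => 'a trie => 'a trie" where
  "trie_from k [] t = t"
| "trie_from k (x # xs) t = trie_from (Num.inc k) xs (insert_num k x t)"

definition trie_of :: "'a list => 'a trie" where "trie_of xs = trie_from num.One xs Tip"

type_synonym coset_entry = "nat \<times> nat \<times> nat"

definition move :: "coset_entry list trie => nat => nat => nat" where "move T i p = fst (look T p ! i)"

text \<open>An entry \<open>(q, k, m)\<close> at position \<open>p\<close> for the \<open>i\<close>-th generator gives the image \<open>q\<close> of \<open>p\<close>. It is justified for
  \<open>m = 0\<close> as an edge of the spanning tree given by the words \<open>W\<close>, and otherwise because it closes the relator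
  \<open>rs ! (m - 1)\<close>, all other edges of which have rank less than \<open>k\<close>.\<close>

fun walk :: "coset_entry list trie => nat => nat => nat list => nat option" where
  "walk T k p [] = Some p"
| "walk T k p (i # w) = (case look T p ! i of (q, k', m) => if k' < k then walk T k q w else None)"

definition entry_ok :: "coset_entry list trie => nat list trie => nat list list => nat => nat => bool" where
  "entry_ok T W rs p i = (case look T p ! i of (q, k, m) =>
     if m = 0 then look W q = look W p @ [i]
     else m \<le> length rs \<and> (case rs ! (m - 1) of [] => False | j # r => j = i \<and> walk T k q r = Some p))"

text \<open>A relator may be closed at any of its edges; its rotations let it start there.\<close>

definition rotations :: "nat list => nat list list" where
  "rotations r = map (\<lambda>k. drop k r @ take k r) [0..<length r]"

definition all_rotations :: "nat list list => nat list list" where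
  "all_rotations base = concat (map rotations base)"

definition deduce_ok :: "nat => nat list => coset_entry list trie => nat list trie => nat list list => bool" where
  "deduce_ok n gs T W rs \<longleftrightarrow> list_all (\<lambda>p. list_all (entry_ok T W rs p) gs) [0..<n]"

definition shape_ok :: "nat => nat => coset_entry list trie => nat list trie => nat list => nat list list => bool" where
  "shape_ok n k T W iv base \<longleftrightarrow> 0 < n \<and> list_all (\<lambda>i. i < k) iv \<and> look W 0 = [] \<and> length iv = k \<and>
     list_all (\<lambda>p. list_all (\<lambda>i. move T i p < n) [0..<k] \<and> list_all (\<lambda>i. i < k) (look W p) \<and>
       fold (move T) (look W p) 0 = p \<and> list_all (\<lambda>r. fold (move T) r p = p) base) [0..<n] \<and>
     list_all (list_all (\<lambda>i. i < k)) base \<and> list_all (\<lambda>i. [i, iv ! i] \<in> set base) [0..<k]"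

locale coset_table =
  fixes n k :: nat and T :: "coset_entry list trie" and W :: "nat list trie" and iv :: "nat list" and base :: "nat list list"
  assumes shape: "shape_ok n k T W iv base" and ded: "deduce_ok n [0..<k] T W (all_rotations base)"
begin

lemma n0: "0 < n"
  and move_lt: "p < n ==> i < k ==> move T i p < n" and iv_lt: "i < k ==> iv ! i < k"
  and W_lt: "p < n ==> set (look W p) \<subseteq> {..<k}" and base_lt: "r \<in> set base ==> set r \<subseteq> {..<k}" and W0: "look W 0 = []"
  and pos: "p < n ==> fold (move T) (look W p) 0 = p" and tab_rel: "r \<in> set base ==> p < n ==> fold (move T) r p = p"
  and inv_rel: "i < k ==> [i, iv ! i] \<in> set base" and entry: "p < n ==> i < k ==> entry_ok T W (all_rotations base) p i"
  using shape ded unfolding shape_ok_def deduce_ok_def list_all_iff by auto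

context
  fixes g :: "nat => 's => 's"
  assumes rel: "!!r s. r \<in> set base ==> act g r s = s"
begin

lemma g_inv: "i < k ==> g (iv ! i) (g i s) = s"
  using rel[OF inv_rel, of i s] by (simp add: act_simps)

lemma act_inj: "set w \<subseteq> {..<k} ==> act g w s = act g w t ==> s = t"
proof (induction w arbitrary: s t)
  case (Cons i w)
  have "g i s = g i t" by (rule Cons.IH) (use Cons.prems in \<open>simp_all add: act_simps\<close>)
  then have "g (iv ! i) (g i s) = g (iv ! i) (g i t)" by simp
  moreover have "i < k" using Cons.prems(1) by simp
  ultimately show ?case using g_inv by metis
qed (simp add: act_simps)

text \<open>A rotation is a conjugate of the relator, and words act injectively.\<close>

lemma act_rotation: "r \<in> set (all_rotations base) ==> act g r s = s \<and> set r \<subseteq> {..<k}"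
proof -
  assume "r \<in> set (all_rotations base)"
  then obtain b j where b: "b \<in> set base" "r = drop j b @ take j b" unfolding all_rotations_def rotations_def by auto
  have sub: "set (take j b) \<subseteq> {..<k}" "set (drop j b) \<subseteq> {..<k}" using base_lt[OF b(1)] set_take_subset set_drop_subset by fast+
  have "act g (drop j b) (act g (take j b) t) = t" for t
    using rel[OF b(1), of t] act_simps(3)[of g "take j b" "drop j b" t] by simp
  then have "act g (drop j b) (act g r s) = act g (drop j b) s" unfolding b(2) act_simps(3) by simp
  then show ?thesis using act_inj[OF sub(2)] sub b(2) by auto
qed

lemma walk_valid:
  assumes "!!p i. p < n ==> i < k ==> fst (snd (look T p ! i)) < r ==> g i (act g (look W p) s) = act g (look W (move T i p)) s"
  shows "set w \<subseteq> {..<k} ==> p < n ==> walk T r p w = Some q ==> act g w (act g (look W p) s) = act g (look W q) s"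
proof (induction w arbitrary: p)
  case (Cons i w)
  obtain p' k' m where e: "look T p ! i = (p', k', m)" by (metis prod_cases3)
  have k': "k' < r" and w: "walk T r p' w = Some q" using Cons.prems(3) unfolding walk.simps e by (auto split: if_splits)
  have p': "p' = move T i p" unfolding move_def e by simp
  have "p' < n" unfolding p' using move_lt Cons.prems by simp
  moreover have "g i (act g (look W p) s) = act g (look W p') s" unfolding p' by (rule assms) (use Cons.prems e k' in auto)
  ultimately show ?case using Cons.IH[of p'] Cons.prems(1) w by (simp add: act_simps)
qed (simp add: act_simps)

text \<open>Induction on the rank: an entry closed by a relator rests on edges of smaller rank only,
  and the rest \<open>v\<close> of the relator is cancelled by injectivity.\<close>

lemma move_rank: "p < n ==> i < k ==> fst (snd (look T p ! i)) = r ==> g i (act g (look W p) s) = act g (look W (move T i p)) s"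
proof (induction r arbitrary: p i rule: less_induct)
  case (less r)
  obtain q m where t: "look T p ! i = (q, r, m)" using less.prems(3) by (metis prod.collapse)
  have q: "move T i p = q" unfolding move_def t by simp
  have ok: "if m = 0 then look W q = look W p @ [i] else m \<le> length (all_rotations base) \<and>
    (case all_rotations base ! (m - 1) of [] => False | j # v => j = i \<and> walk T r q v = Some p)"
    using entry[OF less.prems(1,2)] unfolding entry_ok_def t by simp
  show ?case
  proof (cases "m = 0")
    case True
    then show ?thesis using ok q by (simp add: act_simps)
  next
    case False
    then have m: "m - 1 < length (all_rotations base)" and c: "case all_rotations base ! (m - 1) of [] => False | j # v => j = i \<and> walk T r q v = Some p"
      using ok by auto
    then obtain v where v: "all_rotations base ! (m - 1) = i # v" "walk T r q v = Some p" by (cases "all_rotations base ! (m - 1)") auto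
    have rr: "act g (i # v) t = t" "set (i # v) \<subseteq> {..<k}" for t using act_rotation[OF nth_mem[OF m], of t] unfolding v(1) by auto
    have qn: "q < n" using move_lt[OF less.prems(1,2)] unfolding q .
    have "act g v (g i (act g (look W p) s)) = act g (look W p) s" using rr(1) by (simp add: act_simps)
    also have "\<dots> = act g v (act g (look W q) s)"
      by (rule walk_valid[OF less.IH _ qn v(2), symmetric]) (use rr(2) in auto)
    finally show ?thesis unfolding q using act_inj rr(2) by auto
  qed
qed

lemma move: "p < n ==> i < k ==> g i (act g (look W p) s) = act g (look W (move T i p)) s"
  by (rule move_rank[OF _ _ refl])

lemma move_word: "set w \<subseteq> {..<k} ==> p < n ==>
    fold (move T) w p < n \<and> act g w (act g (look W p) s) = act g (look W (fold (move T) w p)) s"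
proof (induction w arbitrary: p)
  case (Cons i w)
  then show ?case using Cons.IH[of "move T i p"] move_lt[of p i] move[of p i s] by (simp add: act_simps)
qed (simp add: act_simps)

lemma act_pos: "set w \<subseteq> {..<k} ==> act g w s = act g (look W (fold (move T) w 0)) s"
  using move_word[of w 0 s] n0 W0 by (simp add: act_simps)

definition inverse_word :: "nat list => nat list" where "inverse_word w = map ((!) iv) (rev w)"

lemma inverse_word: "set w \<subseteq> {..<k} ==> act g (inverse_word w) (act g w s) = s \<and> set (inverse_word w) \<subseteq> {..<k}"
proof (induction w arbitrary: s)
  case (Cons i w)
  then show ?case using g_inv[of i s] iv_lt unfolding inverse_word_def by (auto simp: act_simps)
qed (simp add: act_simps inverse_word_def)

end

text \<open>The coset table is itself an action of the group, which is therefore regular on the positions.\<close>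

lemma table_action: "r \<in> set base ==> act (\<lambda>i p. if p < n \<and> i < k then move T i p else p) r s = s"
  "set w \<subseteq> {..<k} ==> p < n ==> act (\<lambda>i p. if p < n \<and> i < k then move T i p else p) w p = fold (move T) w p"
proof -
  let ?g = "\<lambda>i p. if p < n \<and> i < k then move T i p else p"
  have big: "act ?g w p = p" if "\<not> p < n" for w p
    using that by (induction w) (simp_all add: act_simps)
  show *: "set w \<subseteq> {..<k} ==> p < n ==> act ?g w p = fold (move T) w p" for w p
  proof (induction w arbitrary: p)
    case (Cons i w)
    then show ?case using Cons.IH[of "move T i p"] move_lt[of p i] by (simp add: act_simps)
  qed (simp add: act_simps)
  show "r \<in> set base ==> act ?g r s = s"
    using big * base_lt tab_rel by (cases "s < n") simp_all
qed

text \<open>Let \<open>v\<close> run back along the word of \<open>p\<close> and then along that of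
  \<open>q\<close>, and let \<open>h\<close> be its position. The word of \<open>h\<close> acts like
  \<open>v\<close>, both in the table, where \<open>v\<close> moves \<open>p\<close> to
  \<open>q\<close>, and in the given action, where \<open>v\<close> fixes the common image.\<close>

lemma collision:
  fixes g :: "nat => 's => 's"
  assumes rel: "!!r s. r \<in> set base ==> act g r s = s"
    and pq: "p < n" "q < n" and e: "act g (look W p) s = act g (look W q) s"
  shows "\<exists>h<n. fold (move T) (look W h) p = q \<and> act g (look W h) (act g (look W p) s) = act g (look W p) s"
proof -
  let ?t = "\<lambda>i p. if p < n \<and> i < k then move T i p else p"
  define v where "v = inverse_word (look W p) @ look W q"
  define h where "h = fold (move T) v 0"
  have iw: "set (inverse_word (look W p)) \<subseteq> {..<k}" "act g (inverse_word (look W p)) (act g (look W p) s) = s"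
    "act ?t (inverse_word (look W p)) (act ?t (look W p) 0) = 0"
    using inverse_word[OF rel W_lt[OF pq(1)]] inverse_word[of ?t, OF table_action(1) W_lt[OF pq(1)]] by blast+
  have v: "set v \<subseteq> {..<k}" unfolding v_def using iw(1) W_lt[OF pq(2)] by simp
  have h: "h < n" unfolding h_def using move_word[of ?t, OF table_action(1) v n0] by simp
  have "act g (look W h) (act g (look W p) s) = act g v (act g (look W p) s)" unfolding h_def by (rule act_pos[OF rel v, symmetric])
  also have "\<dots> = act g (look W p) s" unfolding v_def act_simps(3) iw(2) by (rule e[symmetric])
  finally have 1: "act g (look W h) (act g (look W p) s) = act g (look W p) s" .
  have "fold (move T) (look W h) p = act ?t (look W h) p" using table_action(2)[OF W_lt[OF h] pq(1)] by simp
  also have "\<dots> = act ?t v p" unfolding h_def by (rule act_pos[of ?t, OF table_action(1) v, symmetric])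
  also have "\<dots> = act ?t (look W q) (act ?t (inverse_word (look W p)) (act ?t (look W p) 0))"
    unfolding v_def act_simps(3) using table_action(2)[OF W_lt[OF pq(1)] n0] pos[OF pq(1)] by simp
  also have "\<dots> = q" unfolding iw(3) using table_action(2)[OF W_lt[OF pq(2)] n0] pos[OF pq(2)] by simp
  finally show ?thesis using h 1 by blast
qed

end

text \<open>\<open>idx\<close> sends a position to its vertex in the quotient, \<open>rep\<close>
  picks a position for each vertex, and \<open>nbp\<close> gives the adjacent positions.\<close>

definition quotient_ok :: "nat list list => nat => (nat => nat list) => nat trie => nat trie => bool" where
  "quotient_ok nb m nbp rep idx \<longleftrightarrow> nb ~= [] \<and> table_ok nb \<and>
     list_all (\<lambda>q. look idx q < length nb) [0..<m] \<and>
     list_all (\<lambda>v. look rep v < m \<and> list_all (\<lambda>q. q < m) (nbp (look rep v)) \<and> set (map (look idx) (nbp (look rep v))) = set (nb ! v) \<and> look idx (look rep v) = v) [0..<length nb]"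

context pm_rep
begin

lemma rooted_model_of_lists:
  assumes "nb ~= []" and tab: "table_ok nb" and v: "!!x. length (v x) = length nb" "!!x. v x ! 0 = x" "!!x. distinct (v x)"
    "!!x p. p < length nb ==> N (v x ! p) = (!) (v x) ` set (nb ! p)"
  shows "rooted_model adj nb (\<lambda>x. (!) (v x))"
proof -
  have "bij_betw ((!) (v x)) {..<length nb} UNIV" for x
  proof -
    have "y \<in> set (v x)" for y
    proof (rule conn_induct[of "\<lambda>y. y \<in> set (v x)" x])
      show "x \<in> set (v x)" using v(1,2)[of x] \<open>nb ~= []\<close> by (metis length_greater_0_conv nth_mem)
      fix y z assume "y \<in> set (v x)" "adj y z"
      then obtain p where p: "p < length nb" "y = v x ! p" using v(1) by (metis in_set_conv_nth)
      then have "z \<in> (!) (v x) ` set (nb ! p)" using v(4)[of p x] \<open>adj y z\<close> by auto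
      then show "z \<in> set (v x)" using tab nth_mem[OF p(1)] v(1) unfolding table_ok_def by auto
    qed
    then show ?thesis using bij_betw_nth[OF v(3)[of x], of "{..<length nb}" UNIV] v(1)[of x] by auto
  qed
  then show ?thesis unfolding rooted_model_def using v(2,4) unfolding N_def by blast
qed

text \<open>\<open>B x\<close> labels vertices by positions, starting at \<open>x\<close>; the last
  two hypotheses say that its fibres are those of \<open>idx\<close>.\<close>

lemma quotient_model:
  assumes ok: "quotient_ok nb m nbp rep idx" and B0: "!!x. B x (look rep 0) = x"
    and N: "!!x q. q < m ==> N (B x q) = B x ` set (nbp q)"
    and idx: "!!x q. q < m ==> B x q = B x (look rep (look idx q))"
    and inj: "!!x p q. p < m ==> q < m ==> B x p = B x q ==> look idx p = look idx q"
  shows "rooted_model adj nb (\<lambda>x. (!) (map (\<lambda>v. B x (look rep v)) [0..<length nb]))"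
proof -
  let ?n = "length nb" and ?vs = "\<lambda>x. map (\<lambda>v. B x (look rep v)) [0..<length nb]"
  note o = ok[unfolded quotient_ok_def list_all_iff]
  have nb: "nb ~= []" "table_ok nb" using o by blast+
  have rep: "look rep v < m" "look idx (look rep v) = v" if "v < ?n" for v using o that by auto
  show ?thesis
  proof (rule rooted_model_of_lists[OF nb])
    fix x
    show "length (?vs x) = ?n" by simp
    show "?vs x ! 0 = x" using B0[of x] nb(1) by simp
    have "inj_on (\<lambda>v. B x (look rep v)) {0..<?n}" by (rule inj_onI) (use inj rep in \<open>metis atLeastLessThan_iff\<close>)
    then show "distinct (?vs x)" by (simp add: distinct_map)
    fix p assume p: "p < ?n"
    have s: "set (nb ! p) = look idx ` set (nbp (look rep p))" and l: "\<forall>q\<in>set (nbp (look rep p)). q < m" using o p by auto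
    have "N (?vs x ! p) = B x ` set (nbp (look rep p))" using N[OF rep(1)[OF p], of x] p by simp
    also have "\<dots> = (\<lambda>q. ?vs x ! (look idx q)) ` set (nbp (look rep p))"
    proof (rule image_cong[OF refl])
      fix q assume "q \<in> set (nbp (look rep p))"
      then have "q < m" using l by blast
      moreover have "look idx q < ?n" using o \<open>q < m\<close> by auto
      ultimately show "B x q = ?vs x ! (look idx q)" using idx[of q x] by simp
    qed
    finally show "N (?vs x ! p) = (!) (?vs x) ` set (nb ! p)" unfolding s image_image .
  qed
qed

end

section \<open>The group of order 48 and its quotients\<close>

definition colour_entries :: "coset_entry list list" where
    "colour_entries = [[(1, 0, 0), (23, 0, 0), (24, 0, 0)], [(0, 1, 1), (2, 0, 0), (25, 0, 0)], [(3, 0, 0), (1,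
    1, 3), (26, 0, 0)], [(2, 1, 1), (4, 0, 0), (27, 0, 0)], [(5, 2, 9), (3, 1, 3), (28, 2, 18)], [(4, 2, 13), (6, 2,
    26), (29, 1, 5)], [(7, 2, 30), (5, 2, 28), (30, 1, 5)], [(6, 2, 24), (8, 2, 26), (31, 1, 5)], [(9, 3, 9), (7, 2,
    28), (32, 1, 5)], [(8, 3, 13), (10, 3, 19), (33, 1, 5)], [(11, 3, 11), (9, 3, 19), (34, 1, 5)], [(10, 3, 11),
    (12, 3, 19), (35, 1, 5)], [(13, 4, 7), (11, 3, 19), (36, 1, 5)], [(12, 4, 7), (14, 3, 19), (37, 1, 5)], [(15, 3,
    11), (13, 3, 19), (38, 1, 5)], [(14, 3, 11), (16, 3, 19), (39, 1, 5)], [(17, 3, 13), (15, 3, 19), (40, 1, 5)],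
    [(16, 3, 9), (18, 2, 28), (41, 1, 5)], [(19, 2, 24), (17, 2, 26), (42, 1, 5)], [(18, 2, 30), (20, 2, 28), (43,
    1, 5)], [(21, 2, 13), (19, 2, 26), (44, 1, 5)], [(20, 2, 9), (22, 1, 3), (45, 2, 18)], [(23, 1, 1), (21, 0, 0),
    (46, 0, 0)], [(22, 0, 0), (0, 1, 3), (47, 0, 0)], [(29, 0, 0), (43, 0, 0), (0, 1, 5)], [(44, 0, 0), (30, 0, 0),
    (1, 1, 5)], [(31, 0, 0), (45, 0, 0), (2, 1, 5)], [(46, 2, 11), (32, 0, 0), (3, 1, 5)], [(33, 0, 0), (47, 1, 3),
    (4, 2, 20)], [(24, 1, 1), (34, 0, 0), (5, 0, 0)], [(35, 0, 0), (25, 1, 3), (6, 0, 0)], [(26, 1, 1), (36, 0, 0),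
    (7, 0, 0)], [(37, 3, 7), (27, 1, 3), (8, 0, 0)], [(28, 1, 1), (38, 2, 15), (9, 0, 0)], [(39, 2, 7), (29, 1, 3),
    (10, 0, 0)], [(30, 1, 1), (40, 2, 15), (11, 0, 0)], [(41, 3, 7), (31, 1, 3), (12, 0, 0)], [(32, 3, 7), (42, 1,
    3), (13, 0, 0)], [(43, 1, 1), (33, 2, 15), (14, 0, 0)], [(34, 2, 7), (44, 1, 3), (15, 0, 0)], [(45, 1, 1), (35,
    2, 15), (16, 0, 0)], [(36, 3, 7), (46, 1, 3), (17, 0, 0)], [(47, 1, 1), (37, 0, 0), (18, 0, 0)], [(38, 0, 0),
    (24, 1, 3), (19, 0, 0)], [(25, 1, 1), (39, 0, 0), (20, 0, 0)], [(40, 0, 0), (26, 1, 3), (21, 2, 20)], [(27, 2,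
    11), (41, 0, 0), (22, 1, 5)], [(42, 0, 0), (28, 0, 0), (23, 1, 5)]]"

definition colour_words :: "nat list list" where
    "colour_words = [[], [0], [0, 1], [0, 1, 0], [0, 1, 0, 1], [2, 0, 2], [0, 2, 1, 2], [0, 1, 2, 0, 2], [0, 1,
    0, 2, 1, 2], [1, 2, 1, 0, 2], [2, 0, 1, 2], [0, 2, 1, 0, 2], [0, 1, 2, 0, 1, 2], [1, 2, 0, 1, 2], [2, 1, 0, 2],
    [0, 2, 0, 1, 2], [0, 1, 2, 1, 0, 2], [1, 0, 2, 1, 2], [1, 2, 0, 2], [2, 1, 2], [0, 2, 0, 2], [1, 0, 1], [1, 0],
    [1], [2], [0, 2], [0, 1, 2], [0, 1, 0, 2], [1, 2, 1], [2, 0], [0, 2, 1], [0, 1, 2, 0], [0, 1, 0, 2, 1], [1, 2,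
    1, 0], [2, 0, 1], [0, 2, 1, 0], [0, 1, 2, 0, 1], [1, 2, 0, 1], [2, 1, 0], [0, 2, 0, 1], [0, 1, 2, 1, 0], [1, 0,
    2, 1], [1, 2, 0], [2, 1], [0, 2, 0], [0, 1, 2, 1], [1, 0, 2], [1, 2]]"

text \<open>The involutions, and \<open>Q\<close> as a relator with each colour in the role of
  \<open>i\<close>.\<close>

definition colour_rels :: "nat list list" where
    "colour_rels = [[0, 0], [1, 1], [2, 2], [0, 1, 0, 2, 0, 2, 0, 1], [1, 0, 1, 2, 1, 2, 1, 0], [2, 0, 2, 1, 2,
    1, 2, 0]]"

definition "colour_T = trie_of colour_entries"
definition "colour_W = trie_of colour_words"

lemma colour_table: "coset_table 48 3 colour_T colour_W [0, 1, 2] colour_rels"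
proof
  show "shape_ok 48 3 colour_T colour_W [0, 1, 2] colour_rels" by code_simp
  show "deduce_ok 48 [0..<3] colour_T colour_W (all_rotations colour_rels)" by code_simp
qed

text \<open>Positions are numbered so that the table is \<open>GP(24,5)\<close> itself: 0 to 23 form
  the rim with alternating colours 0 and 1, 24 to 47 are the inner vertices, and colour 2 joins
  both. Reducing both halves modulo \<open>4 * r\<close> gives \<open>GP(4r,5)\<close>.\<close>

definition octa_rep :: "nat => nat list" where "octa_rep r = [0..<4 * r] @ [24..<24 + 4 * r]"

definition octa_idx :: "nat => nat list" where
  "octa_idx r = map (\<lambda>q. q mod (4 * r)) [0..<24] @ map (\<lambda>q. 4 * r + q mod (4 * r)) [0..<24]"

text \<open>An element fixing a vertex preserves its signs, so its letter counts are all even or all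
  odd. The even ones sit at the multiples of 4; the odd ones, listed in \<open>od\<close>, are words
  in three distinct letters, which cannot close up in a graph without triangles.\<close>

definition kernel_ok :: "coset_entry list trie => nat list trie => nat list => bool" where
  "kernel_ok T W od \<longleftrightarrow> list_all (\<lambda>h.
     (even (count_list (look W h) 0) \<and> even (count_list (look W h) 1) \<and> even (count_list (look W h) 2) --> h \<in> set [0, 4, 8, 12, 16, 20]) \<and>
     (odd (count_list (look W h) 0) \<and> odd (count_list (look W h) 1) \<and> odd (count_list (look W h) 2) --> h \<in> set od)) [0..<48] \<and>
     od = map (\<lambda>w. fold (move T) w 0) [[0, 1, 2], [0, 2, 1], [1, 0, 2], [1, 2, 0], [2, 0, 1], [2, 1, 0]] \<and> fold (move T) [0, 1, 0, 1] 0 = 4"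

text \<open>With \<open>z\<close> the element \<open>0 1 0 1\<close> at position 4, position
  \<open>4 * m\<close> is \<open>z ^ m\<close>, of order six, and each colour conjugates
  \<open>z\<close> into its inverse; so the powers of \<open>z\<close> form a normal
  subgroup.\<close>

definition centre_ok :: "coset_entry list trie => nat list trie => bool" where
  "centre_ok T W \<longleftrightarrow> list_all (\<lambda>m.
     list_all (\<lambda>i. fold (move T) (look W (4 * m)) (move T i 0) = move T i (4 * ((6 - m) mod 6))) [0, 1, 2] \<and>
     list_all (\<lambda>m'. fold (move T) (look W (4 * m)) (4 * m') = 4 * ((m + m') mod 6)) [0..<6]) [0..<6]"

definition octa_ok :: "coset_entry list trie => nat list trie => nat list list => nat trie => nat trie => nat list => bool" where
  "octa_ok T W nb rep idx M \<longleftrightarrow> quotient_ok nb 48 (\<lambda>p. map (\<lambda>i. move T i p) [0, 1, 2]) rep idx \<and> look rep 0 = 0 \<and>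
     list_all (\<lambda>q. list_ex (\<lambda>m. fold (move T) (look W (4 * m)) (look rep (look idx q)) = q) M \<and>
       list_all (\<lambda>m. look idx (fold (move T) (look W (4 * m)) q) = look idx q) M) [0..<48]"

lemma kernel: "kernel_ok colour_T colour_W [26, 30, 46, 42, 34, 38]" by code_simp

lemma centre: "centre_ok colour_T colour_W" by code_simp

lemma octa_ok2: "octa_ok colour_T colour_W (gp_tab 8 5) (trie_of (octa_rep 2)) (trie_of (octa_idx 2)) [0, 2, 4]" by code_simp

lemma octa_ok3: "octa_ok colour_T colour_W (gp_tab 12 5) (trie_of (octa_rep 3)) (trie_of (octa_idx 3)) [0, 3]" by code_simp

lemma octa_ok6: "octa_ok colour_T colour_W (gp_tab 24 5) (trie_of (octa_rep 6)) (trie_of (octa_idx 6)) [0]" by code_simp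

context pm_octa
begin

lemma col_rels: "r \<in> set colour_rels ==> act col r x = x"
proof -
  have sq: "act col [i, j, i, k, i, k, i, j] x = x" if "perm3 i j k" for i j k
  proof -
    have "act col [i, j, i, k] x = act col [j, i, k, i] x" using Q[OF that, of x] unfolding ap_def act_def .
    then have "act col [i, k, i, j] (act col [i, j, i, k] x) = act col [i, k, i, j] (act col [j, i, k, i] x)" by simp
    then show ?thesis using perm3D[OF that] by (simp add: act_simps col_col)
  qed
  have "perm3 0 1 2" "perm3 1 0 2" "perm3 2 0 1" unfolding perm3_def by simp_all
  note p = this[THEN sq]
  assume "r \<in> set colour_rels"
  then show ?thesis unfolding colour_rels_def using p by (auto simp: act_simps col_col)
qed

interpretation ct: coset_table 48 3 colour_T colour_W "[0, 1, 2]" colour_rels by (rule colour_table)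

definition A :: "'x => nat => 'x" where "A x p = act col (look colour_W p) x"

abbreviation "cmove \<equiv> move colour_T"

lemma A_0: "A x 0 = x" unfolding A_def ct.W0 by (simp add: act_simps)

lemma A_col: "p < 48 ==> i < 3 ==> col i (A x p) = A x (cmove i p)"
  unfolding A_def by (rule ct.move[OF col_rels])

lemma A_A: "p < 48 ==> h < 48 ==> A (A x p) h = A x (fold cmove (look colour_W h) p)"
  unfolding A_def using ct.move_word[OF col_rels ct.W_lt] by metis

lemma kernel_mult4:
  assumes "h < 48" "A x h = x" shows "\<exists>m<6. h = 4 * m"
proof -
  let ?w = "look colour_W h"
  note k = kernel[unfolded kernel_ok_def list_all_iff]
  have w: "set ?w \<subseteq> {..<3}" by (rule ct.W_lt[OF assms(1)])
  have e: "ap ?w x = x" using assms(2) unfolding A_def act_def ap_def .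
  have s: "\<theta> ^ length ?w * (-1) ^ count_list ?w e = (1::real)" if "e < 3" for e
    using sg_ap[OF w that, of x] sg_nz[OF that, of x] unfolding e by simp
  have "\<theta> ^ length ?w = 1 \<or> \<theta> ^ length ?w = -1" using theta_cases by (cases "even (length ?w)") auto
  then show ?thesis
  proof
    assume "\<theta> ^ length ?w = 1"
    then have "even (count_list ?w e)" if "e < 3" for e using s[OF that] by (cases "even (count_list ?w e)") auto
    then have "even (count_list ?w 0)" "even (count_list ?w 1)" "even (count_list ?w 2)" by simp_all
    then have "h \<in> set [0, 4, 8, 12, 16, 20]" using k assms(1) by auto
    then have "h = 4 * (h div 4) \<and> h div 4 < 6" by auto
    then show ?thesis by blast
  next
    assume "\<theta> ^ length ?w = -1"
    then have "odd (count_list ?w e)" if "e < 3" for e using s[OF that] by (cases "even (count_list ?w e)") auto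
    then have "odd (count_list ?w 0)" "odd (count_list ?w 1)" "odd (count_list ?w 2)" by simp_all
    then have "h \<in> set [26, 30, 46, 42, 34, 38]" using k assms(1) by auto
    then have "h \<in> (\<lambda>w. fold cmove w 0) ` set [[0, 1, 2], [0, 2, 1], [1, 0, 2], [1, 2, 0], [2, 0, 1], [2, 1, 0]]"
      using k by (metis list.set_map)
    then obtain a b d where abd: "h = fold cmove [a, b, d] 0" "a < 3" "b < 3" "d < 3" "a ~= b" "b ~= d" by auto
    have "act col [a, b, d] x = act col (look colour_W h) x"
      unfolding abd(1) by (rule ct.act_pos[OF col_rels]) (use abd in auto)
    then have "ap [a, b, d] x = act col (look colour_W h) x" unfolding ap_def act_def .
    then have "ap [a, b, d] x = x" using assms(2) unfolding A_def by simp
    then show ?thesis using path3_neq[OF ap_path3'[OF abd(2,3,5), of x] ap_path3'[OF abd(3,4,6), of "col a x"]] by (simp add: ap_simps)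
  qed
qed

definition fixing :: "nat => bool" where "fixing m \<longleftrightarrow> (\<forall>x. A x (4 * m) = x)"

lemma centreD: "m < 6 ==> i < 3 ==> fold cmove (look colour_W (4 * m)) (cmove i 0) = cmove i (4 * ((6 - m) mod 6))"
  "m < 6 ==> m' < 6 ==> fold cmove (look colour_W (4 * m)) (4 * m') = 4 * ((m + m') mod 6)"
proof -
  note c = centre[unfolded centre_ok_def list_all_iff]
  show "m < 6 ==> m' < 6 ==> fold cmove (look colour_W (4 * m)) (4 * m') = 4 * ((m + m') mod 6)" using c by auto
  assume m: "m < 6" and i: "i < 3"
  have "i = 0 \<or> i = 1 \<or> i = 2" using i by auto
  then show "fold cmove (look colour_W (4 * m)) (cmove i 0) = cmove i (4 * ((6 - m) mod 6))"
    using c m by (elim disjE) simp_all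
qed

text \<open>Passing an edge replaces \<open>z ^ m\<close> by its inverse, which fixes the same
  vertices; so the property spreads over the connected graph.\<close>

lemma fixing_all:
  assumes m: "m < 6" and b: "A b (4 * m) = b" shows "fixing m"
  unfolding fixing_def
proof
  fix x
  show "A x (4 * m) = x"
  proof (rule conn_induct[of _ b])
    fix y z assume y: "A y (4 * m) = y" and a: "adj y z"
    obtain i where i: "i < 3" "z = col i y" using a unfolding adj_col by blast
    let ?m = "(6 - m) mod 6"
    have m': "?m < 6" by simp
    have "A (A y (4 * m)) (4 * ?m) = A y (4 * ((?m + m) mod 6))" using A_A[of "4 * m" "4 * ?m" y] centreD(2)[OF m' m] m m' by simp
    also have "(?m + m) mod 6 = 0" using m by (simp add: mod_simps)
    finally have ym: "A y (4 * ?m) = y" unfolding y using A_0 by simp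
    have "z = A y (cmove i 0)" using A_col[of 0 i y] A_0 i by simp
    then have "A z (4 * m) = A y (cmove i (4 * ?m))"
      using A_A[of "cmove i 0" "4 * m" y] ct.move_lt[of 0 i] m i(1) centreD(1)[OF m i(1)] by simp
    also have "\<dots> = col i (A y (4 * ?m))" using A_col[of "4 * ?m" i y] i(1) m' by simp
    finally show "A z (4 * m) = z" unfolding ym i(2) .
  qed (rule b)
qed

lemma fixing_add: "m < 6 ==> m' < 6 ==> fixing m ==> fixing m' ==> fixing ((m + m') mod 6)"
proof -
  assume m: "m < 6" "m' < 6" "fixing m" "fixing m'"
  have "A (A x (4 * m')) (4 * m) = A x (4 * ((m + m') mod 6))" for x using A_A[of "4 * m'" "4 * m" x] centreD(2)[OF m(1,2)] m(1,2) by simp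
  then show ?thesis using m(3,4) unfolding fixing_def by simp
qed

text \<open>The word \<open>0 1 0 1\<close> fixing a vertex would be a 4-cycle.\<close>

lemma not_fixing_1: "\<not> fixing 1"
proof
  assume "fixing 1"
  then have "A a0 4 = a0" unfolding fixing_def by (metis mult.right_neutral)
  moreover have "act col [0, 1, 0, 1] a0 = A a0 4"
    unfolding A_def using ct.act_pos[OF col_rels, of "[0, 1, 0, 1]" a0] kernel[unfolded kernel_ok_def] by simp
  ultimately have "col 1 (ap [0, 1, 0] a0) = a0" unfolding ap_def act_def by simp
  then have "col 1 (col 1 (ap [0, 1, 0] a0)) = col 1 a0" by simp
  then have "ap [0, 1, 0] a0 = col 1 a0" by (simp add: col_col)
  then show False using not_adj_ap3[of 0 1 0 a0] col(1)[of 1 a0] by simp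
qed

lemma octa_model:
  assumes ok: "octa_ok colour_T colour_W nb rep idx M" and M: "!!m. m < 6 ==> fixing m \<longleftrightarrow> m \<in> set M" "set M \<subseteq> {..<6}"
  shows "\<exists>F. rooted_model adj nb F"
proof (rule exI)
  note o = ok[unfolded octa_ok_def list_all_iff list_ex_iff]
  have q: "quotient_ok nb 48 (\<lambda>p. map (\<lambda>i. cmove i p) [0, 1, 2]) rep idx" using o by blast
  note q' = q[unfolded quotient_ok_def list_all_iff]
  have rep: "look rep v < 48" if "v < length nb" for v using q' that by auto
  have idx: "look idx p < length nb" if "p < 48" for p using q' that by auto
  show "rooted_model adj nb (\<lambda>x. (!) (map (\<lambda>v. A x (look rep v)) [0..<length nb]))"
  proof (rule quotient_model[OF q, of A])
    show "A x (look rep 0) = x" for x using o A_0 by simp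
    show "N (A x p) = A x ` set (map (\<lambda>i. cmove i p) [0, 1, 2])" if "p < 48" for x p
    proof -
      have "N (A x p) = {col 0 (A x p), col 1 (A x p), col 2 (A x p)}"
      proof -
        have "{..<3::nat} = {0, 1, 2}" by auto
        moreover have "N (A x p) = (\<lambda>i. col i (A x p)) ` {..<3}" unfolding N_def adj_col by auto
        ultimately show ?thesis by auto
      qed
      then show ?thesis using A_col[OF that, of _ x] by simp
    qed
    show "A x p = A x (look rep (look idx p))" if "p < 48" for x p
    proof -
      have "\<exists>m\<in>set M. fold cmove (look colour_W (4 * m)) (look rep (look idx p)) = p" using o that by simp
      then obtain m where m: "m \<in> set M" "fold cmove (look colour_W (4 * m)) (look rep (look idx p)) = p" by blast
      have m6: "m < 6" "fixing m" using m(1) M by auto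
      then show ?thesis using A_A[OF rep[OF idx[OF that]], of "4 * m" x] m(2) unfolding fixing_def by simp
    qed
    show "look idx p = look idx q" if pq: "p < 48" "q < 48" and e: "A x p = A x q" for x p q
    proof -
      obtain h where h: "h < 48" "fold cmove (look colour_W h) p = q" "A (A x p) h = A x p"
        using ct.collision[OF col_rels pq e[unfolded A_def]] unfolding A_def by blast
      obtain m where m: "m < 6" "h = 4 * m" using kernel_mult4[OF h(1,3)] by blast
      then have "m \<in> set M" using fixing_all[of m "A x p"] h(3) M(1) by blast
      then have "look idx (fold cmove (look colour_W (4 * m)) p) = look idx p" using o pq(1) by auto
      then show ?thesis using h(2) m(2) by simp
    qed
  qed
qed

text \<open>The exponents that fix all vertices form a subgroup of the cyclic group of order six
  without a generator. Orders one, two and three give \<open>GP(24,5)\<close>,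
  \<open>GP(12,5)\<close> and \<open>GP(8,5)\<close>.\<close>

lemma octa_models: "\<exists>F. rooted_model adj (gp_tab 8 5) F \<or> rooted_model adj (gp_tab 12 5) F \<or> rooted_model adj (gp_tab 24 5) F"
proof -
  have f0: "fixing 0" unfolding fixing_def using A_0 by simp
  have add: "fixing m ==> fixing m' ==> (m + m') mod 6 = 1 ==> m < 6 ==> m' < 6 ==> False" for m m'
    using fixing_add[of m m'] not_fixing_1 by metis
  have dbl: "fixing 2 \<longleftrightarrow> fixing 4" using fixing_add[of 2 2] fixing_add[of 4 4] by auto
  have n5: "\<not> fixing 5"
  proof
    assume 5: "fixing 5"
    then have "fixing 4" using fixing_add[of 5 5] by simp
    then have "fixing 2" using dbl by simp
    then show False using add[of 5 2] 5 by simp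
  qed
  have l6: "m = 0 \<or> m = 1 \<or> m = 2 \<or> m = 3 \<or> m = 4 \<or> m = 5" if "m < 6" for m :: nat using that by auto
  show ?thesis
  proof (cases "fixing 2")
    case True
    then have "\<not> fixing 3" using add[of 3 4] dbl by auto
    then have "fixing m \<longleftrightarrow> m \<in> set [0, 2, 4]" if "m < 6" for m using l6[OF that] True dbl f0 n5 not_fixing_1 by auto
    then show ?thesis using octa_model[OF octa_ok2] by auto
  next
    case n2: False
    show ?thesis
    proof (cases "fixing 3")
      case True
      then have "fixing m \<longleftrightarrow> m \<in> set [0, 3]" if "m < 6" for m using l6[OF that] n2 dbl f0 n5 not_fixing_1 by auto
      then show ?thesis using octa_model[OF octa_ok3] by auto
    next
      case False
      then have "fixing m \<longleftrightarrow> m \<in> set [0]" if "m < 6" for m using l6[OF that] n2 dbl f0 n5 not_fixing_1 by auto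
      then show ?thesis using octa_model[OF octa_ok6] by auto
    qed
  qed
qed

end

section \<open>The group of order 120 on arcs and its quotients\<close>

definition arc_entries :: "coset_entry list list" where
    "arc_entries = [[(1, 0, 0), (2, 0, 0), (3, 0, 0)], [(0, 1, 1), (4, 0, 0), (17, 0, 0)], [(18, 0, 0), (3, 2,
    7), (0, 1, 4)], [(16, 0, 0), (0, 1, 3), (2, 2, 10)], [(5, 0, 0), (17, 2, 7), (1, 1, 4)], [(4, 1, 1), (6, 0, 0),
    (37, 0, 0)], [(7, 0, 0), (37, 2, 7), (5, 1, 4)], [(6, 1, 1), (44, 0, 0), (8, 0, 0)], [(9, 0, 0), (7, 1, 3), (44,
    2, 10)], [(8, 1, 1), (10, 0, 0), (72, 0, 0)], [(11, 2, 13), (72, 2, 7), (9, 1, 4)], [(10, 3, 1), (12, 1, 3),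
    (69, 2, 10)], [(13, 1, 1), (69, 0, 0), (11, 0, 0)], [(12, 0, 0), (14, 1, 3), (38, 2, 10)], [(15, 1, 1), (38, 0,
    0), (13, 0, 0)], [(14, 0, 0), (86, 2, 7), (16, 1, 4)], [(3, 1, 1), (15, 0, 0), (86, 0, 0)], [(29, 0, 0), (1, 1,
    3), (4, 2, 10)], [(2, 1, 1), (19, 0, 0), (51, 0, 0)], [(20, 0, 0), (51, 2, 7), (18, 1, 4)], [(19, 1, 1), (30, 0,
    0), (21, 0, 0)], [(22, 0, 0), (20, 1, 3), (30, 2, 10)], [(21, 1, 1), (23, 0, 0), (43, 0, 0)], [(24, 2, 13), (43,
    2, 7), (22, 1, 4)], [(23, 3, 1), (25, 1, 3), (52, 2, 10)], [(26, 1, 1), (52, 0, 0), (24, 0, 0)], [(25, 0, 0),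
    (27, 1, 3), (100, 2, 10)], [(28, 1, 1), (100, 0, 0), (26, 0, 0)], [(27, 0, 0), (65, 2, 7), (29, 1, 4)], [(17, 1,
    1), (28, 0, 0), (65, 0, 0)], [(31, 0, 0), (21, 2, 7), (20, 1, 4)], [(30, 1, 1), (104, 0, 0), (32, 0, 0)], [(33,
    2, 19), (31, 1, 3), (104, 2, 10)], [(32, 3, 1), (34, 1, 3), (73, 2, 10)], [(35, 1, 1), (73, 0, 0), (33, 0, 0)],
    [(34, 0, 0), (36, 1, 3), (57, 2, 10)], [(37, 1, 1), (57, 0, 0), (35, 0, 0)], [(36, 0, 0), (5, 1, 3), (6, 2,
    10)], [(39, 0, 0), (13, 2, 7), (14, 1, 4)], [(38, 1, 1), (70, 0, 0), (40, 0, 0)], [(41, 0, 0), (39, 1, 3), (70,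
    2, 10)], [(40, 1, 1), (42, 3, 20), (113, 5, 4)], [(43, 1, 1), (113, 0, 0), (41, 4, 4)], [(42, 0, 0), (22, 1, 3),
    (23, 2, 10)], [(45, 0, 0), (8, 2, 7), (7, 1, 4)], [(44, 1, 1), (58, 0, 0), (46, 0, 0)], [(47, 2, 19), (45, 1,
    3), (58, 2, 10)], [(46, 3, 1), (48, 1, 3), (108, 2, 10)], [(49, 1, 1), (108, 0, 0), (47, 0, 0)], [(48, 0, 0),
    (50, 1, 3), (103, 2, 10)], [(51, 1, 1), (103, 0, 0), (49, 0, 0)], [(50, 0, 0), (18, 1, 3), (19, 2, 10)], [(53,
    0, 0), (24, 2, 7), (25, 1, 4)], [(52, 1, 1), (54, 3, 14), (66, 5, 4)], [(55, 1, 1), (66, 0, 0), (53, 4, 4)],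
    [(54, 0, 0), (56, 1, 3), (99, 2, 10)], [(57, 1, 1), (99, 0, 0), (55, 0, 0)], [(56, 0, 0), (35, 2, 7), (36, 1,
    4)], [(59, 0, 0), (46, 2, 7), (45, 1, 4)], [(58, 1, 1), (117, 0, 0), (60, 3, 18)], [(61, 1, 1), (59, 3, 16),
    (117, 4, 10)], [(60, 0, 0), (62, 1, 3), (71, 2, 10)], [(63, 1, 1), (71, 0, 0), (61, 0, 0)], [(62, 0, 0), (64, 1,
    3), (95, 2, 10)], [(65, 1, 1), (95, 0, 0), (63, 0, 0)], [(64, 0, 0), (29, 1, 3), (28, 2, 10)], [(67, 5, 13),
    (53, 4, 7), (54, 1, 4)], [(66, 5, 13), (68, 4, 7), (85, 1, 4)], [(69, 1, 1), (85, 3, 14), (67, 5, 4)], [(68, 0,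
    0), (11, 2, 7), (12, 1, 4)], [(71, 2, 17), (40, 2, 7), (39, 1, 4)], [(70, 3, 1), (61, 2, 7), (62, 1, 4)], [(79,
    0, 0), (9, 1, 3), (10, 2, 10)], [(74, 0, 0), (33, 2, 7), (34, 1, 4)], [(73, 1, 1), (75, 0, 0), (80, 4, 4)],
    [(76, 0, 0), (80, 4, 7), (74, 1, 4)], [(75, 1, 1), (77, 3, 16), (119, 5, 4)], [(78, 1, 1), (119, 0, 0), (76, 4,
    4)], [(77, 0, 0), (93, 4, 7), (79, 1, 4)], [(72, 1, 1), (78, 0, 0), (93, 4, 4)], [(81, 1, 1), (74, 3, 16), (75,
    5, 4)], [(80, 0, 0), (82, 2, 7), (94, 1, 4)], [(83, 3, 1), (94, 1, 3), (81, 2, 10)], [(82, 2, 15), (84, 2, 7),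
    (102, 1, 4)], [(85, 0, 0), (102, 1, 3), (83, 2, 10)], [(84, 1, 1), (67, 0, 0), (68, 4, 4)], [(87, 0, 0), (16, 1,
    3), (15, 2, 10)], [(86, 1, 1), (96, 0, 0), (88, 0, 0)], [(89, 0, 0), (87, 1, 3), (96, 2, 10)], [(88, 1, 1), (90,
    0, 0), (107, 0, 0)], [(91, 3, 1), (107, 2, 7), (89, 1, 4)], [(90, 2, 17), (92, 2, 7), (101, 1, 4)], [(93, 0, 0),
    (101, 1, 3), (91, 2, 10)], [(92, 1, 1), (79, 3, 20), (78, 5, 4)], [(95, 1, 1), (81, 0, 0), (82, 0, 0)], [(94, 0,
    0), (63, 2, 7), (64, 1, 4)], [(97, 0, 0), (88, 2, 7), (87, 1, 4)], [(96, 1, 1), (115, 0, 0), (98, 0, 0)], [(99,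
    3, 1), (97, 1, 3), (115, 2, 10)], [(98, 2, 15), (55, 2, 7), (56, 1, 4)], [(101, 0, 0), (26, 2, 7), (27, 1, 4)],
    [(100, 1, 1), (91, 0, 0), (92, 0, 0)], [(103, 1, 1), (83, 0, 0), (84, 0, 0)], [(102, 0, 0), (49, 2, 7), (50, 1,
    4)], [(105, 0, 0), (32, 2, 7), (31, 1, 4)], [(104, 1, 1), (116, 0, 0), (106, 3, 18)], [(107, 1, 1), (105, 3,
    16), (116, 4, 10)], [(106, 0, 0), (89, 1, 3), (90, 2, 10)], [(109, 0, 0), (47, 2, 7), (48, 1, 4)], [(108, 1, 1),
    (110, 0, 0), (114, 4, 4)], [(111, 0, 0), (114, 4, 7), (109, 1, 4)], [(110, 1, 1), (112, 3, 16), (118, 5, 4)],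
    [(113, 1, 1), (118, 0, 0), (111, 4, 4)], [(112, 0, 0), (41, 4, 7), (42, 1, 4)], [(115, 1, 1), (109, 3, 16),
    (110, 5, 4)], [(114, 0, 0), (98, 2, 7), (97, 1, 4)], [(117, 3, 17), (106, 4, 7), (105, 1, 4)], [(116, 3, 17),
    (60, 4, 7), (59, 1, 4)], [(119, 5, 15), (111, 4, 7), (112, 1, 4)], [(118, 5, 15), (76, 4, 7), (77, 1, 4)]]"

definition arc_words :: "nat list list" where
    "arc_words = [[], [0], [1], [2], [0, 1], [0, 1, 0], [0, 1, 0, 1], [0, 1, 0, 1, 0], [0, 1, 0, 1, 0, 2], [0,
    1, 0, 1, 0, 2, 0], [0, 1, 0, 1, 0, 2, 0, 1], [2, 0, 1, 0, 2, 0, 2], [2, 0, 1, 0, 2, 0], [2, 0, 1, 0, 2], [2, 0,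
    1, 0], [2, 0, 1], [2, 0], [0, 2], [1, 0], [1, 0, 1], [1, 0, 1, 0], [1, 0, 1, 0, 2], [1, 0, 1, 0, 2, 0], [1, 0,
    1, 0, 2, 0, 1], [0, 2, 0, 1, 0, 2, 0, 2], [0, 2, 0, 1, 0, 2, 0], [0, 2, 0, 1, 0, 2], [0, 2, 0, 1, 0], [0, 2, 0,
    1], [0, 2, 0], [1, 0, 1, 0, 1], [1, 0, 1, 0, 1, 0], [1, 0, 1, 0, 1, 0, 2], [0, 1, 0, 2, 0, 2, 0, 2], [0, 1, 0,
    2, 0, 2, 0], [0, 1, 0, 2, 0, 2], [0, 1, 0, 2, 0], [0, 1, 0, 2], [2, 0, 1, 0, 1], [2, 0, 1, 0, 1, 0], [2, 0, 1,
    0, 1, 0, 2], [2, 0, 1, 0, 1, 0, 2, 0], [1, 0, 1, 0, 2, 0, 2, 0], [1, 0, 1, 0, 2, 0, 2], [0, 1, 0, 1, 0, 1], [0,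
    1, 0, 1, 0, 1, 0], [0, 1, 0, 1, 0, 1, 0, 2], [1, 0, 2, 0, 2, 0, 2], [1, 0, 2, 0, 2, 0], [1, 0, 2, 0, 2], [1, 0,
    2, 0], [1, 0, 2], [0, 2, 0, 1, 0, 2, 0, 1], [0, 2, 0, 1, 0, 2, 0, 1, 0], [0, 1, 0, 2, 0, 1, 0, 2, 0], [0, 1, 0,
    2, 0, 1, 0, 2], [0, 1, 0, 2, 0, 1, 0], [0, 1, 0, 2, 0, 1], [0, 1, 0, 1, 0, 1, 0, 1], [0, 1, 0, 1, 0, 1, 0, 1,
    0], [0, 2, 0, 2, 0, 2, 0, 2, 0], [0, 2, 0, 2, 0, 2, 0, 2], [0, 2, 0, 2, 0, 2, 0], [0, 2, 0, 2, 0, 2], [0, 2, 0,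
    2, 0], [0, 2, 0, 2], [0, 1, 0, 2, 0, 1, 0, 2, 0, 1], [1, 0, 2, 0, 1, 0, 2, 0, 1], [2, 0, 1, 0, 2, 0, 1, 0], [2,
    0, 1, 0, 2, 0, 1], [2, 0, 1, 0, 1, 0, 1], [0, 2, 0, 2, 0, 2, 0, 1], [0, 1, 0, 1, 0, 2, 0, 2], [0, 1, 0, 2, 0, 2,
    0, 1], [0, 1, 0, 2, 0, 2, 0, 1, 0], [0, 1, 0, 2, 0, 2, 0, 1, 0, 1], [0, 1, 0, 2, 0, 2, 0, 1, 0, 1, 0], [0, 1, 0,
    1, 0, 2, 0, 2, 0, 1, 0], [0, 1, 0, 1, 0, 2, 0, 2, 0, 1], [0, 1, 0, 1, 0, 2, 0, 2, 0], [0, 2, 0, 2, 0, 1, 0, 1,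
    0], [0, 2, 0, 2, 0, 1, 0, 1], [0, 2, 0, 2, 0, 1, 0, 2], [1, 0, 2, 0, 1, 0, 1], [1, 0, 2, 0, 1, 0, 2], [1, 0, 2,
    0, 1, 0, 2, 0], [2, 0, 2], [2, 0, 2, 0], [2, 0, 2, 0, 2], [2, 0, 2, 0, 2, 0], [2, 0, 2, 0, 2, 0, 1], [0, 2, 0,
    1, 0, 1, 0, 1], [0, 2, 0, 1, 0, 1, 0, 2], [0, 2, 0, 1, 0, 1, 0, 2, 0], [0, 2, 0, 2, 0, 1, 0], [0, 2, 0, 2, 0,
    1], [2, 0, 2, 0, 1], [2, 0, 2, 0, 1, 0], [2, 0, 2, 0, 1, 0, 2], [0, 1, 0, 2, 0, 1, 0, 1], [0, 2, 0, 1, 0, 1],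
    [0, 2, 0, 1, 0, 1, 0], [1, 0, 2, 0, 1, 0], [1, 0, 2, 0, 1], [1, 0, 1, 0, 1, 0, 1], [1, 0, 1, 0, 1, 0, 1, 0], [2,
    0, 2, 0, 2, 0, 2, 0], [2, 0, 2, 0, 2, 0, 2], [1, 0, 2, 0, 2, 0, 1], [1, 0, 2, 0, 2, 0, 1, 0], [1, 0, 2, 0, 2, 0,
    1, 0, 1], [1, 0, 2, 0, 2, 0, 1, 0, 1, 0], [1, 0, 1, 0, 2, 0, 2, 0, 1, 0], [1, 0, 1, 0, 2, 0, 2, 0, 1], [2, 0, 2,
    0, 1, 0, 1, 0], [2, 0, 2, 0, 1, 0, 1], [1, 0, 1, 0, 1, 0, 1, 0, 1], [0, 1, 0, 1, 0, 1, 0, 1, 0, 1], [1, 0, 1, 0,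
    2, 0, 2, 0, 1, 0, 1], [0, 1, 0, 1, 0, 2, 0, 2, 0, 1, 0, 1]]"

text \<open>Letter 0 reverses an arc, 1 rotates it about its tail, 2 rotates it back. So
  \<open>0 1\<close> and \<open>0 2\<close> are left and right turns, and the last relator is the
  octagon with the turns left, left, right, left taken twice.\<close>

definition arc_rels :: "nat list list" where
    "arc_rels = [[0, 0], [1, 2], [2, 1], [1, 1, 1], [2, 2, 2], [0, 1, 0, 1, 0, 2, 0, 1, 0, 1, 0, 1, 0, 2, 0,
    1]]"

text \<open>One arc for each vertex of \<open>gp_tab 10 2\<close>, with its tail there;
  \<open>double_rep\<close> does the same for \<open>double_tab\<close>.\<close>

definition dodec_rep :: "nat list" where
    "dodec_rep = [0, 1, 5, 35, 55, 53, 67, 41, 39, 18, 15, 28, 7, 26, 9, 24, 11, 22, 13, 20]"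

definition dodec_idx :: "nat list" where
    "dodec_idx = [0, 1, 0, 0, 1, 2, 2, 12, 12, 14, 14, 16, 16, 18, 18, 10, 10, 1, 9, 9, 19, 19, 17, 17, 15, 15,
    13, 13, 11, 11, 19, 11, 11, 13, 13, 3, 3, 2, 18, 8, 8, 7, 7, 17, 12, 10, 10, 18, 18, 8, 8, 9, 15, 5, 5, 4, 4, 3,
    10, 0, 0, 9, 9, 19, 19, 11, 5, 6, 6, 16, 8, 9, 14, 13, 15, 15, 5, 5, 4, 4, 15, 17, 17, 7, 7, 6, 10, 12, 12, 2,
    2, 3, 3, 4, 17, 19, 12, 14, 14, 4, 13, 3, 7, 8, 11, 1, 1, 2, 18, 16, 16, 6, 6, 7, 16, 14, 1, 0, 6, 5]"

definition double_rep :: "nat list" where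
    "double_rep = [0, 105, 5, 91, 55, 76, 67, 41, 49, 61, 45, 28, 87, 33, 9, 24, 109, 81, 13, 20, 59, 1, 89, 35,
    78, 53, 111, 83, 39, 18, 15, 31, 7, 26, 97, 74, 11, 22, 47, 63]"

definition double_idx :: "nat list" where
    "double_idx = [0, 21, 0, 0, 21, 2, 2, 32, 32, 14, 14, 36, 36, 18, 18, 30, 30, 21, 29, 29, 19, 19, 37, 37,
    15, 15, 33, 33, 11, 11, 19, 31, 31, 13, 13, 23, 23, 2, 18, 28, 28, 7, 7, 37, 32, 10, 10, 38, 38, 8, 8, 29, 15,
    25, 25, 4, 4, 23, 10, 20, 20, 9, 9, 39, 39, 11, 25, 6, 6, 36, 28, 9, 14, 13, 35, 35, 5, 5, 24, 24, 35, 17, 17,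
    27, 27, 6, 30, 12, 12, 22, 22, 3, 3, 24, 17, 39, 12, 34, 34, 4, 33, 3, 27, 8, 31, 1, 1, 22, 38, 16, 16, 26, 26,
    7, 16, 34, 1, 20, 26, 5]"


text \<open>Inner products with the vector of the initial vertex along a word of turns, as \<open>a + b \<theta>\<close> up to
  the factor \<open>3 \<cdot> 2\<^sup>l\<close> with \<open>l\<close> the length of the word: for the tail, the head, and the normal vector \<open>T\<close> of the arc.\<close>

type_synonym quad = "int \<times> int"

text \<open>The rotations are \<open>turn_vec\<close> and \<open>T_step\<close> for a turn about the
  tail, doubled to stay integral; 5 is \<open>\<theta>\<^sup>2\<close>.\<close>

fun arc_step :: "nat => quad \<times> quad \<times> quad => quad \<times> quad \<times> quad" where
  "arc_step i ((a, a'), (b, b'), (d, d')) =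
    (if i = 0 then ((2 * b, 2 * b'), (2 * a, 2 * a'), (- 2 * d, - 2 * d'))
     else if i = 1 then ((2 * a, 2 * a'), (5 * a' - b - d, a - b' - d'), (3 * b - 5 * a' - d, 3 * b' - a - d'))
     else ((2 * a, 2 * a'), (5 * a' - b + d, a - b' + d'), (5 * a' - 3 * b - d, a - 3 * b' - d')))"

text \<open>The start values are three times the inner products 1, \<open>\<theta> / 3\<close> and
  0.\<close>

definition arc_value :: "nat list => quad \<times> quad \<times> quad" where
  "arc_value w = fold arc_step w ((3, 0), (0, 1), (0, 0))"

text \<open>Inner product 1 would mean \<open>a - 3 * 2 ^ length w = - b * \<theta>\<close>;
  comparing squares covers both signs of \<open>\<theta>\<close>.\<close>

definition distinct_value :: "nat list => bool" where
  "distinct_value w \<longleftrightarrow> (case arc_value w of ((a, b), _, _) => (a - 3 * 2 ^ length w) * (a - 3 * 2 ^ length w) ~= 5 * (b * b))"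

text \<open>Fixing an arc is excluded by the inner product, or because the fourth power is a
  rotation, which moves every arc. The two exceptions are the identity and position 117, whose
  element commutes with the generators; whether it fixes an arc separates the dodecahedron from its
  double.\<close>

definition arc_kernel_ok :: "coset_entry list trie => nat list trie => bool" where
  "arc_kernel_ok T W \<longleftrightarrow> list_all (\<lambda>h. h = 0 \<or> h = 117 \<or> distinct_value (look W h) \<or>
     (let w = look W h; q = fold (move T) (w @ w @ w @ w) 0 in q = move T 1 0 \<or> q = move T 2 0)) [0..<120] \<and>
   list_all (\<lambda>i. fold (move T) (look W 117) (move T i 0) = move T i 117) [0, 1, 2]"

text \<open>Vertices are arcs up to rotation: fibres of \<open>idx\<close> are closed under letters
  1 and 2, and neighbours are found by reversing the three rotated arcs.\<close>

definition arc_ok :: "coset_entry list trie => nat list trie => nat list list => nat trie => nat trie => nat list => bool" where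
  "arc_ok T W nb rep idx M \<longleftrightarrow>
     quotient_ok nb 120 (\<lambda>p. [move T 0 p, move T 0 (move T 1 p), move T 0 (move T 2 p)]) rep idx \<and> look rep 0 = 0 \<and>
     list_all (\<lambda>q. list_ex (\<lambda>h. q = fold (move T) (look W h) (look rep (look idx q)) \<or>
         q = fold (move T) (look W h) (move T 1 (look rep (look idx q))) \<or> q = fold (move T) (look W h) (move T 2 (look rep (look idx q)))) M \<and>
       list_all (\<lambda>h. look idx (fold (move T) (look W h) q) = look idx q) M \<and>
       look idx (move T 1 q) = look idx q \<and> look idx (move T 2 q) = look idx q) [0..<120]"

text \<open>The halves below and from 20 are the sides of the bipartition; \<open>p + 20\<close> is
  the twin of \<open>p\<close>.\<close>

definition double_tab :: "nat list list" where
  "double_tab = map (map (\<lambda>i. i + 20)) (gp_tab 10 2) @ gp_tab 10 2"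

definition "arc_T = trie_of arc_entries"
definition "arc_W = trie_of arc_words"

lemma arc_table: "coset_table 120 3 arc_T arc_W [0, 2, 1] arc_rels"
proof
  show "shape_ok 120 3 arc_T arc_W [0, 2, 1] arc_rels" by code_simp
  show "deduce_ok 120 [0..<3] arc_T arc_W (all_rotations arc_rels)" by code_simp
qed

lemma arc_kernel: "arc_kernel_ok arc_T arc_W" by code_simp

text \<open>Distances from vertex 0 of the dodecahedron, in the numbering of
  \<open>gp_tab 10 2\<close>.\<close>

definition dodec_dist :: "nat list" where
  "dodec_dist = [0, 1, 2, 3, 4, 5, 4, 3, 2, 1, 1, 2, 2, 3, 3, 4, 3, 3, 2, 2]"

text \<open>The pairs are three times the cosines at distances 0 to 5 in the coordinates 1 and
  \<open>\<theta>\<close>. The other parts say that the element at position 117 leads to the twin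
  and leaves the image unchanged.\<close>

definition double_values_ok :: "coset_entry list trie => nat list trie => nat trie => nat trie => bool" where
  "double_values_ok T W rep idx \<longleftrightarrow> list_all (\<lambda>p. dodec_dist ! (p mod 20) < 6 \<and>
       (case [(3, 0), (0, 1), (1, 0), (-1, 0), (0, -1), (-3, 0)] ! (dodec_dist ! (p mod 20)) of (a, b) =>
         fst (arc_value (look W (look rep p))) = (2 ^ length (look W (look rep p)) * a, 2 ^ length (look W (look rep p)) * b))) [0..<40] \<and>
     list_all (\<lambda>p. look idx (fold (move T) (look W 117) (look rep p)) = p + 20) [0..<20] \<and>
     fst (arc_value (look W 117)) = (2 ^ length (look W 117) * 3, 2 ^ length (look W 117) * 0)"

lemma double_values: "double_values_ok arc_T arc_W (trie_of double_rep) (trie_of double_idx)" by code_simp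

lemma dodec_ok: "arc_ok arc_T arc_W (gp_tab 10 2) (trie_of dodec_rep) (trie_of dodec_idx) [0, 117]" by code_simp

lemma double_ok: "arc_ok arc_T arc_W double_tab (trie_of double_rep) (trie_of double_idx) [0]" by code_simp

section \<open>Certificates\<close>

text \<open>Successive rounds of refinement with their key tables, here and in the certificates
  below. In the last round the colours 0, 1, 2 are the root, its neighbours and vertices at distance
  two, from which the chain reaches the others.\<close>

definition mk_ref :: "(nat list \<times> nat list list) list" where
  "mk_ref = [([0, 1, 2, 2, 2, 2, 2, 1, 1, 2, 2, 2, 2, 2, 2, 2], [[0, 1, 1, 1], [1, 0, 1, 1], [1, 1, 1, 1]]),
    ([0, 1, 2, 3, 3, 3, 2, 1, 1, 2, 3, 2, 3, 2, 3, 2], [[0, 1, 1, 1], [1, 0, 2, 2], [2, 1, 2, 2], [2, 2, 2, 2]]),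
    ([0, 1, 2, 4, 5, 4, 2, 1, 1, 2, 3, 2, 4, 2, 3, 2], [[0, 1, 1, 1], [1, 0, 2, 2], [2, 1, 3, 3], [3, 2, 2, 2],
    [3, 2, 2, 3], [3, 3, 3, 3]])]"
definition mk_chain :: "(nat \<times> nat) list" where
  "mk_chain = [(2, 3), (2, 4), (4, 5)]"
definition nauru_ref :: "(nat list \<times> nat list list) list" where
  "nauru_ref = [([0, 1, 2, 2, 2, 2, 2, 2, 2, 2, 2, 1, 1, 2, 2, 2, 2, 2, 2, 2, 2, 2, 2, 2], [[0, 1, 1, 1], [1,
    0, 1, 1], [1, 1, 1, 1]]), ([0, 1, 2, 3, 3, 3, 3, 3, 3, 3, 2, 1, 1, 2, 3, 3, 3, 2, 3, 2, 3, 3, 3, 2], [[0, 1,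
    1, 1], [1, 0, 2, 2], [2, 1, 2, 2], [2, 2, 2, 2]]), ([0, 1, 2, 3, 5, 3, 5, 3, 5, 3, 2, 1, 1, 2, 4, 5, 3, 2, 4,
    2, 3, 5, 4, 2], [[0, 1, 1, 1], [1, 0, 2, 2], [2, 1, 3, 3], [3, 2, 3, 3], [3, 2, 2, 3], [3, 3, 3, 3]]), ([0, 1,
    2, 4, 6, 4, 5, 4, 6, 4, 2, 1, 1, 2, 3, 5, 4, 2, 3, 2, 4, 5, 3, 2], [[0, 1, 1, 1], [1, 0, 2, 2], [2, 1, 3, 4],
    [4, 2, 2, 5], [3, 2, 5, 5], [5, 3, 3, 4], [5, 3, 3, 3]])]"
definition nauru_chain :: "(nat \<times> nat) list" where
  "nauru_chain = [(2, 3), (2, 4), (3, 5), (4, 6)]"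
definition foster_ref :: "(nat list \<times> nat list list) list" where
  "foster_ref = [([0, 1, 2, 2, 2, 2, 2, 2, 2, 2, 2, 2, 2, 2, 2, 2, 2, 2, 2, 2, 2, 2, 2, 1, 1, 2, 2, 2, 2, 2,
    2, 2, 2, 2, 2, 2, 2, 2, 2, 2, 2, 2, 2, 2, 2, 2, 2, 2], [[0, 1, 1, 1], [1, 0, 1, 1], [1, 1, 1, 1]]), ([0, 1, 2,
    3, 3, 3, 3, 3, 3, 3, 3, 3, 3, 3, 3, 3, 3, 3, 3, 3, 3, 3, 2, 1, 1, 2, 3, 3, 3, 2, 3, 3, 3, 3, 3, 3, 3, 3, 3, 3,
    3, 3, 3, 2, 3, 3, 3, 2], [[0, 1, 1, 1], [1, 0, 2, 2], [2, 1, 2, 2], [2, 2, 2, 2]]), ([0, 1, 2, 3, 4, 3, 4, 4,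
    4, 4, 4, 4, 4, 4, 4, 4, 4, 4, 4, 3, 4, 3, 2, 1, 1, 2, 3, 4, 3, 2, 3, 4, 4, 4, 3, 4, 4, 4, 3, 4, 4, 4, 3, 2, 3,
    4, 3, 2], [[0, 1, 1, 1], [1, 0, 2, 2], [2, 1, 3, 3], [3, 2, 3, 3], [3, 3, 3, 3]]), ([0, 1, 2, 3, 4, 3, 5, 7,
    7, 7, 6, 7, 7, 7, 6, 7, 7, 7, 5, 3, 4, 3, 2, 1, 1, 2, 3, 5, 3, 2, 3, 6, 7, 5, 3, 6, 7, 6, 3, 5, 7, 6, 3, 2, 3,
    5, 3, 2], [[0, 1, 1, 1], [1, 0, 2, 2], [2, 1, 3, 3], [3, 2, 4, 4], [4, 3, 3, 3], [4, 3, 3, 4], [4, 3, 4, 4],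
    [4, 4, 4, 4]]), ([0, 1, 2, 3, 5, 3, 6, 8, 10, 8, 7, 9, 10, 9, 7, 8, 10, 8, 6, 3, 5, 3, 2, 1, 1, 2, 4, 6, 3, 2,
    4, 7, 8, 6, 4, 7, 9, 7, 4, 6, 8, 7, 4, 2, 3, 6, 4, 2], [[0, 1, 1, 1], [1, 0, 2, 2], [2, 1, 3, 3], [3, 2, 4,
    5], [3, 2, 5, 6], [4, 3, 3, 3], [5, 3, 3, 7], [6, 3, 7, 7], [7, 5, 6, 7], [7, 6, 6, 7], [7, 7, 7, 7]]), ([0,
    1, 2, 3, 5, 3, 6, 8, 10, 8, 7, 9, 11, 9, 7, 8, 10, 8, 6, 3, 5, 3, 2, 1, 1, 2, 4, 6, 3, 2, 4, 7, 8, 6, 4, 7, 9,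
    7, 4, 6, 8, 7, 4, 2, 3, 6, 4, 2], [[0, 1, 1, 1], [1, 0, 2, 2], [2, 1, 3, 4], [3, 2, 5, 6], [4, 2, 6, 7], [5,
    3, 3, 3], [6, 3, 4, 8], [7, 4, 8, 9], [8, 6, 7, 10], [9, 7, 7, 10], [10, 8, 8, 8], [10, 9, 9, 9]])]"
definition foster_chain :: "(nat \<times> nat) list" where
  "foster_chain = [(2, 3), (2, 4), (3, 5), (3, 6), (4, 7), (6, 8), (7, 9), (8, 10), (9, 11)]"
definition dodec_ref :: "(nat list \<times> nat list list) list" where
  "dodec_ref = [([0, 1, 2, 2, 2, 2, 2, 2, 2, 1, 1, 2, 2, 2, 2, 2, 2, 2, 2, 2], [[0, 1, 1, 1], [1, 0, 1, 1],
    [1, 1, 1, 1]]), ([0, 1, 2, 3, 3, 3, 3, 3, 2, 1, 1, 2, 2, 3, 3, 3, 3, 3, 2, 2], [[0, 1, 1, 1], [1, 0, 2, 2],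
    [2, 1, 2, 2], [2, 2, 2, 2]]), ([0, 1, 2, 3, 4, 4, 4, 3, 2, 1, 1, 2, 2, 3, 3, 4, 3, 3, 2, 2], [[0, 1, 1, 1],
    [1, 0, 2, 2], [2, 1, 2, 3], [3, 2, 3, 3], [3, 3, 3, 3]]), ([0, 1, 2, 3, 4, 5, 4, 3, 2, 1, 1, 2, 2, 3, 3, 4, 3,
    3, 2, 2], [[0, 1, 1, 1], [1, 0, 2, 2], [2, 1, 2, 3], [3, 2, 3, 4], [4, 3, 3, 4], [4, 4, 4, 4]])]"
definition dodec_chain :: "(nat \<times> nat) list" where
  "dodec_chain = [(2, 3), (3, 4), (4, 5)]"
definition cube_ref :: "(nat list \<times> nat list list) list" where
  "cube_ref = [([0, 1, 1, 1, 2, 2, 2, 2], [[0, 1, 1, 1], [1, 0, 1, 1], [1, 1, 1, 1]]), ([0, 1, 1, 1, 2, 2, 2,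
    3], [[0, 1, 1, 1], [1, 0, 2, 2], [2, 1, 1, 2], [2, 2, 2, 2]])]"
definition cube_chain :: "(nat \<times> nat) list" where
  "cube_chain = [(2, 3)]"
definition icosa_ref :: "(nat list \<times> nat list list) list" where
  "icosa_ref = [([0, 1, 1, 1, 1, 1, 2, 2, 2, 2, 2, 2], [[0, 1, 1, 1, 1, 1], [1, 0, 1, 1, 1, 1], [1, 1, 1, 1,
    1, 1]]), ([0, 1, 1, 1, 1, 1, 2, 2, 2, 2, 2, 3], [[0, 1, 1, 1, 1, 1], [1, 0, 1, 1, 2, 2], [2, 1, 1, 2, 2, 2],
    [2, 2, 2, 2, 2, 2]])]"
definition icosa_chain :: "(nat \<times> nat) list" where
  "icosa_chain = [(2, 3)]"
definition double_classes :: "nat list" where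
    "double_classes = [0, 5, 2, 6, 7, 11, 7, 6, 2, 5, 5, 2, 2, 6, 6, 7, 6, 6, 2, 2, 8, 1, 3, 4, 9, 10, 9, 4, 3,
    1, 1, 3, 3, 4, 4, 9, 4, 4, 3, 3]"

text \<open>The root, then the positions by dodecahedral distance, which the inner products reveal
  in the given scheme. \<open>double_init2\<close> knows only the root and its twin, which is what a
  pulled-back scheme reveals; both refine to \<open>double_classes\<close>.\<close>

definition double_init :: "nat list" where
    "double_init = [0, 2, 3, 4, 5, 6, 5, 4, 3, 2, 2, 3, 3, 4, 4, 5, 4, 4, 3, 3, 1, 2, 3, 4, 5, 6, 5, 4, 3, 2, 2,
    3, 3, 4, 4, 5, 4, 4, 3, 3]"

definition double_ref :: "(nat list \<times> nat list list) list" where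
    "double_ref = [([0, 1, 2, 3, 4, 5, 4, 3, 2, 1, 1, 2, 2, 3, 3, 4, 3, 3, 2, 2, 6, 7, 2, 3, 4, 5, 4, 3, 2, 7,
    7, 2, 2, 3, 3, 4, 3, 3, 2, 2], [[0, 2, 2, 2], [2, 1, 3, 3], [3, 2, 3, 4], [4, 3, 4, 5], [5, 4, 4, 6], [6, 5, 5,
    5], [1, 2, 2, 2], [2, 0, 3, 3]]), ([0, 1, 2, 3, 4, 5, 4, 3, 2, 1, 1, 2, 2, 3, 3, 4, 3, 3, 2, 2, 6, 7, 8, 3, 4,
    5, 4, 3, 8, 7, 7, 8, 8, 3, 3, 4, 3, 3, 8, 8], [[0, 7, 7, 7], [1, 2, 2, 6], [2, 2, 3, 7], [3, 2, 3, 4], [4, 3, 3,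
    5], [5, 4, 4, 4], [6, 1, 1, 1], [7, 0, 2, 2], [2, 1, 2, 3]]), ([0, 1, 2, 3, 4, 5, 4, 3, 2, 1, 1, 2, 2, 3, 3, 4,
    3, 3, 2, 2, 6, 7, 8, 9, 4, 5, 4, 9, 8, 7, 7, 8, 8, 9, 9, 4, 9, 9, 8, 8], [[0, 7, 7, 7], [1, 6, 8, 8], [2, 3, 7,
    8], [3, 3, 4, 8], [4, 3, 3, 5], [5, 4, 4, 4], [6, 1, 1, 1], [7, 0, 2, 2], [8, 1, 2, 3], [3, 2, 3, 4]]), ([0, 1,
    2, 3, 4, 5, 4, 3, 2, 1, 1, 2, 2, 3, 3, 4, 3, 3, 2, 2, 6, 7, 8, 9, 10, 5, 10, 9, 8, 7, 7, 8, 8, 9, 9, 10, 9, 9,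
    8, 8], [[0, 7, 7, 7], [1, 6, 8, 8], [2, 7, 8, 9], [3, 4, 8, 9], [4, 5, 9, 9], [5, 4, 4, 4], [6, 1, 1, 1], [7, 0,
    2, 2], [8, 1, 2, 3], [9, 2, 3, 4], [4, 3, 3, 5]]), ([0, 5, 2, 6, 7, 11, 7, 6, 2, 5, 5, 2, 2, 6, 6, 7, 6, 6, 2,
    2, 8, 1, 3, 4, 9, 10, 9, 4, 3, 1, 1, 3, 3, 4, 4, 9, 4, 4, 3, 3], [[0, 7, 7, 7], [7, 0, 2, 2], [2, 7, 8, 9], [8,
    1, 2, 3], [9, 2, 3, 4], [1, 6, 8, 8], [3, 8, 9, 10], [4, 5, 9, 9], [6, 1, 1, 1], [10, 3, 3, 5], [5, 4, 4, 4],
    [5, 10, 10, 10]])]"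

definition double_init2 :: "nat list" where
    "double_init2 = [0, 2, 2, 2, 2, 2, 2, 2, 2, 2, 2, 2, 2, 2, 2, 2, 2, 2, 2, 2, 1, 2, 2, 2, 2, 2, 2, 2, 2, 2,
    2, 2, 2, 2, 2, 2, 2, 2, 2, 2]"

definition double_ref2 :: "(nat list \<times> nat list list) list" where
    "double_ref2 = [([0, 1, 2, 2, 2, 2, 2, 2, 2, 1, 1, 2, 2, 2, 2, 2, 2, 2, 2, 2, 3, 4, 2, 2, 2, 2, 2, 2, 2, 4,
    4, 2, 2, 2, 2, 2, 2, 2, 2, 2], [[0, 2, 2, 2], [2, 1, 2, 2], [2, 2, 2, 2], [1, 2, 2, 2], [2, 0, 2, 2]]), ([0, 1,
    2, 3, 3, 3, 3, 3, 2, 1, 1, 2, 2, 3, 3, 3, 3, 3, 2, 2, 4, 5, 6, 3, 3, 3, 3, 3, 6, 5, 5, 6, 6, 3, 3, 3, 3, 3, 6,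
    6], [[0, 4, 4, 4], [1, 2, 2, 3], [2, 2, 2, 4], [2, 2, 2, 2], [3, 1, 1, 1], [4, 0, 2, 2], [2, 1, 2, 2]]), ([0, 1,
    2, 3, 4, 4, 4, 3, 2, 1, 1, 2, 2, 3, 3, 4, 3, 3, 2, 2, 5, 6, 7, 8, 4, 4, 4, 8, 7, 6, 6, 7, 7, 8, 8, 4, 8, 8, 7,
    7], [[0, 5, 5, 5], [1, 4, 6, 6], [2, 3, 5, 6], [3, 3, 3, 6], [3, 3, 3, 3], [4, 1, 1, 1], [5, 0, 2, 2], [6, 1, 2,
    3], [3, 2, 3, 3]]), ([0, 1, 2, 3, 4, 5, 4, 3, 2, 1, 1, 2, 2, 3, 3, 4, 3, 3, 2, 2, 6, 7, 8, 9, 10, 5, 10, 9, 8,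
    7, 7, 8, 8, 9, 9, 10, 9, 9, 8, 8], [[0, 6, 6, 6], [1, 5, 7, 7], [2, 6, 7, 8], [3, 4, 7, 8], [4, 4, 8, 8], [4, 4,
    4, 4], [5, 1, 1, 1], [6, 0, 2, 2], [7, 1, 2, 3], [8, 2, 3, 4], [4, 3, 3, 4]]), ([0, 5, 2, 6, 7, 11, 7, 6, 2, 5,
    5, 2, 2, 6, 6, 7, 6, 6, 2, 2, 8, 1, 3, 4, 9, 10, 9, 4, 3, 1, 1, 3, 3, 4, 4, 9, 4, 4, 3, 3], [[0, 7, 7, 7], [7,
    0, 2, 2], [2, 7, 8, 9], [8, 1, 2, 3], [9, 2, 3, 4], [1, 6, 8, 8], [3, 8, 9, 10], [4, 5, 9, 9], [6, 1, 1, 1],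
    [10, 3, 3, 5], [5, 4, 4, 4], [5, 10, 10, 10]])]"

definition double_chain :: "(nat \<times> nat) list" where
    "double_chain = [(2, 3), (2, 4), (3, 5), (3, 6), (4, 7), (5, 8), (6, 9), (7, 10), (9, 11)]"

lemma mk_cert: "cert_ok (gp_tab 8 5) mk_ref mk_chain" by code_simp
lemma nauru_cert: "cert_ok (gp_tab 12 5) nauru_ref nauru_chain" by code_simp
lemma foster_cert: "cert_ok (gp_tab 24 5) foster_ref foster_chain" by code_simp
lemma dodec_cert: "cert_ok (gp_tab 10 2) dodec_ref dodec_chain" by code_simp
lemma cube_cert: "cert_ok cube_tab cube_ref cube_chain" by code_simp
lemma icosa_cert: "cert_ok icosa_tab icosa_ref icosa_chain" by code_simp

lemma cert_ranks:
  "card (set (fst (last mk_ref))) = 6" "card (set (fst (last nauru_ref))) = 7" "card (set (fst (last foster_ref))) = 12"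
  "card (set (fst (last dodec_ref))) = 6" "card (set (fst (last cube_ref))) = 4" "card (set (fst (last icosa_ref))) = 4"
  by code_simp+

definition double_ok2 :: bool where
  "double_ok2 \<longleftrightarrow> table_ok double_tab \<and> refines_ok double_tab double_init double_ref \<and> refines_ok double_tab double_init2 double_ref2 \<and>
     start_ok double_tab double_classes \<and> chains_ok double_tab double_classes [0, 1, 2] double_chain \<and>
     fst (last double_ref) = double_classes \<and> fst (last double_ref2) = double_classes"

text \<open>The final colour is equivalent to the pair of dodecahedral distance and side of the
  bipartition; the two literal tables translate in either direction.\<close>

definition double_spec :: bool where
  "double_spec \<longleftrightarrow> list_all (\<lambda>p. dodec_dist ! (p mod 20) < 6 \<and>
      double_init ! p = (if p = 0 then 0 else 1 + dodec_dist ! (p mod 20)) \<and>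
      double_init2 ! p = (if p = 0 then 0 else if p = 20 then 1 else 2) \<and>
      double_classes ! p = [[0, 8], [5, 1], [2, 3], [6, 4], [7, 9], [11, 10]] ! (dodec_dist ! (p mod 20)) ! (p div 20) \<and>
      [(0, 0), (1, 1), (2, 0), (2, 1), (3, 1), (1, 0), (3, 0), (4, 0), (0, 1), (4, 1), (5, 1), (5, 0)] ! (double_classes ! p) = (dodec_dist ! (p mod 20), p div 20) \<and>
      (dodec_dist ! (p mod 20) = 0 \<longleftrightarrow> p = 0 \<or> p = 20) \<and>
      list_all (\<lambda>q. (p < 20) ~= (q < 20)) (double_tab ! p) \<and>
      (p \<in> set (double_tab ! 0) \<longleftrightarrow> dodec_dist ! (p mod 20) = 1 \<and> 20 \<le> p)) [0..<40]"

lemma double_ok2: double_ok2 by code_simp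

lemma double_spec: double_spec by code_simp

lemma double_classes_card: "card (set double_classes) = 12" by code_simp

definition cube_words :: "bool list list" where
  "cube_words = [[False, False, False], [True, False, False], [False, True, False], [False, False, True],
     [True, True, False], [True, False, True], [False, True, True], [True, True, True]]"

lemma cube_iso_check: "list_all (\<lambda>p. list_all (\<lambda>q. (length (filter (\<lambda>i. cube_words ! p ! i ~= cube_words ! q ! i) [0, 1, 2]) = 1) = (q \<in> set (cube_tab ! p))) [0..<8]) [0..<8]"
  by code_simp

text \<open>The lower pentagon starts at index 1: \<open>(2, 1)\<close> is the lower neighbour
  common to \<open>(1, 0)\<close> and \<open>(1, 1)\<close>, as position 6 is for 1 and 2 in
  \<open>icosa_tab\<close>.\<close>

definition icosa_points :: "(nat \<times> int) list" where
  "icosa_points = [(0, 0), (1, 0), (1, 1), (1, 2), (1, 3), (1, 4), (2, 1), (2, 2), (2, 3), (2, 4), (2, 0), (3, 0)]"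

definition icosa_pairs :: "(nat \<times> nat) list" where
  "icosa_pairs = [(0, 1), (11, 10), (1, 2), (10, 6), (1, 10), (1, 6), (0, 2), (11, 6), (2, 3), (6, 7), (2, 6), (2, 7), (0, 3), (11, 7), (3, 4), (7, 8), (3, 7), (3, 8), (0, 4), (11, 8), (4, 5), (8, 9), (4, 8), (4, 9), (0, 5), (11, 9), (5, 1), (9, 10), (5, 9), (5, 10)]"

definition pair_nbrs :: "(nat \<times> nat) list => nat => nat list" where
  "pair_nbrs es p = map snd (filter (\<lambda>e. fst e = p) es) @ map fst (filter (\<lambda>e. snd e = p) es)"

lemma pair_nbrs: "q \<in> set (pair_nbrs es p) \<longleftrightarrow> (p, q) \<in> set es \<or> (q, p) \<in> set es"
  unfolding pair_nbrs_def by force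

lemma icosa_iso_check: "map (\<lambda>p. sort (pair_nbrs icosa_pairs p)) [0..<12] = map sort icosa_tab"
  by code_simp

lemma icosa_pairs_lt: "list_all (\<lambda>(p, q). p < 12 \<and> q < 12) icosa_pairs" by code_simp

lemma icosa_base_pairs: "icosa_base = set (map (\<lambda>(p, q). (icosa_points ! p, icosa_points ! q)) icosa_pairs)"
proof -
  have five: "{0..<5::int} = {0, 1, 2, 3, 4}" by auto
  show ?thesis unfolding icosa_base_def five icosa_pairs_def icosa_points_def by (simp add: insert_commute)
qed

section \<open>Eigenvalue with square five: arcs and the octagon\<close>

locale pm_icos = pm_cubic c u \<theta> a0 b0 for c :: "'x::finite => 'x => nat" and u \<theta> a0 b0 +
  assumes theta5: "\<theta>\<^sup>2 = 5"
begin

lemma th5: "\<theta> * \<theta> = 5" "\<theta> * (\<theta> * a) = 5 * a"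
  using theta5 by (simp_all add: power2_eq_square mult.assoc[symmetric])

text \<open>The component of \<open>u x\<close> along \<open>T y z\<close> has the sign of the turn,
  and reversal negates the normal.\<close>

lemma eps_rev: "path3 x y z ==> eps z y x = - eps x y z"
proof -
  assume p: "path3 x y z"
  have xy: "adj x y" using p unfolding path3_def by blast
  have "u x \<bullet> T y z = eps x y z * ((9 - \<theta>\<^sup>2) / 6)"
    unfolding T_step[OF p] using inner_adj[OF xy] w1_theta
    by (simp add: inner_add_right inner_diff_right T_perp power2_eq_square field_simps)
  then have "u x \<bullet> T z y = - eps x y z * (2 / 3)" unfolding T_swap[of z y] using theta5 by simp
  then show ?thesis using eps_cases[of x y z] unfolding eps_def[of z y x] by auto
qed

lemma inner_step:
  assumes "path3 x y z"
  shows "u z \<bullet> V = (\<theta> * (u y \<bullet> V) - u x \<bullet> V + eps x y z * (T x y \<bullet> V)) / 2"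
    "T y z \<bullet> V = (T x y \<bullet> V + eps x y z * (3 * (u x \<bullet> V) - \<theta> * (u y \<bullet> V))) / 2"
  by (subst turn_vec(1)[OF assms], simp add: inner_add_left inner_diff_left)
    (subst T_step[OF assms], simp add: inner_add_left inner_diff_left)

lemma not_rational: "\<theta> ~= 1" "\<theta> ~= -1" "\<theta> ~= 3" "\<theta> ~= -3" "\<theta> ~= 0" using theta5 by auto

text \<open>A path of length four turning left, left, right has its endpoints joined by exactly one other
  path with a right--left or left--right pattern, and together they form an octagon, the boundary of
  two adjacent pentagons.\<close>

lemma octagon:
  assumes p: "path3 x p q" "eps x p q = 1" "path3 p q r" "eps p q r = 1" "path3 q r v" "eps q r v = -1"
  shows "\<exists>p' q' r'. path3 r v r' \<and> eps r v r' = 1 \<and> path3 v r' q' \<and> eps v r' q' = 1 \<and> path3 r' q' p' \<and> eps r' q' p' = 1 \<and>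
    path3 q' p' x \<and> eps q' p' x = -1 \<and> path3 p' x p \<and> eps p' x p = 1"
proof -
  have xp: "adj x p" using p(1) unfolding path3_def by blast
  have "(p, q, r) \<in> walks True False x v" unfolding walks_def
    using p cis_iff[OF p(1,3)] cis_iff[OF p(3,5)] by simp
  then have "card (walks True False x v) > 0" by (subst card_gt_0_iff) auto
  then have "walks False True x v ~= {}" using card_switch[of x v] by auto
  then obtain p' q' r' where w: "path3 x p' q'" "path3 p' q' r'" "path3 q' r' v" "\<not> cis x r'" "cis p' v"
    unfolding walks_def by blast
  define e where "e = eps x p' q'"
  have e: "e = 1 \<or> e = -1" unfolding e_def by (rule eps_cases)
  have e2: "eps p' q' r' = - e" using cis_iff[OF w(1,2)] w(4) eps_cases[of p' q' r'] e unfolding e_def by auto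
  have e3: "eps q' r' v = - e" using cis_iff[OF w(2,3)] w(5) e2 by simp
  define X where "X = u x"
  define Y where "Y = u p"
  define M where "M = T x p"
  have b: "X \<bullet> X = 1" "Y \<bullet> Y = 1" "X \<bullet> Y = \<theta>/3" "Y \<bullet> X = \<theta>/3" "M \<bullet> X = 0" "M \<bullet> Y = 0" "X \<bullet> M = 0" "Y \<bullet> M = 0" "M \<bullet> M = 4/3"
    using inner_adj[OF xp] w1_theta T_perp T_sq[OF xp] theta5 unfolding X_def Y_def M_def by (simp_all add: inner_commute)
  \<comment> \<open>\<open>V\<close> is an arbitrary test vector, so these are identities between
    vectors in the basis \<open>X\<close>, \<open>Y\<close>, \<open>M\<close>.\<close>
  have CT: "u v \<bullet> V = (-3/4 + \<theta>/4) * (X \<bullet> V) + (-3/4 + \<theta>/4) * (Y \<bullet> V) + (1/4 + \<theta>/4) * (M \<bullet> V)"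
    "u r \<bullet> V = (3/4 - \<theta>/4) * (X \<bullet> V) + (3/4 - \<theta>/4) * (Y \<bullet> V) + (1/4 + \<theta>/4) * (M \<bullet> V)"
    "T r v \<bullet> V = (1/2 + \<theta>/2) * (X \<bullet> V) - (1/2 + \<theta>/2) * (Y \<bullet> V)" for V
    unfolding inner_step[OF p(5)] inner_step[OF p(3)] inner_step[OF p(1)] p(2,4,6) X_def Y_def M_def
    by (simp_all add: field_simps th5)
  have P1: "u v \<bullet> V = (-3/4 - \<theta>/4) * (u x \<bullet> V) + (3/4 + \<theta>/4) * (u p' \<bullet> V) + e * (1/4 - \<theta>/4) * (T x p' \<bullet> V)"
    "u r' \<bullet> V = (-3/4 - \<theta>/4) * (u x \<bullet> V) + (3/4 + \<theta>/4) * (u p' \<bullet> V) - e * (1/4 - \<theta>/4) * (T x p' \<bullet> V)" for V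
    using e unfolding inner_step[OF w(3)] inner_step[OF w(2)] inner_step[OF w(1)] e2 e3 e_def[symmetric]
    by (elim disjE; simp add: field_simps th5)+
  have pne: "p' ~= p"
  proof
    assume "p' = p"
    then have "u v \<bullet> Y = (-3/4 - \<theta>/4) * (X \<bullet> Y) + (3/4 + \<theta>/4) * (Y \<bullet> Y) + e * (1/4 - \<theta>/4) * (M \<bullet> Y)"
      using P1(1)[of Y] unfolding X_def Y_def M_def by simp
    then show False unfolding CT(1)[of Y] b by (simp add: field_simps th5)
  qed
  have pp: "path3 p x p'" using w(1) xp pne adj_sym unfolding path3_def by blast
  define s where "s = eps p x p'"
  have s: "s = 1 \<or> s = -1" unfolding s_def by (rule eps_cases)
  have P2: "u p' \<bullet> V = (\<theta> * (X \<bullet> V) - Y \<bullet> V - s * (M \<bullet> V)) / 2" "T x p' \<bullet> V = (- (M \<bullet> V) + s * (3 * (Y \<bullet> V) - \<theta> * (X \<bullet> V))) / 2" for V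
    unfolding inner_step[OF pp] T_swap[of p x] s_def[symmetric] X_def Y_def M_def by simp_all
  \<comment> \<open>Testing the two expressions for \<open>u v\<close> against the basis decides
    both signs, as \<open>\<theta>\<close> avoids the values in \<open>not_rational\<close>.\<close>
  have "s = -1 \<and> e = 1"
  proof -
    have 1: "(-3/4 + \<theta>/4) * (X \<bullet> V) + (-3/4 + \<theta>/4) * (Y \<bullet> V) + (1/4 + \<theta>/4) * (M \<bullet> V) =
      (-3/4 - \<theta>/4) * (X \<bullet> V) + (3/4 + \<theta>/4) * ((\<theta> * (X \<bullet> V) - Y \<bullet> V - s * (M \<bullet> V)) / 2) +
      e * (1/4 - \<theta>/4) * ((- (M \<bullet> V) + s * (3 * (Y \<bullet> V) - \<theta> * (X \<bullet> V))) / 2)" for V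
      using P1(1)[of V] unfolding CT(1)[of V] P2 X_def by simp
    show ?thesis using 1[of X] 1[of Y] 1[of M] s e not_rational unfolding b
      by (elim disjE) (simp_all add: field_simps th5)
  qed
  then have se: "s = -1" "e = 1" by blast+
  have rv: "adj r v" "adj v r'" using p(5) w(3) adj_sym unfolding path3_def by blast+
  \<comment> \<open>The components along \<open>M\<close> show that the second path does not enter
    \<open>v\<close> through \<open>r\<close>, so the two paths can be traversed as one closed walk
    without backtracking at \<open>v\<close>.\<close>
  have "u r' \<bullet> M ~= u r \<bullet> M"
    unfolding P1(2) CT(2) P2 se b X_def[symmetric] using not_rational by (simp add: field_simps th5)
  then have "r' ~= r" by auto
  then have rr: "path3 r v r'" unfolding path3_def using rv by blast
  have "eps r v r' = 1"
  proof (rule ccontr)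
    assume "eps r v r' ~= 1"
    then have "eps r v r' = -1" using eps_cases[of r v r'] by blast
    then have "u r' \<bullet> X = (\<theta> * (u v \<bullet> X) - u r \<bullet> X - T r v \<bullet> X) / 2" using inner_step(1)[OF rr, of X] by simp
    then show False unfolding P1(2) CT P2 se b X_def[symmetric] using not_rational by (simp add: field_simps th5)
  qed
  moreover have "path3 v r' q'" "path3 r' q' p'" "path3 q' p' x" "path3 p' x p" using w(1-3) pp path3_sym by blast+
  moreover have "eps v r' q' = 1" "eps r' q' p' = 1" "eps q' p' x = -1" "eps p' x p = 1"
    using eps_rev[OF w(3)] eps_rev[OF w(2)] eps_rev[OF w(1)] eps_rev[OF pp] e2 e3 se e_def s_def by simp_all
  ultimately show ?thesis using rr by blast
qed

text \<open>Rotation about the tail to the left. Pairs that are not arcs stay fixed, so that the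
  relators hold on the whole type.\<close>

definition rot :: "'x \<times> 'x => 'x \<times> 'x" where
  "rot = (\<lambda>(x, y). if adj x y then (x, SOME z. path3 y x z \<and> eps y x z = 1) else (x, y))"

definition rev_arc :: "'x \<times> 'x => 'x \<times> 'x" where
  "rev_arc = (\<lambda>(x, y). if adj x y then (y, x) else (x, y))"

definition turn :: "nat => 'x \<times> 'x => 'x \<times> 'x" where
  "turn i s = (if i = 0 then rev_arc s else if i = 1 then rot s else rot (rot s))"

lemma turn_simps [simp]: "turn 0 s = rev_arc s" "turn 1 s = rot s" "turn (Suc 0) s = rot s" "turn 2 s = rot (rot s)"
  unfolding turn_def by simp_all

lemma rev_arc: "adj x y ==> rev_arc (x, y) = (y, x)" unfolding rev_arc_def by simp

lemma not_arc: "\<not> adj x y ==> rot (x, y) = (x, y)" "\<not> adj x y ==> rev_arc (x, y) = (x, y)"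
  unfolding rot_def rev_arc_def by simp_all

lemma rot_left: "path3 y x z ==> eps y x z = 1 ==> rot (x, y) = (x, z)"
proof -
  assume p: "path3 y x z" "eps y x z = 1"
  then have "\<exists>z. path3 y x z \<and> eps y x z = 1" by blast
  from someI_ex[OF this] have "(SOME z. path3 y x z \<and> eps y x z = 1) = z" using turn_unique[of y x _ z] p by metis
  moreover have "adj x y" using p(1) adj_sym unfolding path3_def by blast
  ultimately show ?thesis unfolding rot_def by simp
qed

text \<open>Coming from \<open>y\<close>, left is \<open>z\<close> and right is \<open>w\<close>;
  left of \<open>z\<close> is \<open>w\<close>, and left of \<open>w\<close> is \<open>y\<close>. So
  turning left permutes the three arcs at \<open>x\<close> cyclically.\<close>

lemma star:
  assumes "adj x y"
  obtains z w where "path3 y x z" "eps y x z = 1" "path3 y x w" "eps y x w = -1" "path3 z x w" "eps z x w = 1"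
    "path3 w x y" "eps w x y = 1" "N x = {y, z, w}"
proof -
  have yx: "adj y x" using assms adj_sym by blast
  obtain z where z: "path3 y x z" "eps y x z = 1" using ex_turn[OF yx, of 1] by blast
  obtain w where w: "path3 y x w" "eps y x w = -1" using ex_turn[OF yx, of "-1"] by blast
  have zw: "z ~= w" using z w by auto
  have pzw: "path3 z x w" using z(1) w(1) zw adj_sym unfolding path3_def by blast
  have pzy: "path3 z x y" "eps z x y = -1" using z(1) path3_sym[of y x z] eps_rev[OF z(1)] z(2) by simp_all
  have wy: "w ~= y" using w(1) unfolding path3_def by blast
  have "eps z x w = 1" using turn_vec(2)[OF pzy(1)] pzw pzy(2) wy by auto
  moreover have "path3 w x y" "eps w x y = 1" using w(1) path3_sym[of y x w] eps_rev[OF w(1)] w(2) by simp_all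
  moreover have "N x = {y, z, w}"
  proof (rule card_subset_eq[symmetric])
    show "{y, z, w} \<subseteq> N x" using z(1) w(1) assms unfolding path3_def by auto
    have "y ~= z" using z(1) unfolding path3_def by blast
    then show "card {y, z, w} = card (N x)" using k3[of x] zw wy by simp
  qed simp
  ultimately show ?thesis using that z w pzw by blast
qed

lemma rot_star: "adj x y ==> \<exists>z w. rot (x, y) = (x, z) \<and> rot (x, z) = (x, w) \<and> rot (x, w) = (x, y) \<and> N x = {y, z, w}"
proof -
  assume "adj x y"
  then obtain z w where s: "path3 y x z" "eps y x z = 1" "path3 y x w" "eps y x w = -1" "path3 z x w" "eps z x w = 1"
    "path3 w x y" "eps w x y = 1" "N x = {y, z, w}" by (rule star)
  show ?thesis using rot_left[OF s(1,2)] rot_left[OF s(5,6)] rot_left[OF s(7,8)] s(9) by blast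
qed

lemma rot_right: "path3 y x z ==> eps y x z = -1 ==> rot (rot (x, y)) = (x, z)"
proof -
  assume p: "path3 y x z" "eps y x z = -1"
  have "adj x y" using p(1) adj_sym unfolding path3_def by blast
  then obtain z' w where s: "path3 y x z'" "eps y x z' = 1" "path3 y x w" "eps y x w = -1" "path3 z' x w" "eps z' x w = 1"
    "path3 w x y" "eps w x y = 1" "N x = {y, z', w}" by (rule star)
  have "w = z" using turn_unique[OF s(3) p(1)] s(4) p(2) by simp
  then show ?thesis using rot_left[OF s(1,2)] rot_left[OF s(5,6)] by simp
qed

lemma left_turn: "path3 x y z ==> eps x y z = 1 ==> rot (rev_arc (x, y)) = (y, z)"
  using rev_arc[of x y] rot_left[of x y z] unfolding path3_def by simp

lemma right_turn: "path3 x y z ==> eps x y z = -1 ==> rot (rot (rev_arc (x, y))) = (y, z)"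
  using rev_arc[of x y] rot_right[of x y z] unfolding path3_def by simp

lemma rot3: "rot (rot (rot s)) = s"
proof (cases s)
  case (Pair x y)
  show ?thesis
  proof (cases "adj x y")
    case True
    then show ?thesis using rot_star[OF True] unfolding Pair by auto
  qed (simp add: Pair not_arc)
qed

lemma rev_rev: "rev_arc (rev_arc s) = s"
  by (cases s) (auto simp: rev_arc_def adj_sym)

definition arc :: "'x \<times> 'x => bool" where "arc s \<longleftrightarrow> adj (fst s) (snd s)"

lemma rot_arc: "arc s ==> arc (rot s) \<and> fst (rot s) = fst s \<and> N (fst s) = {snd s, snd (rot s), snd (rot (rot s))}"
proof -
  assume "arc s"
  then have a: "adj (fst s) (snd s)" unfolding arc_def .
  obtain z w where s: "rot (fst s, snd s) = (fst s, z)" "rot (fst s, z) = (fst s, w)" "N (fst s) = {snd s, z, w}"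
    using rot_star[OF a] by blast
  have r: "rot s = (fst s, z)" using s(1) by simp
  have "z \<in> N (fst s)" unfolding s(3) by simp
  then have "adj (fst s) z" by simp
  then show ?thesis unfolding arc_def r s(2) using s(3) by simp
qed

lemma turn_arc: "arc s ==> arc (turn i s)"
  using rot_arc[of s] rot_arc[of "rot s"] adj_sym[of "fst s" "snd s"] rev_arc[of "fst s" "snd s"]
  unfolding turn_def arc_def by auto

lemma arc_rels: "r \<in> set arc_rels ==> act turn r s = s"
proof -
  have oct: "act turn [0, 1, 0, 1, 0, 2, 0, 1, 0, 1, 0, 1, 0, 2, 0, 1] s = s"
  proof (cases s)
    case (Pair x p)
    show ?thesis
    proof (cases "adj x p")
      case True
      obtain q where q: "path3 x p q" "eps x p q = 1" using ex_turn[OF True, of 1] by blast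
      have pq: "adj p q" using q unfolding path3_def by blast
      obtain r where r: "path3 p q r" "eps p q r = 1" using ex_turn[OF pq, of 1] by blast
      have qr: "adj q r" using r unfolding path3_def by blast
      obtain v where v: "path3 q r v" "eps q r v = -1" using ex_turn[OF qr, of "-1"] by blast
      obtain p' q' r' where o: "path3 r v r'" "eps r v r' = 1" "path3 v r' q'" "eps v r' q' = 1" "path3 r' q' p'"
        "eps r' q' p' = 1" "path3 q' p' x" "eps q' p' x = -1" "path3 p' x p" "eps p' x p = 1"
        using octagon[OF q r v] by blast
      show ?thesis unfolding Pair
        by (simp add: act_simps left_turn[OF q] left_turn[OF r] right_turn[OF v] left_turn[OF o(1,2)] left_turn[OF o(3,4)]
            left_turn[OF o(5,6)] right_turn[OF o(7,8)] left_turn[OF o(9,10)])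
    qed (simp add: Pair act_simps not_arc)
  qed
  assume "r \<in> set arc_rels"
  then show ?thesis using oct unfolding arc_rels_def by (auto simp: act_simps rot3 rev_rev)
qed

end

section \<open>The arcs as a quotient of the table of order 120\<close>

context pm_icos
begin

interpretation ct: coset_table 120 3 arc_T arc_W "[0, 2, 1]" arc_rels by (rule arc_table)

abbreviation "amove \<equiv> move arc_T"

definition A :: "'x \<times> 'x => nat => 'x \<times> 'x" where "A s p = act turn (look arc_W p) s"

lemma A_0: "A s 0 = s" unfolding A_def ct.W0 by (simp add: act_simps)

lemma A_turn: "p < 120 ==> i < 3 ==> turn i (A s p) = A s (amove i p)"
  unfolding A_def by (rule ct.move[OF arc_rels])

lemma A_A: "p < 120 ==> h < 120 ==> A (A s p) h = A s (fold amove (look arc_W h) p)"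
  unfolding A_def using ct.move_word[OF arc_rels ct.W_lt] by metis

lemma act_arc: "arc s ==> arc (act turn w s)"
  by (induction w arbitrary: s) (simp_all add: act_simps turn_arc)

lemma A_arc: "arc s ==> arc (A s p)" unfolding A_def by (rule act_arc)

definition realises :: "real^3 => real => 'x \<times> 'x => quad \<times> quad \<times> quad => bool" where
  "realises V m s q \<longleftrightarrow> (case q of ((a, a'), (b, b'), (d, d')) =>
     m * (u (fst s) \<bullet> V) = of_int a + of_int a' * \<theta> \<and> m * (u (snd s) \<bullet> V) = of_int b + of_int b' * \<theta> \<and>
     m * (T (fst s) (snd s) \<bullet> V) = of_int d + of_int d' * \<theta>)"

lemma realises_step:
  assumes s: "arc s" and i: "i < 3" and r: "realises V m s q"
  shows "realises V (2 * m) (turn i s) (arc_step i q)"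
proof -
  obtain x y where xy: "s = (x, y)" by fastforce
  obtain a a' b b' d d' where q: "q = ((a, a'), (b, b'), (d, d'))" by (metis prod.collapse)
  have e: "m * (u x \<bullet> V) = of_int a + of_int a' * \<theta>" "m * (u y \<bullet> V) = of_int b + of_int b' * \<theta>"
    "m * (T x y \<bullet> V) = of_int d + of_int d' * \<theta>" using r unfolding realises_def q xy by auto
  have axy: "adj x y" using s unfolding arc_def xy by simp
  obtain z w where st: "path3 y x z" "eps y x z = 1" "path3 y x w" "eps y x w = -1" by (rule star[OF axy])
  have n: "2 * m * (u v \<bullet> V) = \<theta> * (m * (u x \<bullet> V)) - m * (u y \<bullet> V) - f * (m * (T x y \<bullet> V))"
    "2 * m * (T x v \<bullet> V) = - (m * (T x y \<bullet> V)) + f * (3 * (m * (u y \<bullet> V)) - \<theta> * (m * (u x \<bullet> V)))"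
    if "path3 y x v" "eps y x v = f" for v f
    unfolding inner_step[OF that(1)] that(2) T_swap[of y x] by (simp_all add: field_simps)
  have x2: "2 * m * (u x \<bullet> V) = 2 * of_int a + 2 * of_int a' * \<theta>" using e(1) by simp
  have "i = 0 \<or> i = 1 \<or> i = 2" using i by auto
  then show ?thesis
  proof (elim disjE)
    assume "i = 0"
    then show ?thesis using e unfolding xy q realises_def by (simp add: rev_arc[OF axy] T_swap[of y x] algebra_simps)
  next
    assume "i = 1"
    then show ?thesis using x2 n(1)[OF st(1,2), unfolded e] n(2)[OF st(1,2), unfolded e] unfolding xy q realises_def
      by (simp add: rot_left[OF st(1,2)] algebra_simps th5)
  next
    assume "i = 2"
    then show ?thesis using x2 n(1)[OF st(3,4), unfolded e] n(2)[OF st(3,4), unfolded e] unfolding xy q realises_def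
      by (simp add: rot_right[OF st(3,4)] algebra_simps th5)
  qed
qed

lemma realises_word:
  "arc s ==> set w \<subseteq> {..<3} ==> realises V m s q ==> realises V (2 ^ length w * m) (act turn w s) (fold arc_step w q)"
proof (induction w arbitrary: s m q)
  case (Cons i w)
  have "realises V (2 ^ length w * (2 * m)) (act turn w (turn i s)) (fold arc_step w (arc_step i q))"
    by (rule Cons.IH[OF turn_arc[OF Cons.prems(1)]]) (use Cons.prems realises_step[of s i V m q] in auto)
  then show ?case by (simp add: act_simps mult_ac)
qed (simp add: act_simps)

lemma distinct_value: "arc s ==> set w \<subseteq> {..<3} ==> distinct_value w ==> act turn w s ~= s"
proof
  assume s: "arc s" and w: "set w \<subseteq> {..<3}" "distinct_value w" and e: "act turn w s = s"
  have xy: "adj (fst s) (snd s)" using s unfolding arc_def .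
  have "realises (u (fst s)) 3 s ((3, 0), (0, 1), (0, 0))"
    unfolding realises_def using inner_adj[OF xy] w1_theta by (simp add: T_perp inner_commute)
  from realises_word[OF s w(1) this] have r: "realises (u (fst s)) (2 ^ length w * 3) s (arc_value w)"
    unfolding e arc_value_def .
  obtain a b q where v: "arc_value w = ((a, b), q)" by (metis prod.collapse)
  have "2 ^ length w * 3 = of_int a + of_int b * \<theta>" using r unfolding realises_def v by (auto simp: case_prod_beta)
  then have "(of_int a - 3 * 2 ^ length w) = - of_int b * \<theta>" by simp
  then have "(of_int a - 3 * 2 ^ length w) * (of_int a - 3 * 2 ^ length w) = (- of_int b * \<theta>) * (- of_int b * \<theta>)" by simp
  also have "\<dots> = 5 * (of_int b * of_int b)" by (simp add: th5 mult_ac)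
  finally have "real_of_int ((a - 3 * 2 ^ length w) * (a - 3 * 2 ^ length w)) = real_of_int (5 * (b * b))" by simp
  then have "(a - 3 * 2 ^ length w) * (a - 3 * 2 ^ length w) = 5 * (b * b)" by (simp only: of_int_eq_iff)
  then show False using w(2) unfolding distinct_value_def v by simp
qed

lemma act_word: "set w \<subseteq> {..<3} ==> act turn w s = A s (fold amove w 0)"
  unfolding A_def by (rule ct.act_pos[OF arc_rels])

lemma rot_moves: "arc s ==> rot s ~= s" "arc s ==> rot (rot s) ~= s"
proof -
  assume s: "arc s"
  have "card {snd s, snd (rot s), snd (rot (rot s))} = 3" using rot_arc[OF s] k3[of "fst s"] by simp
  then show "rot s ~= s" "rot (rot s) ~= s"
    by (auto simp: card_insert_if split: if_splits)
qed

lemma kernel_cases: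
  assumes "arc s" "h < 120" "A s h = s" shows "h = 0 \<or> h = 117"
proof (rule ccontr)
  assume n: "\<not> ?thesis"
  define w where "w = look arc_W h"
  have w: "set w \<subseteq> {..<3}" unfolding w_def by (rule ct.W_lt[OF assms(2)])
  have e: "act turn w s = s" using assms(3) unfolding A_def w_def .
  have nd: "\<not> distinct_value w" using distinct_value[OF assms(1) w] e by blast
  have "\<forall>h\<in>set [0..<120]. h = 0 \<or> h = 117 \<or> distinct_value (look arc_W h) \<or>
     (let w = look arc_W h; q = fold amove (w @ w @ w @ w) 0 in q = amove 1 0 \<or> q = amove 2 0)"
    using arc_kernel unfolding arc_kernel_ok_def list_all_iff by blast
  from bspec[OF this, of h] have "h = 0 \<or> h = 117 \<or> distinct_value w \<or> fold amove (w @ w @ w @ w) 0 = amove 1 0 \<or>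
      fold amove (w @ w @ w @ w) 0 = amove 2 0"
    using assms(2) unfolding Let_def w_def by (simp only: set_upt atLeastLessThan_iff) blast
  then have q: "fold amove (w @ w @ w @ w) 0 = amove 1 0 \<or> fold amove (w @ w @ w @ w) 0 = amove 2 0" using n nd by blast
  have "act turn (w @ w @ w @ w) s = s" by (simp add: act_simps e)
  then have "A s (fold amove (w @ w @ w @ w) 0) = s" using act_word[of "w @ w @ w @ w" s] w by simp
  then have "A s (amove 1 0) = s \<or> A s (amove 2 0) = s" using q by auto
  then have "rot s = s \<or> rot (rot s) = s" using A_turn[of 0 1 s] A_turn[of 0 2 s] A_0 by simp
  then show False using rot_moves[OF assms(1)] by blast
qed

text \<open>Rotations reach all arcs at a vertex and reversal passes to a neighbour, so the letters
  act transitively on arcs.\<close>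

lemma arc_induct:
  assumes "arc s" "P s" and step: "!!t i. arc t ==> i < 3 ==> P t ==> P (turn i t)" and "arc t"
  shows "P t"
proof -
  have star: "P (fst t, z)" if t: "arc t" "P t" "adj (fst t) z" for t z
  proof -
    have r: "rot t = (fst t, snd (rot t))" "rot (rot t) = (fst t, snd (rot (rot t)))"
      using rot_arc[OF t(1)] rot_arc[of "rot t"] by (simp_all add: prod_eq_iff)
    have p: "P (fst t, snd t)" "P (fst t, snd (rot t))" "P (fst t, snd (rot (rot t)))"
      using step[of t 1] step[of t 2] t(1,2) r by simp_all
    have "z \<in> {snd t, snd (rot t), snd (rot (rot t))}" using rot_arc[OF t(1)] t(3) by (metis N_iff)
    then show ?thesis using p by auto
  qed
  have "\<forall>z. adj y z --> P (y, z)" for y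
  proof (rule conn_induct[of _ "fst s"])
    show "\<forall>z. adj (fst s) z --> P (fst s, z)" using star[OF assms(1,2)] by blast
    fix y z assume y: "\<forall>z. adj y z --> P (y, z)" and a: "adj y z"
    have zy: "adj z y" using a adj_sym by blast
    have "P (turn 0 (y, z))" using step[of "(y, z)" 0] y a unfolding arc_def by simp
    then have "P (z, y)" using rev_arc[OF a] by simp
    then show "\<forall>w. adj z w --> P (z, w)" using star[of "(z, y)"] zy unfolding arc_def by simp
  qed
  then show ?thesis using \<open>arc t\<close> unfolding arc_def by (metis prod.collapse)
qed

text \<open>The element at position 117 commutes with the letters, so its fixed arcs are closed
  under them.\<close>

lemma central_fixed:
  assumes "arc s" "A s 117 = s" "arc t" shows "A t 117 = t"
proof (rule arc_induct[OF assms(1) _ _ assms(3)])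
  fix t i assume t: "arc t" "i < (3::nat)" "A t 117 = t"
  have "i = 0 \<or> i = 1 \<or> i = 2" using t(2) by auto
  then have k: "fold amove (look arc_W 117) (amove i 0) = amove i 117"
    using arc_kernel[unfolded arc_kernel_ok_def list_all_iff] by auto
  have "turn i t = A t (amove i 0)" using A_turn[of 0 i t] A_0 t(2) by simp
  then have "A (turn i t) 117 = A t (amove i 117)" using A_A[of "amove i 0" 117 t] ct.move_lt[of 0 i] t(2) k by simp
  also have "\<dots> = turn i t" using A_turn[of 117 i t] t(2,3) by simp
  finally show "A (turn i t) 117 = turn i t" .
qed (rule assms(2))

definition base_arc :: "'x => 'x \<times> 'x" where "base_arc x = (x, SOME y. adj x y)"

lemma base_arc: "arc (base_arc x)" "fst (base_arc x) = x"
proof -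
  have "\<exists>y. adj x y" using k3[of x] by (metis N_iff card.empty ex_in_conv zero_neq_numeral)
  then show "arc (base_arc x)" "fst (base_arc x) = x" unfolding arc_def base_arc_def by (auto intro: someI_ex)
qed

definition vert :: "'x => nat => 'x" where "vert x q = fst (A (base_arc x) q)"

lemma arc_model:
  assumes ok: "arc_ok arc_T arc_W nb rep idx M" and M: "set M \<subseteq> {..<120}"
    and fx: "!!s h. arc s ==> h \<in> set M ==> A s h = s" "!!s h. arc s ==> h < 120 ==> A s h = s ==> h \<in> set M"
  shows "rooted_model adj nb (\<lambda>x. (!) (map (\<lambda>v. vert x (look rep v)) [0..<length nb]))"
    and "p < 120 ==> vert x p = vert x (look rep (look idx p))"
proof -
  note o = ok[unfolded arc_ok_def list_all_iff list_ex_iff]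
  have q: "quotient_ok nb 120 (\<lambda>p. [amove 0 p, amove 0 (amove 1 p), amove 0 (amove 2 p)]) rep idx" using o by blast
  note q' = q[unfolded quotient_ok_def list_all_iff]
  have rep: "look rep v < 120" if "v < length nb" for v using q' that by auto
  have idx: "look idx p < length nb" if "p < 120" for p using q' that by auto
  have rots: "A (base_arc x) (amove 1 p) = rot (A (base_arc x) p)" "A (base_arc x) (amove 2 p) = rot (rot (A (base_arc x) p))"
     "A (base_arc x) (amove 0 p) = rev_arc (A (base_arc x) p)" if "p < 120" for x p
    using A_turn[OF that, of 1 "base_arc x"] A_turn[OF that, of 2 "base_arc x"] A_turn[OF that, of 0 "base_arc x"] by simp_all
  have ar: "arc (A (base_arc x) p)" for x p by (rule A_arc[OF base_arc(1)])
  have fr: "fst (rev_arc s) = snd s" if "arc s" for s using that rev_arc[of "fst s" "snd s"] unfolding arc_def by simp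
  have B12: "vert x (amove 1 p) = vert x p" "vert x (amove 2 p) = vert x p" if "p < 120" for x p
    unfolding vert_def rots[OF that] using rot_arc[OF ar[of x p]] rot_arc[of "rot (A (base_arc x) p)"] by simp_all
  have Bh: "vert x (fold amove (look arc_W h) p) = vert x p" if "p < 120" "h \<in> set M" for x p h
    unfolding vert_def using A_A[OF that(1), of h "base_arc x"] fx(1)[OF ar that(2)] M that(2) by auto
  have oq: "(\<exists>h\<in>set M. p = fold amove (look arc_W h) (look rep (look idx p)) \<or> p = fold amove (look arc_W h) (amove 1 (look rep (look idx p))) \<or>
        p = fold amove (look arc_W h) (amove 2 (look rep (look idx p))))"
    "(\<forall>h\<in>set M. look idx (fold amove (look arc_W h) p) = look idx p)" "look idx (amove 1 p) = look idx p" "look idx (amove 2 p) = look idx p"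
    if "p < 120" for p using o that by simp_all
  have idxs: "vert x p = vert x (look rep (look idx p))" if p: "p < 120" for x p
    proof -
      define r where "r = look rep (look idx p)"
      have r: "r < 120" "amove 1 r < 120" "amove 2 r < 120" using rep[OF idx[OF p]] ct.move_lt unfolding r_def by simp_all
      obtain h where h: "h \<in> set M" "p = fold amove (look arc_W h) r \<or> p = fold amove (look arc_W h) (amove 1 r) \<or> p = fold amove (look arc_W h) (amove 2 r)"
        using oq(1)[OF p] unfolding r_def by blast
      have "vert x p = vert x r" using h(2) Bh[OF r(1) h(1)] Bh[OF r(2) h(1)] Bh[OF r(3) h(1)] B12[OF r(1)] by metis
      then show ?thesis unfolding r_def .
    qed
  show "p < 120 ==> vert x p = vert x (look rep (look idx p))" by (rule idxs)
  show "rooted_model adj nb (\<lambda>x. (!) (map (\<lambda>v. vert x (look rep v)) [0..<length nb]))"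
  proof (rule quotient_model[OF q, of vert])
    show "vert x (look rep 0) = x" for x using o A_0 base_arc(2) unfolding vert_def by simp
    show "N (vert x p) = vert x ` set [amove 0 p, amove 0 (amove 1 p), amove 0 (amove 2 p)]" if p: "p < 120" for x p
    proof -
      have p': "amove 1 p < 120" "amove 2 p < 120" using ct.move_lt[OF p] by simp_all
      have "vert x (amove 0 r) = snd (A (base_arc x) r)" if "r < 120" for r
        unfolding vert_def rots[OF that] using fr[OF ar] .
      then have "vert x ` set [amove 0 p, amove 0 (amove 1 p), amove 0 (amove 2 p)] =
          {snd (A (base_arc x) p), snd (A (base_arc x) (amove 1 p)), snd (A (base_arc x) (amove 2 p))}" using p p' by simp
      then show ?thesis unfolding vert_def rots[OF p] using rot_arc[OF ar[of x p]] by blast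
    qed
    show "vert x p = vert x (look rep (look idx p))" if "p < 120" for x p by (rule idxs[OF that])
    show "look idx p = look idx q" if pq: "p < 120" "q < 120" and e: "vert x p = vert x q" for x p q
    proof -
      define s where "s = base_arc x"
      have aq: "arc (A s q)" "arc (A s p)" using ar unfolding s_def by blast+
      have p3: "p < 120" "amove 1 p < 120" "amove 2 p < 120" using pq(1) ct.move_lt by simp_all
      have f: "fst (A s q) = fst (A s p)" using e unfolding vert_def s_def by simp
      have "snd (A s q) \<in> N (fst (A s p))" using aq(1) f unfolding arc_def by simp
      \<comment> \<open>Arcs with equal tails become equal after rotating one of them;
        \<open>collision\<close> turns the equality into an element fixing an arc, which lies in
        \<open>M\<close>.\<close>
      then have "snd (A s q) \<in> {snd (A s p), snd (rot (A s p)), snd (rot (rot (A s p)))}" using rot_arc[OF aq(2)] by blast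
      then have "A s q = A s p \<or> A s q = rot (A s p) \<or> A s q = rot (rot (A s p))"
        using f rot_arc[OF aq(2)] rot_arc[of "rot (A s p)"] by (auto simp: prod_eq_iff)
      then have "A s p = A s q \<or> A s (amove 1 p) = A s q \<or> A s (amove 2 p) = A s q" using rots[OF pq(1), of x] unfolding s_def by auto
      then obtain p' where p': "p' < 120" "A s p' = A s q" "look idx p' = look idx p" using p3 oq(3,4)[OF pq(1)] by metis
      obtain h where h: "h < 120" "fold amove (look arc_W h) p' = q" "A (A s p') h = A s p'"
        using ct.collision[OF arc_rels p'(1) pq(2) p'(2)[unfolded A_def]] unfolding A_def by blast
      have "h \<in> set M" using fx(2)[OF _ h(1,3)] ar unfolding s_def by blast
      then have "look idx q = look idx p'" using oq(2)[OF p'(1)] h(2) by blast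
      then show ?thesis using p'(3) by simp
    qed
  qed
qed

text \<open>The inner products on the dodecahedron, by distance, as \<open>(a + b \<theta>) / 3\<close>.\<close>

definition dodec_cos :: "nat => real" where
  "dodec_cos i = [1, \<theta> / 3, 1 / 3, - 1 / 3, - \<theta> / 3, -1] ! i"

lemma dodec_cos_inj: "i < 6 ==> j < 6 ==> dodec_cos i = dodec_cos j ==> i = j"
proof -
  have six: "i = 0 \<or> i = 1 \<or> i = 2 \<or> i = 3 \<or> i = 4 \<or> i = 5" if "i < 6" for i :: nat using that by auto
  assume i: "i < 6" and j: "j < 6" and e: "dodec_cos i = dodec_cos j"
  show "i = j" using six[OF i] six[OF j] e not_rational unfolding dodec_cos_def
    by (elim disjE) (auto simp: field_simps)
qed

lemma arc_value_inner:
  assumes s: "arc s" and w: "set w \<subseteq> {..<3}" and v: "fst (arc_value w) = (2 ^ length w * a, 2 ^ length w * b)"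
  shows "u (fst s) \<bullet> u (fst (act turn w s)) = (of_int a + of_int b * \<theta>) / 3"
proof -
  have xy: "adj (fst s) (snd s)" using s unfolding arc_def .
  have "realises (u (fst s)) 3 s ((3, 0), (0, 1), (0, 0))"
    unfolding realises_def using inner_adj[OF xy] w1_theta by (simp add: T_perp inner_commute)
  from realises_word[OF s w this] have r: "realises (u (fst s)) (2 ^ length w * 3) (act turn w s) (arc_value w)"
    unfolding arc_value_def .
  obtain q where q: "arc_value w = ((2 ^ length w * a, 2 ^ length w * b), q)" using v by (metis prod.collapse)
  have "2 ^ length w * 3 * (u (fst (act turn w s)) \<bullet> u (fst s)) = 2 ^ length w * (of_int a + of_int b * \<theta>)"
    using r unfolding realises_def q by (auto simp: case_prod_beta algebra_simps)
  then have "3 * (u (fst (act turn w s)) \<bullet> u (fst s)) = of_int a + of_int b * \<theta>" by simp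
  then show ?thesis by (simp add: inner_commute)
qed

text \<open>If the element at position 117 fixes one arc it fixes all, and the graph is the
  dodecahedron; otherwise the whole table is the arc set of the double. There the inner products are
  recorded as well, because the scheme is identified with their help.\<close>

lemma icos_models: "(\<exists>F. rooted_model adj (gp_tab 10 2) F) \<or> (\<exists>F. rooted_model adj double_tab F \<and>
    (\<forall>x. \<forall>p<40. u x \<bullet> u (F x p) = dodec_cos (dodec_dist ! (p mod 20))) \<and> (\<forall>x. \<forall>p<20. u (F x (p + 20)) = u (F x p)))"
proof (cases "\<exists>s. arc s \<and> A s 117 = s")
  case True
  then have "A t 117 = t" if "arc t" for t using central_fixed that by blast
  then have "rooted_model adj (gp_tab 10 2) (\<lambda>x. (!) (map (\<lambda>v. vert x (look (trie_of dodec_rep) v)) [0..<length (gp_tab 10 2)]))"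
    by (intro arc_model(1)[OF dodec_ok]) (use kernel_cases A_0 in auto)
  then show ?thesis by blast
next
  case False
  let ?rep = "trie_of double_rep" and ?idx = "trie_of double_idx"
  define F where "F x = (!) (map (\<lambda>v. vert x (look ?rep v)) [0..<length double_tab])" for x
  have len: "length double_tab = 40" unfolding double_tab_def using gp_length(1)[of 10 2] by simp
  have fx: "A s h = s" if "arc s" "h \<in> set [0]" for s h using that A_0 by simp
  have fx': "h \<in> set [0]" if "arc s" "h < 120" "A s h = s" for s h
  proof -
    have "h ~= 117" using False that by blast
    then show ?thesis using kernel_cases[OF that] by simp
  qed
  have m: "rooted_model adj double_tab F"
    unfolding F_def by (rule arc_model(1)[OF double_ok]) (use fx fx' in auto)
  have ix: "p < 120 ==> vert x p = vert x (look ?rep (look ?idx p))" for x p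
    by (rule arc_model(2)[OF double_ok]) (use fx fx' in auto)
  note v = double_values[unfolded double_values_ok_def list_all_iff]
  have Fv: "F x p = vert x (look ?rep p)" if "p < 40" for x p unfolding F_def len using that by simp
  have rep: "look ?rep p < 120" if "p < 40" for p
    using double_ok[unfolded arc_ok_def quotient_ok_def list_all_iff] that len by simp
  have "u x \<bullet> u (F x p) = dodec_cos (dodec_dist ! (p mod 20))" if p: "p < 40" for x p
  proof -
    let ?w = "look arc_W (look ?rep p)"
    obtain a b where ab: "(a, b) = ([(3, 0), (0, 1), (1, 0), (-1, 0), (0, -1), (-3, 0)] :: quad list) ! (dodec_dist ! (p mod 20))" by (metis prod.collapse)
    have d: "dodec_dist ! (p mod 20) < 6" using v p by simp
    then have six: "dodec_dist ! (p mod 20) = 0 \<or> dodec_dist ! (p mod 20) = 1 \<or> dodec_dist ! (p mod 20) = 2 \<or> dodec_dist ! (p mod 20) = 3 \<or>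
      dodec_dist ! (p mod 20) = 4 \<or> dodec_dist ! (p mod 20) = 5" by auto
    have "fst (arc_value ?w) = (2 ^ length ?w * a, 2 ^ length ?w * b)" using v p ab by (simp add: case_prod_beta Let_def prod_eq_iff)
    then have "u (fst (base_arc x)) \<bullet> u (fst (act turn ?w (base_arc x))) = (of_int a + of_int b * \<theta>) / 3"
      by (rule arc_value_inner[OF base_arc(1) ct.W_lt[OF rep[OF p]]])
    then have "u x \<bullet> u (F x p) = (of_int a + of_int b * \<theta>) / 3" unfolding Fv[OF p] vert_def A_def base_arc(2) .
    then show ?thesis using six ab unfolding dodec_cos_def by (elim disjE) simp_all
  qed
  moreover have "u (F x (p + 20)) = u (F x p)" if p: "p < 20" for x p
  proof -
    let ?q = "look ?rep p" and ?s = "base_arc x"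
    have q: "?q < 120" using rep p by simp
    have w: "set (look arc_W 117) \<subseteq> {..<3}" by (rule ct.W_lt) simp
    have fq: "fold amove (look arc_W 117) ?q < 120" "look ?idx (fold amove (look arc_W 117) ?q) = p + 20"
      using ct.move_word[OF arc_rels w q] v p by simp_all
    have "vert x (fold amove (look arc_W 117) ?q) = F x (p + 20)" using ix[OF fq(1), of x] Fv[of "p + 20" x] fq(2) p by simp
    moreover have "vert x (fold amove (look arc_W 117) ?q) = fst (act turn (look arc_W 117) (A ?s ?q))"
      unfolding vert_def using A_A[OF q, of 117 ?s] unfolding A_def by simp
    moreover have "u (fst (A ?s ?q)) \<bullet> u (fst (act turn (look arc_W 117) (A ?s ?q))) = (of_int 3 + of_int 0 * \<theta>) / 3"
      by (rule arc_value_inner[OF A_arc[OF base_arc(1)] w]) (use v in simp)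
    ultimately have "u (F x p) \<bullet> u (F x (p + 20)) = 1" using Fv[of p x] p unfolding vert_def by simp
    then show ?thesis using unit_eqI[OF uu uu] by metis
  qed
  ultimately show ?thesis using m by blast
qed

end

section \<open>The bipartite double of the dodecahedron\<close>

unbundle no cross3_syntax

lemma assoc_schemeD:
  assumes "assoc_scheme X R d"
  shows "finite X" "i \<le> d ==> R i \<subseteq> X \<times> X" "i \<le> d ==> R i ~= {}"
    "i \<le> d ==> j \<le> d ==> i ~= j ==> R i \<inter> R j = {}" "(\<Union>i\<le>d. R i) = X \<times> X" "R 0 = Id_on X" "i \<le> d ==> sym (R i)"
    "h \<le> d ==> i \<le> d ==> j \<le> d ==> \<exists>p. \<forall>(x, y)\<in>R h. card {z\<in>X. (x, z) \<in> R i \<and> (z, y) \<in> R j} = p"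
proof -
  note a = assms[unfolded assoc_scheme_def]
  show "finite X" by (rule a[THEN conjunct1])
  note a1 = a[THEN conjunct2, THEN conjunct1, rule_format]
  show "i \<le> d ==> R i \<subseteq> X \<times> X" by (rule a1[THEN conjunct1])
  show "i \<le> d ==> R i ~= {}" by (rule a1[THEN conjunct2])
  note b = a[THEN conjunct2, THEN conjunct2]
  show "i \<le> d ==> j \<le> d ==> i ~= j ==> R i \<inter> R j = {}" by (rule b[THEN conjunct1, rule_format])
  note e = b[THEN conjunct2]
  show "(\<Union>i\<le>d. R i) = X \<times> X" by (rule e[THEN conjunct1])
  note f = e[THEN conjunct2]
  show "R 0 = Id_on X" by (rule f[THEN conjunct1])
  note g = f[THEN conjunct2]
  show "i \<le> d ==> sym (R i)" by (rule g[THEN conjunct1, rule_format])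
  show "h \<le> d ==> i \<le> d ==> j \<le> d ==> \<exists>p. \<forall>(x, y)\<in>R h. card {z\<in>X. (x, z) \<in> R i \<and> (z, y) \<in> R j} = p"
    using g[THEN conjunct2, THEN spec, THEN mp, THEN spec, THEN mp, THEN spec, THEN mp] .
qed

text \<open>Index \<open>2 * i\<close> is the relation with \<open>I_2\<close>, index
  \<open>2 * i + 1\<close> the one with \<open>J_2 - I_2\<close>, transported along
  \<open>f\<close>.\<close>

definition pull :: "('x => 'b \<times> bool) => (nat => ('b \<times> 'b) set) => nat => ('x \<times> 'x) set" where
  "pull f S m = {(x, y). (f x, f y) \<in> bd_rel (S (m div 2)) (odd m)}"

lemma bd_rel_iff: "(p, q) \<in> bd_rel D b \<longleftrightarrow> (fst p, fst q) \<in> D \<and> ((snd p ~= snd q) \<longleftrightarrow> b)"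
  unfolding bd_rel_def by (cases p; cases q) simp

lemma pull_iff: "(x, y) \<in> pull f S m \<longleftrightarrow> (fst (f x), fst (f y)) \<in> S (m div 2) \<and> ((snd (f x) ~= snd (f y)) \<longleftrightarrow> odd m)"
  unfolding pull_def by (simp add: bd_rel_iff)

text \<open>The side of an intermediate vertex is forced by the parity of \<open>i\<close>. One
  exists only if \<open>h\<close> has the parity of \<open>i + j\<close>, and then the intersection
  number is that of \<open>S\<close>.\<close>

lemma pull_scheme:
  fixes f :: "'x::finite => 'b \<times> bool"
  assumes S: "assoc_scheme V S d" and f: "bij_betw f UNIV (bd_V V)"
  shows "assoc_scheme UNIV (pull f S) (2 * d + 1)"
proof -
  define g where "g v b = inv_into UNIV f (v, b)" for v b
  have fg: "f (g v b) = (v, b)" if "v \<in> V" for v b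
    unfolding g_def by (rule f_inv_into_f) (use f that in \<open>simp add: bij_betw_def bd_V_def\<close>)
  have fV: "fst (f x) \<in> V" for x
  proof -
    have "f x \<in> bd_V V" using f unfolding bij_betw_def by blast
    then show ?thesis unfolding bd_V_def by (cases "f x") simp
  qed
  have finj: "f x = f y ==> x = y" for x y using f unfolding bij_betw_def inj_def by blast
  have dv: "i div 2 \<le> d" if "i \<le> 2 * d + 1" for i using that by auto
  note s = assoc_schemeD[OF S]
  have sub: "S i \<subseteq> V \<times> V" "S i ~= {}" "sym (S i)" if "i \<le> d" for i by (rule s(2)[OF that], rule s(3)[OF that], rule s(7)[OF that])
  show ?thesis unfolding assoc_scheme_def
  proof (intro conjI allI impI)
    show "finite (UNIV :: 'x set)" by simp
    show "pull f S i \<subseteq> UNIV \<times> UNIV" for i by simp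
    show "pull f S i ~= {}" if i: "i \<le> 2 * d + 1" for i
    proof -
      obtain v w where vw: "(v, w) \<in> S (i div 2)" using sub(2)[OF dv[OF i]] by (metis equals0I surj_pair)
      then have "v \<in> V" "w \<in> V" using sub(1)[OF dv[OF i]] by blast+
      then have "(g v False, g w (odd i)) \<in> pull f S i" using vw by (simp add: pull_iff fg)
      then show ?thesis by blast
    qed
    show "pull f S i \<inter> pull f S j = {}" if "i \<le> 2 * d + 1" "j \<le> 2 * d + 1" "i ~= j" for i j
    proof (rule ccontr)
      assume "pull f S i \<inter> pull f S j ~= {}"
      then obtain x y where xy: "(x, y) \<in> pull f S i" "(x, y) \<in> pull f S j" by auto
      then have "odd i \<longleftrightarrow> odd j" unfolding pull_iff by blast
      moreover have "i div 2 = j div 2"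
      proof (rule ccontr)
        assume "i div 2 ~= j div 2"
        from s(4)[OF dv[OF that(1)] dv[OF that(2)] this] show False using xy unfolding pull_iff by blast
      qed
      ultimately have "i = j" by (metis even_two_times_div_two odd_two_times_div_two_succ)
      then show False using that(3) by blast
    qed
    show "(\<Union>i\<le>2 * d + 1. pull f S i) = UNIV \<times> UNIV"
    proof -
      have "\<exists>i\<le>2 * d + 1. (x, y) \<in> pull f S i" for x y
      proof -
        have "(fst (f x), fst (f y)) \<in> (\<Union>i\<le>d. S i)" unfolding s(5) using fV by simp
        then obtain i where i: "i \<le> d" "(fst (f x), fst (f y)) \<in> S i" by blast
        define m where "m = 2 * i + (if snd (f x) ~= snd (f y) then 1 else 0)"
        have "m div 2 = i" "odd m \<longleftrightarrow> snd (f x) ~= snd (f y)" "m \<le> 2 * d + 1" unfolding m_def using i(1) by auto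
        then show ?thesis using i(2) by (intro exI[of _ m]) (simp add: pull_iff)
      qed
      then show ?thesis by auto
    qed
    show "pull f S 0 = Id_on UNIV"
    proof -
      have "(x, y) \<in> pull f S 0 \<longleftrightarrow> x = y" for x y
      proof -
        have "(x, y) \<in> pull f S 0 \<longleftrightarrow> f x = f y" unfolding pull_iff using fV by (auto simp: prod_eq_iff Id_on_iff s(6))
        then show ?thesis using finj by auto
      qed
      then show ?thesis by auto
    qed
    show "sym (pull f S i)" if "i \<le> 2 * d + 1" for i
      using sub(3)[OF dv[OF that]] unfolding sym_def pull_iff by blast
    fix h i j assume hij: "h \<le> 2 * d + 1" "i \<le> 2 * d + 1" "j \<le> 2 * d + 1"
    obtain p where p: "\<forall>(v, w)\<in>S (h div 2). card {t\<in>V. (v, t) \<in> S (i div 2) \<and> (t, w) \<in> S (j div 2)} = p"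
      using s(8)[OF dv[OF hij(1)] dv[OF hij(2)] dv[OF hij(3)]] by blast
    show "\<exists>p. \<forall>(x, y)\<in>pull f S h. card {z \<in> UNIV. (x, z) \<in> pull f S i \<and> (z, y) \<in> pull f S j} = p"
    proof (cases "odd h \<longleftrightarrow> (odd i ~= odd j)")
      case False
      have "{z \<in> UNIV. (x, z) \<in> pull f S i \<and> (z, y) \<in> pull f S j} = {}" if "(x, y) \<in> pull f S h" for x y
        using that False unfolding pull_iff by blast
      then show ?thesis by (intro exI[of _ 0]) auto
    next
      case True
      have "card {z \<in> UNIV. (x, z) \<in> pull f S i \<and> (z, y) \<in> pull f S j} = p" if xy: "(x, y) \<in> pull f S h" for x y
      proof -
        let ?v = "fst (f x)" and ?w = "fst (f y)" and ?b = "snd (f x) ~= odd i"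
        let ?A = "{t\<in>V. (?v, t) \<in> S (i div 2) \<and> (t, ?w) \<in> S (j div 2)}"
        have e: "{z \<in> UNIV. (x, z) \<in> pull f S i \<and> (z, y) \<in> pull f S j} = (\<lambda>t. g t ?b) ` ?A"
        proof (intro equalityI subsetI)
          fix z assume "z \<in> {z \<in> UNIV. (x, z) \<in> pull f S i \<and> (z, y) \<in> pull f S j}"
          then have z: "(?v, fst (f z)) \<in> S (i div 2)" "(fst (f z), ?w) \<in> S (j div 2)" "snd (f z) = ?b" unfolding pull_iff by auto
          have "f z = f (g (fst (f z)) ?b)" using fg[OF fV] z(3) by (simp add: prod_eq_iff)
          then show "z \<in> (\<lambda>t. g t ?b) ` ?A" using z(1,2) fV[of z] finj by blast
        next
          fix z assume "z \<in> (\<lambda>t. g t ?b) ` ?A"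
          then obtain t where t: "t \<in> V" "(?v, t) \<in> S (i div 2)" "(t, ?w) \<in> S (j div 2)" "z = g t ?b" by blast
          then show "z \<in> {z \<in> UNIV. (x, z) \<in> pull f S i \<and> (z, y) \<in> pull f S j}"
            using xy True unfolding pull_iff by (auto simp: fg)
        qed
        have "inj_on (\<lambda>t. g t ?b) ?A" by (rule inj_onI) (metis (no_types, lifting) fg fst_conv mem_Collect_eq)
        then have "card ((\<lambda>t. g t ?b) ` ?A) = card ?A" by (rule card_image)
        also have "\<dots> = p"
        proof -
          have m: "(?v, ?w) \<in> S (h div 2)" using xy unfolding pull_iff by (rule conjunct1)
          show ?thesis using bspec[OF p m] by (simp only: prod.case)
        qed
        finally show ?thesis unfolding e .
      qed
      then show ?thesis by blast
    qed
  qed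
qed

lemma gp_tab_10_lt: "p < 20 ==> q \<in> set (gp_tab 10 2 ! p) ==> q < 20"
  using dodec_cert[unfolded cert_ok_def table_ok_def] gp_length(1)[of 10 2] nth_mem[of p "gp_tab 10 2"] by auto

definition double_list :: "((bool \<times> int) \<times> bool) list" where
  "double_list = map (\<lambda>v. (v, False)) (gp_list 10) @ map (\<lambda>v. (v, True)) (gp_list 10)"

lemma double_list_nth: "p < 40 ==> double_list ! p = (gp_list 10 ! (p mod 20), 20 \<le> p)"
proof -
  assume p: "p < 40"
  have "p mod 20 = (if p < 20 then p else p - 20)" using p by (simp add: mod_if)
  then show ?thesis unfolding double_list_def using p gp_length(2)[of 10] by (simp add: nth_append)
qed

lemma double_tab_mem:
  assumes "p < 40" "q < 40"
  shows "q \<in> set (double_tab ! p) \<longleftrightarrow> q mod 20 \<in> set (gp_tab 10 2 ! (p mod 20)) \<and> (20 \<le> p \<longleftrightarrow> q < 20)"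
proof -
  have m: "r mod 20 = (if r < 20 then r else r - 20)" if "r < 40" for r :: nat using that by (simp add: mod_if)
  have l: "length (gp_tab 10 2) = 20" using gp_length(1)[of 10 2] by simp
  show ?thesis
  proof (cases "p < 20")
    case True
    then have "double_tab ! p = map (\<lambda>i. i + 20) (gp_tab 10 2 ! p)" unfolding double_tab_def using l by (simp add: nth_append)
    then have "q \<in> set (double_tab ! p) \<longleftrightarrow> (\<exists>r\<in>set (gp_tab 10 2 ! p). q = r + 20)" by auto
    also have "\<dots> \<longleftrightarrow> 20 \<le> q \<and> q - 20 \<in> set (gp_tab 10 2 ! p)"
    proof
      assume "20 \<le> q \<and> q - 20 \<in> set (gp_tab 10 2 ! p)"
      then show "\<exists>r\<in>set (gp_tab 10 2 ! p). q = r + 20" by (intro bexI[of _ "q - 20"]) auto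
    qed auto
    finally show ?thesis using True m[OF assms(1)] m[OF assms(2)] by auto
  next
    case False
    then have "double_tab ! p = gp_tab 10 2 ! (p - 20)" unfolding double_tab_def using l by (simp add: nth_append)
    moreover have "p - 20 < 20" using assms(1) by linarith
    ultimately show ?thesis using False m[OF assms(1)] m[OF assms(2)] gp_tab_10_lt[of "p - 20" q] by auto
  qed
qed

text \<open>Everything rests on \<open>Ceq\<close>: in \<open>R\<close>, the class of a pair amounts
  to its inner product and whether the two vertices lie on the same side of the bipartition. The
  relations \<open>D i\<close> are the level sets of the inner product on one side.\<close>

lemma double_case:
  fixes R :: "nat => ('x::finite \<times> 'x) set" and u :: "'x => real^3" and val :: "nat => real"
  assumes R: "assoc_scheme UNIV R d" and d1: "1 \<le> d" and conn: "!!x y. (x, y) \<in> (R 1)\<^sup>*"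
    and d2: "dist2_one_class (scheme_class R d) (\<lambda>x y. (x, y) \<in> R 1)"
    and model: "rooted_model (\<lambda>x y. (x, y) \<in> R 1) double_tab F"
    and uinv: "class_inv (scheme_class R d) (\<lambda>x y. u x \<bullet> u y)"
    and val: "!!i j. i < 6 ==> j < 6 ==> val i = val j ==> i = j"
    and cosF: "!!x p. p < 40 ==> u x \<bullet> u (F x p) = val (dodec_dist ! (p mod 20))"
    and anti: "!!x p. p < 20 ==> u (F x (p + 20)) = u (F x p)"
  shows "d = 11 \<and> (\<exists>f D. graph_iso_via f (R 1) (bd_V dodeca_V) (bd_E dodeca_E) \<and>
      generated_scheme dodeca_V dodeca_E D 5 \<and>
      R ` {..d} = {{(x, y). (f x, f y) \<in> bd_rel (D i) b} | i b. i \<le> 5})"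
proof -
  let ?c = "scheme_class R d" and ?adj = "\<lambda>x y. (x, y) \<in> R 1" and ?K = double_classes
  have tab: "table_ok double_tab" and ref: "refines_ok double_tab double_init double_ref" "refines_ok double_tab double_init2 double_ref2"
    and st: "start_ok double_tab ?K" and ch: "chains_ok double_tab ?K [0, 1, 2] double_chain"
    and fin: "fst (last double_ref) = ?K" "fst (last double_ref2) = ?K"
    using double_ok2 unfolding double_ok2_def by blast+
  have len: "length double_tab = 40" unfolding double_tab_def using gp_length(1)[of 10 2] by simp
  have lenK: "length ?K = 40" using st len unfolding start_ok_def by simp
  note sp = double_spec[unfolded double_spec_def list_all_iff]
  have mem40: "p < 40 ==> p \<in> set [0..<40]" for p :: nat by simp
  note sp40 = bspec[OF sp mem40]
  let ?dd = "\<lambda>p. dodec_dist ! (p mod 20)"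
  have dd6: "?dd p < 6" and init: "double_init ! p = (if p = 0 then 0 else 1 + ?dd p)"
    and init2: "double_init2 ! p = (if p = 0 then 0 else if p = 20 then 1 else 2)"
    and fwd: "?K ! p = [[0, 8], [5, 1], [2, 3], [6, 4], [7, 9], [11, 10]] ! ?dd p ! (p div 20)"
    and bwd: "[(0, 0), (1, 1), (2, 0), (2, 1), (3, 1), (1, 0), (3, 0), (4, 0), (0, 1), (4, 1), (5, 1), (5, 0)] ! (?K ! p) = (?dd p, p div 20)"
    and dd0: "?dd p = 0 \<longleftrightarrow> p = 0 \<or> p = 20" and flip: "q \<in> set (double_tab ! p) ==> (p < 20) ~= (q < 20)"
    and root: "p \<in> set (double_tab ! 0) \<longleftrightarrow> ?dd p = 1 \<and> 20 \<le> p" if "p < 40" for p q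
    by (insert sp40[OF that], ((elim conjE, assumption) | (elim conjE, drule (1) bspec, assumption))+)
  have adj_c: "class_inv ?c ?adj" unfolding class_inv_def scheme_class_iff[OF R d1, symmetric] by simp
  interpret coherent ?c by (rule scheme_coherent[OF R])
  interpret M: model ?c ?adj double_tab F using adj_c model tab by unfold_locales
  have F0: "F x 0 = x" for x by (rule M.F0)
  have Finj: "p = q" if "F x p = F x q" "p < 40" "q < 40" for x p q
    using M.Fbij[of x] that len unfolding bij_betw_def by (auto dest: inj_onD)
  have Fsurj: "\<exists>p<40. y = F x p" for x y using M.Fsurj[of y x] len by auto
  have Fadj: "(F x p, y) \<in> R 1 \<longleftrightarrow> y \<in> F x ` set (double_tab ! p)" if "p < 40" for x p y
    using M.Fadj[of p x] that len by auto
  have nb_lt: "q < 40" if "p < 40" "q \<in> set (double_tab ! p)" for p q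
    using tab that len nth_mem[of p double_tab] unfolding table_ok_def by auto
  \<comment> \<open>Inner products are class functions and separate the six distances; the diagonal
    separates the root.\<close>
  have "colored ?c F 40 double_init"
    unfolding colored_def
  proof (intro allI impI)
    fix x x' p p' assume p: "p < 40" "p' < 40" and e: "?c x (F x p) = ?c x' (F x' p')"
    have "val (?dd p) = val (?dd p')" using class_invD[OF uinv e] cosF p by simp
    then have "?dd p = ?dd p'" using val dd6 p by blast
    moreover have "p = 0 \<longleftrightarrow> p' = 0" using e p F0 Finj c_diag by (metis zero_less_numeral)
    ultimately show "double_init ! p = double_init ! p'" using init p by simp
  qed
  then have colK: "colored ?c F 40 ?K"
    using M.refines[OF _ ref(1), of "[]"] len fin(1) by (cases double_ref) (simp_all add: double_ref_def)
  have d1': "?c x y = ?c x' y'" if "?adj x y" "?adj x' y'" for x y x' y' using that scheme_class_iff[OF R d1] by metis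
  note d2' = d2[unfolded dist2_one_class_def, rule_format]
  have one012: "one_class ?c F 40 ?K j" if "j \<in> {0, 1, 2}" for j
  proof -
    have "one_class ?c F (length double_tab) ?K j"
    proof (rule M.start[OF st _ _ that])
      fix x y x' y' assume "?adj x y" "?adj x' y'"
      then show "?c x y = ?c x' y'" by (rule d1')
    next
      fix x y z x' y' z' assume "x ~= y" "\<not> ?adj x y" "?adj x z" "?adj z y"
        "x' ~= y'" "\<not> ?adj x' y'" "?adj x' z'" "?adj z' y'"
      then show "?c x y = ?c x' y'" by (rule d2')
    qed
    then show ?thesis unfolding len .
  qed
  have one: "one_class ?c F 40 ?K j" if "j \<in> set ?K" for j
    by (rule M.chains[OF _ _ ch that, unfolded len]) (use colK one012 in auto)
  have "card (set ?K) = Suc d"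
    by (rule model_rank[OF R Fsurj lenK colK one])
  then have d11: "d = 11" using double_classes_card by simp
  define x0 :: 'x where "x0 = undefined"
  have gpd: "distinct (gp_list 10)" "set (gp_list 10) = dodeca_V" "length (gp_list 10) = 20"
    using gp_list_distinct[of 10] gp_list_set[of 10] gp_length(2)[of 10] unfolding dodeca_V_def by simp_all
  have dl: "distinct double_list" "set double_list = bd_V dodeca_V" "length double_list = length double_tab"
    using gpd len unfolding double_list_def bd_V_def by (auto simp: distinct_map inj_on_def)
  have E: "(double_list ! p, double_list ! q) \<in> bd_E dodeca_E \<longleftrightarrow> q \<in> set (double_tab ! p)"
    if "p < length double_tab" "q < length double_tab" for p q
    using that gp_edge[of "p mod 20" 10 "q mod 20" 2] double_tab_mem[of p q] double_list_nth[of p] double_list_nth[of q]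
    unfolding bd_E_def len dodeca_E_def by auto
  obtain f where f: "graph_iso_via f {(x, y). ?adj x y} (bd_V dodeca_V) (bd_E dodeca_E)"
    and fF: "!!p. p < 40 ==> f (F x0 p) = double_list ! p"
    using model_graph_iso[OF model dl E tab, of x0] len by auto
  have fb: "bij_betw f UNIV (bd_V dodeca_V)" and fe: "(x, y) \<in> R 1 \<longleftrightarrow> (f x, f y) \<in> bd_E dodeca_E" for x y
    using f unfolding graph_iso_via_def by auto
  have fe': "(x, y) \<in> R 1 \<longleftrightarrow> (fst (f x), fst (f y)) \<in> dodeca_E \<and> snd (f x) ~= snd (f y)" for x y
    unfolding fe bd_E_def by (cases "f x"; cases "f y") simp
  define g where "g v b = inv_into UNIV f (v, b)" for v b
  have fg: "f (g v b) = (v, b)" if "v \<in> dodeca_V" for v b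
    unfolding g_def by (rule f_inv_into_f) (use fb that in \<open>simp add: bij_betw_def bd_V_def\<close>)
  have fV: "fst (f x) \<in> dodeca_V" for x
  proof -
    have "f x \<in> bd_V dodeca_V" using fb unfolding bij_betw_def by blast
    then show ?thesis unfolding bd_V_def by (cases "f x") simp
  qed
  have finj: "f x = f y ==> x = y" for x y using fb unfolding bij_betw_def inj_def by blast
  let ?par = "\<lambda>x y. snd (f x) ~= snd (f y)"
  \<comment> \<open>Along a walk from \<open>y\<close>, each edge changes both the side of the
    bipartition and the half in which the position lies.\<close>
  have par: "?par (F y p) y \<longleftrightarrow> 20 \<le> p" if p: "p < 40" for y p
  proof -
    have "\<forall>p<40. z = F y p --> (?par z y \<longleftrightarrow> 20 \<le> p)" for z
      using conn[of y z]
    proof (induction rule: rtrancl_induct)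
      case base
      then show ?case using Finj[of y _ 0] F0 by (metis not_numeral_le_zero zero_less_numeral)
    next
      case (step z z')
      obtain q where q: "q < 40" "z = F y q" using Fsurj by blast
      obtain q' where q': "q' \<in> set (double_tab ! q)" "z' = F y q'" using Fadj[OF q(1), of y z'] step.hyps(2) q(2) by blast
      have q4: "q' < 40" using nb_lt q(1) q'(1) by blast
      have "?par z' y \<longleftrightarrow> 20 \<le> q'" using step.IH q flip[OF q(1) q'(1)] fe'[of z z'] step.hyps(2) by auto
      then show ?case using Finj[of y _ q'] q4 q'(2) by metis
    qed
    then show ?thesis using p by blast
  qed
  have Uf: "u y = u y'" if "fst (f y) = fst (f y')" for y y'
  proof -
    obtain p p' where p: "p < 40" "y = F x0 p" and p': "p' < 40" "y' = F x0 p'" using Fsurj by metis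
    have "gp_list 10 ! (p mod 20) = gp_list 10 ! (p' mod 20)" using that fF double_list_nth p p' by simp
    then have e: "p mod 20 = p' mod 20" using gpd(1,3) by (simp add: nth_eq_iff_index_eq)
    have "u (F x0 r) = u (F x0 (r mod 20))" if "r < 40" for r
    proof (cases "r < 20")
      case False
      then have "r = (r - 20) + 20" "r mod 20 = r - 20" using that by (auto simp: mod_if)
      then show ?thesis using anti[of "r - 20" x0] that by simp
    qed simp
    then show ?thesis using e p p' by metis
  qed
  have Ceq: "?c x y = ?c x' y' \<longleftrightarrow> u x \<bullet> u y = u x' \<bullet> u y' \<and> (?par x y \<longleftrightarrow> ?par x' y')" for x y x' y'
  proof -
    obtain p p' where p: "p < 40" "y = F x p" and p': "p' < 40" "y' = F x' p'" using Fsurj by metis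
    have pr: "?par x y \<longleftrightarrow> 20 \<le> p" "?par x' y' \<longleftrightarrow> 20 \<le> p'" using par[OF p(1), of x] par[OF p'(1), of x'] p(2) p'(2) by auto
    have dv: "p div 20 = (if 20 \<le> p then 1 else 0)" "p' div 20 = (if 20 \<le> p' then 1 else 0)" using p(1) p'(1) by auto
    show ?thesis
    proof
      assume e: "?c x y = ?c x' y'"
      then have "?K ! p = ?K ! p'" using colK p p' unfolding colored_def by blast
      then have "p div 20 = p' div 20" using bwd[OF p(1)] bwd[OF p'(1)] by simp
      then have "20 \<le> p \<longleftrightarrow> 20 \<le> p'" unfolding dv by (auto split: if_splits)
      then show "u x \<bullet> u y = u x' \<bullet> u y' \<and> (?par x y \<longleftrightarrow> ?par x' y')" using class_invD[OF uinv e] pr by blast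
    next
      assume a: "u x \<bullet> u y = u x' \<bullet> u y' \<and> (?par x y \<longleftrightarrow> ?par x' y')"
      then have "val (?dd p) = val (?dd p')" using cosF[OF p(1), of x] cosF[OF p'(1), of x'] p(2) p'(2) by simp
      then have "?dd p = ?dd p'" using val dd6 p(1) p'(1) by blast
      moreover have "p div 20 = p' div 20" using a pr unfolding dv by simp
      ultimately have "?K ! p = ?K ! p'" using fwd[OF p(1)] fwd[OF p'(1)] by simp
      then show "?c x y = ?c x' y'" using one[of "?K ! p"] p p' lenK unfolding one_class_def by (metis nth_mem)
    qed
  qed
  have vals: "\<exists>i<6. u x \<bullet> u y = val i" for x y using Fsurj[of y x] cosF dd6 by metis
  have zero: "u x \<bullet> u y = val 0 \<longleftrightarrow> fst (f x) = fst (f y)" for x y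
  proof
    assume "fst (f x) = fst (f y)"
    then have "u x \<bullet> u y = u x \<bullet> u x" using Uf by metis
    also have "\<dots> = val 0" using cosF[of 0 x] F0 dd0[of 0] by simp
    finally show "u x \<bullet> u y = val 0" .
  next
    have val0: "p = 0 \<or> p = 20" if "u x \<bullet> u (F x p) = val 0" "p < 40" for p
      using that cosF[OF that(2), of x] val[OF dd6[OF that(2)], of 0] dd0[OF that(2)] by simp
    assume e: "u x \<bullet> u y = val 0"
    obtain p where p: "p < 40" "y = F x p" using Fsurj by blast
    \<comment> \<open>The twin of \<open>x\<close>. Only positions 0 and 20 have the inner product
      of distance 0, and the twin is on the other side, hence at position 20.\<close>
    define z where "z = g (fst (f x)) (\<not> snd (f x))"
    have fz: "f z = (fst (f x), \<not> snd (f x))" unfolding z_def by (rule fg[OF fV])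
    obtain q where q: "q < 40" "z = F x q" using Fsurj by blast
    have "u x = u z" by (rule Uf) (simp add: fz)
    then have "u x \<bullet> u z = u x \<bullet> u (F x 0)" using F0 by simp
    then have "u x \<bullet> u (F x q) = val 0" using cosF[of 0 x] dd0[of 0] q(2) by simp
    then have "q = 0 \<or> q = 20" using val0 q(1) by blast
    moreover have "20 \<le> q" using par[OF q(1), of x] fz q(2) by simp
    ultimately have "z = F x 20" using q by auto
    moreover have "p = 0 \<or> p = 20" using val0 e p by blast
    ultimately show "fst (f x) = fst (f y)" using p(2) F0 fz by auto
  qed
  have adjv: "(x, y) \<in> R 1 \<longleftrightarrow> u x \<bullet> u y = val 1 \<and> ?par x y" for x y
  proof -
    obtain p where p: "p < 40" "y = F x p" using Fsurj by blast
    have "(x, y) \<in> R 1 \<longleftrightarrow> y \<in> F x ` set (double_tab ! 0)" using Fadj[of 0 x y] F0 by simp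
    also have "\<dots> \<longleftrightarrow> p \<in> set (double_tab ! 0)" using Finj[of x p] p nb_lt[of 0] by auto
    also have "\<dots> \<longleftrightarrow> ?dd p = 1 \<and> 20 \<le> p" by (rule root[OF p(1)])
    also have "\<dots> \<longleftrightarrow> u x \<bullet> u y = val 1 \<and> ?par x y"
      using cosF[OF p(1), of x] val[OF dd6[OF p(1)], of 1] par[OF p(1), of x] unfolding p(2) by auto
    finally show ?thesis .
  qed
  define D where "D i = {(v, w). v \<in> dodeca_V \<and> w \<in> dodeca_V \<and> u (g v False) \<bullet> u (g w False) = val i}" for i
  have inD: "(fst (f x), fst (f y)) \<in> D i \<longleftrightarrow> u x \<bullet> u y = val i" for x y i
  proof -
    have "u (g (fst (f x)) False) = u x" "u (g (fst (f y)) False) = u y" by (rule Uf, simp add: fg[OF fV])+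
    then show ?thesis unfolding D_def using fV by simp
  qed
  have pre: "(f x, f y) \<in> bd_rel (D i) b \<longleftrightarrow> u x \<bullet> u y = val i \<and> (?par x y \<longleftrightarrow> b)" for x y i b
    unfolding bd_rel_iff inD ..
  have Rim: "R ` {..d} = {{(x, y). (f x, f y) \<in> bd_rel (D i) b} | i b. i \<le> 5}"
  proof (intro equalityI subsetI)
    fix r assume "r \<in> R ` {..d}"
    then obtain k where k: "k \<le> d" "r = R k" by blast
    then have "R k ~= {}" using assoc_schemeD(3)[OF R] by blast
    then obtain x y where xy: "(x, y) \<in> R k" by (metis equals0I surj_pair)
    obtain i where i: "i < 6" "u x \<bullet> u y = val i" using vals by blast
    have "R k = {(x', y'). (f x', f y') \<in> bd_rel (D i) (?par x y)}"
    proof -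
      have "(x', y') \<in> R k \<longleftrightarrow> (f x', f y') \<in> bd_rel (D i) (?par x y)" for x' y'
        unfolding pre using Ceq[of x' y' x y] scheme_class_iff[OF R k(1)] xy i(2) by metis
      then show ?thesis by auto
    qed
    moreover have "i \<le> 5" using i(1) by simp
    ultimately show "r \<in> {{(x, y). (f x, f y) \<in> bd_rel (D i) b} | i b. i \<le> 5}" unfolding k(2) by blast
  next
    fix r assume "r \<in> {{(x, y). (f x, f y) \<in> bd_rel (D i) b} | i b. i \<le> 5}"
    then obtain i b where ib: "i \<le> 5" "r = {(x, y). (f x, f y) \<in> bd_rel (D i) b}" by blast
    have "i = 0 \<or> i = 1 \<or> i = 2 \<or> i = 3 \<or> i = 4 \<or> i = 5" using ib(1) by auto
    then have di: "dodec_dist ! i = i" unfolding dodec_dist_def by (elim disjE) simp_all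
    define p where "p = (if b then i + 20 else i)"
    have p: "p < 40" "?dd p = i" "20 \<le> p \<longleftrightarrow> b" unfolding p_def using ib(1) di by (simp_all add: mod_if)
    define y where "y = F x0 p"
    have y: "u x0 \<bullet> u y = val i" "?par x0 y \<longleftrightarrow> b" using cosF[OF p(1)] par[OF p(1), of x0] p unfolding y_def by auto
    have k: "?c x0 y \<le> d" by (rule scheme_class_le[OF R])
    have "r = R (?c x0 y)"
    proof -
      have "(x', y') \<in> R (?c x0 y) \<longleftrightarrow> (f x', f y') \<in> bd_rel (D i) b" for x' y'
        unfolding pre using Ceq[of x' y' x0 y] scheme_class_iff[OF R k] y by metis
      then show ?thesis unfolding ib(2) by auto
    qed
    then show "r \<in> R ` {..d}" using k by blast
  qed
  have DV: "D i \<subseteq> dodeca_V \<times> dodeca_V" for i unfolding D_def by auto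
  have Dne: "D i ~= {}" if "i \<le> 5" for i
  proof -
    have "i = 0 \<or> i = 1 \<or> i = 2 \<or> i = 3 \<or> i = 4 \<or> i = 5" using that by auto
    then have "dodec_dist ! i = i" unfolding dodec_dist_def by (elim disjE) simp_all
    then have "u x0 \<bullet> u (F x0 i) = val i" using cosF[of i x0] that by simp
    then show ?thesis using inD by blast
  qed
  have gg: "(v, w) \<in> D i \<longleftrightarrow> u (g v False) \<bullet> u (g w False) = val i" "fst (f (g v b)) = v" "snd (f (g v b)) = b"
    if "v \<in> dodeca_V" "w \<in> dodeca_V" for v w i b
    using that fg[OF that(1)] unfolding D_def by simp_all
  have sch: "assoc_scheme dodeca_V D 5" unfolding assoc_scheme_def
  proof (intro conjI allI impI)
    show "finite dodeca_V" unfolding gpd(2)[symmetric] by simp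
    show "D i \<subseteq> dodeca_V \<times> dodeca_V" for i by (rule DV)
    show "D i ~= {}" if "i \<le> 5" for i by (rule Dne[OF that])
    show "D i \<inter> D j = {}" if "i \<le> 5" "j \<le> 5" "i ~= j" for i j
    proof -
      have "val i ~= val j" using val[of i j] that by auto
      then show ?thesis unfolding D_def by auto
    qed
    show "(\<Union>i\<le>5. D i) = dodeca_V \<times> dodeca_V"
    proof (intro equalityI subsetI)
      fix z assume "z \<in> dodeca_V \<times> dodeca_V"
      then obtain v w where z: "z = (v, w)" "v \<in> dodeca_V" "w \<in> dodeca_V" by blast
      obtain i where i: "i < 6" "u (g v False) \<bullet> u (g w False) = val i" using vals by blast
      then have "i \<in> {..5}" "z \<in> D i" using gg(1)[OF z(2,3)] z(1) by auto
      then show "z \<in> (\<Union>i\<le>5. D i)" by blast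
    qed (use DV in blast)
    show "D 0 = Id_on dodeca_V"
    proof (intro equalityI subsetI)
      fix z assume "z \<in> D 0"
      then obtain v w where z: "z = (v, w)" "v \<in> dodeca_V" "w \<in> dodeca_V" "(v, w) \<in> D 0" using DV by blast
      then have "fst (f (g v False)) = fst (f (g w False))" using zero gg(1) by blast
      then show "z \<in> Id_on dodeca_V" using fg z by auto
    next
      fix z assume "z \<in> Id_on dodeca_V"
      then obtain v where z: "z = (v, v)" "v \<in> dodeca_V" by (auto simp: Id_on_def)
      then show "z \<in> D 0" using zero[of "g v False" "g v False"] gg(1)[of v v 0] by simp
    qed
    show "sym (D i)" for i unfolding sym_def D_def by (auto simp: inner_commute)
    fix h i j :: nat
    \<comment> \<open>Restricted to one side of the bipartition, the counts for \<open>D\<close>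
      become counts for these class functions, which the scheme \<open>R\<close> makes
      constant.\<close>
    define P where "P i x y \<longleftrightarrow> u x \<bullet> u y = val i \<and> \<not> ?par x y" for i x y
    have Pinv: "class_inv ?c (P i)" for i unfolding class_inv_def P_def Ceq by simp
    have card: "card {t \<in> dodeca_V. (v, t) \<in> D i \<and> (t, w) \<in> D j} = card {z. P i (g v False) z \<and> P j z (g w False)}"
      if vw: "v \<in> dodeca_V" "w \<in> dodeca_V" for v w
    proof -
      have "{z. P i (g v False) z \<and> P j z (g w False)} = (\<lambda>t. g t False) ` {t \<in> dodeca_V. (v, t) \<in> D i \<and> (t, w) \<in> D j}"
      proof (intro equalityI subsetI)
        fix z assume "z \<in> {z. P i (g v False) z \<and> P j z (g w False)}"
        then have z: "u (g v False) \<bullet> u z = val i" "u z \<bullet> u (g w False) = val j" "\<not> snd (f z)"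
          unfolding P_def using fg[OF vw(1)] by auto
        have zz: "z = g (fst (f z)) False" by (rule finj) (use fg[OF fV] z(3) in \<open>simp add: prod_eq_iff\<close>)
        have "(v, fst (f z)) \<in> D i" "(fst (f z), w) \<in> D j" using z(1,2) zz gg(1)[OF vw(1) fV] gg(1)[OF fV vw(2)] by metis+
        then show "z \<in> (\<lambda>t. g t False) ` {t \<in> dodeca_V. (v, t) \<in> D i \<and> (t, w) \<in> D j}" using zz fV by blast
      next
        fix z assume "z \<in> (\<lambda>t. g t False) ` {t \<in> dodeca_V. (v, t) \<in> D i \<and> (t, w) \<in> D j}"
        then obtain t where t: "t \<in> dodeca_V" "(v, t) \<in> D i" "(t, w) \<in> D j" "z = g t False" by blast
        then show "z \<in> {z. P i (g v False) z \<and> P j z (g w False)}"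
          unfolding P_def using fg[OF vw(1)] fg[OF vw(2)] fg[OF t(1)] gg(1)[OF vw(1) t(1)] gg(1)[OF t(1) vw(2)] by simp
      qed
      moreover have "inj_on (\<lambda>t. g t False) {t \<in> dodeca_V. (v, t) \<in> D i \<and> (t, w) \<in> D j}"
        by (rule inj_onI) (metis (no_types, lifting) fg fst_conv mem_Collect_eq)
      ultimately show ?thesis by (simp add: card_image)
    qed
    have "card {t \<in> dodeca_V. (v, t) \<in> D i \<and> (t, w) \<in> D j} = card {t \<in> dodeca_V. (v', t) \<in> D i \<and> (t, w') \<in> D j}"
      if vw: "(v, w) \<in> D h" "(v', w') \<in> D h" for v w v' w'
    proof -
      have m: "v \<in> dodeca_V" "w \<in> dodeca_V" "v' \<in> dodeca_V" "w' \<in> dodeca_V" using vw DV by blast+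
      have "?c (g v False) (g w False) = ?c (g v' False) (g w' False)"
        unfolding Ceq using vw gg(1)[OF m(1,2)] gg(1)[OF m(3,4)] m fg by simp
      then show ?thesis unfolding card[OF m(1,2)] card[OF m(3,4)] by (rule class_invD[OF class_inv_card[OF Pinv Pinv]])
    qed
    note cc = this
    show "\<exists>p. \<forall>(x, y)\<in>D h. card {z \<in> dodeca_V. (x, z) \<in> D i \<and> (z, y) \<in> D j} = p"
    proof (cases "D h = {}")
      case False
      then obtain q where q: "q \<in> D h" by blast
      then have q': "(fst q, snd q) \<in> D h" by simp
      have "\<forall>(x, y)\<in>D h. card {z \<in> dodeca_V. (x, z) \<in> D i \<and> (z, y) \<in> D j} =
          card {z \<in> dodeca_V. (fst q, z) \<in> D i \<and> (z, snd q) \<in> D j}"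
      proof (rule ballI)
        fix r assume r: "r \<in> D h"
        obtain v w where vw: "r = (v, w)" by (cases r)
        then have m: "(v, w) \<in> D h" using r by simp
        show "case r of (x, y) => card {z \<in> dodeca_V. (x, z) \<in> D i \<and> (z, y) \<in> D j} =
            card {z \<in> dodeca_V. (fst q, z) \<in> D i \<and> (z, snd q) \<in> D j}"
          unfolding vw prod.case by (rule cc[OF m q'])
      qed
      then show ?thesis by (rule exI)
    qed simp
  qed
  have EV: "dodeca_E \<subseteq> dodeca_V \<times> dodeca_V" unfolding dodeca_E_def dodeca_V_def GP_E_def by auto
  \<comment> \<open>Adjacent vertices lie on different sides, while \<open>D\<close> is read on one
    side; twins having equal images bridges the gap.\<close>
  have D1: "D 1 = dodeca_E"
  proof -
    have "(v, w) \<in> D 1 \<longleftrightarrow> (v, w) \<in> dodeca_E" if vw: "v \<in> dodeca_V" "w \<in> dodeca_V" for v w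
    proof -
      have "u (g w True) = u (g w False)" by (rule Uf) (simp add: fg[OF vw(2)])
      then have "(v, w) \<in> D 1 \<longleftrightarrow> u (g v False) \<bullet> u (g w True) = val 1" using gg(1)[OF vw] by simp
      also have "\<dots> \<longleftrightarrow> (g v False, g w True) \<in> R 1" unfolding adjv using fg vw by simp
      also have "\<dots> \<longleftrightarrow> (v, w) \<in> dodeca_E" unfolding fe' using fg vw by simp
      finally show ?thesis .
    qed
    then show ?thesis using EV DV[of 1] by (intro equalityI subsetI) auto
  qed
  \<comment> \<open>A competitor \<open>S\<close> on the dodecahedron is pulled back to the double.
    There it contains the edge relation and the twin relation, so the refinement from
    \<open>double_init2\<close> applies. As its rank is at most that of \<open>R\<close>, it equals
    \<open>R\<close>, and comparing first coordinates returns \<open>S\<close>.\<close>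
  have gen: "S ` {..e} = D ` {..5}" if S: "assoc_scheme dodeca_V S e" "1 \<le> i" "i \<le> e" "S i = dodeca_E" "e \<le> 5" for e S i
  proof -
    let ?S = "pull f S" and ?e = "2 * e + 1"
    have PS: "assoc_scheme UNIV ?S ?e" by (rule pull_scheme[OF S(1) fb])
    let ?c2 = "scheme_class ?S ?e"
    have R1: "?S (2 * i + 1) = R 1"
    proof (rule set_eqI)
      fix z
      have "(2 * i + 1) div 2 = i" "odd (2 * i + 1)" by simp_all
      then have "(fst z, snd z) \<in> ?S (2 * i + 1) \<longleftrightarrow> (fst z, snd z) \<in> R 1" unfolding pull_iff fe' using S(4) by simp
      then show "z \<in> ?S (2 * i + 1) \<longleftrightarrow> z \<in> R 1" unfolding prod.collapse .
    qed
    have le: "2 * i + 1 \<le> ?e" using S(3) by simp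
    interpret S: coherent ?c2 by (rule scheme_coherent[OF PS])
    have "class_inv ?c2 ?adj" unfolding class_inv_def R1[symmetric] scheme_class_iff[OF PS le, symmetric] by simp
    then interpret SM: model ?c2 ?adj double_tab F using model tab by unfold_locales
    have "colored ?c2 F 40 double_init2"
      unfolding colored_def
    proof (intro allI impI)
      fix x x' p p' assume p: "p < 40" "p' < 40" and e: "?c2 x (F x p) = ?c2 x' (F x' p')"
      have "p = 0 \<longleftrightarrow> p' = 0" using e p F0 Finj S.c_diag by (metis zero_less_numeral)
      \<comment> \<open>Class 1 of a pulled-back scheme is the twin relation, by the numbering in
        \<open>pull\<close>.\<close>
      moreover have twenty: "?c2 x (F x p) = 1 \<longleftrightarrow> p = 20" if "p < 40" for x p
      proof -
        have "?c2 x (F x p) = 1 \<longleftrightarrow> (x, F x p) \<in> ?S 1" by (rule scheme_class_iff[OF PS]) simp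
        also have "\<dots> \<longleftrightarrow> fst (f x) = fst (f (F x p)) \<and> ?par x (F x p)"
          using fV unfolding pull_iff by (auto simp: Id_on_iff assoc_schemeD(6)[OF S(1)])
        also have "\<dots> \<longleftrightarrow> ?dd p = 0 \<and> 20 \<le> p"
          unfolding zero[symmetric] using cosF[OF that, of x] val[OF dd6[OF that], of 0] par[OF that, of x] by auto
        also have "\<dots> \<longleftrightarrow> p = 20" using dd0[OF that] by auto
        finally show ?thesis .
      qed
      ultimately show "double_init2 ! p = double_init2 ! p'" using init2 p e twenty[OF p(1), of x] twenty[OF p(2), of x'] by simp
    qed
    then have colS: "colored ?c2 F 40 ?K"
      using SM.refines[OF _ ref(2), of "[]"] len fin(2) by (cases double_ref2) (simp_all add: double_ref2_def)
    have im: "?S ` {..?e} = R ` {..d}"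
    proof (rule scheme_image_eq[OF R PS])
      show "?e \<le> d" using S(5) d11 by simp
      fix x y x' y' assume e: "?c2 x y = ?c2 x' y'"
      obtain p p' where p: "p < 40" "y = F x p" and p': "p' < 40" "y' = F x' p'" using Fsurj by metis
      have "?K ! p = ?K ! p'" using colS e p p' unfolding colored_def by blast
      then show "?c x y = ?c x' y'" using one[of "?K ! p"] p p' lenK unfolding one_class_def by (metis nth_mem)
    qed
    have SV: "S k \<subseteq> dodeca_V \<times> dodeca_V" "S k ~= {}" if "k \<le> e" for k by (rule assoc_schemeD(2)[OF S(1) that], rule assoc_schemeD(3)[OF S(1) that])
    \<comment> \<open>Because relations are not empty, the parity \<open>b\<close> can be recovered;
      then the relations on first coordinates agree.\<close>
    have cmp: "S (m div 2) = D k \<and> (odd m \<longleftrightarrow> b)"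
      if m: "m \<le> ?e" "?S m = {(x, y). (f x, f y) \<in> bd_rel (D k) b}" for m k b
    proof -
      have me: "m div 2 \<le> e" using m(1) by auto
      have eq: "(v, w) \<in> S (m div 2) \<and> (b' \<longleftrightarrow> odd m) \<longleftrightarrow> (v, w) \<in> D k \<and> (b' \<longleftrightarrow> b)" if "v \<in> dodeca_V" "w \<in> dodeca_V" for v w b'
      proof -
        have "(g v False, g w b') \<in> ?S m \<longleftrightarrow> (f (g v False), f (g w b')) \<in> bd_rel (D k) b" unfolding m(2) by simp
        then show ?thesis unfolding pull_iff bd_rel_iff using fg that by simp
      qed
      obtain v w where vw: "(v, w) \<in> S (m div 2)" using SV(2)[OF me] by (metis equals0I surj_pair)
      then have "v \<in> dodeca_V" "w \<in> dodeca_V" using SV(1)[OF me] by blast+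
      then have ob: "odd m \<longleftrightarrow> b" using eq[of v w "odd m"] vw by blast
      have "(v, w) \<in> S (m div 2) \<longleftrightarrow> (v, w) \<in> D k" if "v \<in> dodeca_V" "w \<in> dodeca_V" for v w
        using eq[OF that, of b] ob by blast
      then show ?thesis using ob SV(1)[OF me] DV[of k] by blast
    qed
    show ?thesis
    proof (intro equalityI subsetI)
      fix r assume "r \<in> S ` {..e}"
      then obtain k where k: "k \<le> e" "r = S k" by blast
      then have "?S (2 * k) \<in> R ` {..d}" unfolding im[symmetric] by simp
      then obtain j b where "?S (2 * k) = {(x, y). (f x, f y) \<in> bd_rel (D j) b}" "j \<le> 5" unfolding Rim by blast
      then show "r \<in> D ` {..5}" using cmp[of "2 * k" j b] k by auto
    next
      fix r assume "r \<in> D ` {..5}"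
      then obtain j where j: "j \<le> 5" "r = D j" by blast
      then have "{(x, y). (f x, f y) \<in> bd_rel (D j) False} \<in> ?S ` {..?e}" unfolding im Rim by blast
      then obtain m where m: "m \<le> ?e" "?S m = {(x, y). (f x, f y) \<in> bd_rel (D j) False}" by (metis (no_types, lifting) atMost_iff imageE)
      have "m div 2 \<le> e" using m(1) by auto
      then show "r \<in> S ` {..e}" using cmp[OF m] j(2) by (metis atMost_iff imageI)
    qed
  qed
  have "generated_scheme dodeca_V dodeca_E D 5" unfolding generated_scheme_def
  proof (intro conjI allI impI)
    show "\<exists>i\<ge>1. i \<le> 5 \<and> D i = dodeca_E" using D1 by (intro exI[of _ 1]) simp
    fix e S assume "assoc_scheme dodeca_V S e \<and> (\<exists>i\<ge>1. i \<le> e \<and> S i = dodeca_E) \<and> e \<le> 5"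
    then show "S ` {..e} = D ` {..5}" using gen by blast
  qed (rule sch)
  moreover have "graph_iso_via f (R 1) (bd_V dodeca_V) (bd_E dodeca_E)" using f by simp
  ultimately show ?thesis using d11 Rim by blast
qed

section \<open>The classification\<close>

text \<open>The only classes are equality, adjacency and possibly one for the remaining pairs, and
  every scheme with this edge relation separates these.\<close>

lemma small_scheme:
  fixes R :: "nat => ('x::finite \<times> 'x) set"
  assumes R: "assoc_scheme UNIV R d" and d: "1 \<le> d"
    and one: "!!x y x' y'. x ~= y ==> (x, y) \<notin> R 1 ==> x' ~= y' ==> (x', y') \<notin> R 1 ==>
      scheme_class R d x y = scheme_class R d x' y'"
  shows "generated_scheme UNIV (R 1) R d"
    and "d = (if \<exists>x y. x ~= y \<and> (x, y) \<notin> R 1 then 2 else 1)"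
proof -
  let ?c = "scheme_class R d"
  interpret coherent ?c by (rule scheme_coherent[OF R])
  have c0: "?c x x = 0" for x
  proof -
    have "(x, x) \<in> R 0" unfolding assoc_schemeD(6)[OF R] by (simp add: Id_on_iff)
    then show ?thesis using scheme_class_iff[OF R, of 0 x x] by simp
  qed
  have c1: "?c x y = 1 \<longleftrightarrow> (x, y) \<in> R 1" for x y by (rule scheme_class_iff[OF R d])
  show "generated_scheme UNIV (R 1) R d" unfolding generated_scheme_def
  proof (intro conjI allI impI)
    show "\<exists>i\<ge>1. i \<le> d \<and> R i = R 1" using d by blast
    fix e S assume "assoc_scheme UNIV S e \<and> (\<exists>i\<ge>1. i \<le> e \<and> S i = R 1) \<and> e \<le> d"
    then obtain i where S: "assoc_scheme UNIV S e" "i \<le> e" "S i = R 1" "e \<le> d" by blast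
    interpret S: coherent "scheme_class S e" by (rule scheme_coherent[OF S(1)])
    show "S ` {..e} = R ` {..d}"
    proof (rule scheme_image_eq[OF R S(1,4)])
      fix x y x' y' assume e: "scheme_class S e x y = scheme_class S e x' y'"
      have "x = y \<longleftrightarrow> x' = y'" by (rule class_invD[OF S.class_inv_eq e])
      moreover have "(x, y) \<in> R 1 \<longleftrightarrow> (x', y') \<in> R 1"
        unfolding S(3)[symmetric] scheme_class_iff[OF S(1,2), symmetric] e ..
      moreover have "?c x y = 0" if "x = y" using that c0 by simp
      moreover have "?c x' y' = 0" if "x' = y'" using that c0 by simp
      moreover have "?c x y = 1" if "(x, y) \<in> R 1" using that c1[of x y] by blast
      moreover have "?c x' y' = 1" if "(x', y') \<in> R 1" using that c1[of x' y'] by blast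
      ultimately show "?c x y = ?c x' y'" using one[of x y x' y'] by fastforce
    qed
  qed (rule R)
  have ex: "\<exists>x y. ?c x y = i" if "i \<le> d" for i
  proof -
    have "R i ~= {}" by (rule assoc_schemeD(3)[OF R that])
    then show ?thesis using scheme_class_iff[OF R that] by (metis equals0I surj_pair)
  qed
  show "d = (if \<exists>x y. x ~= y \<and> (x, y) \<notin> R 1 then 2 else 1)"
  proof (cases "\<exists>x y. x ~= y \<and> (x, y) \<notin> R 1")
    case True
    then obtain a b where ab: "a ~= b" "(a, b) \<notin> R 1" by blast
    have val: "?c x y = 0 \<or> ?c x y = 1 \<or> ?c x y = ?c a b" for x y using one[of x y a b] ab c0 c1 by metis
    have "?c a b ~= 0" "?c a b ~= 1" using ab c1 c_diag by auto
    moreover have "?c a b \<le> d" by (rule scheme_class_le[OF R])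
    ultimately have d2: "2 \<le> d" by linarith
    have "\<not> 3 \<le> d"
    proof
      assume "3 \<le> d"
      then have "2 = ?c a b" "3 = ?c a b" using ex[of 2] ex[of 3] val by (metis d2 numeral_eq_one_iff semiring_norm(85) semiring_norm(86) zero_neq_numeral)+
      then show False by simp
    qed
    then show ?thesis using True d2 by simp
  next
    case False
    then have "?c x y = 0 \<or> ?c x y = 1" for x y using c0 c1 by metis
    then have "\<not> 2 \<le> d" using ex[of 2] by (metis numeral_eq_one_iff semiring_norm(85) zero_neq_numeral)
    then show ?thesis using False d by simp
  qed
qed

lemma cube_graph_iso:
  fixes G :: "('x::finite \<times> 'x) set"
  assumes "rooted_model (\<lambda>x y. (x, y) \<in> G) cube_tab F"
  shows "graph_iso G cube_V cube_E"
proof -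
  have tab: "table_ok cube_tab" using cube_cert unfolding cert_ok_def by blast
  have len: "length cube_tab = 8" unfolding cube_tab_def by simp
  have V: "set cube_words = cube_V"
  proof -
    have "xs \<in> set cube_words \<longleftrightarrow> length xs = 3" for xs
    proof
      assume "length xs = 3"
      then obtain p q r where "xs = [p, q, r]" by (auto simp: numeral_3_eq_3 length_Suc_conv)
      then show "xs \<in> set cube_words" unfolding cube_words_def by (cases p; cases q; cases r) simp_all
    qed (auto simp: cube_words_def)
    then show ?thesis unfolding cube_V_def by blast
  qed
  have E: "(cube_words ! p, cube_words ! q) \<in> cube_E \<longleftrightarrow> q \<in> set (cube_tab ! p)" if "p < length cube_tab" "q < length cube_tab" for p q
  proof -
    have l: "length cube_words = 8" unfolding cube_words_def by simp
    have "card {i. i < 3 \<and> xs ! i ~= ys ! i} = length (filter (\<lambda>i. xs ! i ~= ys ! i) [0, 1, 2])" for xs ys :: "bool list"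
    proof -
      have three: "[0, 1, 2] = [0..<3::nat]" by (simp add: upt_rec)
      have e: "{i. i < 3 \<and> xs ! i ~= ys ! i} = set (filter (\<lambda>i. xs ! i ~= ys ! i) [0..<3])" by auto
      show ?thesis unfolding three e by (rule distinct_card, rule distinct_filter, rule distinct_upt)
    qed
    moreover have "cube_words ! p \<in> cube_V" "cube_words ! q \<in> cube_V" using V that l len nth_mem by metis+
    moreover have "(length (filter (\<lambda>i. cube_words ! p ! i ~= cube_words ! q ! i) [0, 1, 2]) = 1) = (q \<in> set (cube_tab ! p))"
    proof -
      have "p \<in> set [0..<8]" "q \<in> set [0..<8]" using that len by simp_all
      then show ?thesis using cube_iso_check[unfolded list_all_iff] by blast
    qed
    ultimately show ?thesis unfolding cube_E_def by simp
  qed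
  obtain f where "graph_iso_via f {(x, y). (x, y) \<in> G} cube_V cube_E"
    using model_graph_iso[OF assms _ V _ E tab] unfolding cube_words_def len by auto
  then show ?thesis unfolding graph_iso_def by auto
qed

lemma icosa_graph_iso:
  fixes G :: "('x::finite \<times> 'x) set"
  assumes "rooted_model (\<lambda>x y. (x, y) \<in> G) icosa_tab F"
  shows "graph_iso G icosa_V icosa_E"
proof -
  have tab: "table_ok icosa_tab" using icosa_cert unfolding cert_ok_def by blast
  have len: "length icosa_tab = 12" unfolding icosa_tab_def by simp
  have dl: "distinct icosa_points" "length icosa_points = 12" unfolding icosa_points_def by simp_all
  have V: "set icosa_points = icosa_V"
  proof -
    have five: "0 \<le> i \<and> i < 5 \<longleftrightarrow> i = 0 \<or> i = 1 \<or> i = 2 \<or> i = 3 \<or> i = 4" for i :: int by auto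
    show ?thesis unfolding icosa_V_def five icosa_points_def by auto
  qed
  have B: "(icosa_points ! p, icosa_points ! q) \<in> icosa_base \<longleftrightarrow> (p, q) \<in> set icosa_pairs" if "p < 12" "q < 12" for p q
  proof -
    have "(p', q') \<in> set icosa_pairs ==> p' < 12 \<and> q' < 12" for p' q'
      using icosa_pairs_lt[unfolded list_all_iff] by blast
    then show ?thesis unfolding icosa_base_pairs using that dl by (auto simp: nth_eq_iff_index_eq)
  qed
  have E: "(icosa_points ! p, icosa_points ! q) \<in> icosa_E \<longleftrightarrow> q \<in> set (icosa_tab ! p)" if "p < length icosa_tab" "q < length icosa_tab" for p q
  proof -
    have pq: "p \<in> set [0..<12]" "q \<in> set [0..<12]" using that len by simp_all
    have "map (\<lambda>p. sort (pair_nbrs icosa_pairs p)) [0..<12] ! p = map sort icosa_tab ! p" unfolding icosa_iso_check ..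
    then have "sort (pair_nbrs icosa_pairs p) = sort (icosa_tab ! p)" using that(1) len by simp
    then have "set (pair_nbrs icosa_pairs p) = set (icosa_tab ! p)" by (metis set_sort)
    then have "((p, q) \<in> set icosa_pairs \<or> (q, p) \<in> set icosa_pairs) = (q \<in> set (icosa_tab ! p))"
      using pair_nbrs by metis
    then show ?thesis unfolding icosa_E_def using B[of p q] B[of q p] pq by simp
  qed
  obtain f where "graph_iso_via f {(x, y). (x, y) \<in> G} icosa_V icosa_E"
    using model_graph_iso[OF assms dl(1) V _ E tab] dl(2) len by auto
  then show ?thesis unfolding graph_iso_def by auto
qed

text \<open>5 and -3 agree modulo 8, and the adjacency allows both signs.\<close>

lemma GP_8: "GP_E 8 5 = GP_E 8 3"
proof -
  have "(i - j) mod 8 = 5 mod 8 \<longleftrightarrow> (i - j) mod 8 = (-3) mod 8" "(i - j) mod 8 = (-5) mod 8 \<longleftrightarrow> (i - j) mod 8 = 3 mod 8" for i j :: int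
    by simp_all
  then show ?thesis unfolding GP_E_def by (simp only: disj_commute)
qed

lemma K4_iso:
  fixes G :: "('x::finite \<times> 'x) set"
  assumes "!!x y. (x, y) \<in> G \<longleftrightarrow> x ~= y" "card (UNIV :: 'x set) = 4"
  shows "graph_iso G K4_V K4_E"
proof -
  obtain f where f: "bij_betw f (UNIV :: 'x set) {0..<card (UNIV :: 'x set)}"
    using ex_bij_betw_finite_nat[of "UNIV :: 'x set"] by auto
  then have b: "bij_betw f UNIV K4_V" unfolding K4_V_def assms(2) by simp
  have "(x, y) \<in> G \<longleftrightarrow> (f x, f y) \<in> K4_E" for x y
    using b unfolding assms(1) K4_E_def bij_betw_def inj_def by blast
  then show ?thesis unfolding graph_iso_def graph_iso_via_def using b by blast
qed

theorem theorem5p1: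
  fixes R :: "nat \<Rightarrow> ('x::finite \<times> 'x) set" and d :: nat
  assumes pm: "partially_metric UNIV R d"
    and idem: "\<exists>E. minimal_idempotent R d E \<and> rank E = 3"
  shows
    "(d = 1 \<and> graph_iso (R 1) K4_V K4_E \<and> generated_scheme UNIV (R 1) R d) \<or>
     (d = 3 \<and> graph_iso (R 1) cube_V cube_E \<and> generated_scheme UNIV (R 1) R d) \<or>
     (d = 5 \<and> graph_iso (R 1) (GP_V 8) (GP_E 8 3) \<and> generated_scheme UNIV (R 1) R d) \<or>
     (d = 6 \<and> graph_iso (R 1) (GP_V 12) (GP_E 12 5) \<and> generated_scheme UNIV (R 1) R d) \<or>
     (d = 11 \<and> graph_iso (R 1) (GP_V 24) (GP_E 24 5) \<and> generated_scheme UNIV (R 1) R d) \<or>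
     (d = 5 \<and> graph_iso (R 1) dodeca_V dodeca_E \<and> generated_scheme UNIV (R 1) R d) \<or>
     (d = 11 \<and> (\<exists>f D. graph_iso_via f (R 1) (bd_V dodeca_V) (bd_E dodeca_E) \<and>
                     generated_scheme dodeca_V dodeca_E D 5 \<and>
                     R ` {..d} = {{(x, y). (f x, f y) \<in> bd_rel (D i) b} | i b. i \<le> 5})) \<or>
     (d = 3 \<and> graph_iso (R 1) icosa_V icosa_E \<and> generated_scheme UNIV (R 1) R d) \<or>
     (d = 2 \<and> graph_iso (R 1) (cmp_V 3 2) (cmp_E 3 2) \<and> generated_scheme UNIV (R 1) R d) \<or>
     (d = 2 \<and> (\<exists>k\<ge>1. graph_iso (R 1) (cmp_V 4 k) (cmp_E 4 k)) \<and> generated_scheme UNIV (R 1) R d)"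
proof -
  have R: "assoc_scheme UNIV R d" and d: "1 \<le> d" and rconn: "(x, y) \<in> (R 1)\<^sup>*"
    and pmd: "d = 1 \<or> (\<exists>j\<le>d. R j = dist2_rel UNIV (R 1))" for x y
    using pm unfolding partially_metric_def by auto
  obtain E where E: "minimal_idempotent R d E" "rank E = 3" using idem by blast
  let ?c = "scheme_class R d"
  obtain u \<theta> where urep: "eutactic_rep ?c u \<theta>" by (rule minimal_idempotent_rep[OF R d E])
  have c1: "?c x y = 1 \<longleftrightarrow> (x, y) \<in> R 1" for x y by (rule scheme_class_iff[OF R d])
  interpret coherent ?c by (rule scheme_coherent[OF R])
  have dd2: "dist2_one_class ?c (\<lambda>x y. (x, y) \<in> R 1)"
    unfolding dist2_one_class_def
  proof (intro allI impI)
    fix x y z x' y' z'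
    assume a: "x \<noteq> y" "(x, y) \<notin> R 1" "(x, z) \<in> R 1" "(z, y) \<in> R 1" "x' \<noteq> y'" "(x', y') \<notin> R 1" "(x', z') \<in> R 1" "(z', y') \<in> R 1"
    from pmd show "?c x y = ?c x' y'"
    proof
      assume "d = 1"
      then have "?c x y = 0 \<or> ?c x y = 1" using scheme_class_le[OF R, of x y] by linarith
      then show ?thesis using a(1,2) c1 c_diag by auto
    next
      assume "\<exists>j\<le>d. R j = dist2_rel UNIV (R 1)"
      then obtain j where j: "j \<le> d" "R j = dist2_rel UNIV (R 1)" by blast
      have "(x, y) \<in> R j" "(x', y') \<in> R j" unfolding j(2) dist2_rel_def using a by auto
      then have "?c x y = j" "?c x' y' = j" using scheme_class_iff[OF R j(1)] by simp_all
      then show ?thesis by simp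
    qed
  qed
  have e1: "{(x, y). ?c x y = 1} = R 1" using c1 by auto
  interpret pm_rep ?c u \<theta>
  proof
    show "eutactic_rep ?c u \<theta>" by (rule urep)
    show "(x, y) \<in> {(x, y). ?c x y = 1}\<^sup>*" for x y unfolding e1 by (rule rconn)
    show "dist2_one_class ?c (\<lambda>x y. ?c x y = 1)" unfolding c1 by (rule dd2)
  qed
  have adj: "adj = (\<lambda>x y. (x, y) \<in> R 1)" unfolding adj_def c1 ..
  have adj': "adj x y \<longleftrightarrow> (x, y) \<in> R 1" for x y unfolding adj ..
  note cert = cert_generated[OF R d dd2]
  \<comment> \<open>Used for both complete multipartite families: there all distinct non-adjacent
    pairs are at distance two, hence form one class.\<close>
  have small: "generated_scheme UNIV (R 1) R d" "d = 2"
    if fib: "\<And>x y z. adj x z ==> \<not> adj x y ==> adj z y" and ab: "dist2 a b" for a b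
  proof -
    have far: "dist2 x y" if xy: "x \<noteq> y" "\<not> adj x y" for x y
    proof -
      obtain z where z: "adj x z" using ex_adj by blast
      then have "adj z y" by (rule fib) (rule xy(2))
      then show ?thesis unfolding dist2_def using xy z by blast
    qed
    have one: "?c x y = ?c x' y'" if n: "x \<noteq> y" "(x, y) \<notin> R 1" "x' \<noteq> y'" "(x', y') \<notin> R 1" for x y x' y'
    proof (rule dist2_class)
      show "dist2 x y" by (rule far[OF n(1)]) (unfold adj', rule n(2))
      show "dist2 x' y'" by (rule far[OF n(3)]) (unfold adj', rule n(4))
    qed
    have ex: "\<exists>x y. x \<noteq> y \<and> (x, y) \<notin> R 1" using ab unfolding dist2_def adj' by blast
    show "generated_scheme UNIV (R 1) R d" by (rule small_scheme(1)[OF R d one])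
    show "d = 2" using small_scheme(2)[OF R d one] if_P[OF ex, of "2::nat" 1] by (rule trans)
  qed
  show ?thesis
  proof (cases "\<forall>x y. x \<noteq> y \<longrightarrow> adj x y")
    case True
    have card4: "card (UNIV :: 'x set) = 4" by (rule complete_card) (use True in blast)
    have ne: "(x, y) \<in> R 1 \<longleftrightarrow> x \<noteq> y" for x y using True adj_neq[of x y] unfolding adj' by blast
    have one: "?c x y = ?c x' y'" if n: "x \<noteq> y" "(x, y) \<notin> R 1" "x' \<noteq> y'" "(x', y') \<notin> R 1" for x y x' y'
      using n(1,2) ne[of x y] by blast
    have nex: "\<not> (\<exists>x y. x \<noteq> y \<and> (x, y) \<notin> R 1)" using ne by blast
    have dv: "d = 1" using small_scheme(2)[OF R d one] if_not_P[OF nex, of "2::nat" 1] by (rule trans)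
    show ?thesis by (rule disjI1, intro conjI, rule dv, rule K4_iso[OF ne card4], rule small_scheme(1)[OF R d one])
  next
    case False
    then obtain a b where ab: "dist2 a b" using ex_dist2 by blast
    show ?thesis
    proof (cases "u a \<bullet> u b = 1")
      case True
      note mp = multipartite_case[OF ab True]
      obtain q where q: "q \<ge> 1" "\<forall>b\<in>range u. card {x. u x = b} = q" using mp(3) by blast
      have iso: "graph_iso (R 1) (cmp_V 4 q) (cmp_E 4 q)"
      proof (rule multipartite_iso[where f = u])
        show "(x, y) \<in> R 1 \<longleftrightarrow> u x \<noteq> u y" for x y using mp(1)[of x y] unfolding adj' .
        show "card (range u) = 4" by (rule mp(2))
        show "card {x. u x = b} = q" if "b \<in> range u" for b using q(2) that by (rule bspec)
      qed
      have fib: "adj z y" if "adj x z" "\<not> adj x y" for x y z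
        using that mp(1)[of x z] mp(1)[of x y] mp(1)[of z y] by metis
      have ex: "\<exists>k\<ge>1. graph_iso (R 1) (cmp_V 4 k) (cmp_E 4 k)" using q(1) iso by blast
      have dv: "d = 2" by (rule small(2)[OF fib ab])
      have gen: "generated_scheme UNIV (R 1) R d" by (rule small(1)[OF fib ab])
      show ?thesis by (rule disjI2, rule disjI2, rule disjI2, rule disjI2, rule disjI2, rule disjI2, rule disjI2, rule disjI2, rule disjI2, intro conjI, rule dv, rule ex, rule gen)
    next
      case False
      interpret pm_inj ?c u \<theta> a b
      proof
        show "dist2 a b" by (rule ab)
        show "u a \<bullet> u b \<noteq> 1" by (rule False)
      qed
      show ?thesis
      proof (rule degree_cases)
        assume k: "\<And>x. card (N x) = 4" and a1: "\<And>x y. adj x y ==> card (N x \<inter> N y) = 1"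
        show ?thesis using no_four_one[OF k a1] by (rule FalseE)
      next
        assume k: "\<And>x. card (N x) = 4" and a2: "\<And>x y. adj x y ==> card (N x \<inter> N y) = 2"
        have oc1: "adj x y \<longleftrightarrow> UNIV - N x \<noteq> UNIV - N y" for x y by (rule octahedron(1)[OF k a2])
        have oc2: "card (range (\<lambda>x. UNIV - N x)) = 3" by (rule octahedron(2)[OF k a2])
        have oc3: "card {x. UNIV - N x = b} = 2" if "b \<in> range (\<lambda>x. UNIV - N x)" for b
          by (rule octahedron(3)[OF k a2]) (assumption, rule that)
        have iso: "graph_iso (R 1) (cmp_V 3 2) (cmp_E 3 2)"
        proof (rule multipartite_iso[where f = "\<lambda>x. UNIV - N x"])
          show "(x, y) \<in> R 1 \<longleftrightarrow> UNIV - N x \<noteq> UNIV - N y" for x y using oc1[of x y] unfolding adj' .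
          show "card (range (\<lambda>x. UNIV - N x)) = 3" by (rule oc2)
          show "card {x. UNIV - N x = b} = 2" if "b \<in> range (\<lambda>x. UNIV - N x)" for b by (rule oc3[OF that])
        qed
        have fib: "adj z y" if "adj x z" "\<not> adj x y" for x y z
          using that oc1[of x z] oc1[of x y] oc1[of z y] by metis
        have dv: "d = 2" by (rule small(2)[OF fib ab])
        have gen: "generated_scheme UNIV (R 1) R d" by (rule small(1)[OF fib ab])
        show ?thesis by (rule disjI2, rule disjI2, rule disjI2, rule disjI2, rule disjI2, rule disjI2, rule disjI2, rule disjI2, rule disjI1, intro conjI, rule dv, rule iso, rule gen)
      next
        assume k: "\<And>x. card (N x) = 5" and a2: "\<And>x y. adj x y ==> card (N x \<inter> N y) = 2"
        note c = icosa_cert[unfolded cert_ok_def]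
        note t = conjunct1[OF c] conjunct1[OF conjunct2[OF conjunct2[OF c]]]
        have vs: "\<exists>vs. length vs = length icosa_tab \<and> vs ! 0 = x \<and> distinct vs \<and>
            (\<forall>p<length icosa_tab. N (vs ! p) = (!) vs ` set (icosa_tab ! p))" for x by (rule icosahedron_list[OF k a2])
        obtain Fm where "rooted_model adj icosa_tab Fm"
          using model_from_lists[OF t(1) vs t(2)] by blast
        then have Fm: "rooted_model (\<lambda>x y. (x, y) \<in> R 1) icosa_tab Fm" unfolding adj .
        have dv: "d = 3" using cert(1)[OF Fm icosa_cert] unfolding cert_ranks by simp
        show ?thesis by (rule disjI2, rule disjI2, rule disjI2, rule disjI2, rule disjI2, rule disjI2, rule disjI2, rule disjI1, intro conjI, rule dv, rule icosa_graph_iso[OF Fm], rule cert(2)[OF Fm icosa_cert])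
      next
        assume k: "\<And>x. card (N x) = 3" and no3: "\<And>x y. adj x y ==> N x \<inter> N y = {}"
        \<comment> \<open>Distance two is one class, so the number of common neighbours is constant
          on it. It is at least one and at most the valency three, which leaves three
          subcases.\<close>
        have cc: "card (N x \<inter> N y) = card (N a \<inter> N b)" if "dist2 x y" for x y
        proof -
          have e: "N x \<inter> N y = {z. adj x z \<and> adj z y}" for x y
          proof (rule set_eqI)
            fix z
            show "z \<in> N x \<inter> N y \<longleftrightarrow> z \<in> {z. adj x z \<and> adj z y}" using adj_sym[of z y] by simp
          qed
          show ?thesis unfolding e
            by (rule class_invD[OF class_inv_card[OF adj_inv adj_inv] dist2_class[OF that ab]])
        qed
        have le: "card (N a \<inter> N b) \<le> card (N a)" by (intro card_mono) auto
        obtain z where z: "adj a z" "adj z b" using ab unfolding dist2_def by blast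
        then have "z \<in> N a \<inter> N b" using adj_sym[of z b] by simp
        then have "card (N a \<inter> N b) > 0" by (auto simp: card_gt_0_iff)
        then have "card (N a \<inter> N b) = 1 \<or> card (N a \<inter> N b) = 2 \<or> card (N a \<inter> N b) = 3" using k[of a] le by linarith
        then show ?thesis
        proof (elim disjE)
          assume c3: "card (N a \<inter> N b) = 3"
          have "card (N x \<inter> N y) = 3" if "dist2 x y" for x y using cc[OF that] c3 by (rule trans)
          from no_K33[OF k no3 this] show ?thesis by (rule FalseE)
        next
          assume c3: "card (N a \<inter> N b) = 2"
          have cN: "card (N x \<inter> N y) = 2" if "dist2 x y" for x y using cc[OF that] c3 by (rule trans)
          note c = cube_cert[unfolded cert_ok_def]
          note t = conjunct1[OF c] conjunct1[OF conjunct2[OF conjunct2[OF c]]]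
          have vs: "\<exists>vs. length vs = length cube_tab \<and> vs ! 0 = x \<and> distinct vs \<and>
              (\<forall>p<length cube_tab. N (vs ! p) = (!) vs ` set (cube_tab ! p))" for x by (rule cube_list[OF k no3 cN])
          obtain Fm where "rooted_model adj cube_tab Fm"
            using model_from_lists[OF t(1) vs t(2)] by blast
          then have Fm: "rooted_model (\<lambda>x y. (x, y) \<in> R 1) cube_tab Fm" unfolding adj .
          have dv: "d = 3" using cert(1)[OF Fm cube_cert] unfolding cert_ranks by simp
          show ?thesis by (rule disjI2, rule disjI1, intro conjI, rule dv, rule cube_graph_iso[OF Fm], rule cert(2)[OF Fm cube_cert])
        next
          assume c3: "card (N a \<inter> N b) = 1"
          have cN: "card (N x \<inter> N y) = 1" if "dist2 x y" for x y using cc[OF that] c3 by (rule trans)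
          interpret pm_cubic ?c u \<theta> a b
          proof
            show "card (N x) = 3" for x by (rule k)
            show "N x \<inter> N y = {}" if "adj x y" for x y by (rule no3[OF that])
            show "card (N x \<inter> N y) = 1" if "dist2 x y" for x y by (rule cN[OF that])
          qed
          from eigenvalue_cases show ?thesis
          proof (elim disjE)
            assume th: "\<theta>\<^sup>2 = 1"
            interpret pm_octa ?c u \<theta> a b
            proof
              show "\<theta>\<^sup>2 = 1" by (rule th)
            qed
            obtain Fm where "rooted_model adj (gp_tab 8 5) Fm \<or> rooted_model adj (gp_tab 12 5) Fm \<or> rooted_model adj (gp_tab 24 5) Fm"
              using octa_models by blast
            then show ?thesis unfolding adj
            proof (elim disjE)
              assume Fm: "rooted_model (\<lambda>x y. (x, y) \<in> R 1) (gp_tab 8 5) Fm"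
              have t: "table_ok (gp_tab 8 5)" using mk_cert unfolding cert_ok_def by (elim conjE)
              have "graph_iso (R 1) (GP_V (int 8)) (GP_E (int 8) (int 5))"
                by (rule gp_graph_iso[OF Fm _ _ t]) simp_all
              then have iso: "graph_iso (R 1) (GP_V 8) (GP_E 8 3)" using GP_8 by simp
              have dv: "d = 5" using cert(1)[OF Fm mk_cert] unfolding cert_ranks by simp
              show ?thesis by (rule disjI2, rule disjI2, rule disjI1, intro conjI, rule dv, rule iso, rule cert(2)[OF Fm mk_cert])
            next
              assume Fm: "rooted_model (\<lambda>x y. (x, y) \<in> R 1) (gp_tab 12 5) Fm"
              have t: "table_ok (gp_tab 12 5)" using nauru_cert unfolding cert_ok_def by (elim conjE)
              have "graph_iso (R 1) (GP_V (int 12)) (GP_E (int 12) (int 5))"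
                by (rule gp_graph_iso[OF Fm _ _ t]) simp_all
              then have iso: "graph_iso (R 1) (GP_V 12) (GP_E 12 5)" by simp
              have dv: "d = 6" using cert(1)[OF Fm nauru_cert] unfolding cert_ranks by simp
              show ?thesis by (rule disjI2, rule disjI2, rule disjI2, rule disjI1, intro conjI, rule dv, rule iso, rule cert(2)[OF Fm nauru_cert])
            next
              assume Fm: "rooted_model (\<lambda>x y. (x, y) \<in> R 1) (gp_tab 24 5) Fm"
              have t: "table_ok (gp_tab 24 5)" using foster_cert unfolding cert_ok_def by (elim conjE)
              have "graph_iso (R 1) (GP_V (int 24)) (GP_E (int 24) (int 5))"
                by (rule gp_graph_iso[OF Fm _ _ t]) simp_all
              then have iso: "graph_iso (R 1) (GP_V 24) (GP_E 24 5)" by simp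
              have dv: "d = 11" using cert(1)[OF Fm foster_cert] unfolding cert_ranks by simp
              show ?thesis by (rule disjI2, rule disjI2, rule disjI2, rule disjI2, rule disjI1, intro conjI, rule dv, rule iso, rule cert(2)[OF Fm foster_cert])
            qed
          next
            assume th: "\<theta>\<^sup>2 = 5"
            interpret pm_icos ?c u \<theta> a b
            proof
              show "\<theta>\<^sup>2 = 5" by (rule th)
            qed
            from icos_models show ?thesis unfolding adj
            proof (elim disjE exE conjE)
              fix Fm
              assume Fm: "rooted_model (\<lambda>x y. (x, y) \<in> R 1) (gp_tab 10 2) Fm"
              have t: "table_ok (gp_tab 10 2)" using dodec_cert unfolding cert_ok_def by (elim conjE)
              have "graph_iso (R 1) (GP_V (int 10)) (GP_E (int 10) (int 2))"
                by (rule gp_graph_iso[OF Fm _ _ t]) simp_all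
              then have iso: "graph_iso (R 1) dodeca_V dodeca_E" unfolding dodeca_V_def dodeca_E_def by simp
              have dv: "d = 5" using cert(1)[OF Fm dodec_cert] unfolding cert_ranks by simp
              show ?thesis by (rule disjI2, rule disjI2, rule disjI2, rule disjI2, rule disjI2, rule disjI1, intro conjI, rule dv, rule iso, rule cert(2)[OF Fm dodec_cert])
            next
              fix Fm assume Fm: "rooted_model (\<lambda>x y. (x, y) \<in> R 1) double_tab Fm"
                and v: "\<forall>x. \<forall>p<40. u x \<bullet> u (Fm x p) = dodec_cos (dodec_dist ! (p mod 20))" "\<forall>x. \<forall>p<20. u (Fm x (p + 20)) = u (Fm x p)"
              show ?thesis
                by (rule disjI2, rule disjI2, rule disjI2, rule disjI2, rule disjI2, rule disjI2, rule disjI1,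
                    rule double_case[OF R d rconn dd2 Fm u_inv dodec_cos_inj v(1)[rule_format] v(2)[rule_format]])
            qed
          qed
        qed
      qed
    qed
  qed
qed

end
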